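(* Let $A:\mathcal{S}'(\mathbb{R}^d)\to\mathcal{S}'(\mathbb{R}^d)$ be continuous linear and suppose there are $g\in\mathcal{S}(\mathbb{R}^d)\setminus\{0\}$ and $\mathcal{A}=\begin{pmatrix}A&B\\C&D\end{pmatrix}\in Sp(d,\mathbb{R})$ with $\det B\neq0$ such that for every $N\in\mathbb{N}$ there is $C_N$ with \[ |\langle A\pi(z)g,\pi(w)g\rangle|\leq C_N(1+|w-\mathcal{A}z|)^{-N}\qquad z,w\in\mathbb{R}^{2d}. \] Let $\psi\in C^\infty(\mathbb{R}^{2d})$ coincide for $|z|\geq1$ with a positively homogeneous function of degree $0$, and satisfy $\psi(z)=1$ for $|z|\geq1$ and $z$ in an open conic neighborhood of $\mathcal{A}^{-1}(\{0\}\times(\mathbb{R}^d\setminus\{0\}))$. Then for every $\varphi\in\mathcal{S}(\mathbb{R}^d)$ and $1\leq p\leq2$ there is $C>0$ and, for every $N\in\mathbb{N}$, $C_N>0$ such that \[ \|\mathcal{F}(\varphi Af)\|_{L^p}\leq C\|\psi^wf\|_{L^p}+C_N\|\langle x\rangle^{-N}f\|_{H^{-N}}\qquad f\in\mathcal{S}(\mathbb{R}^d). \]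
   Context: $\pi(x,\xi)g(y)=e^{iy\cdot\xi}g(y-x)$. $\mathcal{F}f(\xi)=\int e^{-ix\cdot\xi}f(x)dx$. Weyl quantization $b^wf(x)=(2\pi)^{-d}\int e^{i(x-y)\cdot\xi}b(\frac{x+y}{2},\xi)f(y)\,dy\,d\xi$. $\langle x\rangle=(1+|x|^2)^{1/2}$ and $\|\cdot\|_{H^{-N}}$ is the $L^2$-based Sobolev norm of order $-N$ on $\mathbb{R}^d$. Matrices are identified with the corresponding linear maps. *)

theory Defs
  imports "HOL-Analysis.Analysis"
begin

definition pdiff :: "'a::euclidean_space \<Rightarrow> ('a \<Rightarrow> complex) \<Rightarrow> 'a \<Rightarrow> complex" where
  "pdiff b f x = vector_derivative (\<lambda>t. f (x + t *\<^sub>R b)) (at 0)"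

fun iter_pdiff :: "'a::euclidean_space list \<Rightarrow> ('a \<Rightarrow> complex) \<Rightarrow> 'a \<Rightarrow> complex" where
  "iter_pdiff [] f = f"
| "iter_pdiff (b # bs) f = pdiff b (iter_pdiff bs f)"

definition C_inf :: "('a::euclidean_space \<Rightarrow> complex) \<Rightarrow> bool" where
  "C_inf f \<longleftrightarrow> (\<forall>bs. set bs \<subseteq> Basis \<longrightarrow>
      continuous_on UNIV (iter_pdiff bs f) \<and>
      (\<forall>b\<in>Basis. \<forall>x. (\<lambda>t. iter_pdiff bs f (x + t *\<^sub>R b)) differentiable (at 0)))"

definition schwartz :: "('a::euclidean_space \<Rightarrow> complex) \<Rightarrow> bool" where
  "schwartz f \<longleftrightarrow> C_inf f \<and> (\<forall>bs k. set bs \<subseteq> Basis \<longrightarrow>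
      bounded (range (\<lambda>x. (1 + norm x) ^ k * norm (iter_pdiff bs f x))))"

definition schwartz_seminorm :: "nat \<Rightarrow> ('a::euclidean_space \<Rightarrow> complex) \<Rightarrow> real" where
  "schwartz_seminorm m f =
     (\<Sum>bs\<in>{bs. set bs \<subseteq> Basis \<and> length bs \<le> m}.
        (SUP x. (1 + norm x) ^ m * norm (iter_pdiff bs f x)))"

section \<open>Tempered distributions (functionals, only their values on Schwartz functions matter)\<close>

definition tempered :: "(('a::euclidean_space \<Rightarrow> complex) \<Rightarrow> complex) \<Rightarrow> bool" where
  "tempered u \<longleftrightarrow>
     (\<forall>f g a b. schwartz f \<longrightarrow> schwartz g \<longrightarrow>
        u (\<lambda>x. a * f x + b * g x) = a * u f + b * u g) \<and>
     (\<exists>C m. \<forall>f. schwartz f \<longrightarrow> norm (u f) \<le> C * schwartz_seminorm m f)"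

definition cont_lin_op ::
  "((('a::euclidean_space \<Rightarrow> complex) \<Rightarrow> complex) \<Rightarrow> (('a \<Rightarrow> complex) \<Rightarrow> complex)) \<Rightarrow> bool" where
  "cont_lin_op T \<longleftrightarrow>
     (\<forall>u. tempered u \<longrightarrow> tempered (T u)) \<and>
     (\<forall>u v. tempered u \<longrightarrow> tempered v \<longrightarrow> (\<forall>f. schwartz f \<longrightarrow> u f = v f) \<longrightarrow>
        (\<forall>f. schwartz f \<longrightarrow> T u f = T v f)) \<and>
     (\<forall>u v a b. tempered u \<longrightarrow> tempered v \<longrightarrow>
        (\<forall>f. schwartz f \<longrightarrow> T (\<lambda>g. a * u g + b * v g) f = a * T u f + b * T v f)) \<and>
     (\<forall>us u. (\<forall>n. tempered (us n)) \<longrightarrow> tempered u \<longrightarrow>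
        (\<forall>f. schwartz f \<longrightarrow> (\<lambda>n. us n f) \<longlonglongrightarrow> u f) \<longrightarrow>
        (\<forall>f. schwartz f \<longrightarrow> (\<lambda>n. T (us n) f) \<longlonglongrightarrow> T u f))"

definition emb :: "('a::euclidean_space \<Rightarrow> complex) \<Rightarrow> ('a \<Rightarrow> complex) \<Rightarrow> complex" where
  "emb f = (\<lambda>g. integral\<^sup>L lborel (\<lambda>x. f x * g x))"

definition pairing :: "(('a::euclidean_space \<Rightarrow> complex) \<Rightarrow> complex) \<Rightarrow> ('a \<Rightarrow> complex) \<Rightarrow> complex" where
  "pairing u h = u (\<lambda>x. cnj (h x))"

definition dist_mult :: "('a::euclidean_space \<Rightarrow> complex) \<Rightarrow> (('a \<Rightarrow> complex) \<Rightarrow> complex) \<Rightarrow> ('a \<Rightarrow> complex) \<Rightarrow> complex" where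
  "dist_mult \<phi> u = (\<lambda>g. u (\<lambda>x. \<phi> x * g x))"

definition tfshift :: "((real^'d) \<times> (real^'d)) \<Rightarrow> (real^'d \<Rightarrow> complex) \<Rightarrow> real^'d \<Rightarrow> complex" where
  "tfshift z g = (\<lambda>y. exp (\<i> * complex_of_real (y \<bullet> snd z)) * g (y - fst z))"

definition fourier :: "(real^'d \<Rightarrow> complex) \<Rightarrow> real^'d \<Rightarrow> complex" where
  "fourier f = (\<lambda>\<xi>. integral\<^sup>L lborel (\<lambda>x. exp (- (\<i> * complex_of_real (x \<bullet> \<xi>))) * f x))"

definition dist_fourier :: "((real^'d \<Rightarrow> complex) \<Rightarrow> complex) \<Rightarrow> (real^'d \<Rightarrow> complex) \<Rightarrow> complex" where
  "dist_fourier u = (\<lambda>g. u (fourier g))"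

definition weyl :: "((real^'d) \<times> (real^'d) \<Rightarrow> complex) \<Rightarrow> (real^'d \<Rightarrow> complex) \<Rightarrow> real^'d \<Rightarrow> complex" where
  "weyl b f = (\<lambda>x. complex_of_real (inverse ((2 * pi) ^ CARD('d))) *
     integral\<^sup>L lborel (\<lambda>\<xi>. integral\<^sup>L lborel (\<lambda>y.
        exp (\<i> * complex_of_real ((x - y) \<bullet> \<xi>)) * b ((1/2) *\<^sub>R (x + y), \<xi>) * f y)))"

definition japanese :: "real^'d \<Rightarrow> real" where
  "japanese x = sqrt (1 + (norm x)\<^sup>2)"

definition lp_norm :: "real \<Rightarrow> (real^'d \<Rightarrow> complex) \<Rightarrow> real" where
  "lp_norm p h = (integral\<^sup>L lborel (\<lambda>x. norm (h x) powr p)) powr (1 / p)"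

definition sobolev_norm :: "real \<Rightarrow> (real^'d \<Rightarrow> complex) \<Rightarrow> real" where
  "sobolev_norm s f = sqrt (inverse ((2 * pi) ^ CARD('d)) *
      integral\<^sup>L lborel (\<lambda>\<xi>. japanese \<xi> powr (2 * s) * (norm (fourier f \<xi>))\<^sup>2))"

text \<open>The distribution u is given by an L^p function whose L^p norm is at most M
  (i.e. the L^p norm of u, infinite if u is not in L^p, is at most M).\<close>
definition dist_Lp_le :: "real \<Rightarrow> ((real^'d \<Rightarrow> complex) \<Rightarrow> complex) \<Rightarrow> real \<Rightarrow> bool" where
  "dist_Lp_le p u M \<longleftrightarrow> (\<exists>h. h \<in> borel_measurable lborel \<and>
      integrable lborel (\<lambda>x. norm (h x) powr p) \<and>
      (\<forall>g. schwartz g \<longrightarrow> u g = integral\<^sup>L lborel (\<lambda>x. h x * g x)) \<and>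
      lp_norm p h \<le> M)"

definition phase_map :: "real^'d^'d \<Rightarrow> real^'d^'d \<Rightarrow> real^'d^'d \<Rightarrow> real^'d^'d \<Rightarrow>
    (real^'d) \<times> (real^'d) \<Rightarrow> (real^'d) \<times> (real^'d)" where
  "phase_map A B C D z = (A *v fst z + B *v snd z, C *v fst z + D *v snd z)"

definition sympl_form :: "(real^'d) \<times> (real^'d) \<Rightarrow> (real^'d) \<times> (real^'d) \<Rightarrow> real" where
  "sympl_form z w = fst z \<bullet> snd w - snd z \<bullet> fst w"

definition symplectic :: "real^'d^'d \<Rightarrow> real^'d^'d \<Rightarrow> real^'d^'d \<Rightarrow> real^'d^'d \<Rightarrow> bool" where
  "symplectic A B C D \<longleftrightarrow> (\<forall>z w. sympl_form (phase_map A B C D z) (phase_map A B C D w) = sympl_form z w)"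

end

theory Submission
  imports Defs "HOL-Probability.Characteristic_Functions"
begin

text \<open>
  Let \<open>P\<close> be the phase map. Expanding a Schwartz function in the Gabor system \<open>tfshift z g\<close> and using
  that the matrix of \<open>T\<close> is concentrated on the graph of \<open>P\<close>, one gets
  \<open>norm (fourier (\<phi> T F) \<xi>) \<le> C \<integral> norm (stft g F z) (1 + norm ((0, \<xi>) - P z))\<^sup>-\<^sup>n dz\<close>, since \<open>\<phi>\<close>
  localizes the output to the fibre over position \<open>0\<close>. As \<open>det B\<close> does not vanish, the position
  component \<open>L \<xi>\<close> of \<open>P\<^sup>-\<^sup>1 (0, \<xi>)\<close> is an injective linear function of \<open>\<xi>\<close>. Hence the right-hand side is at
  most a convolution of \<open>norm F\<close> with an integrable kernel, evaluated at \<open>L \<xi>\<close>, and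
  \<open>F \<mapsto> fourier (\<phi> T F)\<close> is bounded in every \<open>L\<^sup>p\<close> norm.

  This is applied to \<open>F = weyl \<psi> f\<close>. For the remainder \<open>weyl (1 - \<psi>) f\<close> the symbol vanishes in a
  cone around the points \<open>P\<^sup>-\<^sup>1 (0, \<xi>)\<close>, so on these points its short-time Fourier transform decays
  rapidly in \<open>\<xi>\<close>; moving the Weyl operator to the window and using the duality of \<open>H\<^sup>N\<close> and \<open>H\<^sup>-\<^sup>N\<close>
  bounds it by the weak norm of \<open>f\<close>.
\<close>

section \<open>Families of smooth functions\<close>

text \<open>All estimates must be uniform in parameters such as phase-space points and frequencies.
  Smoothness is therefore treated for indexed families: \<open>all_derivs P\<close> says that
  \<open>P\<close>, which carries the uniform constants, survives all partial derivatives of the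
  whole family. For the remainder the index is a pair (z, \<xi>). The short-time Fourier transform
  at z does not involve \<xi>; what holds for every \<xi> is a gain of any power of
  \<open>pw \<xi>\<close> against a loss of some power of \<open>pw ((0, \<xi>) - P z)\<close>. Near
  the fibre this is the rapid decay in question; away from it the loss is paid by the kernel of
  \<open>T\<close>, which offers every power. This trade is the shape of the class
  \<open>rapid\<close> and makes it unnecessary to cut phase space into regions. A second obstacle
  is that \<open>T\<close> acts on distributions and is only sequentially continuous for pointwise
  convergence, whereas Gabor expansions are integrals. The exchange is made over a finite measure
  equivalent to Lebesgue measure, where bounded continuous integrands suffice.\<close>

definition has_pd :: "'a::euclidean_space \<Rightarrow> ('a \<Rightarrow> complex) \<Rightarrow> ('a \<Rightarrow> complex) \<Rightarrow> bool" where
  "has_pd b f f' \<longleftrightarrow> (\<forall>x. ((\<lambda>t. f (x + t *\<^sub>R b)) has_vector_derivative f' x) (at 0))"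

lemma has_pd_pdiff: "has_pd b f f' \<Longrightarrow> pdiff b f = f'"
  by (auto simp: has_pd_def pdiff_def fun_eq_iff intro!: vector_derivative_at)

text \<open>\<open>has_pd\<close> asks for the derivative at parameter 0 only, but at every base
  point; moving the base point along the line gives it at every parameter. The fundamental theorem
  of calculus and the mean value inequality need this form.\<close>

lemma has_pd_at:
  assumes "has_pd b f f'"
  shows "((\<lambda>t. f (x + t *\<^sub>R b)) has_vector_derivative f' (x + t *\<^sub>R b)) (at t)"
proof -
  have "((\<lambda>s. f ((x + t *\<^sub>R b) + s *\<^sub>R b)) has_vector_derivative f' (x + t *\<^sub>R b)) (at (t - t))"
    using assms by (simp add: has_pd_def)
  then have "((\<lambda>u. f ((x + t *\<^sub>R b) + (u - t) *\<^sub>R b)) has_vector_derivative 1 *\<^sub>R f' (x + t *\<^sub>R b)) (at t)"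
    by (intro vector_diff_chain_at[unfolded o_def, where f="\<lambda>u. u - t" and g="\<lambda>s. f ((x + t *\<^sub>R b) + s *\<^sub>R b)"])
       (auto intro!: derivative_eq_intros)
  then show ?thesis by (simp add: algebra_simps)
qed

lemma has_pd_const: "has_pd b (\<lambda>x. c) (\<lambda>x. 0)"
  by (simp add: has_pd_def)

lemma has_pd_add: "has_pd b f f' \<Longrightarrow> has_pd b g g' \<Longrightarrow> has_pd b (\<lambda>x. f x + g x) (\<lambda>x. f' x + g' x)"
  by (auto simp: has_pd_def intro: has_vector_derivative_add)

lemma has_pd_diff: "has_pd b f f' \<Longrightarrow> has_pd b g g' \<Longrightarrow> has_pd b (\<lambda>x. f x - g x) (\<lambda>x. f' x - g' x)"
  by (auto simp: has_pd_def intro: has_vector_derivative_diff)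

lemma has_pd_mult:
  assumes "has_pd b f f'" "has_pd b g g'"
  shows "has_pd b (\<lambda>x. f x * g x) (\<lambda>x. f' x * g x + f x * g' x)"
  unfolding has_pd_def
proof
  fix x
  show "((\<lambda>t. f (x + t *\<^sub>R b) * g (x + t *\<^sub>R b)) has_vector_derivative f' x * g x + f x * g' x) (at 0)"
    using has_vector_derivative_mult[of "\<lambda>t. f (x + t *\<^sub>R b)" "f' x" 0 UNIV "\<lambda>t. g (x + t *\<^sub>R b)" "g' x"] assms
    by (simp add: has_pd_def add.commute)
qed

lemma has_pd_cmult: "has_pd b f f' \<Longrightarrow> has_pd b (\<lambda>x. c * f x) (\<lambda>x. c * f' x)"
  using has_pd_mult[OF has_pd_const[of b c]] by simp

lemma has_pd_cnj: "has_pd b f f' \<Longrightarrow> has_pd b (\<lambda>x. cnj (f x)) (\<lambda>x. cnj (f' x))"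
  by (auto simp: has_pd_def intro: has_vector_derivative_cnj)

text \<open>Only the action of the map along \<open>b\<close> enters, so one chain rule covers
  shifts, midpoints, reflections and embeddings of a factor into a product.\<close>

lemma has_pd_compose:
  fixes L :: "'a::euclidean_space \<Rightarrow> 'b::euclidean_space"
  assumes f: "has_pd b' f f'" and L: "\<And>x t. L (x + t *\<^sub>R b) = L x + (c * t) *\<^sub>R b'"
  shows "has_pd b (\<lambda>x. f (L x)) (\<lambda>x. of_real c * f' (L x))"
  unfolding has_pd_def
proof
  fix x
  have "((\<lambda>t. f (L x + t *\<^sub>R b')) has_vector_derivative f' (L x)) (at (c * 0))"
    using f by (simp add: has_pd_def)
  then have "((\<lambda>t. f (L x + (c * t) *\<^sub>R b')) has_vector_derivative c *\<^sub>R f' (L x)) (at 0)"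
    by (intro vector_diff_chain_at[unfolded o_def, where f="\<lambda>t. c * t" and g="\<lambda>s. f (L x + s *\<^sub>R b')"])
       (auto intro!: derivative_eq_intros)
  then show "((\<lambda>t. f (L (x + t *\<^sub>R b))) has_vector_derivative of_real c * f' (L x)) (at 0)"
    by (simp add: L scaleR_conv_of_real)
qed

lemma has_pd_shift: "has_pd b f f' \<Longrightarrow> has_pd b (\<lambda>x. f (x - a)) (\<lambda>x. f' (x - a))"
  using has_pd_compose[of b f f' "\<lambda>x. x - a" b 1] by (simp add: algebra_simps)

lemma has_pd_real:
  assumes "\<And>x. ((\<lambda>t. f (x + t *\<^sub>R b)) has_real_derivative f' x) (at 0)"
  shows "has_pd b (\<lambda>x. of_real (f x)) (\<lambda>x. of_real (f' x))"
  unfolding has_pd_def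
  using has_vector_derivative_of_real[OF assms] by blast

lemma has_pd_inner: "has_pd b (\<lambda>x. of_real (x \<bullet> e)) (\<lambda>x. of_real (b \<bullet> e))"
  by (rule has_pd_real) (auto intro!: derivative_eq_intros simp: inner_add_left)

lemma has_pd_exp:
  "has_pd b (\<lambda>x. exp (\<i> * of_real (x \<bullet> a))) (\<lambda>x. \<i> * of_real (b \<bullet> a) * exp (\<i> * of_real (x \<bullet> a)))"
  unfolding has_pd_def
proof
  fix x
  have "((\<lambda>t. exp (\<i> * of_real ((x + t *\<^sub>R b) \<bullet> a))) has_vector_derivative
      (\<i> * of_real (b \<bullet> a)) * exp (\<i> * of_real ((x + 0 *\<^sub>R b) \<bullet> a))) (at 0)"
    using has_vector_derivative_mult_right[OF has_pd_inner[of b a, unfolded has_pd_def, rule_format, of x], of \<i>]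
    by (intro field_vector_diff_chain_at[where g=exp, unfolded o_def]) (auto intro: DERIV_exp)
  then show "((\<lambda>t. exp (\<i> * of_real ((x + t *\<^sub>R b) \<bullet> a))) has_vector_derivative
      \<i> * of_real (b \<bullet> a) * exp (\<i> * of_real (x \<bullet> a))) (at 0)" by simp
qed

lemma has_pd_japanese_powr:
  fixes b :: "real^'d"
  shows "has_pd b (\<lambda>x. of_real (japanese x powr s)) (\<lambda>x. of_real (s * (x \<bullet> b) * japanese x powr (s - 2)))"
proof (rule has_pd_real)
  fix x :: "real^'d"
  have pos: "1 + (x + 0 *\<^sub>R b) \<bullet> (x + 0 *\<^sub>R b) > 0"
    by (smt (verit) inner_ge_zero)
  \<comment> \<open>As a power of \<open>1 + y \<bullet> y\<close> the bracket has a positive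
    polynomial inside, and the square root disappears from the derivative.\<close>
  have *: "japanese y powr r = (1 + y \<bullet> y) powr (r / 2)" for y :: "real^'d" and r
    by (simp add: japanese_def power2_norm_eq_inner powr_half_sqrt[symmetric] powr_powr mult.commute add_nonneg_nonneg)
  have "((\<lambda>t. (1 + (x + t *\<^sub>R b) \<bullet> (x + t *\<^sub>R b)) powr (s / 2)) has_real_derivative
      s * (x \<bullet> b) * (1 + x \<bullet> x) powr ((s - 2) / 2)) (at 0)"
  proof -
    have "((\<lambda>t. 1 + (x \<bullet> x + 2 * t * (x \<bullet> b) + t\<^sup>2 * (b \<bullet> b))) has_real_derivative 2 * (x \<bullet> b)) (at 0)"
      by (auto intro!: derivative_eq_intros)
    then have "((\<lambda>t. 1 + (x + t *\<^sub>R b) \<bullet> (x + t *\<^sub>R b)) has_real_derivative 2 * (x \<bullet> b)) (at 0)"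
      by (simp add: inner_add_left inner_add_right inner_commute power2_eq_square algebra_simps)
    from DERIV_fun_powr[OF this pos, of "s / 2"] show ?thesis by (simp add: diff_divide_distrib mult_ac)
  qed
  then show "((\<lambda>t. japanese (x + t *\<^sub>R b) powr s) has_real_derivative s * (x \<bullet> b) * japanese x powr (s - 2)) (at 0)"
    unfolding * .
qed

section \<open>Properties of families preserved by all partial derivatives\<close>

fun derivs_upto :: "(('i \<Rightarrow> 'a::euclidean_space \<Rightarrow> complex) \<Rightarrow> bool) \<Rightarrow> nat \<Rightarrow> ('i \<Rightarrow> 'a \<Rightarrow> complex) \<Rightarrow> bool" where
  "derivs_upto P 0 F = P F"
| "derivs_upto P (Suc n) F \<longleftrightarrow> P F \<and>
     (\<forall>b\<in>Basis. \<exists>F'. (\<forall>i. has_pd b (F i) (F' i)) \<and> derivs_upto P n F')"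

text \<open>The derivatives are taken for all indices at once, so constants in \<open>P\<close> may
  be uniform in the index. They are quantified existentially and need not be computed, and the
  cut-off at depth n gives access to ordinary induction.\<close>

definition all_derivs :: "(('i \<Rightarrow> 'a::euclidean_space \<Rightarrow> complex) \<Rightarrow> bool) \<Rightarrow> ('i \<Rightarrow> 'a \<Rightarrow> complex) \<Rightarrow> bool" where
  "all_derivs P F \<longleftrightarrow> (\<forall>n. derivs_upto P n F)"

lemma has_pd_family_unique:
  assumes "\<forall>i. has_pd b (F i) (F' i)" "\<forall>i. has_pd b (F i) (F'' i)" shows "F' = F''"
  using assms by (metis has_pd_pdiff ext)

lemma all_derivs_base: "all_derivs P F \<Longrightarrow> P F"
  by (metis all_derivs_def derivs_upto.simps(1))

text \<open>Each depth supplies its own derivative family; uniqueness of derivatives identifies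
  them, so the quantifiers may be exchanged.\<close>

lemma all_derivs_pd:
  assumes "all_derivs P F" "b \<in> Basis"
  shows "\<exists>F'. (\<forall>i. has_pd b (F i) (F' i)) \<and> all_derivs P F'"
proof -
  have "\<exists>F'. (\<forall>i. has_pd b (F i) (F' i)) \<and> derivs_upto P n F'" for n
    using assms unfolding all_derivs_def by (metis derivs_upto.simps(2))
  then show ?thesis unfolding all_derivs_def by (metis has_pd_family_unique)
qed

text \<open>\<open>all_derivs P\<close> is a greatest fixed point: membership follows from any class
  of families inside \<open>P\<close> that is closed under partial derivatives.\<close>

lemma all_derivs_coinduct:
  assumes "X F" and step: "\<And>F. X F \<Longrightarrow> P F \<and> (\<forall>b\<in>Basis. \<exists>F'. (\<forall>i. has_pd b (F i) (F' i)) \<and> X F')"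
  shows "all_derivs P F"
proof -
  have "X F \<Longrightarrow> derivs_upto P n F" for n F
    by (induction n arbitrary: F) (auto dest!: step, metis)
  with \<open>X F\<close> show ?thesis by (auto simp: all_derivs_def)
qed

lemma derivs_upto_Suc_D: "derivs_upto P (Suc n) F \<Longrightarrow> derivs_upto P n F"
proof (induction n arbitrary: F)
  case (Suc n)
  then show ?case by (metis derivs_upto.simps(2))
qed simp

text \<open>Covers pullbacks that change the index set or the space. A direction \<open>b\<close>
  after the transformation corresponds to a direction \<open>b'\<close> before it up to a constant
  factor; these factors accumulate with the order, hence the stability of \<open>Q\<close> under
  scalars.\<close>

lemma derivs_upto_transform:
  assumes PQ: "\<And>F. P F \<Longrightarrow> Q (H F)"
    and cm: "\<And>c F. Q F \<Longrightarrow> Q (\<lambda>i x. c * F i x)"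
    and H: "\<And>b. b \<in> Basis \<Longrightarrow> \<exists>b'\<in>Basis. \<exists>c::complex. \<forall>F F'. (\<forall>i. has_pd b' (F i) (F' i)) \<longrightarrow>
       (\<forall>j. has_pd b (H F j) (\<lambda>x. c * H F' j x))"
  shows "derivs_upto P n F \<Longrightarrow> derivs_upto Q n (H F)"
proof (induction n arbitrary: F)
  case (Suc n)
  have cm': "derivs_upto Q n (\<lambda>i x. c * F i x)" if "derivs_upto Q n F" for n F c
    using that
  proof (induction n arbitrary: F)
    case (Suc n)
    show ?case
      unfolding derivs_upto.simps
    proof (intro conjI ballI)
      show "Q (\<lambda>i x. c * F i x)" using Suc.prems cm by auto
      fix b :: 'd assume "b \<in> Basis"
      with Suc.prems obtain F' where "\<forall>i. has_pd b (F i) (F' i)" "derivs_upto Q n F'" by auto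
      then show "\<exists>F'. (\<forall>i. has_pd b (\<lambda>x. c * F i x) (F' i)) \<and> derivs_upto Q n F'"
        using Suc.IH by (intro exI[of _ "\<lambda>i x. c * F' i x"]) (auto intro: has_pd_cmult)
    qed
  qed (auto intro: cm)
  show ?case
    unfolding derivs_upto.simps
  proof (intro conjI ballI)
    show "Q (H F)" using Suc.prems PQ by auto
    fix b :: 'd assume "b \<in> Basis"
    from H[OF this] obtain b' c where b': "b' \<in> Basis"
      and c: "\<And>F F'. \<forall>i. has_pd b' (F i) (F' i) \<Longrightarrow> \<forall>j. has_pd b (H F j) (\<lambda>x. c * H F' j x)" by metis
    from Suc.prems b' obtain F' where F': "\<forall>i. has_pd b' (F i) (F' i)" "derivs_upto P n F'" by auto
    show "\<exists>G. (\<forall>i. has_pd b (H F i) (G i)) \<and> derivs_upto Q n G"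
      using c[OF F'(1)] cm'[OF Suc.IH[OF F'(2)]] by (intro exI[of _ "\<lambda>j x. c * H F' j x"]) auto
  qed
qed (simp add: PQ)

lemma all_derivs_transform:
  assumes "all_derivs P F" "\<And>F. P F \<Longrightarrow> Q (H F)"
    "\<And>c F. Q F \<Longrightarrow> Q (\<lambda>i x. c * F i x)"
    "\<And>b. b \<in> Basis \<Longrightarrow> \<exists>b'\<in>Basis. \<exists>c::complex. \<forall>F F'. (\<forall>i. has_pd b' (F i) (F' i)) \<longrightarrow>
       (\<forall>j. has_pd b (H F j) (\<lambda>x. c * H F' j x))"
  shows "all_derivs Q (H F)"
  using assms(1) derivs_upto_transform[of P Q H, OF assms(2-)] by (auto simp: all_derivs_def)

lemma all_derivs_map:
  assumes "all_derivs P F" "\<And>F. P F \<Longrightarrow> Q (H F)"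
    "\<And>b F F'. b \<in> Basis \<Longrightarrow> (\<forall>i. has_pd b (F i) (F' i)) \<Longrightarrow> (\<forall>j. has_pd b (H F j) (H F' j))"
  shows "all_derivs Q (H F)"
  by (rule all_derivs_coinduct[where X="\<lambda>G. \<exists>F. all_derivs P F \<and> G = H F"])
     (use assms all_derivs_base all_derivs_pd in \<open>blast, metis\<close>)

lemma all_derivs_mono: "all_derivs P F \<Longrightarrow> (\<And>F. P F \<Longrightarrow> Q F) \<Longrightarrow> all_derivs Q F"
  by (erule all_derivs_map[where H="\<lambda>F. F"]) auto

lemma derivs_upto_add:
  assumes R: "\<And>F G. R F \<Longrightarrow> R G \<Longrightarrow> R (\<lambda>i x. F i x + G i x)"
  shows "derivs_upto R n F \<Longrightarrow> derivs_upto R n G \<Longrightarrow> derivs_upto R n (\<lambda>i x. F i x + G i x)"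
proof (induction n arbitrary: F G)
  case (Suc n)
  show ?case
    unfolding derivs_upto.simps
  proof (intro conjI ballI)
    show "R (\<lambda>i x. F i x + G i x)" using Suc.prems R by auto
    fix b :: 'b assume b: "b \<in> Basis"
    from Suc.prems b obtain F' G' where "\<forall>i. has_pd b (F i) (F' i)" "derivs_upto R n F'"
      "\<forall>i. has_pd b (G i) (G' i)" "derivs_upto R n G'" by (metis derivs_upto.simps(2))
    then show "\<exists>H. (\<forall>i. has_pd b (\<lambda>x. F i x + G i x) (H i)) \<and> derivs_upto R n H"
      using Suc.IH by (intro exI[of _ "\<lambda>i x. F' i x + G' i x"]) (auto intro: has_pd_add)
  qed
qed (simp add: R)

lemma all_derivs_add:
  assumes "all_derivs R F" "all_derivs R G" "\<And>F G. R F \<Longrightarrow> R G \<Longrightarrow> R (\<lambda>i x. F i x + G i x)"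
  shows "all_derivs R (\<lambda>i x. F i x + G i x)"
  using assms(1,2) derivs_upto_add[of R, OF assms(3)] unfolding all_derivs_def by blast

text \<open>By Leibniz' rule a derivative of the product is a sum of two products, hence the closure
  of \<open>R\<close> under sums. The undifferentiated factors enter the induction one order below
  what is available for them.\<close>

lemma derivs_upto_mult:
  assumes R: "\<And>F G. R F \<Longrightarrow> R G \<Longrightarrow> R (\<lambda>i x. F i x + G i x)"
    and PQ: "\<And>F G. P F \<Longrightarrow> Q G \<Longrightarrow> R (\<lambda>i x. F i x * G i x)"
  shows "derivs_upto P n F \<Longrightarrow> derivs_upto Q n G \<Longrightarrow> derivs_upto R n (\<lambda>i x. F i x * G i x)"
proof (induction n arbitrary: F G)
  case (Suc n)
  show ?case
    unfolding derivs_upto.simps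
  proof (intro conjI ballI)
    show "R (\<lambda>i x. F i x * G i x)" using Suc.prems PQ by auto
    fix b :: 'b assume b: "b \<in> Basis"
    from Suc.prems b obtain F' G' where *: "\<forall>i. has_pd b (F i) (F' i)" "derivs_upto P n F'"
      "\<forall>i. has_pd b (G i) (G' i)" "derivs_upto Q n G'" by (metis derivs_upto.simps(2))
    have "derivs_upto R n (\<lambda>i x. F' i x * G i x + F i x * G' i x)"
      using * Suc derivs_upto_Suc_D by (intro derivs_upto_add R) blast+
    with * show "\<exists>H. (\<forall>i. has_pd b (\<lambda>x. F i x * G i x) (H i)) \<and> derivs_upto R n H"
      by (intro exI[of _ "\<lambda>i x. F' i x * G i x + F i x * G' i x"]) (auto intro: has_pd_mult)
  qed
qed (simp add: PQ)

lemma all_derivs_mult: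
  assumes "all_derivs P F" "all_derivs Q G"
    "\<And>F G. R F \<Longrightarrow> R G \<Longrightarrow> R (\<lambda>i x. F i x + G i x)" "\<And>F G. P F \<Longrightarrow> Q G \<Longrightarrow> R (\<lambda>i x. F i x * G i x)"
  shows "all_derivs R (\<lambda>i x. F i x * G i x)"
  using assms(1,2) derivs_upto_mult[of R P Q, OF assms(3,4)] unfolding all_derivs_def by blast

lemma all_derivs_iter:
  assumes "all_derivs P F" "set bs \<subseteq> Basis"
  shows "all_derivs P (\<lambda>i. iter_pdiff bs (F i))"
  using assms(2)
proof (induction bs)
  case (Cons b bs)
  then obtain F' where F': "\<forall>i. has_pd b (iter_pdiff bs (F i)) (F' i)" "all_derivs P F'"
    using all_derivs_pd[of P "\<lambda>i. iter_pdiff bs (F i)" b] by auto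
  then have "pdiff b (iter_pdiff bs (F i)) = F' i" for i using has_pd_pdiff by blast
  with F' show ?case by simp
qed (simp add: assms(1))

lemma all_derivs_iter_pd:
  assumes "all_derivs P F" "set bs \<subseteq> Basis" "b \<in> Basis"
  shows "has_pd b (iter_pdiff bs (F i)) (iter_pdiff (b # bs) (F i))"
proof -
  obtain F' where F': "\<forall>i. has_pd b (iter_pdiff bs (F i)) (F' i)"
    using all_derivs_pd[OF all_derivs_iter[OF assms(1,2)] assms(3)] by auto
  then have "iter_pdiff (b # bs) (F i) = F' i" using has_pd_pdiff by (metis iter_pdiff.simps(2))
  with F' show ?thesis by simp
qed

lemma all_derivsI:
  fixes F :: "'i \<Rightarrow> 'a::euclidean_space \<Rightarrow> complex"
  assumes "\<And>bs. set bs \<subseteq> Basis \<Longrightarrow> P (\<lambda>i. iter_pdiff bs (F i))"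
    and "\<And>bs b i. set bs \<subseteq> Basis \<Longrightarrow> b \<in> Basis \<Longrightarrow> has_pd b (iter_pdiff bs (F i)) (iter_pdiff (b # bs) (F i))"
  shows "all_derivs P F"
proof (rule all_derivs_coinduct[where X="\<lambda>G. \<exists>bs. set bs \<subseteq> Basis \<and> G = (\<lambda>i. iter_pdiff bs (F i))"])
  show "\<exists>bs. set bs \<subseteq> Basis \<and> F = (\<lambda>i. iter_pdiff bs (F i))" by (intro exI[of _ "[]"]) simp
  fix G assume "\<exists>bs. set bs \<subseteq> Basis \<and> G = (\<lambda>i. iter_pdiff bs (F i))"
  then obtain bs where bs: "set bs \<subseteq> Basis" "G = (\<lambda>i. iter_pdiff bs (F i))" by blast
  show "P G \<and> (\<forall>b\<in>Basis. \<exists>F'. (\<forall>i. has_pd b (G i) (F' i)) \<and> (\<exists>bs. set bs \<subseteq> Basis \<and> F' = (\<lambda>i. iter_pdiff bs (F i))))"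
  proof (intro conjI ballI)
    show "P G" using assms(1) bs by auto
    fix b :: 'a assume b: "b \<in> Basis"
    show "\<exists>F'. (\<forall>i. has_pd b (G i) (F' i)) \<and> (\<exists>bs. set bs \<subseteq> Basis \<and> F' = (\<lambda>i. iter_pdiff bs (F i)))"
      using assms(2)[OF bs(1) b] bs b
      by (intro exI[of _ "\<lambda>i. iter_pdiff (b # bs) (F i)"] conjI exI[of _ "b # bs"]) auto
  qed
qed

lemma C_inf_has_pd:
  assumes "C_inf f" "set bs \<subseteq> Basis" "b \<in> Basis"
  shows "has_pd b (iter_pdiff bs f) (iter_pdiff (b # bs) f)"
  using assms by (auto simp: C_inf_def has_pd_def pdiff_def vector_derivative_works)

text \<open>The index type \<open>unit\<close> turns a single function into a family, which connects
  iterated partial derivative operators with the closure calculus.\<close>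

lemma C_inf_iff: "C_inf f \<longleftrightarrow> all_derivs (\<lambda>F. \<forall>i. continuous_on UNIV (F i)) (\<lambda>_::unit. f)"
proof
  assume "C_inf f"
  then show "all_derivs (\<lambda>F. \<forall>i. continuous_on UNIV (F i)) (\<lambda>_::unit. f)"
    by (intro all_derivsI C_inf_has_pd) (auto simp: C_inf_def)
next
  assume L: "all_derivs (\<lambda>F. \<forall>i. continuous_on UNIV (F i)) (\<lambda>_::unit. f)"
  show "C_inf f"
    unfolding C_inf_def
  proof (intro allI impI conjI ballI)
    fix bs :: "'a list" assume bs: "set bs \<subseteq> Basis"
    show "continuous_on UNIV (iter_pdiff bs f)"
      using all_derivs_base[OF all_derivs_iter[OF L bs]] by simp
    fix b x assume "b \<in> (Basis::'a set)"
    then show "(\<lambda>t. iter_pdiff bs f (x + t *\<^sub>R b)) differentiable at 0"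
      using all_derivs_iter_pd[OF L bs] unfolding has_pd_def
      by (meson differentiableI_vector)
  qed
qed

section \<open>Polynomial weights and uniform decay classes\<close>

definition pw :: "'a::real_normed_vector \<Rightarrow> real" where
  "pw x = 1 + norm x"

lemma pw_ge1 [simp]: "pw x \<ge> 1" and pw_pos [simp]: "pw x > 0" and pw_nonneg [simp]: "pw x \<ge> 0"
  and pw_nz [simp]: "pw x \<noteq> 0" and pw_0 [simp]: "pw 0 = 1"
  by (auto simp: pw_def add_pos_nonneg add_nonneg_eq_0_iff)

lemma pw_power_ge1 [simp]: "pw x ^ k \<ge> 1" by simp

text \<open>A Peetre inequality without constant: a power of the weight moves from one point to
  another at the price of the same power of the weight of their difference. Every exchange of decay
  between variables rests on it.\<close>

lemma pw_add: "pw (x + y) \<le> pw x * pw y"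
proof -
  have "pw x * pw y = 1 + norm x + norm y + norm x * norm y" by (simp add: pw_def algebra_simps)
  moreover have "norm x * norm y \<ge> 0" by simp
  ultimately show ?thesis using norm_triangle_ineq[of x y] by (simp only: pw_def)
qed

lemma pw_minus [simp]: "pw (- x) = pw x"
  by (simp add: pw_def)

lemma pw_diff: "pw (x - y) \<le> pw x * pw y"
  using pw_add[of x "-y"] by simp

lemma pw_scale_le: "\<bar>c\<bar> \<le> 1 \<Longrightarrow> pw (c *\<^sub>R x) \<le> pw x"
  by (simp add: pw_def mult_left_le_one_le)

lemma pw_Pair: "pw (x, y) \<le> pw x * pw y"
proof -
  have "(x, y) = (x, 0) + (0, y)" by simp
  then show ?thesis using pw_add[of "(x, 0)" "(0, y)"] by (simp add: pw_def norm_Pair)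
qed

lemma pw_Pair_ge: "pw x \<le> pw (x, y)" "pw y \<le> pw (x, y)"
  by (auto simp: pw_def norm_Pair real_le_rsqrt)

lemma pw_fst_snd_le: "pw (fst z) \<le> pw z" "pw (snd z) \<le> pw z" "pw z \<le> pw (fst z) * pw (snd z)"
  using pw_Pair_ge[of "fst z" "snd z"] pw_Pair_ge(2)[of "snd z" "fst z"] pw_Pair[of "fst z" "snd z"] by auto

lemma pw_power_mono: "k \<le> l \<Longrightarrow> pw x ^ k \<le> pw x ^ l"
  by (rule power_increasing) auto

lemma continuous_on_pw [continuous_intros]:
  "continuous_on S f \<Longrightarrow> continuous_on S (\<lambda>x. pw (f x))"
  unfolding pw_def by (intro continuous_intros)

text \<open>In \<open>rapid \<rho> \<tau> F\<close> the family is rapidly decreasing in \<open>x\<close> and in the parameter \<open>\<rho>\<close>, at the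
  cost of polynomial growth in the parameter \<open>\<tau>\<close>.\<close>

definition rapid :: "('i \<Rightarrow> real) \<Rightarrow> ('i \<Rightarrow> real) \<Rightarrow> ('i \<Rightarrow> 'a::euclidean_space \<Rightarrow> complex) \<Rightarrow> bool" where
  "rapid \<rho> \<tau> F \<longleftrightarrow> (\<forall>i. continuous_on UNIV (F i)) \<and>
     (\<forall>k m. \<exists>C M. \<forall>i x. pw (\<rho> i) ^ m * pw x ^ k * norm (F i x) \<le> C * pw (\<tau> i) ^ M)"

text \<open>The multiplier class of \<open>rapid\<close>: powers of \<open>pw x\<close> are absorbed
  by the decay in x, powers of \<open>pw (\<tau> i)\<close> by the growth that \<open>rapid\<close>
  tolerates.\<close>

definition polyg :: "('i \<Rightarrow> real) \<Rightarrow> ('i \<Rightarrow> 'a::euclidean_space \<Rightarrow> complex) \<Rightarrow> bool" where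
  "polyg \<tau> F \<longleftrightarrow> (\<forall>i. continuous_on UNIV (F i)) \<and>
     (\<exists>C M. \<forall>i x. norm (F i x) \<le> C * pw (\<tau> i) ^ M * pw x ^ M)"

lemma pw_bound_enlarge:
  assumes "a \<le> C * pw t ^ M" "\<bar>C\<bar> \<le> C'" "M \<le> M'"
  shows "a \<le> C' * pw t ^ M'"
proof -
  have "a \<le> \<bar>C\<bar> * pw t ^ M" using assms(1) by (rule order_trans) (intro mult_right_mono, auto)
  also have "\<dots> \<le> C' * pw t ^ M'" using assms by (intro mult_mono pw_power_mono) auto
  finally show ?thesis .
qed

lemma rapid_add:
  assumes "rapid \<rho> \<tau> F" "rapid \<rho> \<tau> G"
  shows "rapid \<rho> \<tau> (\<lambda>i x. F i x + G i x)"
  unfolding rapid_def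
proof (intro conjI allI)
  show "continuous_on UNIV (\<lambda>x. F i x + G i x)" for i
    using assms by (auto simp: rapid_def intro!: continuous_intros)
  fix k m
  obtain C M where 1: "\<And>i x. pw (\<rho> i) ^ m * pw x ^ k * norm (F i x) \<le> C * pw (\<tau> i) ^ M"
    using assms unfolding rapid_def by metis
  obtain C' M' where 2: "\<And>i x. pw (\<rho> i) ^ m * pw x ^ k * norm (G i x) \<le> C' * pw (\<tau> i) ^ M'"
    using assms unfolding rapid_def by metis
  have "pw (\<rho> i) ^ m * pw x ^ k * norm (F i x + G i x) \<le> (\<bar>C\<bar> + \<bar>C'\<bar>) * pw (\<tau> i) ^ (max M M')" for i x
  proof -
    have "pw (\<rho> i) ^ m * pw x ^ k * norm (F i x + G i x) \<le> pw (\<rho> i) ^ m * pw x ^ k * (norm (F i x) + norm (G i x))"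
      by (intro mult_left_mono norm_triangle_ineq) simp
    also have "\<dots> \<le> \<bar>C\<bar> * pw (\<tau> i) ^ (max M M') + \<bar>C'\<bar> * pw (\<tau> i) ^ (max M M')"
      unfolding distrib_left by (intro add_mono pw_bound_enlarge[OF 1] pw_bound_enlarge[OF 2]) auto
    finally show ?thesis by (simp add: algebra_simps)
  qed
  then show "\<exists>C M. \<forall>i x. pw (\<rho> i) ^ m * pw x ^ k * norm (F i x + G i x) \<le> C * pw (\<tau> i) ^ M" by blast
qed

lemma polyg_add:
  assumes "polyg \<tau> F" "polyg \<tau> G"
  shows "polyg \<tau> (\<lambda>i x. F i x + G i x)"
proof -
  obtain C M where 1: "\<And>i x. norm (F i x) \<le> C * pw (\<tau> i) ^ M * pw x ^ M" using assms unfolding polyg_def by metis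
  obtain C' M' where 2: "\<And>i x. norm (G i x) \<le> C' * pw (\<tau> i) ^ M' * pw x ^ M'" using assms unfolding polyg_def by metis
  have en: "a \<le> \<bar>C\<bar> * pw (\<tau> i) ^ N' * pw x ^ N'" if "a \<le> C * pw (\<tau> i) ^ N * pw x ^ N" "N \<le> N'" for a C i N N' and x :: 'b
  proof -
    have "a \<le> \<bar>C\<bar> * pw (\<tau> i) ^ N * pw x ^ N"
      using that(1) by (rule order_trans) (intro mult_right_mono, auto)
    also have "\<dots> \<le> \<bar>C\<bar> * pw (\<tau> i) ^ N' * pw x ^ N'"
      using that(2) by (intro mult_mono pw_power_mono) auto
    finally show ?thesis .
  qed
  have "norm (F i x + G i x) \<le> (\<bar>C\<bar> + \<bar>C'\<bar>) * pw (\<tau> i) ^ max M M' * pw x ^ max M M'" for i x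
    using norm_triangle_ineq[of "F i x" "G i x"] en[OF 1[of i x], where N'="max M M'"] en[OF 2[of i x], where N'="max M M'"]
    by (simp add: algebra_simps)
  moreover have "continuous_on UNIV (\<lambda>x. F i x + G i x)" for i
    using assms by (auto simp: polyg_def intro!: continuous_intros)
  ultimately show ?thesis unfolding polyg_def by blast
qed

text \<open>The exponent of the multiplier is added to the number of powers of \<open>pw x\<close>
  requested from \<open>F\<close>; its growth in the parameter stays in the bound.\<close>

lemma rapid_polyg:
  assumes "rapid \<rho> \<tau> F" "polyg \<tau> G"
  shows "rapid \<rho> \<tau> (\<lambda>i x. F i x * G i x)"
  unfolding rapid_def
proof (intro conjI allI)
  show "continuous_on UNIV (\<lambda>x. F i x * G i x)" for i
    using assms by (auto simp: rapid_def polyg_def intro!: continuous_intros)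
  fix k m
  obtain C' M' where 2: "\<And>i x. norm (G i x) \<le> C' * pw (\<tau> i) ^ M' * pw x ^ M'" using assms unfolding polyg_def by metis
  obtain C M where 1: "\<And>i x. pw (\<rho> i) ^ m * pw x ^ (k + M') * norm (F i x) \<le> C * pw (\<tau> i) ^ M"
    using assms unfolding rapid_def by metis
  have "pw (\<rho> i) ^ m * pw x ^ k * norm (F i x * G i x) \<le> (C * \<bar>C'\<bar>) * pw (\<tau> i) ^ (M + M')" for i x
  proof -
    have "norm (G i x) \<le> \<bar>C'\<bar> * pw (\<tau> i) ^ M' * pw x ^ M'"
      using 2 by (rule order_trans) (intro mult_right_mono, auto)
    then have "pw (\<rho> i) ^ m * pw x ^ k * norm (F i x * G i x) \<le>
        pw (\<rho> i) ^ m * pw x ^ k * norm (F i x) * (\<bar>C'\<bar> * pw (\<tau> i) ^ M' * pw x ^ M')"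
      unfolding norm_mult mult.assoc by (intro mult_left_mono) auto
    also have "\<dots> = (pw (\<rho> i) ^ m * pw x ^ (k + M') * norm (F i x)) * (\<bar>C'\<bar> * pw (\<tau> i) ^ M')"
      by (simp add: power_add)
    also have "\<dots> \<le> (C * pw (\<tau> i) ^ M) * (\<bar>C'\<bar> * pw (\<tau> i) ^ M')"
      by (intro mult_right_mono 1) auto
    finally show ?thesis by (simp add: power_add mult_ac)
  qed
  then show "\<exists>C M. \<forall>i x. pw (\<rho> i) ^ m * pw x ^ k * norm (F i x * G i x) \<le> C * pw (\<tau> i) ^ M" by blast
qed

lemma polyg_mult:
  assumes "polyg \<tau> F" "polyg \<tau> G"
  shows "polyg \<tau> (\<lambda>i x. F i x * G i x)"
proof -
  obtain C M where 1: "\<And>i x. norm (F i x) \<le> C * pw (\<tau> i) ^ M * pw x ^ M" using assms unfolding polyg_def by metis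
  obtain C' M' where 2: "\<And>i x. norm (G i x) \<le> C' * pw (\<tau> i) ^ M' * pw x ^ M'" using assms unfolding polyg_def by metis
  have "norm (F i x * G i x) \<le> (C * C') * pw (\<tau> i) ^ (M + M') * pw x ^ (M + M')" for i x
  proof -
    have "norm (F i x * G i x) \<le> (C * pw (\<tau> i) ^ M * pw x ^ M) * (C' * pw (\<tau> i) ^ M' * pw x ^ M')"
      unfolding norm_mult by (intro mult_mono 1 2 order_trans[OF norm_ge_zero 1]) auto
    then show ?thesis by (simp add: power_add mult_ac)
  qed
  moreover have "continuous_on UNIV (\<lambda>x. F i x * G i x)" for i
    using assms by (auto simp: polyg_def intro!: continuous_intros)
  ultimately show ?thesis unfolding polyg_def by blast
qed

lemma all_derivs_rapid_polyg:
  "all_derivs (rapid \<rho> \<tau>) F \<Longrightarrow> all_derivs (polyg \<tau>) G \<Longrightarrow> all_derivs (rapid \<rho> \<tau>) (\<lambda>i x. F i x * G i x)"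
  by (erule (1) all_derivs_mult[where R="rapid \<rho> \<tau>"]) (auto intro: rapid_add rapid_polyg)

lemma rapid_0_iff:
  "rapid (\<lambda>_. 0) (\<lambda>_. 0) F \<longleftrightarrow> (\<forall>i. continuous_on UNIV (F i)) \<and> (\<forall>k. \<exists>C. \<forall>i x. pw x ^ k * norm (F i x) \<le> C)"
  by (auto simp: rapid_def)

text \<open>Families that are bounded in the Schwartz space: both parameters are 0 and
  \<open>pw 0 = 1\<close>, so no index weight remains.\<close>

abbreviation "uschwartz F \<equiv> all_derivs (rapid (\<lambda>_. 0) (\<lambda>_. 0)) F"

lemma schwartz_iff: "schwartz f \<longleftrightarrow> uschwartz (\<lambda>_::unit. f)"
proof
  assume L: "schwartz f"
  then have C: "C_inf f" by (simp add: schwartz_def)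
  have B: "bounded (range (\<lambda>x. pw x ^ k * norm (iter_pdiff bs f x)))" if "set bs \<subseteq> Basis" for bs k
    using L that by (simp add: schwartz_def pw_def)
  show "uschwartz (\<lambda>_::unit. f)"
  proof (rule all_derivsI)
    fix bs :: "'a list" assume bs: "set bs \<subseteq> Basis"
    have "\<exists>C. \<forall>x. pw x ^ k * norm (iter_pdiff bs f x) \<le> C" for k
      using B[OF bs, of k] unfolding bounded_iff by (auto simp: abs_le_iff)
    then show "rapid (\<lambda>_. 0) (\<lambda>_. 0) (\<lambda>i::unit. iter_pdiff bs f)"
      using C bs by (auto simp: rapid_0_iff C_inf_def)
  qed (use C C_inf_has_pd in auto)
next
  assume R: "uschwartz (\<lambda>_::unit. f)"
  show "schwartz f"
    unfolding schwartz_def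
  proof (intro conjI allI impI)
    show "C_inf f" unfolding C_inf_iff using R by (rule all_derivs_mono) (auto simp: rapid_def)
    fix bs :: "'a list" and k assume bs: "set bs \<subseteq> Basis"
    obtain C where "\<And>x. pw x ^ k * norm (iter_pdiff bs f x) \<le> C"
      using all_derivs_base[OF all_derivs_iter[OF R bs]] unfolding rapid_0_iff by blast
    then show "bounded (range (\<lambda>x. (1 + norm x) ^ k * norm (iter_pdiff bs f x)))"
      unfolding bounded_iff pw_def by (intro exI[of _ C]) (auto simp: abs_mult)
  qed
qed

lemma schwartz_bound:
  assumes "schwartz f" obtains C where "C > 0" "\<And>x. norm (f x) \<le> C / pw x ^ k"
proof -
  obtain C where C: "\<And>x. pw x ^ k * norm (f x) \<le> C"
    using all_derivs_base[OF assms[unfolded schwartz_iff]] unfolding rapid_0_iff by blast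
  have "norm (f x) \<le> max C 1 / pw x ^ k" for x
    using C[of x] by (simp add: field_simps max_def)
  then show ?thesis using that[of "max C 1"] by auto
qed

lemma schwartz_cont: "schwartz f \<Longrightarrow> continuous_on UNIV f"
  by (auto simp: schwartz_iff dest!: all_derivs_base simp: rapid_def)

lemma schwartz_add: "schwartz f \<Longrightarrow> schwartz g \<Longrightarrow> schwartz (\<lambda>x. f x + g x)"
  unfolding schwartz_iff by (rule all_derivs_add) (auto intro: rapid_add)

lemma polyg_const: "polyg \<tau> (\<lambda>i x. c)"
proof -
  have "norm c \<le> norm c * pw (\<tau> i) ^ 0 * pw x ^ 0" for i and x :: 'b by simp
  then show ?thesis unfolding polyg_def by (intro conjI allI continuous_on_const) blast
qed

lemma all_derivs_polyg_const: "all_derivs (polyg \<tau>) (\<lambda>i x. c)"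
proof (rule all_derivs_coinduct[where X="\<lambda>F. \<exists>c. F = (\<lambda>i x. c)"])
  fix F :: "'a \<Rightarrow> 'b \<Rightarrow> complex" assume "\<exists>c. F = (\<lambda>i x. c)"
  then show "polyg \<tau> F \<and> (\<forall>b\<in>Basis. \<exists>F'. (\<forall>i. has_pd b (F i) (F' i)) \<and> (\<exists>c. F' = (\<lambda>i x. c)))"
    using polyg_const has_pd_const by metis
qed blast

lemma schwartz_cmult: "schwartz f \<Longrightarrow> schwartz (\<lambda>x. c * f x)"
  unfolding schwartz_iff using all_derivs_rapid_polyg[OF _ all_derivs_polyg_const[of _ c]]
  by (simp add: mult.commute)

lemma schwartz_diff: "schwartz f \<Longrightarrow> schwartz g \<Longrightarrow> schwartz (\<lambda>x. f x - g x)"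
  using schwartz_add[of f "\<lambda>x. (-1) * g x"] schwartz_cmult[of g "-1"] by simp

lemma all_derivs_polyg_inner: "all_derivs (polyg \<tau>) (\<lambda>i x. of_real (x \<bullet> e))"
proof (rule all_derivs_coinduct[where X="\<lambda>F. (\<exists>c. F = (\<lambda>i x. c)) \<or> F = (\<lambda>i x. of_real (x \<bullet> e))"])
  fix F :: "'a \<Rightarrow> 'b \<Rightarrow> complex"
  assume F: "(\<exists>c. F = (\<lambda>i x. c)) \<or> F = (\<lambda>i x. of_real (x \<bullet> e))"
  have "norm (of_real (x \<bullet> e)::complex) \<le> norm e * pw (\<tau> i) ^ 1 * pw x ^ 1" for i x
  proof -
    have "norm (of_real (x \<bullet> e)::complex) \<le> norm e * norm x"
      using Cauchy_Schwarz_ineq2[of x e] by (simp add: mult.commute)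
    also have "\<dots> \<le> (norm e * pw (\<tau> i)) * pw x"
      by (intro mult_mono) (auto simp: pw_def mult_left_le algebra_simps)
    finally show ?thesis by simp
  qed
  then have "polyg \<tau> (\<lambda>i x. of_real (x \<bullet> e) :: complex)"
    unfolding polyg_def by (intro conjI allI continuous_intros) blast
  with F show "polyg \<tau> F \<and> (\<forall>b\<in>Basis. \<exists>F'. (\<forall>i. has_pd b (F i) (F' i)) \<and>
      ((\<exists>c. F' = (\<lambda>i x. c)) \<or> F' = (\<lambda>i x. of_real (x \<bullet> e))))"
    using polyg_const has_pd_const has_pd_inner by metis
qed blast

lemma schwartz_inner_mult: "schwartz f \<Longrightarrow> schwartz (\<lambda>x. of_real (x \<bullet> e) * f x)"
  unfolding schwartz_iff using all_derivs_rapid_polyg[OF _ all_derivs_polyg_inner[of _ e]]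
  by (simp add: mult.commute)

lemma schwartz_cnj: "schwartz f \<Longrightarrow> schwartz (\<lambda>x. cnj (f x))"
  unfolding schwartz_iff
  by (erule all_derivs_map[where H="\<lambda>F i x. cnj (F i x)"])
     (auto simp: rapid_0_iff has_pd_cnj intro!: continuous_intros)

text \<open>Differentiating a modulation multiplies it by the number \<open>b \<bullet> a i\<close>
  up to a constant, which depends on the index but not on x. \<open>R\<close> is general because the
  argument serves classes with and without joint continuity in the index.\<close>

lemma all_derivs_exp:
  fixes R :: "('i \<Rightarrow> 'a::euclidean_space \<Rightarrow> complex) \<Rightarrow> bool" and a :: "'i \<Rightarrow> 'a"
  assumes add: "\<And>F G. R F \<Longrightarrow> R G \<Longrightarrow> R (\<lambda>i x. F i x + G i x)"
    and mult: "\<And>F G. R F \<Longrightarrow> R G \<Longrightarrow> R (\<lambda>i x. F i x * G i x)"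
    and exp: "R (\<lambda>i x. exp (\<i> * of_real (x \<bullet> a i)))" and lin: "\<And>b. R (\<lambda>i x. of_real (b \<bullet> a i))" and const: "\<And>c. R (\<lambda>i x. c)"
  shows "all_derivs R (\<lambda>i x. exp (\<i> * of_real (x \<bullet> a i)))"
proof -
  have cst: "derivs_upto R n (\<lambda>i x. c i)" if "R (\<lambda>i x. c i)" for c n
  proof (cases n)
    case (Suc m)
    have z: "derivs_upto R m (\<lambda>i x. 0)" for m
    proof (induction m)
      case (Suc m)
      then show ?case using const[of 0] has_pd_const[of _ 0] by (auto intro!: exI[of _ "\<lambda>i x. 0"])
    qed (simp add: const)
    then show ?thesis using that Suc has_pd_const z[of m] by (auto intro!: exI[of _ "\<lambda>i x. 0"])
  qed (use that in simp)
  have "derivs_upto R n (\<lambda>i x. exp (\<i> * of_real (x \<bullet> a i)))" for n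
  proof (induction n)
    case (Suc n)
    have "derivs_upto R n (\<lambda>i x. (\<i> * of_real (b \<bullet> a i)) * exp (\<i> * of_real (x \<bullet> a i)))" for b
      by (intro derivs_upto_mult[where P=R and Q=R] add mult Suc cst lin const)
    then show ?case
      unfolding derivs_upto.simps
    proof (intro conjI ballI exp)
      fix b :: 'a
      assume "\<And>b. derivs_upto R n (\<lambda>i x. (\<i> * of_real (b \<bullet> a i)) * exp (\<i> * of_real (x \<bullet> a i)))"
      then show "\<exists>F'. (\<forall>i. has_pd b (\<lambda>x. exp (\<i> * of_real (x \<bullet> a i))) (F' i)) \<and> derivs_upto R n F'"
        using has_pd_exp[of b] by (intro exI[of _ "\<lambda>i x. (\<i> * of_real (b \<bullet> a i)) * exp (\<i> * of_real (x \<bullet> a i))"]) auto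
    qed
  qed (simp add: exp)
  then show ?thesis by (simp add: all_derivs_def)
qed

lemma polyg_exp:
  fixes a :: "'i \<Rightarrow> 'a::euclidean_space"
  shows "polyg \<tau> (\<lambda>i x. exp (\<i> * of_real (x \<bullet> a i)))"
proof -
  have "norm (exp (\<i> * of_real (x \<bullet> a i))) \<le> 1 * pw (\<tau> i) ^ 0 * pw x ^ 0" for i and x :: 'a by simp
  then have "\<exists>C M. \<forall>i (x::'a). norm (exp (\<i> * of_real (x \<bullet> a i))) \<le> C * pw (\<tau> i) ^ M * pw x ^ M" by (intro exI allI)
  then show ?thesis unfolding polyg_def by (intro conjI allI continuous_intros)
qed

lemma polyg_inner_const:
  fixes a :: "'i \<Rightarrow> 'a::euclidean_space"
  assumes "\<And>i. norm (a i) \<le> \<tau> i"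
  shows "polyg \<tau> (\<lambda>i (x::'a). of_real (b \<bullet> a i) :: complex)"
proof -
  have "norm (of_real (b \<bullet> a i)::complex) \<le> norm b * pw (\<tau> i) ^ 1 * pw x ^ 1" for i and x :: 'a
  proof -
    have "norm (of_real (b \<bullet> a i)::complex) \<le> norm b * norm (a i)"
      using Cauchy_Schwarz_ineq2[of b "a i"] by simp
    also have "\<dots> \<le> (norm b * pw (\<tau> i)) * pw x"
      using assms[of i] by (intro order_trans[OF _ mult_left_mono[OF pw_ge1]] ) (auto simp: pw_def intro!: mult_left_mono)
    finally show ?thesis by simp
  qed
  then have "\<exists>C M. \<forall>i (x::'a). norm (of_real (b \<bullet> a i)::complex) \<le> C * pw (\<tau> i) ^ M * pw x ^ M"
    by (intro exI allI)
  then show ?thesis unfolding polyg_def by (intro conjI allI continuous_on_const)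
qed

lemma all_derivs_polyg_exp:
  fixes a :: "'i \<Rightarrow> 'a::euclidean_space"
  assumes "\<And>i. norm (a i) \<le> \<tau> i"
  shows "all_derivs (polyg \<tau>) (\<lambda>i x. exp (\<i> * of_real (x \<bullet> a i)))"
  by (intro all_derivs_exp polyg_add polyg_mult polyg_const polyg_exp polyg_inner_const assms)

lemma japanese_bounds: "pw x / 2 \<le> japanese x" "japanese x \<le> pw x" "japanese x \<ge> 1"
proof -
  show "japanese x \<le> pw x" unfolding japanese_def pw_def
    by (rule real_le_lsqrt) (auto simp: power2_eq_square algebra_simps)
  show 1: "japanese x \<ge> 1" unfolding japanese_def by simp
  have "norm x \<le> japanese x" unfolding japanese_def by (rule real_le_rsqrt) simp
  with 1 show "pw x / 2 \<le> japanese x" by (simp add: pw_def)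
qed

lemma all_derivs_polyg_japanese: "all_derivs (polyg \<tau>) (\<lambda>i (x::real^'d). of_real (japanese x powr s))"
proof -
  have P: "polyg \<tau> (\<lambda>i (x::real^'d). of_real (japanese x powr s) :: complex)" for s
  proof -
    have "japanese x powr s \<le> 1 * pw (\<tau> i) ^ nat \<lceil>\<bar>s\<bar>\<rceil> * pw x ^ nat \<lceil>\<bar>s\<bar>\<rceil>" for i and x :: "real^'d"
    proof -
      have "japanese x powr s \<le> japanese x powr (real (nat \<lceil>\<bar>s\<bar>\<rceil>))"
        using japanese_bounds(3)[of x] by (intro powr_mono) linarith+
      also have "\<dots> = japanese x ^ nat \<lceil>\<bar>s\<bar>\<rceil>"
        using japanese_bounds(3)[of x] by (intro powr_realpow) linarith
      also have "\<dots> \<le> 1 * pw x ^ nat \<lceil>\<bar>s\<bar>\<rceil>"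
        using japanese_bounds[of x] by (simp add: power_mono)
      also have "\<dots> \<le> (1 * pw (\<tau> i) ^ nat \<lceil>\<bar>s\<bar>\<rceil>) * pw x ^ nat \<lceil>\<bar>s\<bar>\<rceil>"
        by (intro mult_right_mono) auto
      finally show ?thesis .
    qed
    moreover have "continuous_on UNIV (\<lambda>x::real^'d. of_real (japanese x powr s) :: complex)"
      unfolding japanese_def
      by (intro continuous_intros) (auto simp: add_nonneg_eq_0_iff)
    ultimately show ?thesis
      unfolding polyg_def norm_of_real abs_of_nonneg[OF powr_ge_zero] by blast
  qed
  have "derivs_upto (polyg \<tau>) n (\<lambda>i (x::real^'d). of_real (japanese x powr s))" for n
  \<comment> \<open>A derivative replaces the exponent \<open>s\<close> by \<open>s - 2\<close> and
    adds a linear factor, so the induction runs over all exponents at once.\<close>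
  proof (induction n arbitrary: s)
    case (Suc n)
    have "derivs_upto (polyg \<tau>) n (\<lambda>i x. (of_real s * of_real (x \<bullet> b)) * of_real (japanese x powr (s - 2)))" for b :: "real^'d"
      using all_derivs_polyg_const[of \<tau> "of_real s", unfolded all_derivs_def] all_derivs_polyg_inner[of \<tau> b, unfolded all_derivs_def]
      by (intro derivs_upto_mult[where P="polyg \<tau>" and Q="polyg \<tau>"] polyg_add polyg_mult Suc(1)) auto
    then have D: "derivs_upto (polyg \<tau>) n (\<lambda>i x. of_real (s * (x \<bullet> b) * japanese x powr (s - 2)))" for b :: "real^'d"
      by simp
    show ?case
      unfolding derivs_upto.simps
    proof (intro conjI ballI P)
      fix b :: "real^'d"
      show "\<exists>F'. (\<forall>i::'a. has_pd b (\<lambda>x. complex_of_real (japanese x powr s)) (F' i)) \<and> derivs_upto (polyg \<tau>) n F'"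
        using D[of b] has_pd_japanese_powr[of b s] by (intro exI[of _ "\<lambda>i x. of_real (s * (x \<bullet> b) * japanese x powr (s - 2))"]) auto
    qed
  qed (simp add: P)
  then show ?thesis by (simp add: all_derivs_def)
qed

section \<open>Integrals, Fourier inversion and Sobolev duality\<close>

text \<open>The function is dominated by the sum over n of \<open>1 / Suc n ^ k\<close> on the ball
  of radius \<open>Suc n\<close>. The volume contributes \<open>Suc n ^ DIM('a)\<close>, so two
  exponents beyond the dimension leave a multiple of the series of inverse squares. This is the
  origin of \<open>DIM('a) + 2\<close> in all integrations.\<close>

lemma integrable_pw:
  assumes "k \<ge> DIM('a::euclidean_space) + 2"
  shows "integrable lborel (\<lambda>x::'a. 1 / pw x ^ k)"
proof (rule integrableI_bounded)
  let ?V = "unit_ball_vol (real DIM('a))"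
  have cont: "continuous_on UNIV (\<lambda>x::'a. 1 / pw x ^ k)" by (intro continuous_intros) auto
  then show "(\<lambda>x::'a. 1 / pw x ^ k) \<in> borel_measurable lborel" by (simp add: borel_measurable_continuous_onI)
  have pt: "ennreal (norm (1 / pw x ^ k)) \<le> (\<Sum>n. ennreal (1 / real (Suc n) ^ k) * indicator (ball 0 (real (Suc n))) x)" for x :: 'a
  proof -
    define n where "n = nat \<lfloor>norm x\<rfloor>"
    have n: "real n \<le> norm x" "norm x < real (Suc n)"
      unfolding n_def by (auto simp: of_nat_nat) linarith
    have "ennreal (norm (1 / pw x ^ k)) \<le> ennreal (1 / real (Suc n) ^ k)"
      using n by (intro ennreal_leI) (auto simp: pw_def intro!: divide_left_mono power_mono)
    also have "\<dots> = ennreal (1 / real (Suc n) ^ k) * indicator (ball 0 (real (Suc n))) x"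
      using n by simp
    also have "\<dots> = (\<Sum>i\<in>{n}. ennreal (1 / real (Suc i) ^ k) * indicator (ball 0 (real (Suc i))) x)"
      by (simp only: sum.insert finite.emptyI empty_iff not_False_eq_True sum.empty add_0_right)
    also have "\<dots> \<le> (\<Sum>n. ennreal (1 / real (Suc n) ^ k) * indicator (ball 0 (real (Suc n))) x)"
      by (intro sum_le_suminf) auto
    finally show ?thesis .
  qed
  have "(\<integral>\<^sup>+ (x::'a). ennreal (norm (1 / pw x ^ k)) \<partial>lborel)
      \<le> (\<integral>\<^sup>+ (x::'a). (\<Sum>n. ennreal (1 / real (Suc n) ^ k) * indicator (ball 0 (real (Suc n))) x) \<partial>lborel)"
    by (intro nn_integral_mono pt)
  also have "\<dots> = (\<Sum>n. \<integral>\<^sup>+ (x::'a). ennreal (1 / real (Suc n) ^ k) * indicator (ball 0 (real (Suc n))) x \<partial>lborel)"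
    by (intro nn_integral_suminf borel_measurable_times_ennreal borel_measurable_const borel_measurable_indicator) simp
  also have "\<dots> = (\<Sum>n. ennreal (1 / real (Suc n) ^ k) * ennreal (?V * real (Suc n) ^ DIM('a)))"
    by (subst nn_integral_cmult_indicator) (simp_all add: emeasure_ball)
  also have "\<dots> \<le> (\<Sum>n. ennreal (?V * (1 / real (Suc n) ^ 2)))"
  proof (intro suminf_le allI)
    fix n
    have "1 / real (Suc n) ^ k * (?V * real (Suc n) ^ DIM('a)) \<le> 1 / real (Suc n) ^ (DIM('a) + 2) * (?V * real (Suc n) ^ DIM('a))"
      using assms by (intro mult_right_mono divide_left_mono power_increasing) auto
    also have "\<dots> = ?V * (1 / real (Suc n) ^ 2)" by (simp add: power_add power2_eq_square field_simps del: of_nat_Suc)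
    finally show "ennreal (1 / real (Suc n) ^ k) * ennreal (?V * real (Suc n) ^ DIM('a)) \<le> ennreal (?V * (1 / real (Suc n) ^ 2))"
      by (subst ennreal_mult[symmetric]) (auto intro!: ennreal_leI)
  qed auto
  also have "\<dots> < \<infinity>"
  proof -
    have "summable (\<lambda>n. ?V * (1 / real (Suc n) ^ 2))"
      using inverse_squares_sums by (intro summable_mult) (auto simp: sums_iff add_ac)
    then show ?thesis by (subst suminf_ennreal2) auto
  qed
  finally show "(\<integral>\<^sup>+ (x::'a). ennreal (norm (1 / pw x ^ k)) \<partial>lborel) < \<infinity>" .
qed

definition pw_int :: "'a::euclidean_space itself \<Rightarrow> real" where
  "pw_int _ = (\<integral>(x::'a). 1 / pw x ^ (DIM('a) + 2) \<partial>lborel)"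

lemma pw_int_nonneg [simp]: "pw_int TYPE('a::euclidean_space) \<ge> 0"
  unfolding pw_int_def by (intro integral_nonneg_AE) auto

lemma integrable_bound_pw:
  fixes f :: "'a::euclidean_space \<Rightarrow> 'b::{banach, second_countable_topology}"
  assumes "f \<in> borel_measurable borel" "\<And>x. norm (f x) \<le> C / pw x ^ k" "k \<ge> DIM('a) + 2"
  shows "integrable lborel f"
proof (rule Bochner_Integration.integrable_bound)
  show "integrable lborel (\<lambda>x::'a. C * (1 / pw x ^ k))"
    using integrable_pw[OF assms(3)] by (rule integrable_mult_right)
  show "AE x in lborel. norm (f x) \<le> norm (C * (1 / pw x ^ k))"
    by (intro AE_I2 order_trans[OF assms(2)]) (simp add: divide_right_mono)
qed (use assms(1) in simp)

text \<open>No integrability is assumed: without it the Bochner integral is 0, and the hypothesis at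
  the origin shows that the bound is nonnegative.\<close>

lemma integral_bound_pw:
  fixes f :: "'a::euclidean_space \<Rightarrow> 'b::{banach, second_countable_topology}"
  assumes "\<And>x. norm (f x) \<le> C / pw x ^ (DIM('a) + 2)"
  shows "norm (\<integral>x. f x \<partial>lborel) \<le> C * pw_int TYPE('a)"
proof (cases "integrable lborel f")
  case True
  have "norm (\<integral>x. f x \<partial>lborel) \<le> (\<integral>x. norm (f x) \<partial>lborel)" by (rule integral_norm_bound)
  also have "\<dots> \<le> (\<integral>(x::'a). C * (1 / pw x ^ (DIM('a) + 2)) \<partial>lborel)"
    using assms True by (intro integral_mono integrable_mult_right integrable_pw integrable_norm) auto
  finally show ?thesis by (simp only: pw_int_def integral_mult_right_zero)
next
  case False
  have "0 \<le> C / pw (0::'a) ^ (DIM('a) + 2)" using assms[of 0] norm_ge_zero order_trans by blast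
  with False show ?thesis by (simp add: not_integrable_integral_eq)
qed

lemma lborel_integral_affine:
  fixes f :: "'a::euclidean_space \<Rightarrow> 'b::{banach, second_countable_topology}"
  assumes f: "f \<in> borel_measurable borel" and c: "c \<noteq> 0"
  shows "(\<integral>x. f (t + c *\<^sub>R x) \<partial>lborel) = (1 / \<bar>c\<bar> ^ DIM('a)) *\<^sub>R (\<integral>x. f x \<partial>lborel)" (is ?A)
    and "integrable lborel (\<lambda>x. f (t + c *\<^sub>R x)) \<longleftrightarrow> integrable lborel f" (is ?B)
proof -
  have 1: "(\<integral>x. f x \<partial>lborel) = \<bar>c\<bar> ^ DIM('a) *\<^sub>R (\<integral>x. f (t + c *\<^sub>R x) \<partial>lborel)"
    using f by (subst lborel_affine[OF c, of t]) (simp add: integral_density integral_distr)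
  then show ?A using c by simp
  have "integrable lborel f \<longleftrightarrow> integrable (density (distr lborel borel (\<lambda>x. t + c *\<^sub>R x)) (\<lambda>_. ennreal (\<bar>c\<bar> ^ DIM('a)))) f"
    using lborel_affine[OF c, of t] by (simp add: ennreal_power)
  also have "\<dots> \<longleftrightarrow> integrable lborel (\<lambda>x. \<bar>c\<bar> ^ DIM('a) *\<^sub>R f (t + c *\<^sub>R x))"
    using f by (subst integrable_density) (auto simp: integrable_distr_eq)
  also have "\<dots> \<longleftrightarrow> integrable lborel (\<lambda>x. f (t + c *\<^sub>R x))"
    using c integrable_scaleR_right[of "\<bar>c\<bar> ^ DIM('a)" lborel "\<lambda>x. f (t + c *\<^sub>R x)"]
      integrable_scaleR_right[of "1 / \<bar>c\<bar> ^ DIM('a)" lborel "\<lambda>x. \<bar>c\<bar> ^ DIM('a) *\<^sub>R f (t + c *\<^sub>R x)"] by auto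
  finally show ?B by simp
qed

lemma lborel_integral_shift:
  fixes f :: "'a::euclidean_space \<Rightarrow> 'b::{banach, second_countable_topology}"
  assumes "f \<in> borel_measurable borel"
  shows "(\<integral>x. f (x - a) \<partial>lborel) = (\<integral>x. f x \<partial>lborel)" "(\<integral>x. f (x + a) \<partial>lborel) = (\<integral>x. f x \<partial>lborel)"
    "(\<integral>x. f (a - x) \<partial>lborel) = (\<integral>x. f x \<partial>lborel)" "(\<integral>x. f (- x) \<partial>lborel) = (\<integral>x. f x \<partial>lborel)"
    "integrable lborel (\<lambda>x. f (x - a)) \<longleftrightarrow> integrable lborel f" "integrable lborel (\<lambda>x. f (x + a)) \<longleftrightarrow> integrable lborel f"
    "integrable lborel (\<lambda>x. f (a - x)) \<longleftrightarrow> integrable lborel f" "integrable lborel (\<lambda>x. f (- x)) \<longleftrightarrow> integrable lborel f"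
  using lborel_integral_affine[OF assms, of 1 a] lborel_integral_affine[OF assms, of 1 "-a"]
    lborel_integral_affine[OF assms, of "-1" a] lborel_integral_affine[OF assms, of "-1" 0]
  by (simp_all add: add.commute)

lemma pw_int_shift:
  fixes a :: "'a::euclidean_space"
  shows "(\<integral>x. 1 / pw (a - x) ^ (DIM('a) + 2) \<partial>lborel) = pw_int TYPE('a)"
  "(\<integral>x. 1 / pw (x - a) ^ (DIM('a) + 2) \<partial>lborel) = pw_int TYPE('a)"
  "k \<ge> DIM('a) + 2 \<Longrightarrow> integrable lborel (\<lambda>x. 1 / pw (a - x) ^ k)"
  "k \<ge> DIM('a) + 2 \<Longrightarrow> integrable lborel (\<lambda>x. 1 / pw (x - a) ^ k)"
proof -
  have m: "(\<lambda>x::'a. 1 / pw x ^ k) \<in> borel_measurable borel" for k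
    by (intro borel_measurable_continuous_onI continuous_intros) auto
  show "(\<integral>x. 1 / pw (a - x) ^ (DIM('a) + 2) \<partial>lborel) = pw_int TYPE('a)"
    unfolding pw_int_def using lborel_integral_shift(3)[OF m[of "DIM('a) + 2"], of a] by metis
  show "(\<integral>x. 1 / pw (x - a) ^ (DIM('a) + 2) \<partial>lborel) = pw_int TYPE('a)"
    unfolding pw_int_def using lborel_integral_shift(1)[OF m[of "DIM('a) + 2"], of a] by metis
  show "integrable lborel (\<lambda>x. 1 / pw (a - x) ^ k)" if "k \<ge> DIM('a) + 2"
    using lborel_integral_shift(7)[OF m, of a k] integrable_pw[OF that] by blast
  show "integrable lborel (\<lambda>x. 1 / pw (x - a) ^ k)" if "k \<ge> DIM('a) + 2"
    using lborel_integral_shift(5)[OF m, of a k] integrable_pw[OF that] by blast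
qed

section \<open>Fubini, integration by parts and differentiation under the integral\<close>

lemma lborel_Fubini:
  fixes f :: "'a::euclidean_space \<Rightarrow> 'b::euclidean_space \<Rightarrow> 'c::{banach, second_countable_topology}"
  assumes "integrable lborel (\<lambda>z. f (fst z) (snd z))"
  shows "(\<integral>x. (\<integral>y. f x y \<partial>lborel) \<partial>lborel) = (\<integral>z. f (fst z) (snd z) \<partial>lborel)"
    "(\<integral>y. (\<integral>x. f x y \<partial>lborel) \<partial>lborel) = (\<integral>z. f (fst z) (snd z) \<partial>lborel)"
    "(\<integral>x. (\<integral>y. f x y \<partial>lborel) \<partial>lborel) = (\<integral>y. (\<integral>x. f x y \<partial>lborel) \<partial>lborel)"
proof -
  have i: "integrable (lborel \<Otimes>\<^sub>M lborel) (case_prod f)"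
    using assms by (simp add: lborel_prod case_prod_unfold)
  show 1: "(\<integral>x. (\<integral>y. f x y \<partial>lborel) \<partial>lborel) = (\<integral>z. f (fst z) (snd z) \<partial>lborel)"
    using lborel_pair.integral_fst[OF i] by (simp add: lborel_prod case_prod_unfold)
  show "(\<integral>y. (\<integral>x. f x y \<partial>lborel) \<partial>lborel) = (\<integral>z. f (fst z) (snd z) \<partial>lborel)"
    using lborel_pair.integral_snd[OF i] by (simp add: lborel_prod case_prod_unfold)
  with 1 show "(\<integral>x. (\<integral>y. f x y \<partial>lborel) \<partial>lborel) = (\<integral>y. (\<integral>x. f x y \<partial>lborel) \<partial>lborel)" by simp
qed

text \<open>By translation invariance the integral of \<open>F'\<close> is unchanged when
  \<open>F'\<close> is shifted by \<open>t *\<^sub>R b\<close>. Averaging over t in the unit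
  interval and exchanging the integrals turns it into the integral of
  \<open>F (x + b) - F x\<close>, which vanishes, again by invariance. All integrations by parts use
  this form, which replaces boundary terms by integrability.\<close>

lemma has_pd_integral_zero:
  fixes F :: "'a::euclidean_space \<Rightarrow> complex"
  assumes pd: "has_pd b F F'" and cont: "continuous_on UNIV F'"
    and F: "integrable lborel F" and F': "integrable lborel F'"
  shows "(\<integral>x. F' x \<partial>lborel) = 0"
proof -
  let ?G = "\<lambda>t x. indicator {0..1::real} t *\<^sub>R F' (x + t *\<^sub>R b)"
  have [measurable]: "F' \<in> borel_measurable borel" "F \<in> borel_measurable borel"
    using F F' by auto
  have eq: "(\<integral>t. ?G t x \<partial>lborel) = F (x + b) - F x" for x
  proof -
    have "(\<integral>t. indicator {0..1::real} t *\<^sub>R F' (x + t *\<^sub>R b) \<partial>lborel) = F (x + 1 *\<^sub>R b) - F (x + 0 *\<^sub>R b)"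
      by (rule integral_FTC_atLeastAtMost)
         (auto intro!: has_vector_derivative_at_within[OF has_pd_at[OF pd]] continuous_on_compose2[OF cont] continuous_intros)
    then show ?thesis by simp
  qed
  have int: "integrable (lborel \<Otimes>\<^sub>M lborel) (case_prod ?G)"
  proof (rule lborel_pair.Fubini_integrable)
    show "case_prod ?G \<in> borel_measurable (lborel \<Otimes>\<^sub>M lborel)" by measurable
    have "integrable lborel (\<lambda>t. indicator {0..1::real} t *\<^sub>R (\<integral>x. norm (F' x) \<partial>lborel))" by simp
    moreover have "(\<integral>x. norm (case_prod ?G (t, x)) \<partial>lborel) = indicator {0..1::real} t *\<^sub>R (\<integral>x. norm (F' x) \<partial>lborel)" for t
      using lborel_integral_shift(2)[of "\<lambda>x. norm (F' x)" "t *\<^sub>R b"] by (auto simp: indicator_def)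
    ultimately show "integrable lborel (\<lambda>t. \<integral>x. norm (case_prod ?G (t, x)) \<partial>lborel)" by (simp only:)
    show "AE t in lborel. integrable lborel (\<lambda>x. case_prod ?G (t, x))"
      using F' lborel_integral_shift(6)[of F'] by (auto intro!: AE_I2)
  qed
  have "(\<integral>x. F' x \<partial>lborel) = (\<integral>t. indicator {0..1::real} t *\<^sub>R (\<integral>x. F' x \<partial>lborel) \<partial>lborel)" by simp
  also have "\<dots> = (\<integral>t. (\<integral>x. ?G t x \<partial>lborel) \<partial>lborel)"
    using lborel_integral_shift(2)[of F'] by (simp add: indicator_def)
  also have "\<dots> = (\<integral>x. (\<integral>t. ?G t x \<partial>lborel) \<partial>lborel)"
    using lborel_pair.Fubini_integral[OF int] by simp
  also have "\<dots> = 0"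
    unfolding eq using F lborel_integral_shift[of F] by simp
  finally show ?thesis .
qed

lemma has_vector_derivative_iff_tendsto:
  fixes f :: "real \<Rightarrow> 'b::real_normed_vector"
  shows "(f has_vector_derivative D) (at 0) \<longleftrightarrow> ((\<lambda>h. (1 / h) *\<^sub>R (f h - f 0)) \<longlongrightarrow> D) (at 0)"
proof -
  have eq: "norm (f (0 + h) - f 0 - h *\<^sub>R D) / norm h = norm ((1 / h) *\<^sub>R (f h - f 0) - D)" if "h \<noteq> 0" for h
  proof -
    have "f h - f 0 - h *\<^sub>R D = h *\<^sub>R ((1 / h) *\<^sub>R (f h - f 0) - D)"
      using that by (simp add: algebra_simps)
    then show ?thesis using that by simp
  qed
  have "(f has_vector_derivative D) (at 0) \<longleftrightarrow> ((\<lambda>h. norm (f (0 + h) - f 0 - h *\<^sub>R D) / norm h) \<longlongrightarrow> 0) (at 0)"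
    unfolding has_vector_derivative_def has_derivative_at by (auto intro!: bounded_linear_scaleR_left)
  also have "\<dots> \<longleftrightarrow> ((\<lambda>h. norm ((1 / h) *\<^sub>R (f h - f 0) - D)) \<longlongrightarrow> 0) (at 0)"
    by (rule filterlim_cong[OF refl refl]) (use eq in \<open>auto simp: eventually_at_filter\<close>)
  also have "\<dots> \<longleftrightarrow> ((\<lambda>h. (1 / h) *\<^sub>R (f h - f 0)) \<longlongrightarrow> D) (at 0)"
    by (subst Lim_null) (simp add: tendsto_norm_zero_iff)
  finally show ?thesis .
qed

lemma has_pd_increment:
  assumes pd: "has_pd b f f'" and B: "\<And>t. \<bar>t\<bar> \<le> r \<Longrightarrow> norm (f' (x + t *\<^sub>R b)) \<le> B" and "\<bar>s\<bar> \<le> r"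
  shows "norm (f (x + s *\<^sub>R b) - f x) \<le> B * \<bar>s\<bar>"
proof -
  have "norm ((\<lambda>t. f (x + t *\<^sub>R b)) s - (\<lambda>t. f (x + t *\<^sub>R b)) 0) \<le> B * norm (s - 0)"
  proof (rule differentiable_bound[where S="{-r..r}" and f'="\<lambda>t h. h *\<^sub>R f' (x + t *\<^sub>R b)"])
    fix t assume "t \<in> {-r..r}"
    then have t: "\<bar>t\<bar> \<le> r" by auto
    show "((\<lambda>t. f (x + t *\<^sub>R b)) has_derivative (\<lambda>h. h *\<^sub>R f' (x + t *\<^sub>R b))) (at t within {-r..r})"
      using has_vector_derivative_at_within[OF has_pd_at[OF pd]] by (simp add: has_vector_derivative_def)
    show "onorm (\<lambda>h. h *\<^sub>R f' (x + t *\<^sub>R b)) \<le> B"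
      using B[OF t] by (intro onorm_le) (simp add: mult.commute[of B] mult_left_mono)
  qed (use assms in auto)
  then show ?thesis by simp
qed

text \<open>The dominating function may depend on the point: it has to control \<open>I'\<close>
  only on the segment of parameters between -1 and 1 in the direction \<open>b\<close>.\<close>

lemma has_pd_integral:
  fixes I :: "'a::euclidean_space \<Rightarrow> 'y \<Rightarrow> complex"
  assumes pd: "\<And>y. has_pd b (\<lambda>p. I p y) (\<lambda>p. I' p y)"
    and int: "\<And>p. integrable M (I p)" and meas: "\<And>p. I' p \<in> borel_measurable M"
    and dom: "\<And>p. \<exists>D. integrable M D \<and> (\<forall>t y. \<bar>t\<bar> \<le> 1 \<longrightarrow> norm (I' (p + t *\<^sub>R b) y) \<le> D y)"
  shows "has_pd b (\<lambda>p. \<integral>y. I p y \<partial>M) (\<lambda>p. \<integral>y. I' p y \<partial>M)"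
  unfolding has_pd_def has_vector_derivative_iff_tendsto
proof
  fix p
  obtain D where D: "integrable M D" "\<And>t y. \<bar>t\<bar> \<le> 1 \<Longrightarrow> norm (I' (p + t *\<^sub>R b) y) \<le> D y"
    using dom[of p] by auto
  \<comment> \<open>Restricting the increments to modulus below 1 keeps every difference quotient on
    the dominated segment.\<close>
  have at: "at (0::real) within {-1<..<1} = at 0" by (rule at_within_open) auto
  have "((\<lambda>h. (1 / h) *\<^sub>R ((\<integral>y. I (p + h *\<^sub>R b) y \<partial>M) - (\<integral>y. I (p + 0 *\<^sub>R b) y \<partial>M))) \<longlongrightarrow> (\<integral>y. I' p y \<partial>M)) (at 0 within {-1<..<1})"
    unfolding tendsto_at_iff_sequentially o_def
  proof (intro allI impI)
    fix X :: "nat \<Rightarrow> real" assume X: "\<forall>i. X i \<in> {-1<..<1} - {0}" "X \<longlonglongrightarrow> 0"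
    have "(\<lambda>i. \<integral>y. (1 / X i) *\<^sub>R (I (p + X i *\<^sub>R b) y - I p y) \<partial>M) \<longlonglongrightarrow> (\<integral>y. I' p y \<partial>M)"
    proof (rule integral_dominated_convergence[where w=D])
      show "I' p \<in> borel_measurable M" by (rule meas)
      show "integrable M D" by (rule D)
      fix i
      show "(\<lambda>y. (1 / X i) *\<^sub>R (I (p + X i *\<^sub>R b) y - I p y)) \<in> borel_measurable M"
        using int[THEN borel_measurable_integrable] by (intro borel_measurable_scaleR borel_measurable_diff borel_measurable_const)
      show "AE y in M. norm ((1 / X i) *\<^sub>R (I (p + X i *\<^sub>R b) y - I p y)) \<le> D y"
      proof (rule AE_I2)
        fix y
        have "\<bar>X i\<bar> \<le> 1" "X i \<noteq> 0" using X(1)[rule_format, of i] by auto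
        then show "norm ((1 / X i) *\<^sub>R (I (p + X i *\<^sub>R b) y - I p y)) \<le> D y"
          using has_pd_increment[OF pd[of y], of 1 p "D y" "X i"] D(2) by (simp add: divide_le_eq mult.commute del: scaleR_diff_right)
      qed
    next
      show "AE y in M. (\<lambda>i. (1 / X i) *\<^sub>R (I (p + X i *\<^sub>R b) y - I p y)) \<longlonglongrightarrow> I' p y"
      proof (rule AE_I2)
        fix y
        have "((\<lambda>h. (1 / h) *\<^sub>R (I (p + h *\<^sub>R b) y - I (p + 0 *\<^sub>R b) y)) \<longlongrightarrow> I' p y) (at 0)"
          using pd[of y] unfolding has_pd_def has_vector_derivative_iff_tendsto by auto
        then have "((\<lambda>h. (1 / h) *\<^sub>R (I (p + h *\<^sub>R b) y - I p y)) \<longlongrightarrow> I' p y) (at 0 within {-1<..<1})"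
          unfolding at by simp
        then show "(\<lambda>i. (1 / X i) *\<^sub>R (I (p + X i *\<^sub>R b) y - I p y)) \<longlonglongrightarrow> I' p y"
          using X unfolding tendsto_at_iff_sequentially o_def by blast
      qed
    qed
    then show "(\<lambda>i. (1 / X i) *\<^sub>R ((\<integral>y. I (p + X i *\<^sub>R b) y \<partial>M) - (\<integral>y. I (p + 0 *\<^sub>R b) y \<partial>M))) \<longlonglongrightarrow> (\<integral>y. I' p y \<partial>M)"
      using int by simp
  qed
  then show "((\<lambda>h. (1 / h) *\<^sub>R ((\<integral>y. I (p + h *\<^sub>R b) y \<partial>M) - (\<integral>y. I (p + 0 *\<^sub>R b) y \<partial>M))) \<longlongrightarrow> (\<integral>y. I' p y \<partial>M)) (at 0)"
    unfolding at .
qed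

lemma continuous_on_integral_dominated:
  fixes I :: "'p::metric_space \<Rightarrow> 'y \<Rightarrow> 'b::{banach, second_countable_topology}"
  assumes cont: "\<And>y. continuous_on UNIV (\<lambda>p. I p y)" and meas: "\<And>p. I p \<in> borel_measurable M"
    and dom: "\<And>p. \<exists>D. integrable M D \<and> (\<forall>q y. dist q p \<le> 1 \<longrightarrow> norm (I q y) \<le> D y)"
  shows "continuous_on UNIV (\<lambda>p. \<integral>y. I p y \<partial>M)"
  unfolding continuous_on_sequentially o_def
proof (intro ballI allI impI)
  fix X p assume "(\<forall>n. X n \<in> UNIV) \<and> X \<longlonglongrightarrow> (p::'p)"
  then have X: "X \<longlonglongrightarrow> p" by auto
  obtain D where D: "integrable M D" "\<And>q y. dist q p \<le> 1 \<Longrightarrow> norm (I q y) \<le> D y" using dom[of p] by auto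
  \<comment> \<open>Domination holds only in the unit ball about \<open>p\<close>, so the first
    \<open>N\<close> terms of the sequence are dropped.\<close>
  obtain N where N: "\<And>n. n \<ge> N \<Longrightarrow> dist (X n) p < 1"
    using X unfolding lim_sequentially by (meson zero_less_one)
  have "(\<lambda>n. \<integral>y. I (X (n + N)) y \<partial>M) \<longlonglongrightarrow> (\<integral>y. I p y \<partial>M)"
  proof (rule integral_dominated_convergence[where w=D])
    show "AE y in M. (\<lambda>n. I (X (n + N)) y) \<longlonglongrightarrow> I p y"
    proof (rule AE_I2)
      fix y
      have "(\<lambda>n. I (X n) y) \<longlonglongrightarrow> I p y"
        using cont[of y] X unfolding continuous_on_sequentially o_def by blast
      then show "(\<lambda>n. I (X (n + N)) y) \<longlonglongrightarrow> I p y" by (rule LIMSEQ_ignore_initial_segment)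
    qed
    show "AE y in M. norm (I (X (i + N)) y) \<le> D y" for i
      using N[of "i + N"] D(2) by (intro AE_I2) (auto intro: less_imp_le)
  qed (use meas D in auto)
  then show "(\<lambda>n. \<integral>y. I (X n) y \<partial>M) \<longlonglongrightarrow> (\<integral>y. I p y \<partial>M)" by (rule LIMSEQ_offset)
qed

lemma continuous_on_slice:
  "continuous_on UNIV (\<lambda>z. f (fst z) (snd z)) \<Longrightarrow> continuous_on UNIV (\<lambda>y. f x y)"
  "continuous_on UNIV (\<lambda>z. f (fst z) (snd z)) \<Longrightarrow> continuous_on UNIV (\<lambda>x. f x y)"
  by (auto intro: continuous_on_compose2[where f="\<lambda>y. (x, y)" and g="\<lambda>z. f (fst z) (snd z)", simplified]
       continuous_on_compose2[where f="\<lambda>x. (x, y)" and g="\<lambda>z. f (fst z) (snd z)", simplified] intro!: continuous_intros)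

lemma schwartz_integrable:
  fixes f :: "'a::euclidean_space \<Rightarrow> complex"
  assumes "schwartz f" shows "integrable lborel f"
proof -
  obtain C where "\<And>x. norm (f x) \<le> C / pw x ^ (DIM('a) + 2)" using schwartz_bound[OF assms] by metis
  then show ?thesis
    using schwartz_cont[OF assms] by (intro integrable_bound_pw[where k="DIM('a) + 2"] borel_measurable_continuous_onI) auto
qed

lemma integrable_lborel_prod:
  fixes f :: "'a::euclidean_space \<Rightarrow> 'c::{banach, second_countable_topology, real_normed_field}"
  assumes f: "integrable lborel f" and g: "integrable lborel (g :: 'b::euclidean_space \<Rightarrow> 'c)"
  shows "integrable lborel (\<lambda>z. f (fst z) * g (snd z))"
proof -
  have [measurable]: "f \<in> borel_measurable borel" "g \<in> borel_measurable borel" using f g by auto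
  have "integrable (lborel \<Otimes>\<^sub>M lborel) (\<lambda>z. f (fst z) * g (snd z))"
  proof (rule lborel_pair.Fubini_integrable)
    show "(\<lambda>z. f (fst z) * g (snd z)) \<in> borel_measurable (lborel \<Otimes>\<^sub>M lborel)" by measurable
    show "integrable lborel (\<lambda>x. \<integral>y. norm (f (fst (x, y)) * g (snd (x, y))) \<partial>lborel)"
      using f by (simp add: norm_mult)
    show "AE x in lborel. integrable lborel (\<lambda>y. f (fst (x, y)) * g (snd (x, y)))"
      using g by simp
  qed
  then show ?thesis by (simp add: lborel_prod)
qed

text \<open>The integral of \<open>(a x - l * b x)\<^sup>2\<close> is a nonnegative quadratic
  polynomial in \<open>l\<close>; its value at \<open>P / B\<close> gives the inequality.\<close>

lemma integral_Cauchy_Schwarz: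
  fixes a b :: "'a \<Rightarrow> real"
  assumes a: "integrable M (\<lambda>x. (a x)\<^sup>2)" and b: "integrable M (\<lambda>x. (b x)\<^sup>2)" and ab: "integrable M (\<lambda>x. a x * b x)"
  shows "(\<integral>x. a x * b x \<partial>M) \<le> sqrt (\<integral>x. (a x)\<^sup>2 \<partial>M) * sqrt (\<integral>x. (b x)\<^sup>2 \<partial>M)"
proof -
  define A where "A = (\<integral>x. (a x)\<^sup>2 \<partial>M)"
  define B where "B = (\<integral>x. (b x)\<^sup>2 \<partial>M)"
  define P where "P = (\<integral>x. a x * b x \<partial>M)"
  have AB: "A \<ge> 0" "B \<ge> 0" unfolding A_def B_def by (auto intro!: integral_nonneg_AE)
  have q: "A - 2 * l * P + l\<^sup>2 * B \<ge> 0" for l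
  proof -
    have "0 \<le> (\<integral>x. (a x - l * b x)\<^sup>2 \<partial>M)" by (auto intro!: integral_nonneg_AE)
    also have "(\<lambda>x. (a x - l * b x)\<^sup>2) = (\<lambda>x. (a x)\<^sup>2 - 2 * l * (a x * b x) + l\<^sup>2 * (b x)\<^sup>2)"
      by (rule ext) (simp add: power2_eq_square algebra_simps)
    also have "(\<integral>x. (a x)\<^sup>2 - 2 * l * (a x * b x) + l\<^sup>2 * (b x)\<^sup>2 \<partial>M) = A - 2 * l * P + l\<^sup>2 * B"
      using a b ab by (simp add: A_def B_def P_def)
    finally show ?thesis .
  qed
  have "P\<^sup>2 \<le> A * B"
  proof (cases "B = 0")
    case True
    have "P = 0"
    proof (rule ccontr)
      assume "P \<noteq> 0"
      \<comment> \<open>With \<open>B = 0\<close> the polynomial is affine in \<open>l\<close>, and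
        at this point it takes the value -1.\<close>
      then show False using q[of "(A + 1) / (2 * P)"] True by simp
    qed
    with AB show ?thesis by simp
  next
    case False
    with AB have "B > 0" by simp
    with q[of "P / B"] have "P\<^sup>2 / B \<le> A" by (simp add: power2_eq_square field_simps)
    with \<open>B > 0\<close> show ?thesis by (simp add: field_simps)
  qed
  then have "P \<le> sqrt (A * B)" by (rule real_le_rsqrt)
  then show ?thesis by (simp add: A_def B_def P_def real_sqrt_mult)
qed

section \<open>Gaussian integrals and Fourier inversion\<close>

lemma gauss_1:
  "integrable lborel (\<lambda>x::real. iexp (t * x) * of_real (exp (- x\<^sup>2 / 2)))"
  "(\<integral>x. iexp (t * x) * of_real (exp (- x\<^sup>2 / 2)) \<partial>lborel) = of_real (sqrt (2 * pi) * exp (- t\<^sup>2 / 2))"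
proof -
  have eq: "(\<lambda>x. iexp (t * x) * of_real (exp (- x\<^sup>2 / 2))) = (\<lambda>x. of_real (sqrt (2 * pi)) * (std_normal_density x *\<^sub>R iexp (t * x)))"
    by (rule ext) (simp add: std_normal_density_def scaleR_conv_of_real)
  have int: "integrable lborel (\<lambda>x. std_normal_density x *\<^sub>R iexp (t * x))"
    by (rule Bochner_Integration.integrable_bound[OF integrable_normal_density[of 1 0]]) auto
  then show "integrable lborel (\<lambda>x::real. iexp (t * x) * of_real (exp (- x\<^sup>2 / 2)))"
    unfolding eq by (rule integrable_mult_right)
  have "char std_normal_distribution t = (\<integral>x. std_normal_density x *\<^sub>R iexp (t * x) \<partial>lborel)"
    unfolding char_def by (subst integral_density) auto
  then have "(\<integral>x. std_normal_density x *\<^sub>R iexp (t * x) \<partial>lborel) = of_real (exp (- t\<^sup>2 / 2))"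
    by (simp add: char_std_normal_distribution)
  then show "(\<integral>x. iexp (t * x) * of_real (exp (- x\<^sup>2 / 2)) \<partial>lborel) = of_real (sqrt (2 * pi) * exp (- t\<^sup>2 / 2))"
    unfolding eq integral_mult_right_zero by simp
qed

text \<open>The one-dimensional formula is the characteristic function of the standard normal
  distribution. It passes to Euclidean space because both factors of the integrand split over the
  coordinates of a product measure.\<close>

lemma gauss:
  fixes x :: "'a::euclidean_space"
  shows "integrable lborel (\<lambda>y. exp (\<i> * of_real (x \<bullet> y)) * of_real (exp (- (norm y)\<^sup>2 / 2)))"
    "(\<integral>y. exp (\<i> * of_real (x \<bullet> y)) * of_real (exp (- (norm y)\<^sup>2 / 2)) \<partial>lborel)
       = of_real (sqrt (2 * pi) ^ DIM('a) * exp (- (norm x)\<^sup>2 / 2))"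
proof -
  interpret P: product_sigma_finite "\<lambda>_::'a. lborel :: real measure" ..
  let ?T = "\<lambda>f. \<Sum>b\<in>Basis. f b *\<^sub>R (b::'a)"
  have [measurable]: "?T \<in> borel_measurable (Pi\<^sub>M Basis (\<lambda>_. lborel))" by measurable
  define h where "h y = exp (\<i> * of_real (x \<bullet> y)) * of_real (exp (- (norm y)\<^sup>2 / 2))" for y
  have hm: "h \<in> borel_measurable borel" unfolding h_def by (intro borel_measurable_continuous_onI continuous_intros) auto
  let ?h = "\<lambda>b t. iexp ((x \<bullet> b) * t) * complex_of_real (exp (- t\<^sup>2 / 2))"
  have hT: "h (?T f) = (\<Prod>b\<in>Basis. ?h b (f b))" for f
  proof -
    have n: "(norm (?T f))\<^sup>2 = (\<Sum>b\<in>Basis. (f b)\<^sup>2)"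
      unfolding power2_norm_eq_inner by (subst euclidean_inner) (simp add: inner_sum_left inner_Basis power2_eq_square if_distrib cong: if_cong)
    have i: "x \<bullet> ?T f = (\<Sum>b\<in>Basis. (x \<bullet> b) * f b)"
      by (simp add: inner_sum_right mult.commute)
    show ?thesis
      unfolding h_def n i prod.distrib
      by (simp add: exp_sum[symmetric] sum_distrib_left sum_negf[symmetric] sum_divide_distrib of_real_prod[symmetric] del: of_real_prod)
  qed
  have "integrable (Pi\<^sub>M Basis (\<lambda>_. lborel)) (\<lambda>f. \<Prod>b\<in>Basis. ?h b (f b))"
    by (rule P.product_integrable_prod) (simp_all only: gauss_1 finite_Basis)
  then show "integrable lborel (\<lambda>y. exp (\<i> * of_real (x \<bullet> y)) * of_real (exp (- (norm y)\<^sup>2 / 2)))"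
    unfolding h_def[symmetric] by (subst lborel_eq) (simp add: integrable_distr_eq hm hT)
  have "(\<integral>y. h y \<partial>lborel) = (\<integral>f. (\<Prod>b\<in>Basis. ?h b (f b)) \<partial>Pi\<^sub>M Basis (\<lambda>_. lborel))"
    by (subst lborel_eq) (simp add: integral_distr hm hT)
  also have "\<dots> = (\<Prod>b\<in>Basis. \<integral>t. ?h b t \<partial>lborel)"
    by (rule P.product_integral_prod) (simp_all only: gauss_1 finite_Basis)
  also have "\<dots> = (\<Prod>b\<in>Basis. of_real (sqrt (2 * pi) * exp (- (x \<bullet> b)\<^sup>2 / 2)))"
    by (simp only: gauss_1)
  also have "\<dots> = of_real (sqrt (2 * pi) ^ DIM('a) * exp (\<Sum>b\<in>Basis. - (x \<bullet> b)\<^sup>2 / 2))"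
    by (simp only: of_real_prod[symmetric] prod.distrib prod_constant exp_sum finite_Basis)
  also have "(\<Sum>b\<in>Basis. - (x \<bullet> b)\<^sup>2 / 2) = - (norm x)\<^sup>2 / 2"
  proof -
    have "x \<bullet> x = (\<Sum>b\<in>Basis. (x \<bullet> b)\<^sup>2)" by (subst euclidean_inner) (simp add: power2_eq_square)
    then show ?thesis unfolding power2_norm_eq_inner by (simp add: sum_negf sum_divide_distrib)
  qed
  finally show "(\<integral>y. exp (\<i> * of_real (x \<bullet> y)) * of_real (exp (- (norm y)\<^sup>2 / 2)) \<partial>lborel)
       = of_real (sqrt (2 * pi) ^ DIM('a) * exp (- (norm x)\<^sup>2 / 2))"
    unfolding h_def .
qed

lemma gauss_real:
  shows "integrable lborel (\<lambda>y::'a::euclidean_space. complex_of_real (exp (- (norm y)\<^sup>2 / 2)))"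
    "(\<integral>(y::'a). complex_of_real (exp (- (norm y)\<^sup>2 / 2)) \<partial>lborel) = of_real (sqrt (2 * pi) ^ DIM('a))"
  using gauss[of "0::'a"] by (auto simp del: of_real_exp of_real_power)

lemma norm_cis [simp]: "norm (exp (\<i> * complex_of_real t)) = 1" "norm (exp (- (\<i> * complex_of_real t))) = 1"
  using norm_exp_i_times[of t] norm_exp_i_times[of "-t"] by simp_all

text \<open>The double integral behind the claim does not converge absolutely, so a Gaussian
  \<open>?G (e n *\<^sub>R \<xi>)\<close> with \<open>e n\<close> tending to 0 is inserted. The
  regularized integral \<open>A n\<close> tends to the left-hand side by dominated convergence;
  after Fubini it is an average of \<open>h\<close> against a rescaled Gaussian, which concentrates
  at \<open>s\<close>.\<close>

lemma fourier_inversion: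
  fixes h :: "real^'d \<Rightarrow> complex"
  assumes hc: "continuous_on UNIV h" and hb: "\<And>x. norm (h x) \<le> B" and hi: "integrable lborel h"
    and Fi: "integrable lborel (fourier h)"
  shows "(\<integral>\<xi>. exp (\<i> * of_real (s \<bullet> \<xi>)) * fourier h \<xi> \<partial>lborel) = of_real ((2 * pi) ^ CARD('d)) * h s"
proof -
  let ?G = "\<lambda>y::real^'d. complex_of_real (exp (- (norm y)\<^sup>2 / 2))"
  let ?c = "sqrt (2 * pi) ^ CARD('d)"
  have [measurable]: "h \<in> borel_measurable borel" "fourier h \<in> borel_measurable borel" using hi Fi by auto
  have Gc: "continuous_on UNIV ?G" by (intro continuous_intros) auto
  then have [measurable]: "?G \<in> borel_measurable borel" by (rule borel_measurable_continuous_onI)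
  have em: "(\<lambda>\<xi>::real^'d. exp (\<i> * of_real (s \<bullet> \<xi>))) \<in> borel_measurable borel" for s
    by (intro borel_measurable_continuous_onI continuous_intros)
  define e where "e n = 1 / real (Suc n)" for n
  have e: "e n > 0" "e \<longlonglongrightarrow> 0" for n
    unfolding e_def using LIMSEQ_inverse_real_of_nat by (auto simp: inverse_eq_divide)
  define A where "A n = (\<integral>\<xi>. exp (\<i> * of_real (s \<bullet> \<xi>)) * fourier h \<xi> * ?G (e n *\<^sub>R \<xi>) \<partial>lborel)" for n
  have Gle: "norm (?G y) \<le> 1" for y by simp
  have lim0: "(\<lambda>n. ?G (e n *\<^sub>R \<xi>)) \<longlonglongrightarrow> ?G (0 *\<^sub>R \<xi>)" for \<xi>
    using e(2) by (intro tendsto_of_real tendsto_exp tendsto_divide tendsto_minus tendsto_power tendsto_norm tendsto_scaleR tendsto_const) auto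
  have "A \<longlonglongrightarrow> (\<integral>\<xi>. exp (\<i> * of_real (s \<bullet> \<xi>)) * fourier h \<xi> \<partial>lborel)"
    unfolding A_def
  proof (rule integral_dominated_convergence[where w="\<lambda>\<xi>. norm (fourier h \<xi>)"])
    show "(\<lambda>\<xi>. exp (\<i> * of_real (s \<bullet> \<xi>)) * fourier h \<xi>) \<in> borel_measurable lborel" using em by simp
    show "(\<lambda>\<xi>. exp (\<i> * of_real (s \<bullet> \<xi>)) * fourier h \<xi> * ?G (e n *\<^sub>R \<xi>)) \<in> borel_measurable lborel" for n
      using em by simp
    show "integrable lborel (\<lambda>\<xi>. norm (fourier h \<xi>))" using Fi by simp
    show "AE \<xi> in lborel. norm (exp (\<i> * of_real (s \<bullet> \<xi>)) * fourier h \<xi> * ?G (e n *\<^sub>R \<xi>)) \<le> norm (fourier h \<xi>)" for n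
      using Gle by (auto simp: norm_mult mult_left_le simp del: of_real_exp)
    show "AE \<xi> in lborel. (\<lambda>n. exp (\<i> * of_real (s \<bullet> \<xi>)) * fourier h \<xi> * ?G (e n *\<^sub>R \<xi>)) \<longlonglongrightarrow> exp (\<i> * of_real (s \<bullet> \<xi>)) * fourier h \<xi>"
    proof (rule AE_I2)
      fix \<xi> :: "real^'d"
      show "(\<lambda>n. exp (\<i> * of_real (s \<bullet> \<xi>)) * fourier h \<xi> * ?G (e n *\<^sub>R \<xi>)) \<longlonglongrightarrow> exp (\<i> * of_real (s \<bullet> \<xi>)) * fourier h \<xi>"
        using tendsto_mult[OF tendsto_const[of "exp (\<i> * of_real (s \<bullet> \<xi>)) * fourier h \<xi>"] lim0[of \<xi>]] by simp
    qed
  qed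
  moreover have "A \<longlonglongrightarrow> of_real ((2 * pi) ^ CARD('d)) * h s"
  proof -
    have A: "A n = (\<integral>u. h (s - e n *\<^sub>R u) * (of_real ?c * ?G u) \<partial>lborel)" for n
    proof -
      have en: "e n > 0" by (rule e)
      define en' where "en' = e n"
      have Gint: "integrable lborel (\<lambda>\<xi>. ?G (en' *\<^sub>R \<xi>))"
        using lborel_integral_affine(2)[of ?G "en'" 0] gauss_real(1) en by (simp add: en'_def)
      have int: "integrable lborel (\<lambda>z. exp (\<i> * of_real (s \<bullet> fst z)) * (exp (- (\<i> * of_real (snd z \<bullet> fst z))) * h (snd z)) * ?G (en' *\<^sub>R fst z))"
      proof (rule Bochner_Integration.integrable_bound)
        show "integrable lborel (\<lambda>z. ?G (en' *\<^sub>R fst z) * h (snd z))" by (rule integrable_lborel_prod[OF Gint hi])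
        show "(\<lambda>z. exp (\<i> * of_real (s \<bullet> fst z)) * (exp (- (\<i> * of_real (snd z \<bullet> fst z))) * h (snd z)) * ?G (en' *\<^sub>R fst z)) \<in> borel_measurable lborel"
          unfolding measurable_lborel1 measurable_lborel2
          by (intro borel_measurable_continuous_onI continuous_intros continuous_on_compose2[OF hc]) auto
      qed (auto simp: norm_mult mult.commute)
      have "A n = (\<integral>\<xi>. (\<integral>x. exp (\<i> * of_real (s \<bullet> \<xi>)) * (exp (- (\<i> * of_real (x \<bullet> \<xi>))) * h x) * ?G (en' *\<^sub>R \<xi>) \<partial>lborel) \<partial>lborel)"
        unfolding A_def fourier_def en'_def by simp
      also have "\<dots> = (\<integral>x. (\<integral>\<xi>. exp (\<i> * of_real (s \<bullet> \<xi>)) * (exp (- (\<i> * of_real (x \<bullet> \<xi>))) * h x) * ?G (en' *\<^sub>R \<xi>) \<partial>lborel) \<partial>lborel)"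
        by (rule lborel_Fubini(3)[OF int])
      also have "\<dots> = (\<integral>x. h x * (\<integral>\<xi>. exp (\<i> * of_real ((s - x) \<bullet> \<xi>)) * ?G (en' *\<^sub>R \<xi>) \<partial>lborel) \<partial>lborel)"
        by (subst integral_mult_right_zero[symmetric], intro Bochner_Integration.integral_cong refl)
           (simp add: inner_diff_left algebra_simps exp_diff exp_minus field_simps)
      also have "\<dots> = (\<integral>x. h x * ((1 / en' ^ CARD('d)) *\<^sub>R (of_real ?c * ?G ((1 / en') *\<^sub>R (s - x)))) \<partial>lborel)"
      proof (intro Bochner_Integration.integral_cong refl arg_cong2[where f="(*)"])
        fix x
        let ?k = "\<lambda>\<xi>. exp (\<i> * of_real (((1 / en') *\<^sub>R (s - x)) \<bullet> \<xi>)) * ?G \<xi>"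
        have "(\<integral>\<xi>. ?k (0 + en' *\<^sub>R \<xi>) \<partial>lborel) = (1 / \<bar>en'\<bar> ^ DIM(real^'d)) *\<^sub>R (\<integral>\<xi>. ?k \<xi> \<partial>lborel)"
          using en by (intro lborel_integral_affine) (auto simp: en'_def intro!: borel_measurable_continuous_onI continuous_intros)
        then show "(\<integral>\<xi>. exp (\<i> * of_real ((s - x) \<bullet> \<xi>)) * ?G (en' *\<^sub>R \<xi>) \<partial>lborel) =
            (1 / en' ^ CARD('d)) *\<^sub>R (of_real ?c * ?G ((1 / en') *\<^sub>R (s - x)))"
          using en unfolding gauss(2) by (simp add: en'_def)
      qed
      \<comment> \<open>The substitution x = s - en' u; its Jacobian cancels the normalization of
        the dilated Gaussian.\<close>
      also have "\<dots>
          = (\<integral>u. h (s - en' *\<^sub>R u) * (of_real ?c * ?G u) \<partial>lborel)"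
      proof -
        let ?k = "\<lambda>x. h x * ((1 / en' ^ CARD('d)) *\<^sub>R (of_real ?c * ?G ((1 / en') *\<^sub>R (s - x))))"
        have "(\<integral>u. ?k (s + (- en') *\<^sub>R u) \<partial>lborel) = (1 / \<bar>- en'\<bar> ^ DIM(real^'d)) *\<^sub>R (\<integral>x. ?k x \<partial>lborel)"
          using en by (intro lborel_integral_affine)
            (auto simp: en'_def intro!: borel_measurable_continuous_onI continuous_intros continuous_on_compose2[OF hc])
        then have "(\<integral>x. ?k x \<partial>lborel) = (en' ^ CARD('d)) *\<^sub>R (\<integral>u. ?k (s + (- en') *\<^sub>R u) \<partial>lborel)"
          using en by (simp add: en'_def)
        also have "\<dots> = (\<integral>u. (en' ^ CARD('d)) *\<^sub>R ?k (s + (- en') *\<^sub>R u) \<partial>lborel)" by simp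
        also have "\<dots> = (\<integral>u. h (s - en' *\<^sub>R u) * (of_real ?c * ?G u) \<partial>lborel)"
          using en by (intro Bochner_Integration.integral_cong refl) (simp add: en'_def)
        finally show ?thesis .
      qed
      finally show ?thesis by (simp add: en'_def)
    qed
    have "(\<lambda>n. \<integral>u. h (s - e n *\<^sub>R u) * (of_real ?c * ?G u) \<partial>lborel) \<longlonglongrightarrow> (\<integral>u. h s * (of_real ?c * ?G u) \<partial>lborel)"
    proof (rule integral_dominated_convergence[where w="\<lambda>u. B * norm (of_real ?c * ?G u)"])
      have "integrable lborel (\<lambda>u. of_real ?c * ?G u)" using gauss_real(1) by (rule integrable_mult_right)
      then show "integrable lborel (\<lambda>u. B * norm (of_real ?c * ?G u))" by simp
      show "AE u in lborel. norm (h (s - e n *\<^sub>R u) * (of_real ?c * ?G u)) \<le> B * norm (of_real ?c * ?G u)" for n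
        unfolding norm_mult[of "h _"] by (intro AE_I2 mult_right_mono hb) auto
      show "AE u in lborel. (\<lambda>n. h (s - e n *\<^sub>R u) * (of_real ?c * ?G u)) \<longlonglongrightarrow> h s * (of_real ?c * ?G u)"
      proof (intro AE_I2 tendsto_mult tendsto_const)
        fix u
        have "(\<lambda>n. s - e n *\<^sub>R u) \<longlonglongrightarrow> s - 0 *\<^sub>R u" using e(2) by (intro tendsto_intros)
        then have "(\<lambda>n. s - e n *\<^sub>R u) \<longlonglongrightarrow> s" by simp
        then show "(\<lambda>n. h (s - e n *\<^sub>R u)) \<longlonglongrightarrow> h s"
          using hc unfolding continuous_on_sequentially o_def by blast
      qed
    qed (auto intro!: borel_measurable_continuous_onI continuous_intros continuous_on_compose2[OF hc])
    also have "(\<integral>u. h s * (of_real ?c * ?G u) \<partial>lborel) = of_real ((2 * pi) ^ CARD('d)) * h s"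
    proof -
      have "(\<integral>u. h s * (of_real ?c * ?G u) \<partial>lborel) = h s * (of_real ?c * of_real ?c)"
        using gauss_real(2)[where 'a="real^'d"] by (simp del: of_real_exp of_real_power)
      \<comment> \<open>One factor \<open>?c\<close> is the constant in the transform of the
        Gaussian, the other is its total mass.\<close>
      moreover have "?c * ?c = (sqrt (2 * pi) * sqrt (2 * pi)) ^ CARD('d)"
        by (simp only: power_mult_distrib)
      then have "complex_of_real ?c * of_real ?c = of_real ((2 * pi) ^ CARD('d))"
        unfolding of_real_mult[symmetric] by simp
      ultimately show ?thesis by (simp only: mult.commute)
    qed
    finally show ?thesis unfolding A .
  qed
  ultimately show ?thesis by (rule LIMSEQ_unique)
qed


section \<open>Decay of Fourier transforms and Sobolev duality\<close>

lemma fourier_pd: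
  fixes F :: "real^'d \<Rightarrow> complex"
  assumes pd: "has_pd b F F'" and c: "continuous_on UNIV F" "continuous_on UNIV F'"
    and i: "integrable lborel F" "integrable lborel F'"
  shows "\<i> * of_real (b \<bullet> \<xi>) * fourier F \<xi> = fourier F' \<xi>"
proof -
  let ?e = "\<lambda>x. exp (- (\<i> * of_real (x \<bullet> \<xi>)))"
  have m: "(\<lambda>x. ?e x) \<in> borel_measurable borel"
    by (intro borel_measurable_continuous_onI continuous_intros)
  have ei: "integrable lborel (\<lambda>x. ?e x * G x)" if "integrable lborel G" for G :: "real^'d \<Rightarrow> complex"
    by (rule Bochner_Integration.integrable_bound[OF that])
       (use m borel_measurable_integrable[OF that] in \<open>auto simp: norm_mult\<close>)
  have "has_pd b ?e (\<lambda>x. - (\<i> * of_real (b \<bullet> \<xi>)) * ?e x)"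
    using has_pd_exp[of b "- \<xi>"] by simp
  from has_pd_mult[OF this pd]
  have "(\<integral>x. (- (\<i> * of_real (b \<bullet> \<xi>)) * ?e x) * F x + ?e x * F' x \<partial>lborel) = 0"
  proof (rule has_pd_integral_zero)
    have "integrable lborel (\<lambda>x. - (\<i> * of_real (b \<bullet> \<xi>)) * (?e x * F x))"
      by (intro integrable_mult_right ei i)
    then show "integrable lborel (\<lambda>x. (- (\<i> * of_real (b \<bullet> \<xi>)) * ?e x) * F x + ?e x * F' x)"
      using ei[OF i(2)] by (simp only: mult.assoc) (rule Bochner_Integration.integrable_add)
  qed (auto intro!: continuous_intros c ei i)
  also have "(\<integral>x. (- (\<i> * of_real (b \<bullet> \<xi>)) * ?e x) * F x + ?e x * F' x \<partial>lborel)
      = (\<integral>x. - (\<i> * of_real (b \<bullet> \<xi>)) * (?e x * F x) \<partial>lborel) + (\<integral>x. ?e x * F' x \<partial>lborel)"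
    unfolding mult.assoc using ei[OF i(1)] ei[OF i(2)]
    by (intro Bochner_Integration.integral_add integrable_mult_right) (simp_all add: mult.assoc[symmetric])
  finally have "- (\<i> * of_real (b \<bullet> \<xi>)) * (\<integral>x. ?e x * F x \<partial>lborel) + (\<integral>x. ?e x * F' x \<partial>lborel) = 0"
    by (simp only: integral_mult_right_zero)
  then show ?thesis unfolding fourier_def by (simp add: add_eq_0_iff)
qed

lemma all_derivs_rapid_integrable:
  fixes F :: "'i \<Rightarrow> 'a::euclidean_space \<Rightarrow> complex" and i :: 'i
  assumes "rapid \<rho> \<tau> F"
  shows "integrable lborel (F i)" "continuous_on UNIV (F i)" "\<exists>C. \<forall>x. norm (F i x) \<le> C / pw x ^ k"
proof -
  have b: "\<exists>C. \<forall>x. norm (F i x) \<le> C / pw x ^ k" for k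
  proof -
    obtain C M where "\<And>i x. pw (\<rho> i) ^ 0 * pw x ^ k * norm (F i x) \<le> C * pw (\<tau> i) ^ M"
      using assms unfolding rapid_def by metis
    from this[of i] have "norm (F i x) \<le> (C * pw (\<tau> i) ^ M) / pw x ^ k" for x
      by (simp add: pos_le_divide_eq mult.commute)
    then show ?thesis by blast
  qed
  show c: "continuous_on UNIV (F i)" using assms by (auto simp: rapid_def)
  obtain C where "\<forall>x. norm (F i x) \<le> C / pw x ^ (DIM('a) + 2)" using b by metis
  then show "integrable lborel (F i)"
    by (intro integrable_bound_pw[where k="DIM('a) + 2"] borel_measurable_continuous_onI c) auto
  show "\<exists>C. \<forall>x. norm (F i x) \<le> C / pw x ^ k" by (rule b)
qed

lemma all_derivs_rapid_schwartz:
  fixes L :: "'i \<Rightarrow> 'a::euclidean_space \<Rightarrow> complex"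
  assumes "all_derivs (rapid \<rho> \<tau>) L" shows "schwartz (L i)"
  unfolding schwartz_iff
  using assms
proof (rule all_derivs_map[where H="\<lambda>L _::unit. L i"])
  fix F :: "'i \<Rightarrow> 'a \<Rightarrow> complex" assume R: "rapid \<rho> \<tau> F"
  have "\<exists>C. \<forall>x. pw x ^ k * norm (F i x) \<le> C" for k
    using all_derivs_rapid_integrable(3)[OF R, of i k] by (auto simp: pos_le_divide_eq mult.commute)
  then show "rapid (\<lambda>_. 0) (\<lambda>_. 0) (\<lambda>_::unit. F i)"
    using R unfolding rapid_0_iff by (auto simp: rapid_def)
qed auto

lemma pw_le_sum_Basis: "pw x \<le> 1 + (\<Sum>b\<in>Basis. \<bar>b \<bullet> x\<bar>)"
  using norm_le_l1[of x] by (simp add: pw_def inner_commute)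

text \<open>\<open>pw \<xi>\<close> is at most 1 plus the sum of the
  \<open>\<bar>b \<bullet> \<xi>\<bar>\<close>, and each factor \<open>b \<bullet> \<xi>\<close> is
  traded for a derivative of the family. The derivative families obey the same kind of bounds, so
  uniformity in the index and the roles of both parameters survive the induction.\<close>

lemma fourier_rapid:
  fixes F :: "'i \<Rightarrow> real^'d \<Rightarrow> complex"
  assumes "all_derivs (rapid \<rho> \<tau>) F"
  shows "\<exists>C M. \<forall>i \<xi>. pw (\<rho> i) ^ m * pw \<xi> ^ k * norm (fourier (F i) \<xi>) \<le> C * pw (\<tau> i) ^ M"
  using assms
proof (induction k arbitrary: F)
  case 0
  obtain C M where C: "\<And>i x. pw (\<rho> i) ^ m * pw x ^ (DIM(real^'d) + 2) * norm (F i x) \<le> C * pw (\<tau> i) ^ M"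
    using all_derivs_base[OF 0] unfolding rapid_def by metis
  have "pw (\<rho> i) ^ m * pw \<xi> ^ 0 * norm (fourier (F i) \<xi>) \<le> (C * pw_int TYPE(real^'d)) * pw (\<tau> i) ^ M" for i \<xi>
  proof -
    have "norm (fourier (F i) \<xi>) \<le> (C * pw (\<tau> i) ^ M / pw (\<rho> i) ^ m) * pw_int TYPE(real^'d)"
      unfolding fourier_def
    proof (rule integral_bound_pw)
      fix x
      show "norm (exp (- (\<i> * of_real (x \<bullet> \<xi>))) * F i x) \<le> C * pw (\<tau> i) ^ M / pw (\<rho> i) ^ m / pw x ^ (DIM(real^'d) + 2)"
        using C[of i x] by (simp add: norm_mult pos_le_divide_eq mult_ac del: power_add power_Suc add_2_eq_Suc')
    qed
    then show ?thesis by (simp add: field_simps)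
  qed
  then show ?case by blast
next
  case (Suc k)
  have "\<exists>C M. \<forall>i \<xi>. pw (\<rho> i) ^ m * pw \<xi> ^ k * (\<bar>b \<bullet> \<xi>\<bar> * norm (fourier (F i) \<xi>)) \<le> C * pw (\<tau> i) ^ M" if b: "b \<in> Basis" for b
  proof -
    obtain F' where F': "\<And>i. has_pd b (F i) (F' i)" "all_derivs (rapid \<rho> \<tau>) F'"
      using all_derivs_pd[OF Suc.prems b] by auto
    have "\<i> * of_real (b \<bullet> \<xi>) * fourier (F i) \<xi> = fourier (F' i) \<xi>" for i \<xi>
      using all_derivs_rapid_integrable[OF all_derivs_base[OF Suc.prems]] all_derivs_rapid_integrable[OF all_derivs_base[OF F'(2)]]
      by (intro fourier_pd F')
    then have "\<bar>b \<bullet> \<xi>\<bar> * norm (fourier (F i) \<xi>) = norm (fourier (F' i) \<xi>)" for i \<xi>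
      by (metis norm_mult norm_ii norm_of_real mult_1)
    with Suc.IH[OF F'(2)] show ?thesis by simp
  qed
  then obtain C M where CM: "\<And>b i \<xi>. b \<in> Basis \<Longrightarrow>
      pw (\<rho> i) ^ m * pw \<xi> ^ k * (\<bar>b \<bullet> \<xi>\<bar> * norm (fourier (F i) \<xi>)) \<le> C b * pw (\<tau> i) ^ M b"
    by metis
  obtain C0 M0 where 0: "\<And>i \<xi>. pw (\<rho> i) ^ m * pw \<xi> ^ k * norm (fourier (F i) \<xi>) \<le> C0 * pw (\<tau> i) ^ M0"
    using Suc.IH[OF Suc.prems] by metis
  let ?M = "M0 + (\<Sum>b\<in>Basis. M b)" and ?C = "\<bar>C0\<bar> + (\<Sum>b\<in>Basis. \<bar>C b\<bar>)"
  have "pw (\<rho> i) ^ m * pw \<xi> ^ Suc k * norm (fourier (F i) \<xi>) \<le> ?C * pw (\<tau> i) ^ ?M" for i \<xi>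
  proof -
    have "pw (\<rho> i) ^ m * pw \<xi> ^ Suc k * norm (fourier (F i) \<xi>)
        = (pw (\<rho> i) ^ m * pw \<xi> ^ k * norm (fourier (F i) \<xi>)) * pw \<xi>" by simp
    also have "\<dots> \<le> (pw (\<rho> i) ^ m * pw \<xi> ^ k * norm (fourier (F i) \<xi>)) * (1 + (\<Sum>b\<in>Basis. \<bar>b \<bullet> \<xi>\<bar>))"
      by (intro mult_left_mono pw_le_sum_Basis) auto
    also have "\<dots> = pw (\<rho> i) ^ m * pw \<xi> ^ k * norm (fourier (F i) \<xi>)
        + (\<Sum>b\<in>Basis. pw (\<rho> i) ^ m * pw \<xi> ^ k * (\<bar>b \<bullet> \<xi>\<bar> * norm (fourier (F i) \<xi>)))"
      by (simp add: distrib_left sum_distrib_left mult_ac)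
    also have "\<dots> \<le> \<bar>C0\<bar> * pw (\<tau> i) ^ ?M + (\<Sum>b\<in>Basis. \<bar>C b\<bar> * pw (\<tau> i) ^ ?M)"
      by (intro add_mono sum_mono pw_bound_enlarge[OF 0] pw_bound_enlarge[OF CM])
         (auto intro!: trans_le_add2 member_le_sum)
    finally show ?thesis by (simp add: distrib_right sum_distrib_right)
  qed
  then show ?case by blast
qed

lemma fourier_continuous:
  fixes f :: "real^'d \<Rightarrow> complex"
  assumes "integrable lborel f"
  shows "continuous_on UNIV (fourier f)"
  unfolding fourier_def
proof (rule continuous_on_integral_dominated)
  show "continuous_on UNIV (\<lambda>\<xi>. exp (- (\<i> * of_real (y \<bullet> \<xi>))) * f y)" for y by (intro continuous_intros)
  have "(\<lambda>y. exp (- (\<i> * of_real (y \<bullet> \<xi>))) :: complex) \<in> borel_measurable borel" for \<xi> :: "real^'d"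
    by (intro borel_measurable_continuous_onI continuous_intros)
  then show "(\<lambda>y. exp (- (\<i> * of_real (y \<bullet> \<xi>))) * f y) \<in> borel_measurable lborel" for \<xi>
    using borel_measurable_integrable[OF assms] by auto
  show "\<exists>D. integrable lborel D \<and> (\<forall>q y. dist q p \<le> 1 \<longrightarrow> norm (exp (- (\<i> * of_real (y \<bullet> q))) * f y) \<le> D y)" for p :: "real^'d"
    using assms by (intro exI[of _ "\<lambda>y. norm (f y)"]) (auto simp: norm_mult)
qed

lemma fourier_schwartz_bound:
  fixes f :: "real^'d \<Rightarrow> complex"
  assumes "schwartz f"
  shows "\<exists>C. \<forall>\<xi>. norm (fourier f \<xi>) \<le> C / pw \<xi> ^ k" "integrable lborel (fourier f)"
proof -
  have b: "\<exists>C. \<forall>\<xi>. norm (fourier f \<xi>) \<le> C / pw \<xi> ^ k" for k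
    using fourier_rapid[OF assms[unfolded schwartz_iff], of 0 k]
    by (auto simp: pos_le_divide_eq mult.commute)
  then show "\<exists>C. \<forall>\<xi>. norm (fourier f \<xi>) \<le> C / pw \<xi> ^ k" .
  obtain C where "\<forall>\<xi>. norm (fourier f \<xi>) \<le> C / pw \<xi> ^ (DIM(real^'d) + 2)" using b by metis
  then show "integrable lborel (fourier f)"
    by (intro integrable_bound_pw[where k="DIM(real^'d) + 2"] borel_measurable_continuous_onI fourier_continuous schwartz_integrable assms) auto
qed

lemma schwartz_fourier_inversion:
  fixes h :: "real^'d \<Rightarrow> complex"
  assumes "schwartz h"
  shows "(\<integral>\<xi>. exp (\<i> * of_real (s \<bullet> \<xi>)) * fourier h \<xi> \<partial>lborel) = of_real ((2 * pi) ^ CARD('d)) * h s"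
proof -
  obtain C where "\<And>x. norm (h x) \<le> C / pw x ^ 0" using schwartz_bound[OF assms] by metis
  then show ?thesis
    using assms by (intro fourier_inversion schwartz_cont schwartz_integrable fourier_schwartz_bound) auto
qed

text \<open>The integrand is rewritten as \<open>F x * L i x\<close>, where powers \<open>-N\<close>
  and \<open>N\<close> of the bracket have been distributed. Parseval moves the product to the
  frequency side, where Cauchy-Schwarz with the same powers of the frequency bracket produces the
  weak norm. What remains is a weighted norm of the transform of \<open>L i\<close>, and
  multiplication by a power of the bracket does not leave the class \<open>rapid\<close>.\<close>

lemma sobolev_duality:
  fixes G :: "'i \<Rightarrow> real^'d \<Rightarrow> complex"
  assumes G: "all_derivs (rapid \<rho> \<tau>) G"
  shows "\<exists>C M. C \<ge> 0 \<and> (\<forall>i f. schwartz f \<longrightarrow> pw (\<rho> i) ^ m * norm (\<integral>x. f x * G i x \<partial>lborel) \<le>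
     C * pw (\<tau> i) ^ M * sobolev_norm (- real N) (\<lambda>x. of_real (japanese x powr (- real N)) * f x))"
proof -
  define L where "L i x = of_real (japanese x powr real N) * G i x" for i x
  have L: "all_derivs (rapid \<rho> \<tau>) L"
    unfolding L_def using all_derivs_rapid_polyg[OF G all_derivs_polyg_japanese[of _ "real N"]] by (simp add: mult.commute)
  \<comment> \<open>\<open>N\<close> powers compensate the weight in frequency; the others pay for
    the integration.\<close>
  let ?k = "N + (DIM(real^'d) + 2)" and ?I = "pw_int TYPE(real^'d)"
  obtain C M where CM: "\<And>i \<xi>. pw (\<rho> i) ^ m * pw \<xi> ^ ?k * norm (fourier (L i) \<xi>) \<le> C * pw (\<tau> i) ^ M"
    using fourier_rapid[OF L, of m ?k] by metis
  have C0: "C \<ge> 0"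
  proof -
    \<comment> \<open>Any index will do to see the sign of \<open>C\<close>.\<close>
    have "0 \<le> C * pw (\<tau> undefined) ^ M" by (rule order_trans[OF _ CM[of undefined 0]]) simp
    then have "0 \<le> C * pw (\<tau> undefined) ^ M / pw (\<tau> undefined) ^ M" by (intro divide_nonneg_pos) auto
    then show ?thesis by simp
  qed
  let ?c = "(2 * pi) ^ CARD('d)"
  have main: "pw (\<rho> i) ^ m * norm (\<integral>x. f x * G i x \<partial>lborel) \<le> (1 / ?c * C * sqrt ?I * sqrt ?c) * pw (\<tau> i) ^ M *
      sobolev_norm (- real N) (\<lambda>x. of_real (japanese x powr (- real N)) * f x)" if f: "schwartz f" for i f
  proof -
    define F where "F x = of_real (japanese x powr (- real N)) * f x" for x
    have F: "schwartz F"
      using f unfolding F_def schwartz_iff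
      using all_derivs_rapid_polyg[OF _ all_derivs_polyg_japanese[of _ "- real N"]] by (simp add: mult.commute)
    have jp: "japanese x > 0" for x :: "real^'d" using japanese_bounds(3)[of x] by linarith
    have FL: "f x * G i x = F x * L i x" for x
      using jp[of x] by (simp add: F_def L_def powr_minus field_simps)
    have Li: "schwartz (L i)" by (rule all_derivs_rapid_schwartz[OF L])
    let ?a = "\<lambda>\<eta>. japanese \<eta> powr real N * norm (fourier (L i) \<eta>)"
    let ?b = "\<lambda>\<eta>. japanese \<eta> powr (- real N) * norm (fourier F (- \<eta>))"
    have cF: "continuous_on UNIV (fourier F)" "continuous_on UNIV (fourier (L i))"
      using fourier_continuous schwartz_integrable F Li by auto
    have cFm: "continuous_on UNIV (\<lambda>\<eta>. fourier F (- \<eta>))"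
      by (rule continuous_on_compose2[OF cF(1)]) (auto intro!: continuous_intros)
    have cj: "continuous_on UNIV (\<lambda>x::real^'d. japanese x powr s)" for s
      unfolding japanese_def by (intro continuous_intros) (auto simp: add_nonneg_eq_0_iff)
    obtain CF where CF: "\<And>\<xi>. norm (fourier F \<xi>) \<le> CF / pw \<xi> ^ (DIM(real^'d) + 2)"
      using fourier_schwartz_bound(1)[OF F] by metis
    define Q where "Q = C * pw (\<tau> i) ^ M / pw (\<rho> i) ^ m"
    have Q0: "Q \<ge> 0" unfolding Q_def using C0 by simp
    have ab: "?a \<eta> \<le> Q / pw \<eta> ^ (DIM(real^'d) + 2)" for \<eta>
    proof -
      have "?a \<eta> \<le> pw \<eta> ^ N * norm (fourier (L i) \<eta>)"
        using jp[of \<eta>] japanese_bounds[of \<eta>] by (intro mult_right_mono) (auto simp: powr_realpow intro: power_mono)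
      also have "norm (fourier (L i) \<eta>) \<le> Q / pw \<eta> ^ ?k"
        unfolding Q_def using CM[of i \<eta>] by (simp add: pos_le_divide_eq mult_ac del: power_add add_2_eq_Suc')
      finally show ?thesis by (simp add: power_add mult_left_mono)
    qed
    have bb: "?b \<eta> \<le> CF / pw \<eta> ^ (DIM(real^'d) + 2)" for \<eta>
    proof -
      have "?b \<eta> \<le> 1 * norm (fourier F (- \<eta>))"
        using japanese_bounds[of \<eta>] by (intro mult_right_mono) (auto simp: powr_minus inverse_le_1_iff ge_one_powr_ge_zero)
      also have "\<dots> \<le> CF / pw \<eta> ^ (DIM(real^'d) + 2)" using CF[of "- \<eta>"] by simp
      finally show ?thesis .
    qed
    \<comment> \<open>Squaring doubles the power of the weight; one copy is at least 1 and is
      discarded.\<close>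
    have sq: "t\<^sup>2 \<le> K\<^sup>2 / pw \<eta> ^ (DIM(real^'d) + 2)" if "0 \<le> t" "t \<le> K / pw \<eta> ^ (DIM(real^'d) + 2)" for t K and \<eta> :: "real^'d"
    proof -
      have "t\<^sup>2 \<le> (K / pw \<eta> ^ (DIM(real^'d) + 2))\<^sup>2" using that by (intro power_mono)
      also have "\<dots> = K\<^sup>2 / (pw \<eta> ^ (DIM(real^'d) + 2) * pw \<eta> ^ (DIM(real^'d) + 2))"
        by (simp add: power2_eq_square)
      also have "\<dots> \<le> K\<^sup>2 / (pw \<eta> ^ (DIM(real^'d) + 2) * 1)"
        by (intro divide_left_mono mult_left_mono pw_power_ge1) auto
      finally show ?thesis by simp
    qed
    have na: "norm ((?a \<eta>)\<^sup>2) \<le> Q\<^sup>2 / pw \<eta> ^ (DIM(real^'d) + 2)" for \<eta>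
      unfolding real_norm_def abs_power2 by (rule sq[OF _ ab]) simp
    have nb: "norm ((?b \<eta>)\<^sup>2) \<le> CF\<^sup>2 / pw \<eta> ^ (DIM(real^'d) + 2)" for \<eta>
      unfolding real_norm_def abs_power2 by (rule sq[OF _ bb]) simp
    have ia: "integrable lborel (\<lambda>\<eta>. (?a \<eta>)\<^sup>2)"
      by (rule integrable_bound_pw[OF _ na order_refl])
         (intro borel_measurable_continuous_onI continuous_intros cF cj)
    have ib: "integrable lborel (\<lambda>\<eta>. (?b \<eta>)\<^sup>2)"
      by (rule integrable_bound_pw[OF _ nb order_refl])
         (intro borel_measurable_continuous_onI continuous_intros cFm cj)
    have iab: "integrable lborel (\<lambda>\<eta>. ?a \<eta> * ?b \<eta>)"
    proof (rule Bochner_Integration.integrable_bound)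
      show "integrable lborel (\<lambda>\<eta>. (?a \<eta>)\<^sup>2 + (?b \<eta>)\<^sup>2)" using ia ib by (rule Bochner_Integration.integrable_add)
      show "(\<lambda>\<eta>. ?a \<eta> * ?b \<eta>) \<in> borel_measurable lborel"
        unfolding measurable_lborel2 by (intro borel_measurable_continuous_onI continuous_intros cF cFm cj)
      have "\<bar>a * b\<bar> \<le> \<bar>a\<^sup>2 + b\<^sup>2\<bar>" for a b :: real
      proof -
        have "2 * (\<bar>a\<bar> * \<bar>b\<bar>) \<le> a\<^sup>2 + b\<^sup>2"
          using sum_squares_bound[of "\<bar>a\<bar>" "\<bar>b\<bar>"] by simp
        moreover have "0 \<le> \<bar>a\<bar> * \<bar>b\<bar>" by simp
        ultimately show ?thesis unfolding abs_mult by linarith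
      qed
      then show "AE \<eta> in lborel. norm (?a \<eta> * ?b \<eta>) \<le> norm ((?a \<eta>)\<^sup>2 + (?b \<eta>)\<^sup>2)" by (simp only: real_norm_def) auto
    qed
    have Fub: "integrable lborel (\<lambda>z. F (fst z) * (exp (\<i> * of_real (fst z \<bullet> snd z)) * fourier (L i) (snd z)))"
    proof (rule Bochner_Integration.integrable_bound)
      show "integrable lborel (\<lambda>z. F (fst z) * fourier (L i) (snd z))"
        by (intro integrable_lborel_prod schwartz_integrable fourier_schwartz_bound F Li)
      show "(\<lambda>z. F (fst z) * (exp (\<i> * of_real (fst z \<bullet> snd z)) * fourier (L i) (snd z))) \<in> borel_measurable lborel"
        unfolding measurable_lborel2
        by (intro borel_measurable_continuous_onI continuous_intros continuous_on_compose2[OF schwartz_cont[OF F]] continuous_on_compose2[OF cF(2)]) auto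
    qed (auto simp: norm_mult)
    \<comment> \<open>Parseval by hand: the inversion formula is inserted for \<open>L i\<close> and
      the integration over x is carried out first. The pairing has no conjugation, so
      \<open>fourier F\<close> is evaluated at \<open>- \<eta>\<close>; a reflection of the variable
      removes the sign later.\<close>
    have "of_real ?c * (\<integral>x. f x * G i x \<partial>lborel) = (\<integral>x. F x * (of_real ?c * L i x) \<partial>lborel)"
      unfolding FL by (subst integral_mult_right_zero[symmetric]) (intro Bochner_Integration.integral_cong refl, simp)
    also have "\<dots> = (\<integral>x. (\<integral>\<eta>. F x * (exp (\<i> * of_real (x \<bullet> \<eta>)) * fourier (L i) \<eta>) \<partial>lborel) \<partial>lborel)"
      unfolding schwartz_fourier_inversion[OF Li, symmetric] by simp
    also have "\<dots> = (\<integral>\<eta>. (\<integral>x. F x * (exp (\<i> * of_real (x \<bullet> \<eta>)) * fourier (L i) \<eta>) \<partial>lborel) \<partial>lborel)"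
      by (rule lborel_Fubini(3)[OF Fub])
    also have "\<dots> = (\<integral>\<eta>. fourier F (- \<eta>) * fourier (L i) \<eta> \<partial>lborel)"
      unfolding fourier_def[of F] by (subst integral_mult_left_zero[symmetric]) (intro Bochner_Integration.integral_cong refl, simp add: mult_ac)
    finally have "norm (of_real ?c * (\<integral>x. f x * G i x \<partial>lborel)) = norm (\<integral>\<eta>. fourier F (- \<eta>) * fourier (L i) \<eta> \<partial>lborel)"
      by (rule arg_cong)
    moreover have "norm (complex_of_real ?c) = ?c" unfolding norm_of_real by simp
    ultimately have "?c * norm (\<integral>x. f x * G i x \<partial>lborel) = norm (\<integral>\<eta>. fourier F (- \<eta>) * fourier (L i) \<eta> \<partial>lborel)"
      by (simp only: norm_mult)
    also have "\<dots> \<le> (\<integral>\<eta>. norm (fourier F (- \<eta>) * fourier (L i) \<eta>) \<partial>lborel)" by (rule integral_norm_bound)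
    also have "\<dots> = (\<integral>\<eta>. ?a \<eta> * ?b \<eta> \<partial>lborel)"
    proof (intro Bochner_Integration.integral_cong refl)
      fix \<eta> show "norm (fourier F (- \<eta>) * fourier (L i) \<eta>) = ?a \<eta> * ?b \<eta>"
        using jp[of \<eta>] by (simp add: norm_mult powr_minus field_simps)
    qed
    also have "\<dots> \<le> sqrt (\<integral>\<eta>. (?a \<eta>)\<^sup>2 \<partial>lborel) * sqrt (\<integral>\<eta>. (?b \<eta>)\<^sup>2 \<partial>lborel)"
      by (rule integral_Cauchy_Schwarz[OF ia ib iab])
    also have "(\<integral>\<eta>. (?b \<eta>)\<^sup>2 \<partial>lborel) = (\<integral>\<eta>. japanese \<eta> powr (2 * (- real N)) * (norm (fourier F \<eta>))\<^sup>2 \<partial>lborel)"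
    proof -
      have *: "(?b \<eta>)\<^sup>2 = japanese (- \<eta>) powr (2 * (- real N)) * (norm (fourier F (- \<eta>)))\<^sup>2" for \<eta>
        by (simp add: power_mult_distrib japanese_def powr_powr[symmetric] power2_eq_square powr_add[symmetric])
      show ?thesis unfolding *
        by (rule lborel_integral_shift(4)) (intro borel_measurable_continuous_onI continuous_intros cF cj)
    qed
    also have "sqrt \<dots> = sqrt ?c * sobolev_norm (- real N) F"
    proof -
      have "?c \<noteq> 0" by simp
      then have "?c * (inverse ?c * X) = X" for X by (metis mult.assoc right_inverse mult_1)
      then show ?thesis unfolding sobolev_norm_def real_sqrt_mult[symmetric] by (simp only:)
    qed
    also have "sqrt (\<integral>\<eta>. (?a \<eta>)\<^sup>2 \<partial>lborel) \<le> Q * sqrt ?I"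
    proof -
      have "norm (\<integral>\<eta>. (?a \<eta>)\<^sup>2 \<partial>lborel) \<le> Q\<^sup>2 * ?I"
        by (rule integral_bound_pw[OF na])
      then have "(\<integral>\<eta>. (?a \<eta>)\<^sup>2 \<partial>lborel) \<le> Q\<^sup>2 * ?I" by simp
      then have "sqrt (\<integral>\<eta>. (?a \<eta>)\<^sup>2 \<partial>lborel) \<le> sqrt (Q\<^sup>2 * ?I)" by (rule real_sqrt_le_mono)
      also have "\<dots> = Q * sqrt ?I" using Q0 by (simp add: real_sqrt_mult)
      finally show ?thesis .
    qed
    finally have "?c * norm (\<integral>x. f x * G i x \<partial>lborel) \<le> Q * sqrt ?I * (sqrt ?c * sobolev_norm (- real N) F)"
      by (simp add: mult_right_mono sobolev_norm_def)
    then have "norm (\<integral>x. f x * G i x \<partial>lborel) \<le> 1 / ?c * (Q * sqrt ?I * (sqrt ?c * sobolev_norm (- real N) F))"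
      by (simp add: field_simps)
    then have "pw (\<rho> i) ^ m * norm (\<integral>x. f x * G i x \<partial>lborel) \<le> pw (\<rho> i) ^ m * (1 / ?c * (Q * sqrt ?I * (sqrt ?c * sobolev_norm (- real N) F)))"
      by (intro mult_left_mono) auto
    then show ?thesis unfolding F_def Q_def by (simp add: field_simps)
  qed
  show ?thesis
    using main C0 by (intro exI[of _ "1 / ?c * C * sqrt ?I * sqrt ?c"] exI[of _ M]) auto
qed

section \<open>The short-time Fourier transform\<close>

definition stft :: "(real^'d \<Rightarrow> complex) \<Rightarrow> (real^'d \<Rightarrow> complex) \<Rightarrow> (real^'d) \<times> (real^'d) \<Rightarrow> complex" where
  "stft g F z = (\<integral>y. F y * cnj (tfshift z g y) \<partial>lborel)"

lemma stft_fourier: "stft g F z = fourier (\<lambda>y. F y * cnj (g (y - fst z))) (snd z)"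
  unfolding stft_def fourier_def tfshift_def
  by (intro Bochner_Integration.integral_cong refl) (simp add: exp_cnj mult_ac)

text \<open>Translates keep their sup norms but not their decay about a fixed centre. Uniformly in
  the shift they are only bounded multipliers.\<close>

lemma schwartz_shift_polyg:
  fixes g :: "'a::euclidean_space \<Rightarrow> complex"
  assumes "schwartz g"
  shows "all_derivs (polyg (\<lambda>_. 0)) (\<lambda>a y. cnj (g (y - a)))"
  using assms[unfolded schwartz_iff]
proof (rule all_derivs_map[where H="\<lambda>G a y. cnj (G () (y - a))"])
  fix G :: "unit \<Rightarrow> 'a \<Rightarrow> complex" assume R: "rapid (\<lambda>_. 0) (\<lambda>_. 0) G"
  then have "\<exists>C. \<forall>i x. pw x ^ 0 * norm (G i x) \<le> C" unfolding rapid_0_iff by blast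
  then obtain C where C: "\<And>x. norm (G () x) \<le> C" by auto
  have "\<forall>a y. norm (cnj (G () (y - a))) \<le> C * pw (0::real) ^ 0 * pw y ^ 0" using C by simp
  then have "\<exists>C M. \<forall>a y. norm (cnj (G () (y - a))) \<le> C * pw (0::real) ^ M * pw y ^ M" by (intro exI)
  moreover have "continuous_on UNIV (\<lambda>y. cnj (G () (y - a)))" for a
    by (intro continuous_on_cnj continuous_on_compose2[OF R[unfolded rapid_def, THEN conjunct1, rule_format, of "()"]] continuous_intros) auto
  ultimately show "polyg (\<lambda>_. 0) (\<lambda>a y. cnj (G () (y - a)))"
    unfolding polyg_def by (intro conjI allI)
qed (intro allI has_pd_cnj has_pd_shift, blast)

lemma schwartz_window_family:
  fixes f g :: "'a::euclidean_space \<Rightarrow> complex"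
  assumes "schwartz f" "schwartz g"
  shows "uschwartz (\<lambda>a y. f y * cnj (g (y - a)))"
proof (rule all_derivs_rapid_polyg[OF _ schwartz_shift_polyg[OF assms(2)]])
  show "uschwartz (\<lambda>i. f)"
    using assms(1)[unfolded schwartz_iff]
    by (rule all_derivs_map[where H="\<lambda>F _. F ()"]) (auto simp: rapid_0_iff)
qed

text \<open>Decay in frequency comes from \<open>fourier_rapid\<close> for the windowed family,
  decay in position from the overlap of two decaying functions. They are merged by looking at the
  larger component: \<open>pw z\<close> is at most the square of its weight, so both estimates are
  made with exponent \<open>2 * k\<close>.\<close>

lemma stft_bound:
  fixes f g :: "real^'d \<Rightarrow> complex"
  assumes f: "schwartz f" and g: "schwartz g"
  obtains C where "C > 0" "\<And>z. norm (stft g f z) \<le> C / pw z ^ k"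
proof -
  have "\<exists>C M. \<forall>i \<xi>. pw (0::real) ^ 0 * pw \<xi> ^ (2 * k) * norm (fourier (\<lambda>y. f y * cnj (g (y - i))) \<xi>) \<le> C * pw (0::real) ^ M"
    by (rule fourier_rapid[OF schwartz_window_family[OF f g], of 0 "2 * k"])
  then obtain C1 where C1: "\<And>z. pw (snd z) ^ (2 * k) * norm (stft g f z) \<le> C1"
    unfolding stft_fourier by auto
  let ?D = "DIM(real^'d) + 2"
  obtain A where A: "A > 0" "\<And>x. norm (f x) \<le> A / pw x ^ (2 * k + ?D)" using schwartz_bound[OF f] by metis
  obtain B where B: "B > 0" "\<And>x. norm (g x) \<le> B / pw x ^ (2 * k)" using schwartz_bound[OF g] by metis
  let ?I = "pw_int TYPE(real^'d)"
  have C2: "pw (fst z) ^ (2 * k) * norm (stft g f z) \<le> A * B * ?I" for z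
  proof -
    have "norm (stft g f z) \<le> (A * B / pw (fst z) ^ (2 * k)) * ?I"
      unfolding stft_def
    proof (rule integral_bound_pw)
      fix y
      have "norm (f y * cnj (tfshift z g y)) = norm (f y) * norm (g (y - fst z))"
        by (simp add: norm_mult tfshift_def)
      also have "\<dots> \<le> (A / pw y ^ (2 * k + ?D)) * (B / pw (y - fst z) ^ (2 * k))"
        using A(1) by (intro mult_mono A B) auto
      also have "\<dots> = A * B / ((pw y * pw (y - fst z)) ^ (2 * k) * pw y ^ ?D)"
        by (simp add: power_add power_mult_distrib mult_ac)
      also have "\<dots> \<le> A * B / (pw (fst z) ^ (2 * k) * pw y ^ ?D)"
        using A(1) B(1) pw_diff[of y "y - fst z"]
        by (intro divide_left_mono mult_right_mono power_mono mult_pos_pos) auto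
      finally show "norm (f y * cnj (tfshift z g y)) \<le> A * B / pw (fst z) ^ (2 * k) / pw y ^ ?D"
        by (simp add: divide_divide_eq_left)
    qed
    then show ?thesis by (simp add: field_simps)
  qed
  define C where "C = max 1 (max C1 (A * B * ?I))"
  have "norm (stft g f z) \<le> C / pw z ^ k" for z
  proof -
    have "pw z ^ k * norm (stft g f z) \<le> C"
    proof (cases "pw (fst z) \<le> pw (snd z)")
      case True
      have "pw z \<le> pw (snd z) * pw (snd z)"
        by (rule order_trans[OF pw_fst_snd_le(3)]) (use True in \<open>auto intro: mult_right_mono\<close>)
      then have "pw z ^ k \<le> pw (snd z) ^ (2 * k)"
        by (metis power_mono pw_nonneg power2_eq_square power_mult)
      then have "pw z ^ k * norm (stft g f z) \<le> pw (snd z) ^ (2 * k) * norm (stft g f z)" by (rule mult_right_mono) simp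
      also have "\<dots> \<le> C" using C1[of z] by (simp add: C_def)
      finally show ?thesis .
    next
      case False
      then have "pw z \<le> pw (fst z) * pw (fst z)"
        by (intro order_trans[OF pw_fst_snd_le(3)] mult_left_mono) auto
      then have "pw z ^ k \<le> pw (fst z) ^ (2 * k)"
        by (metis power_mono pw_nonneg power2_eq_square power_mult)
      then have "pw z ^ k * norm (stft g f z) \<le> pw (fst z) ^ (2 * k) * norm (stft g f z)" by (rule mult_right_mono) simp
      also have "\<dots> \<le> C" using C2[of z] by (simp add: C_def)
      finally show ?thesis .
    qed
    then show ?thesis by (simp add: field_simps)
  qed
  then show ?thesis using that[of C] by (simp add: C_def)
qed

lemma continuous_on_tfshift:
  assumes "continuous_on UNIV g"
  shows "continuous_on UNIV (\<lambda>p. tfshift (fst p) g (snd p))"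
  unfolding tfshift_def by (intro continuous_intros continuous_on_compose2[OF assms]) auto

lemma norm_tfshift: "norm (tfshift z g y) = norm (g (y - fst z))"
  by (simp add: tfshift_def norm_mult)

lemma schwartz_bounded: assumes "schwartz g" obtains B where "B > 0" "\<And>x. norm (g x) \<le> B"
  using schwartz_bound[OF assms, of 0] by auto

lemma stft_continuous:
  assumes f: "integrable lborel f" and g: "schwartz g"
  shows "continuous_on UNIV (stft g f)"
  unfolding stft_def
proof (rule continuous_on_integral_dominated)
  obtain B where B: "\<And>x. norm (g x) \<le> B" using schwartz_bounded[OF g] by metis
  show "continuous_on UNIV (\<lambda>z. f y * cnj (tfshift z g y))" for y
    by (intro continuous_intros continuous_on_slice(2)[OF continuous_on_tfshift] schwartz_cont g)
  have "(\<lambda>y. cnj (tfshift z g y)) \<in> borel_measurable borel" for z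
    by (intro borel_measurable_continuous_onI continuous_intros continuous_on_slice(1)[OF continuous_on_tfshift] schwartz_cont g)
  then show "(\<lambda>y. f y * cnj (tfshift z g y)) \<in> borel_measurable lborel" for z
    using borel_measurable_integrable[OF f] unfolding measurable_lborel2
    by (intro borel_measurable_times)
  show "\<exists>D. integrable lborel D \<and> (\<forall>q y. dist q p \<le> 1 \<longrightarrow> norm (f y * cnj (tfshift q g y)) \<le> D y)" for p
    using f by (intro exI[of _ "\<lambda>y. norm (f y) * B"]) (auto simp: norm_mult norm_tfshift intro!: mult_left_mono B)
qed

lemma stft_integrable:
  fixes f g :: "real^'d \<Rightarrow> complex"
  assumes "schwartz f" "schwartz g" shows "integrable lborel (stft g f)"
proof -
  obtain C where "\<And>z. norm (stft g f z) \<le> C / pw z ^ (DIM((real^'d) \<times> (real^'d)) + 2)"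
    using stft_bound[OF assms] by metis
  moreover have "continuous_on UNIV (stft g f)" by (intro stft_continuous schwartz_integrable assms)
  ultimately show ?thesis
    by (intro integrable_bound_pw[OF _ _ order_refl] borel_measurable_continuous_onI)
qed

text \<open>For a fixed position the frequency integral is Fourier inversion of the windowed
  function at \<open>y\<close>; the position integral then sees only the window and gives its
  squared norm.\<close>

lemma stft_reconstruct:
  fixes f g :: "real^'d \<Rightarrow> complex"
  assumes f: "schwartz f" and g: "schwartz g"
  shows "(\<integral>z. stft g f z * tfshift z g y \<partial>lborel) = of_real ((2 * pi) ^ CARD('d) * (\<integral>x. (norm (g x))\<^sup>2 \<partial>lborel)) * f y"
proof -
  obtain B where B: "B > 0" "\<And>x. norm (g x) \<le> B" using schwartz_bounded[OF g] by metis
  have gc: "continuous_on UNIV g" using g by (rule schwartz_cont)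
  have int: "integrable lborel (\<lambda>z. stft g f (fst z, snd z) * tfshift (fst z, snd z) g y)"
  proof (rule Bochner_Integration.integrable_bound)
    show "integrable lborel (\<lambda>z. stft g f z * B)" using stft_integrable[OF f g] by auto
    have "continuous_on UNIV (\<lambda>z. stft g f z * tfshift z g y)"
      by (intro continuous_intros stft_continuous schwartz_integrable f g continuous_on_slice(2)[OF continuous_on_tfshift] gc)
    then show "(\<lambda>z. stft g f (fst z, snd z) * tfshift (fst z, snd z) g y) \<in> borel_measurable lborel"
      by (simp add: borel_measurable_continuous_onI)
    show "AE z in lborel. norm (stft g f (fst z, snd z) * tfshift (fst z, snd z) g y) \<le> norm (stft g f z * B)"
      using B by (auto simp: norm_mult norm_tfshift intro!: mult_left_mono)
  qed
  have "(\<integral>z. stft g f z * tfshift z g y \<partial>lborel)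
      = (\<integral>a. (\<integral>\<alpha>. stft g f (a, \<alpha>) * tfshift (a, \<alpha>) g y \<partial>lborel) \<partial>lborel)"
    using lborel_Fubini(1)[OF int] by simp
  also have "\<dots> = (\<integral>a. of_real ((2 * pi) ^ CARD('d)) * f y * of_real ((norm (g (y - a)))\<^sup>2) \<partial>lborel)"
  proof (intro Bochner_Integration.integral_cong refl)
    fix a
    let ?h = "\<lambda>y. f y * cnj (g (y - a))"
    have h: "schwartz ?h" by (rule all_derivs_rapid_schwartz[OF schwartz_window_family[OF f g]])
    have "(\<integral>\<alpha>. stft g f (a, \<alpha>) * tfshift (a, \<alpha>) g y \<partial>lborel)
        = (\<integral>\<alpha>. g (y - a) * (exp (\<i> * of_real (y \<bullet> \<alpha>)) * fourier ?h \<alpha>) \<partial>lborel)"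
      by (intro Bochner_Integration.integral_cong refl) (simp add: stft_fourier tfshift_def)
    also have "\<dots> = g (y - a) * (of_real ((2 * pi) ^ CARD('d)) * ?h y)"
      by (simp only: integral_mult_right_zero schwartz_fourier_inversion[OF h])
    also have "\<dots> = of_real ((2 * pi) ^ CARD('d)) * f y * (g (y - a) * cnj (g (y - a)))" by (simp only: mult_ac)
    also have "g (y - a) * cnj (g (y - a)) = of_real ((norm (g (y - a)))\<^sup>2)"
      by (simp only: complex_norm_square)
    finally show "(\<integral>\<alpha>. stft g f (a, \<alpha>) * tfshift (a, \<alpha>) g y \<partial>lborel) = of_real ((2 * pi) ^ CARD('d)) * f y * of_real ((norm (g (y - a)))\<^sup>2)" .
  qed
  also have "\<dots> = of_real ((2 * pi) ^ CARD('d)) * f y * of_real (\<integral>x. (norm (g x))\<^sup>2 \<partial>lborel)"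
  proof -
    have "(\<integral>a. (norm (g (y - a)))\<^sup>2 \<partial>lborel) = (\<integral>x. (norm (g x))\<^sup>2 \<partial>lborel)"
      by (rule lborel_integral_shift(3)) (intro borel_measurable_continuous_onI continuous_intros gc)
    then have "(\<integral>a. complex_of_real ((norm (g (y - a)))\<^sup>2) \<partial>lborel) = of_real (\<integral>x. (norm (g x))\<^sup>2 \<partial>lborel)"
      unfolding integral_complex_of_real by (rule arg_cong)
    then show ?thesis by (simp only: integral_mult_right_zero)
  qed
  finally show ?thesis by (simp only: of_real_mult mult_ac)
qed

text \<open>Modulating the function translates its transform in frequency, so a bound for one
  function serves all its modulations.\<close>

lemma stft_modulate:
  "stft g (\<lambda>x. h x * exp (\<i> * of_real (x \<bullet> \<xi>))) (a, \<alpha>) = stft g h (a, \<alpha> - \<xi>)"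
  unfolding stft_def tfshift_def
  by (intro Bochner_Integration.integral_cong refl)
     (simp add: exp_cnj inner_diff_right exp_diff exp_minus field_simps)

text \<open>If the integral were 0, \<open>g\<close> would vanish almost everywhere; its zero set is
  closed by continuity and would be the whole space.\<close>

lemma integral_norm2_pos:
  fixes g :: "'a::euclidean_space \<Rightarrow> complex"
  assumes g: "schwartz g" and nz: "g \<noteq> (\<lambda>_. 0)"
  shows "(\<integral>x. (norm (g x))\<^sup>2 \<partial>lborel) > 0"
proof -
  obtain B where B: "B > 0" "\<And>x. norm (g x) \<le> B" using schwartz_bounded[OF g] by metis
  have c: "continuous_on UNIV (\<lambda>x. (norm (g x))\<^sup>2)" by (intro continuous_intros schwartz_cont g)
  have i: "integrable lborel (\<lambda>x. (norm (g x))\<^sup>2)"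
  proof (rule Bochner_Integration.integrable_bound)
    show "integrable lborel (\<lambda>x. B * norm (g x))" using schwartz_integrable[OF g] by auto
    show "AE x in lborel. norm ((norm (g x))\<^sup>2) \<le> norm (B * norm (g x))"
      using B by (auto simp: power2_eq_square intro!: mult_right_mono)
  qed (use c in \<open>simp add: borel_measurable_continuous_onI\<close>)
  have "(\<integral>x. (norm (g x))\<^sup>2 \<partial>lborel) \<noteq> 0"
  proof
    assume "(\<integral>x. (norm (g x))\<^sup>2 \<partial>lborel) = 0"
    then have "AE x in lborel. (norm (g x))\<^sup>2 = 0"
      by (subst (asm) integral_nonneg_eq_0_iff_AE[OF i]) auto
    then have "AE x in lborel. x \<in> {x. g x = 0}" by simp
    moreover have "closed {x. g x = 0}"
      using schwartz_cont[OF g] by (auto intro: closed_Collect_eq)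
    ultimately have "x \<in> {x. g x = 0}" for x
      by (intro mem_closed_if_AE_lebesgue AE_completion)
    with nz show False by auto
  qed
  moreover have "(\<integral>x. (norm (g x))\<^sup>2 \<partial>lborel) \<ge> 0" by (intro integral_nonneg_AE) auto
  ultimately show ?thesis by linarith
qed

section \<open>Tempered distributions and integrals of families\<close>

lemma has_pd_sum:
  assumes "\<And>v. v \<in> V \<Longrightarrow> has_pd b (F v) (F' v)"
  shows "has_pd b (\<lambda>x. \<Sum>v\<in>V. c v * F v x) (\<lambda>x. \<Sum>v\<in>V. c v * F' v x)"
  using assms
proof (induction V rule: infinite_finite_induct)
  case (insert v V)
  then show ?case using has_pd_add[OF has_pd_cmult[of b "F v" "F' v" "c v"], of "\<lambda>x. \<Sum>v\<in>V. c v * F v x"] by simp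
qed (auto intro: has_pd_const)

lemma schwartz_iter_pd:
  "schwartz f \<Longrightarrow> set bs \<subseteq> Basis \<Longrightarrow> b \<in> Basis \<Longrightarrow> has_pd b (iter_pdiff bs f) (iter_pdiff (b # bs) f)"
  unfolding schwartz_iff by (rule all_derivs_iter_pd)

lemma iter_pdiff_sum:
  assumes "\<And>v. v \<in> V \<Longrightarrow> schwartz (F v)" "set bs \<subseteq> Basis"
  shows "iter_pdiff bs (\<lambda>x. \<Sum>v\<in>V. c v * F v x) = (\<lambda>x. \<Sum>v\<in>V. c v * iter_pdiff bs (F v) x)"
  using assms(2)
proof (induction bs)
  case (Cons b bs)
  then have "iter_pdiff (b # bs) (\<lambda>x. \<Sum>v\<in>V. c v * F v x) = pdiff b (\<lambda>x. \<Sum>v\<in>V. c v * iter_pdiff bs (F v) x)" by simp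
  also have "\<dots> = (\<lambda>x. \<Sum>v\<in>V. c v * iter_pdiff (b # bs) (F v) x)"
    using Cons.prems assms(1) by (intro has_pd_pdiff has_pd_sum schwartz_iter_pd) auto
  finally show ?case .
qed simp

lemma iter_pdiff_diff:
  assumes "schwartz f" "schwartz g" "set bs \<subseteq> Basis"
  shows "iter_pdiff bs (\<lambda>x. f x - g x) = (\<lambda>x. iter_pdiff bs f x - iter_pdiff bs g x)"
  using assms(3)
proof (induction bs)
  case (Cons b bs)
  then have "iter_pdiff (b # bs) (\<lambda>x. f x - g x) = pdiff b (\<lambda>x. iter_pdiff bs f x - iter_pdiff bs g x)" by simp
  also have "\<dots> = (\<lambda>x. iter_pdiff (b # bs) f x - iter_pdiff (b # bs) g x)"
    using Cons.prems assms(1,2) by (intro has_pd_pdiff has_pd_diff schwartz_iter_pd) auto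
  finally show ?case .
qed simp

lemma schwartz_zero: "schwartz (\<lambda>_. 0)"
proof -
  have "all_derivs (rapid (\<lambda>_. 0) (\<lambda>_. 0)) (\<lambda>(_::unit) (x::'a). 0)"
    by (rule all_derivs_coinduct[where X="\<lambda>F. F = (\<lambda>_ _. 0)"])
       (auto simp: rapid_0_iff intro!: exI[of _ "\<lambda>_ _. 0"] has_pd_const)
  then show ?thesis by (simp add: schwartz_iff)
qed

lemma schwartz_sum:
  "finite V \<Longrightarrow> (\<And>v. v \<in> V \<Longrightarrow> schwartz (F v)) \<Longrightarrow> schwartz (\<lambda>x. \<Sum>v\<in>V. c v * F v x)"
proof (induction V rule: finite_induct)
  case (insert v V)
  then show ?case using schwartz_add[OF schwartz_cmult[of "F v" "c v"], of "\<lambda>x. \<Sum>v\<in>V. c v * F v x"] by simp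
qed (simp add: schwartz_zero)

lemma tempered_linear:
  "tempered u \<Longrightarrow> schwartz f \<Longrightarrow> schwartz g \<Longrightarrow> u (\<lambda>x. a * f x + b * g x) = a * u f + b * u g"
  by (auto simp: tempered_def)

lemma tempered_zero: "tempered u \<Longrightarrow> u (\<lambda>_. 0) = 0"
  using tempered_linear[OF _ schwartz_zero schwartz_zero, of u 0 0] by simp

lemma tempered_diff: "tempered u \<Longrightarrow> schwartz f \<Longrightarrow> schwartz g \<Longrightarrow> u (\<lambda>x. f x - g x) = u f - u g"
  using tempered_linear[of u f g 1 "-1"] by simp

lemma tempered_cmult: "tempered u \<Longrightarrow> schwartz f \<Longrightarrow> u (\<lambda>x. c * f x) = c * u f"
  using tempered_linear[of u f f c 0] by simp

lemma tempered_sum: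
  assumes u: "tempered u" and "finite V" "\<And>v. v \<in> V \<Longrightarrow> schwartz (F v)"
  shows "u (\<lambda>x. \<Sum>v\<in>V. c v * F v x) = (\<Sum>v\<in>V. c v * u (F v))"
  using assms(2,3)
proof (induction V rule: finite_induct)
  case (insert v V)
  then have "u (\<lambda>x. c v * F v x + 1 * (\<Sum>v\<in>V. c v * F v x)) = c v * u (F v) + 1 * u (\<lambda>x. \<Sum>v\<in>V. c v * F v x)"
    by (intro tempered_linear u schwartz_sum) auto
  with insert show ?case by simp
qed (simp add: tempered_zero u)

lemma schwartz_bdd:
  assumes "schwartz f" "set bs \<subseteq> Basis"
  shows "bdd_above (range (\<lambda>x. (1 + norm x) ^ k * norm (iter_pdiff bs f x)))"
  using assms unfolding schwartz_def by (auto intro: bounded_imp_bdd_above)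

text \<open>The evaluation points are allowed to depend on n, which expresses uniform
  convergence without measurability questions for suprema.\<close>

lemma tempered_tendsto_zero:
  fixes R :: "nat \<Rightarrow> 'a::euclidean_space \<Rightarrow> complex"
  assumes u: "tempered u" and R: "\<And>n. schwartz (R n)"
    and lim: "\<And>bs k x. set bs \<subseteq> Basis \<Longrightarrow> (\<lambda>n. pw (x n) ^ k * norm (iter_pdiff bs (R n) (x n))) \<longlonglongrightarrow> 0"
  shows "(\<lambda>n. u (R n)) \<longlonglongrightarrow> 0"
proof -
  obtain C m where C: "\<And>f. schwartz f \<Longrightarrow> norm (u f) \<le> C * schwartz_seminorm m f"
    using u unfolding tempered_def by blast
  have "(\<lambda>n. SUP x. (1 + norm x) ^ m * norm (iter_pdiff bs (R n) x)) \<longlonglongrightarrow> 0" if bs: "set bs \<subseteq> Basis" for bs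
  proof -
    let ?g = "\<lambda>n x. (1 + norm x) ^ m * norm (iter_pdiff bs (R n) x)"
    have bdd: "bdd_above (range (?g n))" for n by (rule schwartz_bdd[OF R bs])
    \<comment> \<open>Near-maximizers: up to \<open>1 / Suc n\<close> the supremum is the value at
      one point, so the hypothesis along arbitrary sequences of points applies.\<close>
    have "\<exists>x. (SUP x. ?g n x) - 1 / real (Suc n) < ?g n x" for n
    proof -
      have "(SUP x. ?g n x) - 1 / real (Suc n) < (SUP x. ?g n x)" by simp
      then show ?thesis using less_cSUP_iff[OF _ bdd[of n]] by auto
    qed
    then have "\<forall>n. \<exists>x. (SUP x. ?g n x) - 1 / real (Suc n) < ?g n x" by blast
    from choice[OF this] obtain x where x: "\<And>n. (SUP x. ?g n x) - 1 / real (Suc n) < ?g n (x n)" by auto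
    have "(\<lambda>n. ?g n (x n) + 1 / real (Suc n)) \<longlonglongrightarrow> 0 + 0"
      using lim[OF bs, of x m] LIMSEQ_inverse_real_of_nat by (intro tendsto_add) (auto simp: pw_def inverse_eq_divide)
    then have u: "(\<lambda>n. ?g n (x n) + 1 / real (Suc n)) \<longlonglongrightarrow> 0" by simp
    show ?thesis
    proof (rule tendsto_sandwich[OF _ _ tendsto_const u])
      show "\<forall>\<^sub>F n in sequentially. 0 \<le> (SUP x. ?g n x)"
        by (intro always_eventually allI order_trans[OF _ cSUP_upper[OF _ bdd, of 0]]) auto
      show "\<forall>\<^sub>F n in sequentially. (SUP x. ?g n x) \<le> ?g n (x n) + 1 / real (Suc n)"
        using x by (intro always_eventually allI) (smt (verit))
    qed
  qed
  then have "(\<lambda>n. C * schwartz_seminorm m (R n)) \<longlonglongrightarrow> C * (\<Sum>bs\<in>{bs::'a list. set bs \<subseteq> Basis \<and> length bs \<le> m}. 0)"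
    unfolding schwartz_seminorm_def by (intro tendsto_mult tendsto_const tendsto_sum) auto
  then have "(\<lambda>n. C * schwartz_seminorm m (R n)) \<longlonglongrightarrow> 0" by simp
  then show ?thesis
    by (rule Lim_null_comparison[OF always_eventually, rotated]) (intro allI C R)
qed

text \<open>Outside a large ball one additional power of \<open>pw x\<close> makes both terms small;
  inside, joint continuity is uniform on a compact set. Neither argument depends on where the points
  \<open>x n\<close> lie.\<close>

lemma uniform_tail_convergence:
  fixes F :: "'w::euclidean_space \<Rightarrow> 'a::euclidean_space \<Rightarrow> complex"
  assumes jc: "continuous_on UNIV (\<lambda>z. F (fst z) (snd z))"
    and b: "\<And>k. \<exists>C. \<forall>w x. pw x ^ k * norm (F w x) \<le> C" and w: "w \<longlonglongrightarrow> w0"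
  shows "(\<lambda>n. pw (x n) ^ k * norm (F (w n) (x n) - F w0 (x n))) \<longlonglongrightarrow> 0"
proof (rule LIMSEQ_I)
  fix e :: real assume e: "e > 0"
  obtain C where C: "\<And>w x. pw x ^ Suc k * norm (F w x) \<le> C" using b by metis
  have C0: "C \<ge> 0" by (rule order_trans[OF _ C[of 0 0]]) simp
  \<comment> \<open>Outside this radius \<open>2 * C / pw x\<close> is below
    \<open>e\<close>.\<close>
  define R where "R = 2 * C / e + 1"
  have R: "R \<ge> 1" unfolding R_def using C0 e by simp
  let ?K = "cball w0 1 \<times> cball (0::'a) R"
  have "uniformly_continuous_on ?K (\<lambda>z. F (fst z) (snd z))"
    by (intro compact_uniformly_continuous compact_Times compact_cball continuous_on_subset[OF jc]) auto
  moreover have "e / pw R ^ k > 0" using e by simp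
  ultimately obtain d where d: "d > 0" "\<And>z z'. z \<in> ?K \<Longrightarrow> z' \<in> ?K \<Longrightarrow> dist z' z < d \<Longrightarrow>
      dist (F (fst z') (snd z')) (F (fst z) (snd z)) < e / pw R ^ k"
    unfolding uniformly_continuous_on_def by metis
  obtain N where N: "\<And>n. n \<ge> N \<Longrightarrow> dist (w n) w0 < min d 1"
    using w d(1) unfolding lim_sequentially by (meson min_less_iff_conj zero_less_one)
  show "\<exists>no. \<forall>n\<ge>no. norm (pw (x n) ^ k * norm (F (w n) (x n) - F w0 (x n)) - 0) < e"
  proof (intro exI[of _ N] allI impI)
    fix n assume n: "n \<ge> N"
    have "pw (x n) ^ k * norm (F (w n) (x n) - F w0 (x n)) < e"
    proof (cases "norm (x n) \<le> R")
      case True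
      have "dist (F (w n) (x n)) (F w0 (x n)) < e / pw R ^ k"
        using d(2)[of "(w0, x n)" "(w n, x n)"] N[OF n] True by (auto simp: dist_Pair_Pair dist_commute)
      then have "norm (F (w n) (x n) - F w0 (x n)) * pw R ^ k < e"
        by (simp add: dist_norm pos_less_divide_eq)
      moreover have "pw (x n) ^ k * norm (F (w n) (x n) - F w0 (x n)) \<le> pw R ^ k * norm (F (w n) (x n) - F w0 (x n))"
        using True R by (intro mult_right_mono power_mono) (auto simp: pw_def)
      ultimately show ?thesis by (simp add: mult.commute)
    next
      case False
      have "pw (x n) ^ Suc k * norm (F (w n) (x n) - F w0 (x n)) \<le> pw (x n) ^ Suc k * (norm (F (w n) (x n)) + norm (F w0 (x n)))"
        by (intro mult_left_mono norm_triangle_ineq4) auto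
      also have "\<dots> \<le> C + C" unfolding distrib_left by (intro add_mono C)
      finally have "(pw (x n) ^ k * norm (F (w n) (x n) - F w0 (x n))) * pw (x n) \<le> 2 * C" by (simp add: mult_ac)
      then have "pw (x n) ^ k * norm (F (w n) (x n) - F w0 (x n)) \<le> 2 * C / pw (x n)" by (simp add: pos_le_divide_eq)
      also have "\<dots> < e"
      proof -
        have "2 * C / e < pw (x n)" using False unfolding R_def pw_def by simp
        then show ?thesis using e by (simp add: field_simps)
      qed
      finally show ?thesis .
    qed
    then show "norm (pw (x n) ^ k * norm (F (w n) (x n) - F w0 (x n)) - 0) < e" by simp
  qed
qed

text \<open>The first variable is the one to be integrated. Decay is uniform in it, but no decay in
  it is required; joint continuity gives measurability and, together with \<open>all_derivs\<close>,
  continuity of \<open>F\<close> in \<open>w\<close> for every Schwartz seminorm.\<close>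

definition jrapid :: "('w::euclidean_space \<Rightarrow> 'a::euclidean_space \<Rightarrow> complex) \<Rightarrow> bool" where
  "jrapid F \<longleftrightarrow> continuous_on UNIV (\<lambda>z. F (fst z) (snd z)) \<and> (\<forall>k. \<exists>C. \<forall>w x. pw x ^ k * norm (F w x) \<le> C)"

lemma jrapid_D:
  assumes "jrapid F"
  shows "continuous_on UNIV (\<lambda>z. F (fst z) (snd z))" "\<exists>C. \<forall>w x. pw x ^ k * norm (F w x) \<le> C"
    "continuous_on UNIV (F w)" "continuous_on UNIV (\<lambda>w. F w x)"
  using assms continuous_on_slice[of F] unfolding jrapid_def by auto

lemma jrapid_schwartz: "all_derivs jrapid F \<Longrightarrow> schwartz (F w)"
  by (rule all_derivs_rapid_schwartz[of "\<lambda>_. 0" "\<lambda>_. 0"], erule all_derivs_mono)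
     (auto simp: rapid_0_iff jrapid_D)

lemma jrapid_bdd:
  assumes "jrapid F" obtains C where "C > 0" "\<And>w x. pw x ^ k * norm (F w x) \<le> C"
proof -
  obtain C where "\<And>w x. pw x ^ k * norm (F w x) \<le> C" using jrapid_D(2)[OF assms] by metis
  then have "pw x ^ k * norm (F w x) \<le> max C 1" for w x by (simp add: le_max_iff_disj)
  then show ?thesis using that[of "max C 1"] by auto
qed

section \<open>Integrals of Schwartz families over finite measures\<close>

locale finite_borel = finite_measure M for M :: "'w::euclidean_space measure" +
  assumes sets_M [measurable_cong]: "sets M = sets borel"
begin

lemma space_M [simp]: "space M = UNIV"
  using sets_eq_imp_space_eq[OF sets_M] by simp

lemma meas_cont: "continuous_on UNIV f \<Longrightarrow> f \<in> borel_measurable M"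
  using borel_measurable_continuous_onI measurable_cong_sets[OF sets_M refl] by blast

lemma integrable_bdd:
  fixes f :: "'w \<Rightarrow> complex"
  assumes "f \<in> borel_measurable M" "\<And>w. norm (f w) \<le> B" shows "integrable M f"
  by (rule integrable_const_bound[of _ B]) (use assms in auto)

text \<open>On a finite measure a constant is an admissible dominating function, so derivatives and
  weights pass under the integral without any decay in \<open>w\<close>.\<close>

lemma integral_jrapid:
  assumes "all_derivs jrapid F"
  shows "schwartz (\<lambda>x. \<integral>w. F w x \<partial>M)"
    and "set bs \<subseteq> Basis \<Longrightarrow> iter_pdiff bs (\<lambda>x. \<integral>w. F w x \<partial>M) = (\<lambda>x. \<integral>w. iter_pdiff bs (F w) x \<partial>M)"
proof -
  have pd: "has_pd b (\<lambda>x. \<integral>w. F w x \<partial>M) (\<lambda>x. \<integral>w. F' w x \<partial>M)"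
    if F: "jrapid F" and F': "jrapid F'" and pd: "\<And>w. has_pd b (F w) (F' w)" for b and F F' :: "'w \<Rightarrow> 'a \<Rightarrow> complex"
  proof (rule has_pd_integral)
    show "has_pd b (\<lambda>p. F y p) (\<lambda>p. F' y p)" for y using pd by simp
    obtain C where "\<And>w x. pw x ^ 0 * norm (F w x) \<le> C" using jrapid_bdd[OF F] by metis
    then show "integrable M (\<lambda>w. F w p)" for p
      by (intro integrable_bdd[where B=C] meas_cont jrapid_D(4)[OF F]) auto
    show "(\<lambda>w. F' w p) \<in> borel_measurable M" for p by (intro meas_cont jrapid_D(4)[OF F'])
    obtain C' where "\<And>w x. pw x ^ 0 * norm (F' w x) \<le> C'" using jrapid_bdd[OF F'] by metis
    then show "\<exists>D. integrable M D \<and> (\<forall>t y. \<bar>t\<bar> \<le> 1 \<longrightarrow> norm (F' y (p + t *\<^sub>R b)) \<le> D y)" for p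
      by (intro exI[of _ "\<lambda>_. C'"]) auto
  qed
  have R: "rapid (\<lambda>_. 0) (\<lambda>_. 0) (\<lambda>_::unit. \<lambda>x. \<integral>w. F w x \<partial>M)" if F: "jrapid F" for F :: "'w \<Rightarrow> 'a \<Rightarrow> complex"
    unfolding rapid_0_iff
  proof (intro conjI allI)
    obtain C where "\<And>w x. pw x ^ 0 * norm (F w x) \<le> C" using jrapid_bdd[OF F] by metis
    then have C: "\<And>w x. norm (F w x) \<le> C" by simp
    show "continuous_on UNIV (\<lambda>x. \<integral>w. F w x \<partial>M)"
      by (rule continuous_on_integral_dominated)
         (auto intro!: jrapid_D(3)[OF F] meas_cont jrapid_D(4)[OF F] exI[of _ "\<lambda>_. C"] C)
    fix k
    obtain C where C: "C > 0" "\<And>w x. pw x ^ k * norm (F w x) \<le> C" using jrapid_bdd[OF F] by metis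
    have "pw x ^ k * norm (\<integral>w. F w x \<partial>M) \<le> C * measure M UNIV" for x
    proof -
      have i: "integrable M (\<lambda>w. F w x)"
        using C(2) by (intro integrable_bdd[where B="C / pw x ^ k"] meas_cont jrapid_D(4)[OF F]) (simp add: pos_le_divide_eq mult.commute)
      have "pw x ^ k * norm (\<integral>w. F w x \<partial>M) \<le> pw x ^ k * (\<integral>w. norm (F w x) \<partial>M)"
        by (intro mult_left_mono integral_norm_bound) auto
      also have "\<dots> = (\<integral>w. pw x ^ k * norm (F w x) \<partial>M)" by simp
      also have "\<dots> \<le> (\<integral>w. C \<partial>M)" using i C by (intro integral_mono) auto
      finally show ?thesis by (simp add: mult.commute)
    qed
    then show "\<exists>C. \<forall>i x. pw x ^ k * norm (\<integral>w. F w x \<partial>M) \<le> C" by blast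
  qed
  show "schwartz (\<lambda>x. \<integral>w. F w x \<partial>M)"
    unfolding schwartz_iff
  proof (rule all_derivs_coinduct[where X="\<lambda>G. \<exists>F. all_derivs jrapid F \<and> G = (\<lambda>_::unit. \<lambda>x. \<integral>w. F w x \<partial>M)"])
    fix G :: "unit \<Rightarrow> 'a \<Rightarrow> complex" assume "\<exists>F. all_derivs jrapid F \<and> G = (\<lambda>_::unit. \<lambda>x. \<integral>w. F w x \<partial>M)"
    then obtain F where F: "all_derivs jrapid F" "G = (\<lambda>_::unit. \<lambda>x. \<integral>w. F w x \<partial>M)" by blast
    show "rapid (\<lambda>_. 0) (\<lambda>_. 0) G \<and> (\<forall>b\<in>Basis. \<exists>G'. (\<forall>i. has_pd b (G i) (G' i)) \<and>
        (\<exists>F. all_derivs jrapid F \<and> G' = (\<lambda>_::unit. \<lambda>x. \<integral>w. F w x \<partial>M)))"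
    proof (intro conjI ballI)
      show "rapid (\<lambda>_. 0) (\<lambda>_. 0) G" using R[OF all_derivs_base[OF F(1)]] F(2) by simp
      fix b :: 'a assume "b \<in> Basis"
      from all_derivs_pd[OF F(1) this] obtain F' where F': "\<And>w. has_pd b (F w) (F' w)" "all_derivs jrapid F'" by auto
      show "\<exists>G'. (\<forall>i. has_pd b (G i) (G' i)) \<and> (\<exists>F. all_derivs jrapid F \<and> G' = (\<lambda>_::unit. \<lambda>x. \<integral>w. F w x \<partial>M))"
        using F'(2) pd[OF all_derivs_base[OF F(1)] all_derivs_base[OF F'(2)] F'(1)] F(2)
        by (intro exI[of _ "\<lambda>_. \<lambda>x. \<integral>w. F' w x \<partial>M"]) auto
    qed
  qed (use assms in blast)
  show "iter_pdiff bs (\<lambda>x. \<integral>w. F w x \<partial>M) = (\<lambda>x. \<integral>w. iter_pdiff bs (F w) x \<partial>M)" if "set bs \<subseteq> Basis"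
    using that
  proof (induction bs)
    case (Cons b bs)
    then have "iter_pdiff (b # bs) (\<lambda>x. \<integral>w. F w x \<partial>M) = pdiff b (\<lambda>x. \<integral>w. iter_pdiff bs (F w) x \<partial>M)" by simp
    also have "\<dots> = (\<lambda>x. \<integral>w. iter_pdiff (b # bs) (F w) x \<partial>M)"
    proof -
      from Cons.prems have bs: "set bs \<subseteq> Basis" and b: "b \<in> Basis" by auto
      show ?thesis
        by (rule has_pd_pdiff[OF pd[OF all_derivs_base[OF all_derivs_iter[OF assms bs]]
              all_derivs_base[OF all_derivs_iter[OF assms Cons.prems]] all_derivs_iter_pd[OF assms bs b]]])
    qed
    finally show ?case .
  qed simp
qed

text \<open>A continuous linear operator on tempered distributions is only sequentially continuous for
  pointwise convergence, so it is exchanged with an integral by approximating the integrand by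
  functions with finite range.\<close>

lemma simple_approx:
  obtains s :: "nat \<Rightarrow> 'w \<Rightarrow> 'w" where "\<And>n. finite (range (s n))" "\<And>w. (\<lambda>n. s n w) \<longlonglongrightarrow> w"
    "\<And>n v. s n -` {v} \<in> sets M" "\<And>n. s n \<in> borel_measurable M"
proof -
  have "(\<lambda>w. w) \<in> borel_measurable M" by (intro meas_cont continuous_intros)
  from borel_measurable_implies_sequence_metric[OF this, of 0] obtain s
    where s: "\<And>i. simple_function M (s i)" "\<And>w. (\<lambda>i. s i w) \<longlonglongrightarrow> w" by auto
  have "finite (range (s n))" for n using s(1)[of n] by (auto simp: simple_function_def)
  moreover have "s n -` {v} \<in> sets M" for n v
    using s(1)[of n] measurable_sets[of "s n" M borel "{v}"] borel_measurable_simple_function[OF s(1)[of n]] by auto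
  moreover have "s n \<in> borel_measurable M" for n by (rule borel_measurable_simple_function[OF s(1)])
  ultimately show ?thesis using that s(2) by metis
qed

text \<open>Composition with a map of finite range and measurable fibres makes every function
  measurable, so nothing is assumed of \<open>\<phi>\<close>.\<close>

lemma integral_finite_range:
  fixes \<phi> :: "'w \<Rightarrow> complex"
  assumes "finite (range s)" "\<And>v. s -` {v} \<in> sets M"
  shows "(\<integral>w. \<phi> (s w) \<partial>M) = (\<Sum>v\<in>range s. of_real (measure M (s -` {v})) * \<phi> v)"
    and "(\<lambda>w. \<phi> (s w)) \<in> borel_measurable M"
proof -
  have eq: "\<phi> (s w) = (\<Sum>v\<in>range s. indicator (s -` {v}) w *\<^sub>R \<phi> v)" for w
  proof -
    have "(\<Sum>v\<in>range s. indicator (s -` {v}) w *\<^sub>R \<phi> v) = (\<Sum>v\<in>range s. if v = s w then \<phi> v else 0)"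
      by (intro sum.cong refl) (auto simp: indicator_def)
    also have "\<dots> = \<phi> (s w)" using assms(1) by (simp add: sum.delta)
    finally show ?thesis by simp
  qed
  show "(\<lambda>w. \<phi> (s w)) \<in> borel_measurable M"
    unfolding eq using assms by (intro borel_measurable_sum borel_measurable_scaleR borel_measurable_indicator) auto
  have "(\<integral>w. \<phi> (s w) \<partial>M) = (\<Sum>v\<in>range s. (\<integral>w. indicator (s -` {v}) w *\<^sub>R \<phi> v \<partial>M))"
    unfolding eq using assms
    by (intro Bochner_Integration.integral_sum integrable_scaleR_left integrable_real_indicator) (auto simp: emeasure_eq_measure)
  also have "\<dots> = (\<Sum>v\<in>range s. of_real (measure M (s -` {v})) * \<phi> v)"
    using assms by (intro sum.cong refl) (simp add: scaleR_conv_of_real)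
  finally show "(\<integral>w. \<phi> (s w) \<partial>M) = (\<Sum>v\<in>range s. of_real (measure M (s -` {v})) * \<phi> v)" .
qed

lemma integral_simple_tendsto:
  fixes \<phi> :: "'w \<Rightarrow> complex"
  assumes "\<And>n. finite (range (s n))" "\<And>w. (\<lambda>n. s n w) \<longlonglongrightarrow> w" "\<And>n v. s n -` {v} \<in> sets M"
    and \<phi>: "continuous_on UNIV \<phi>" "\<And>w. norm (\<phi> w) \<le> B"
  shows "(\<lambda>n. \<integral>w. \<phi> (s n w) \<partial>M) \<longlonglongrightarrow> (\<integral>w. \<phi> w \<partial>M)"
proof (rule integral_dominated_convergence[where w="\<lambda>_. B"])
  show "AE w in M. (\<lambda>n. \<phi> (s n w)) \<longlonglongrightarrow> \<phi> w"
    using assms(2) \<phi>(1) unfolding continuous_on_sequentially o_def by (intro AE_I2) blast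
qed (use assms integral_finite_range(2) meas_cont in auto)

text \<open>The integral is approximated by finite sums, the integrals of \<open>F (s n w)\<close>
  with \<open>s n\<close> of finite range. Linearity handles the sums; they converge in every
  Schwartz seminorm, and one of these controls \<open>u\<close>.\<close>

lemma tempered_integral:
  assumes F: "all_derivs jrapid F" and u: "tempered u"
  shows "continuous_on UNIV (\<lambda>w. u (F w))" "\<exists>B. \<forall>w. norm (u (F w)) \<le> B"
    "u (\<lambda>x. \<integral>w. F w x \<partial>M) = (\<integral>w. u (F w) \<partial>M)"
proof -
  note S = jrapid_schwartz[OF F]
  note J = all_derivs_base[OF all_derivs_iter[OF F]]
  show cont: "continuous_on UNIV (\<lambda>w. u (F w))"
    unfolding continuous_on_sequentially o_def
  proof (intro ballI allI impI)
    fix w w0 assume "(\<forall>n. w n \<in> UNIV) \<and> w \<longlonglongrightarrow> (w0::'w)"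
    then have w: "w \<longlonglongrightarrow> w0" by simp
    have "(\<lambda>n. u (\<lambda>x. F (w n) x - F w0 x)) \<longlonglongrightarrow> 0"
    proof (rule tempered_tendsto_zero[OF u])
      show "schwartz (\<lambda>x. F (w n) x - F w0 x)" for n by (intro schwartz_diff S)
      fix bs :: "'a list" and k x assume bs: "set bs \<subseteq> Basis"
      show "(\<lambda>n. pw (x n) ^ k * norm (iter_pdiff bs (\<lambda>x. F (w n) x - F w0 x) (x n))) \<longlonglongrightarrow> 0"
        unfolding iter_pdiff_diff[OF S S bs]
        by (rule uniform_tail_convergence[OF jrapid_D(1,2)[OF J[OF bs]] w])
    qed
    then have "(\<lambda>n. u (F (w n)) - u (F w0)) \<longlonglongrightarrow> 0" by (simp add: tempered_diff[OF u S S])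
    then show "(\<lambda>n. u (F (w n))) \<longlonglongrightarrow> u (F w0)" by (simp add: LIM_zero_iff)
  qed
  show bdd: "\<exists>B. \<forall>w. norm (u (F w)) \<le> B"
  proof -
    obtain C m where C: "\<And>f. schwartz f \<Longrightarrow> norm (u f) \<le> C * schwartz_seminorm m f"
      using u unfolding tempered_def by blast
    have "\<exists>B. \<forall>w x. (1 + norm x) ^ m * norm (iter_pdiff bs (F w) x) \<le> B" if "set bs \<subseteq> Basis" for bs
      using jrapid_D(2)[OF J[OF that], of m] unfolding pw_def .
    then obtain B where B: "\<And>bs w x. set bs \<subseteq> Basis \<Longrightarrow> (1 + norm x) ^ m * norm (iter_pdiff bs (F w) x) \<le> B bs" by metis
    have "norm (u (F w)) \<le> \<bar>C\<bar> * (\<Sum>bs\<in>{bs::'a list. set bs \<subseteq> Basis \<and> length bs \<le> m}. B bs)" for w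
    proof -
      have s: "schwartz_seminorm m (F w) \<le> (\<Sum>bs\<in>{bs::'a list. set bs \<subseteq> Basis \<and> length bs \<le> m}. B bs)"
        unfolding schwartz_seminorm_def by (intro sum_mono cSUP_least) (auto intro: B)
      have "0 \<le> schwartz_seminorm m (F w)"
        unfolding schwartz_seminorm_def
        by (intro sum_nonneg order_trans[OF _ cSUP_upper[OF _ schwartz_bdd[OF S], of 0]]) auto
      then have "norm (u (F w)) \<le> \<bar>C\<bar> * schwartz_seminorm m (F w)"
        by (intro order_trans[OF C[OF S]] mult_right_mono) auto
      with s show ?thesis by (meson abs_ge_zero mult_left_mono order_trans)
    qed
    then show ?thesis by blast
  qed
  then obtain B where B: "\<And>w. norm (u (F w)) \<le> B" by blast
  obtain s :: "nat \<Rightarrow> 'w \<Rightarrow> 'w" where s: "\<And>n. finite (range (s n))" "\<And>w. (\<lambda>n. s n w) \<longlonglongrightarrow> w"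
    "\<And>n v. s n -` {v} \<in> sets M" "\<And>n. s n \<in> borel_measurable M" by (rule simple_approx) (rule that)
  let ?h = "\<lambda>x. \<integral>w. F w x \<partial>M"
  let ?c = "\<lambda>n v. complex_of_real (measure M (s n -` {v}))"
  let ?hn = "\<lambda>n x. \<Sum>v\<in>range (s n). ?c n v * F v x"
  have hs: "schwartz ?h" by (rule integral_jrapid(1)[OF F])
  have hns: "schwartz (?hn n)" for n by (intro schwartz_sum s S)
  have "(\<lambda>n. u (\<lambda>x. ?hn n x - ?h x)) \<longlonglongrightarrow> 0"
  proof (rule tempered_tendsto_zero[OF u])
    show "schwartz (\<lambda>x. ?hn n x - ?h x)" for n by (intro schwartz_diff hs hns)
    fix bs :: "'a list" and k x assume bs: "set bs \<subseteq> Basis"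
    let ?D = "\<lambda>w x. iter_pdiff bs (F w) x"
    obtain C where C: "C > 0" "\<And>w x. pw x ^ k * norm (?D w x) \<le> C" using jrapid_bdd[OF J[OF bs]] by metis
    have Dx: "norm (?D w x) \<le> C / pw x ^ k" for w x using C(2)[of x w] by (simp add: field_simps)
    have i1: "integrable M (\<lambda>w. ?D w x)" for x
      by (rule integrable_bdd[OF meas_cont[OF jrapid_D(4)[OF J[OF bs]]] Dx])
    have i2: "integrable M (\<lambda>w. ?D (s n w) x)" for n x
      by (rule integrable_bdd[OF integral_finite_range(2)[OF s(1,3)] Dx])
    have eq: "iter_pdiff bs (\<lambda>x. ?hn n x - ?h x) x = (\<integral>w. ?D (s n w) x - ?D w x \<partial>M)" for n x
    proof -
      have "iter_pdiff bs (\<lambda>x. ?hn n x - ?h x) x = (\<Sum>v\<in>range (s n). ?c n v * ?D v x) - (\<integral>w. ?D w x \<partial>M)"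
        unfolding iter_pdiff_diff[OF hns hs bs] iter_pdiff_sum[OF S bs] integral_jrapid(2)[OF F bs] ..
      also have "(\<Sum>v\<in>range (s n). ?c n v * ?D v x) = (\<integral>w. ?D (s n w) x \<partial>M)"
        using integral_finite_range(1)[OF s(1,3), of "\<lambda>v. ?D v x" n] by simp
      finally show ?thesis using i1 i2 by simp
    qed
    \<comment> \<open>For each n the integrand involves the single point \<open>x n\<close>, so
      dominated convergence in \<open>w\<close> applies although the points move.\<close>
    have "(\<lambda>n. \<integral>w. pw (x n) ^ k * norm (?D (s n w) (x n) - ?D w (x n)) \<partial>M) \<longlonglongrightarrow> (\<integral>w. 0 \<partial>M)"
    proof (rule integral_dominated_convergence[where w="\<lambda>_. 2 * C"])
      show "(\<lambda>w. pw (x n) ^ k * norm (?D (s n w) (x n) - ?D w (x n))) \<in> borel_measurable M" for n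
        using borel_measurable_integrable[OF i1[of "x n"]] borel_measurable_integrable[OF i2[of n "x n"]] by measurable
      show "AE w in M. norm (pw (x n) ^ k * norm (?D (s n w) (x n) - ?D w (x n))) \<le> 2 * C" for n
      proof (rule AE_I2)
        fix w
        have "pw (x n) ^ k * norm (?D (s n w) (x n) - ?D w (x n)) \<le> pw (x n) ^ k * (norm (?D (s n w) (x n)) + norm (?D w (x n)))"
          by (intro mult_left_mono norm_triangle_ineq4) auto
        also have "\<dots> \<le> C + C" unfolding distrib_left by (intro add_mono C)
        finally show "norm (pw (x n) ^ k * norm (?D (s n w) (x n) - ?D w (x n))) \<le> 2 * C" by simp
      qed
      show "AE w in M. (\<lambda>n. pw (x n) ^ k * norm (?D (s n w) (x n) - ?D w (x n))) \<longlonglongrightarrow> 0"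
        by (intro AE_I2 uniform_tail_convergence jrapid_D(1,2)[OF J[OF bs]] s)
    qed auto
    then have lim: "(\<lambda>n. \<integral>w. pw (x n) ^ k * norm (?D (s n w) (x n) - ?D w (x n)) \<partial>M) \<longlonglongrightarrow> 0" by simp
    show "(\<lambda>n. pw (x n) ^ k * norm (iter_pdiff bs (\<lambda>x. ?hn n x - ?h x) (x n))) \<longlonglongrightarrow> 0"
      unfolding eq
    proof (rule Lim_null_comparison[OF _ lim], intro always_eventually allI)
      fix n
      show "norm (pw (x n) ^ k * norm (\<integral>w. ?D (s n w) (x n) - ?D w (x n) \<partial>M)) \<le> (\<integral>w. pw (x n) ^ k * norm (?D (s n w) (x n) - ?D w (x n)) \<partial>M)"
        using integral_norm_bound[of M "\<lambda>w. ?D (s n w) (x n) - ?D w (x n)"] by (simp add: mult_left_mono)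
    qed
  qed
  moreover have "u (\<lambda>x. ?hn n x - ?h x) = (\<integral>w. u (F (s n w)) \<partial>M) - u ?h" for n
    using integral_finite_range(1)[OF s(1,3), of "\<lambda>v. u (F v)" n]
    by (simp add: tempered_diff[OF u hns hs] tempered_sum[OF u s(1) S])
  ultimately have "(\<lambda>n. (\<integral>w. u (F (s n w)) \<partial>M) - u ?h) \<longlonglongrightarrow> 0" by simp
  then have "(\<lambda>n. \<integral>w. u (F (s n w)) \<partial>M) \<longlonglongrightarrow> u ?h" by (simp add: LIM_zero_iff)
  moreover have "(\<lambda>n. \<integral>w. u (F (s n w)) \<partial>M) \<longlonglongrightarrow> (\<integral>w. u (F w) \<partial>M)"
    by (rule integral_simple_tendsto[OF s(1-3) cont B])
  ultimately show "u ?h = (\<integral>w. u (F w) \<partial>M)" by (rule LIMSEQ_unique)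
qed

end

section \<open>Continuous operators under the integral\<close>

lemma tempered_const_zero: "tempered (\<lambda>_. 0)"
  unfolding tempered_def by (auto intro!: exI[of _ 0])

lemma tempered_lincomb:
  assumes u: "tempered u" and v: "tempered v"
  shows "tempered (\<lambda>g. a * u g + b * v g)"
proof -
  obtain C m where C: "\<And>f. schwartz f \<Longrightarrow> norm (u f) \<le> C * schwartz_seminorm m f"
    using u unfolding tempered_def by blast
  obtain C' m' where C': "\<And>f. schwartz f \<Longrightarrow> norm (v f) \<le> C' * schwartz_seminorm m' f"
    using v unfolding tempered_def by blast
  \<comment> \<open>The two functionals come with seminorms of different orders; monotonicity in the
    order gives one that bounds both.\<close>
  have mono: "schwartz_seminorm m f \<le> schwartz_seminorm n f" and nn: "0 \<le> schwartz_seminorm n f"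
    if f: "schwartz f" and mn: "m \<le> n" for f :: "'a \<Rightarrow> complex" and m n
  proof -
    let ?S = "\<lambda>m. {bs::'a list. set bs \<subseteq> Basis \<and> length bs \<le> m}"
    let ?q = "\<lambda>m bs. SUP x. (1 + norm x) ^ m * norm (iter_pdiff bs f x)"
    have q0: "0 \<le> ?q n bs" if "bs \<in> ?S n" for bs n
      using that by (intro order_trans[OF _ cSUP_upper[OF _ schwartz_bdd[OF f], of 0]]) auto
    then show "0 \<le> schwartz_seminorm n f" unfolding schwartz_seminorm_def by (intro sum_nonneg) auto
    have "schwartz_seminorm m f \<le> (\<Sum>bs\<in>?S m. ?q n bs)"
      unfolding schwartz_seminorm_def
    proof (intro sum_mono cSUP_mono)
      fix bs assume bs: "bs \<in> ?S m"
      then show "bdd_above (range (\<lambda>x. (1 + norm x) ^ n * norm (iter_pdiff bs f x)))" using schwartz_bdd[OF f] by auto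
      fix x :: 'a
      show "\<exists>y\<in>UNIV. (1 + norm x) ^ m * norm (iter_pdiff bs f x) \<le> (1 + norm y) ^ n * norm (iter_pdiff bs f y)"
        using mn by (intro bexI[of _ x] mult_right_mono power_increasing) auto
    qed simp
    also have "\<dots> \<le> schwartz_seminorm n f"
      unfolding schwartz_seminorm_def using mn q0
      by (intro sum_mono2) (auto intro: finite_lists_length_le)
    finally show "schwartz_seminorm m f \<le> schwartz_seminorm n f" .
  qed
  have "norm (a * u f + b * v f) \<le> (norm a * \<bar>C\<bar> + norm b * \<bar>C'\<bar>) * schwartz_seminorm (max m m') f" if f: "schwartz f" for f
  proof -
    have "norm (u f) \<le> \<bar>C\<bar> * schwartz_seminorm (max m m') f"
      by (rule order_trans[OF C[OF f] mult_mono]) (use mono[OF f, of m "max m m'"] nn[OF f, of m m] in auto)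
    moreover have "norm (v f) \<le> \<bar>C'\<bar> * schwartz_seminorm (max m m') f"
      by (rule order_trans[OF C'[OF f] mult_mono]) (use mono[OF f, of m' "max m m'"] nn[OF f, of m' m'] in auto)
    ultimately have "norm a * norm (u f) + norm b * norm (v f) \<le>
       norm a * (\<bar>C\<bar> * schwartz_seminorm (max m m') f) + norm b * (\<bar>C'\<bar> * schwartz_seminorm (max m m') f)"
      by (intro add_mono mult_left_mono) auto
    then show ?thesis
      using norm_triangle_ineq[of "a * u f" "b * v f"] by (simp add: norm_mult algebra_simps)
  qed
  moreover have "a * u (\<lambda>x. c * f x + d * g x) + b * v (\<lambda>x. c * f x + d * g x) = c * (a * u f + b * v f) + d * (a * u g + b * v g)"
    if "schwartz f" "schwartz g" for f g c d
    using tempered_linear[OF u that] tempered_linear[OF v that] by (simp add: algebra_simps)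
  ultimately show ?thesis unfolding tempered_def by blast
qed

lemma cont_lin_op_sum:
  assumes T: "cont_lin_op T" and "finite V" "\<And>v. v \<in> V \<Longrightarrow> tempered (U v)"
  shows "tempered (\<lambda>g. \<Sum>v\<in>V. c v * U v g) \<and> (\<forall>h. schwartz h \<longrightarrow> T (\<lambda>g. \<Sum>v\<in>V. c v * U v g) h = (\<Sum>v\<in>V. c v * T (U v) h))"
  using assms(2,3)
proof (induction V rule: finite_induct)
  case empty
  have "T (\<lambda>g. 0 * (\<lambda>_. 0) g + 0 * (\<lambda>_. 0) g) h = 0 * T (\<lambda>_. 0) h + 0 * T (\<lambda>_. 0) h" if "schwartz h" for h
    using T tempered_const_zero that unfolding cont_lin_op_def by blast
  then show ?case using tempered_const_zero by simp
next
  case (insert v V)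
  let ?S = "\<lambda>g. \<Sum>v\<in>V. c v * U v g"
  have t: "tempered (U v)" "tempered ?S" using insert by auto
  have "T (\<lambda>g. c v * U v g + 1 * ?S g) h = c v * T (U v) h + 1 * T ?S h" if "schwartz h" for h
    using T t that unfolding cont_lin_op_def by blast
  moreover have "tempered (\<lambda>g. c v * U v g + 1 * ?S g)" by (rule tempered_lincomb[OF t])
  ultimately show ?case using insert by simp
qed

text \<open>The approximation is the one used for a single functional, but \<open>T\<close> comes
  with no seminorm estimate. Continuity and boundedness of \<open>T (U w) h\<close> in
  \<open>w\<close> have to be extracted from sequential continuity alone.\<close>

lemma (in finite_borel) cont_lin_op_integral:
  fixes T :: "(('a::euclidean_space \<Rightarrow> complex) \<Rightarrow> complex) \<Rightarrow> (('a \<Rightarrow> complex) \<Rightarrow> complex)"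
  assumes T: "cont_lin_op T" and U: "\<And>w. tempered (U w)" and u: "tempered u"
    and c: "\<And>h. schwartz h \<Longrightarrow> continuous_on UNIV (\<lambda>w. U w h)"
    and b: "\<And>h. schwartz h \<Longrightarrow> \<exists>B. \<forall>w. norm (U w h) \<le> B"
    and eq: "\<And>h. schwartz h \<Longrightarrow> u h = (\<integral>w. U w h \<partial>M)" and h: "schwartz h"
  shows "continuous_on UNIV (\<lambda>w. T (U w) h)" "\<exists>B. \<forall>w. norm (T (U w) h) \<le> B" "T u h = (\<integral>w. T (U w) h \<partial>M)"
proof -
  have seq: "(\<lambda>n. T (us n) h) \<longlonglongrightarrow> T v h"
    if "\<And>n. tempered (us n)" "tempered v" "\<And>g. schwartz g \<Longrightarrow> (\<lambda>n. us n g) \<longlonglongrightarrow> v g" for us v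
    using T that h unfolding cont_lin_op_def by blast
  have lin: "T (\<lambda>g. a * v g + b * v' g) h = a * T v h + b * T v' h" if "tempered v" "tempered v'" for v v' a b
    using T that h unfolding cont_lin_op_def by blast
  show cont: "continuous_on UNIV (\<lambda>w. T (U w) h)"
    unfolding continuous_on_sequentially o_def
  proof (intro ballI allI impI seq U)
    fix w w0 g assume "(\<forall>n. w n \<in> UNIV) \<and> w \<longlonglongrightarrow> (w0::'w)" "schwartz (g::'a \<Rightarrow> complex)"
    then show "(\<lambda>n. U (w n) g) \<longlonglongrightarrow> U w0 g"
      using c[of g] unfolding continuous_on_sequentially o_def by auto
  qed
  show bdd: "\<exists>B. \<forall>w. norm (T (U w) h) \<le> B"
  proof (rule ccontr)
    assume "\<not> ?thesis"
    then have "\<exists>w. norm (T (U w) h) > real (Suc n)" for n by (meson not_le)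
    then obtain w where w: "\<And>n. norm (T (U (w n)) h) > real (Suc n)" by metis
    \<comment> \<open>If boundedness failed along \<open>w n\<close>, division by
      \<open>Suc n\<close> would give functionals that tend to 0 at each Schwartz function while
      their images stay above 1 in modulus. The zero summand fits them to the two-term linearity
      clause of \<open>cont_lin_op\<close>.\<close>
    let ?u = "\<lambda>n g. of_real (1 / real (Suc n)) * U (w n) g + 0 * (\<lambda>_. 0) g"
    have "(\<lambda>n. T (?u n) h) \<longlonglongrightarrow> T (\<lambda>_. 0) h"
    proof (rule seq)
      show "tempered (?u n)" for n by (rule tempered_lincomb[OF U tempered_const_zero])
      show "tempered (\<lambda>_. 0)" by (rule tempered_const_zero)
      fix g assume "schwartz (g::'a \<Rightarrow> complex)"
      then obtain B where B: "\<And>w. norm (U w g) \<le> B" using b by blast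
      have "(\<lambda>n. (1 / real (Suc n)) * B) \<longlonglongrightarrow> 0 * B"
        using LIMSEQ_inverse_real_of_nat by (intro tendsto_mult tendsto_const) (simp add: inverse_eq_divide)
      then have l: "(\<lambda>n. (1 / real (Suc n)) * B) \<longlonglongrightarrow> 0" by simp
      show "(\<lambda>n. ?u n g) \<longlonglongrightarrow> 0"
      proof (rule Lim_null_comparison[OF _ l], intro always_eventually allI)
        fix n
        show "norm (?u n g) \<le> 1 / real (Suc n) * B"
          using B[of "w n"] by (simp add: norm_divide norm_of_nat divide_right_mono del: of_nat_Suc)
      qed
    qed
    moreover have "T (\<lambda>_. 0) h = 0" using lin[OF tempered_const_zero tempered_const_zero, of 0 0] by simp
    moreover have "T (?u n) h = of_real (1 / real (Suc n)) * T (U (w n)) h" for n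
      using lin[OF U tempered_const_zero, of "of_real (1 / real (Suc n))" "w n" 0] by simp
    ultimately have "(\<lambda>n. of_real (1 / real (Suc n)) * T (U (w n)) h) \<longlonglongrightarrow> 0" by simp
    then have "\<exists>n. norm (of_real (1 / real (Suc n)) * T (U (w n)) h) < 1"
      unfolding LIMSEQ_iff by (metis diff_zero zero_less_one order_refl)
    then obtain n where "norm (of_real (1 / real (Suc n)) * T (U (w n)) h) < 1" by blast
    then have "norm (T (U (w n)) h) < real (Suc n)"
      by (simp add: norm_divide norm_of_nat divide_less_eq del: of_nat_Suc)
    with w[of n] show False by simp
  qed
  then obtain B where B: "\<And>w. norm (T (U w) h) \<le> B" by blast
  obtain s :: "nat \<Rightarrow> 'w \<Rightarrow> 'w" where s: "\<And>n. finite (range (s n))" "\<And>w. (\<lambda>n. s n w) \<longlonglongrightarrow> w"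
    "\<And>n v. s n -` {v} \<in> sets M" "\<And>n. s n \<in> borel_measurable M" by (rule simple_approx) (rule that)
  let ?us = "\<lambda>n g. \<Sum>v\<in>range (s n). complex_of_real (measure M (s n -` {v})) * U v g"
  have sumT: "tempered (?us n) \<and> (\<forall>h. schwartz h \<longrightarrow> T (?us n) h = (\<Sum>v\<in>range (s n). complex_of_real (measure M (s n -` {v})) * T (U v) h))" for n
    by (rule cont_lin_op_sum[OF T s(1) U])
  have "(\<lambda>n. T (?us n) h) \<longlonglongrightarrow> T u h"
  proof (rule seq)
    show "tempered (?us n)" for n using sumT[of n] by blast
    fix g assume g: "schwartz (g::'a \<Rightarrow> complex)"
    obtain B where B: "\<And>w. norm (U w g) \<le> B" using b[OF g] by blast
    show "(\<lambda>n. ?us n g) \<longlonglongrightarrow> u g"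
      unfolding eq[OF g] using integral_simple_tendsto[OF s(1-3) c[OF g] B]
      by (simp add: integral_finite_range(1)[OF s(1,3), of "\<lambda>v. U v g"])
  qed (rule u)
  moreover have "T (?us n) h = (\<integral>w. T (U (s n w)) h \<partial>M)" for n
    using sumT[of n] h integral_finite_range(1)[OF s(1,3), of "\<lambda>v. T (U v) h" n] by simp
  ultimately have "(\<lambda>n. \<integral>w. T (U (s n w)) h \<partial>M) \<longlonglongrightarrow> T u h" by simp
  moreover have "(\<lambda>n. \<integral>w. T (U (s n w)) h \<partial>M) \<longlonglongrightarrow> (\<integral>w. T (U w) h \<partial>M)"
    by (rule integral_simple_tendsto[OF s(1-3) cont B])
  ultimately show "T u h = (\<integral>w. T (U w) h \<partial>M)" by (rule LIMSEQ_unique)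
qed

section \<open>Embedded functions and time-frequency families\<close>

lemma schwartz_seminorm_ge:
  fixes f :: "'a::euclidean_space \<Rightarrow> complex"
  assumes f: "schwartz f"
  shows "norm (f x) \<le> schwartz_seminorm k f / pw x ^ k"
proof -
  have "pw x ^ k * norm (f x) \<le> (SUP x. (1 + norm x) ^ k * norm (iter_pdiff [] f x))"
    unfolding pw_def using cSUP_upper[OF _ schwartz_bdd[OF f, of "[]" k], of x] by simp
  also have "\<dots> \<le> schwartz_seminorm k f"
    unfolding schwartz_seminorm_def
  proof (rule member_le_sum[where i="[]" and f="\<lambda>bs. SUP x. (1 + norm x) ^ k * norm (iter_pdiff bs f x)"])
    show "finite {bs::'a list. set bs \<subseteq> Basis \<and> length bs \<le> k}" by (rule finite_lists_length_le) simp
    fix bs :: "'a list" assume "bs \<in> {bs. set bs \<subseteq> Basis \<and> length bs \<le> k} - {[]}"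
    then have "set bs \<subseteq> Basis" by auto
    from schwartz_bdd[OF f this] show "0 \<le> (SUP x. (1 + norm x) ^ k * norm (iter_pdiff bs f x))"
      by (intro order_trans[OF _ cSUP_upper[of 0 UNIV "\<lambda>x. (1 + norm x) ^ k * norm (iter_pdiff bs f x)"]]) auto
  qed auto
  finally show ?thesis by (simp add: pos_le_divide_eq mult.commute)
qed

lemma emb_tempered:
  fixes F :: "'a::euclidean_space \<Rightarrow> complex"
  assumes c: "continuous_on UNIV F" and b: "\<And>x. norm (F x) \<le> B"
  shows "tempered (emb F)"
  unfolding tempered_def
proof (intro conjI allI impI)
  have B: "B \<ge> 0" by (rule order_trans[OF _ b[of 0]]) simp
  have i: "integrable lborel (\<lambda>x. F x * f x)" if f: "schwartz f" for f
  proof (rule Bochner_Integration.integrable_bound)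
    show "integrable lborel (\<lambda>x. B * norm (f x))" using schwartz_integrable[OF f] by auto
    show "(\<lambda>x. F x * f x) \<in> borel_measurable lborel"
      unfolding measurable_lborel2 by (intro borel_measurable_continuous_onI continuous_intros c schwartz_cont f)
    show "AE x in lborel. norm (F x * f x) \<le> norm (B * norm (f x))"
      using b B by (auto simp: norm_mult intro!: mult_right_mono)
  qed
  fix f g :: "'a \<Rightarrow> complex" and a b' assume "schwartz f" "schwartz g"
  from i[OF this(1)] i[OF this(2)] have "(\<integral>x. a * (F x * f x) + b' * (F x * g x) \<partial>lborel) = a * emb F f + b' * emb F g"
    unfolding emb_def by simp
  then show "emb F (\<lambda>x. a * f x + b' * g x) = a * emb F f + b' * emb F g"
    unfolding emb_def by (simp add: algebra_simps)
next
  let ?D = "DIM('a) + 2"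
  have "norm (emb F f) \<le> (B * pw_int TYPE('a)) * schwartz_seminorm ?D f" if f: "schwartz f" for f
  proof -
    have B: "B \<ge> 0" by (rule order_trans[OF _ b[of 0]]) simp
    have "norm (emb F f) \<le> B * schwartz_seminorm ?D f * pw_int TYPE('a)"
      unfolding emb_def
    proof (rule integral_bound_pw)
      fix x
      have "norm (F x * f x) \<le> B * (schwartz_seminorm ?D f / pw x ^ ?D)"
        unfolding norm_mult by (intro mult_mono b schwartz_seminorm_ge f B) auto
      then show "norm (F x * f x) \<le> B * schwartz_seminorm ?D f / pw x ^ ?D" by simp
    qed
    then show ?thesis by (simp only: mult_ac)
  qed
  then show "\<exists>C m. \<forall>f. schwartz f \<longrightarrow> norm (emb F f) \<le> C * schwartz_seminorm m f" by blast
qed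

text \<open>A finite measure equivalent to Lebesgue measure. Integrands are multiplied by the
  inverse density, which rapidly decaying coefficients tolerate, and become bounded integrands for a
  finite measure.\<close>

definition pw_measure :: "'w::euclidean_space measure" where
  "pw_measure = density lborel (\<lambda>w. ennreal (1 / pw w ^ (DIM('w) + 2)))"

lemma pw_weight_measurable: "(\<lambda>w::'w::euclidean_space. 1 / pw w ^ k) \<in> borel_measurable borel"
  by (intro borel_measurable_continuous_onI continuous_intros) auto

lemma finite_borel_pw_measure: "finite_borel (pw_measure :: 'w::euclidean_space measure)"
proof -
  have "emeasure (pw_measure :: 'w measure) UNIV = (\<integral>\<^sup>+(w::'w). ennreal (1 / pw w ^ (DIM('w) + 2)) \<partial>lborel)"
    unfolding pw_measure_def using pw_weight_measurable by (subst emeasure_density) (auto simp del: add_2_eq_Suc')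
  also have "\<dots> = ennreal (pw_int TYPE('w))"
    unfolding pw_int_def by (intro nn_integral_eq_integral integrable_pw) auto
  finally have "finite_measure (pw_measure :: 'w measure)"
    by (intro finite_measureI) (simp add: pw_measure_def)
  then show ?thesis
    by (simp add: finite_borel_def finite_borel_axioms_def pw_measure_def)
qed

interpretation pwm: finite_borel "pw_measure :: 'w::euclidean_space measure"
  by (rule finite_borel_pw_measure)

lemma integral_pw_measure:
  fixes f :: "'w::euclidean_space \<Rightarrow> complex"
  assumes "f \<in> borel_measurable borel"
  shows "(\<integral>w. of_real (pw w ^ (DIM('w) + 2)) * f w \<partial>pw_measure) = (\<integral>w. f w \<partial>lborel)"
proof -
  have m: "(\<lambda>w::'w. of_real (pw w ^ (DIM('w) + 2)) :: complex) \<in> borel_measurable borel"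
    by (intro borel_measurable_continuous_onI continuous_intros)
  have "(\<integral>w. of_real (pw w ^ (DIM('w) + 2)) * f w \<partial>pw_measure)
      = (\<integral>w. (1 / pw w ^ (DIM('w) + 2)) *\<^sub>R (of_real (pw w ^ (DIM('w) + 2)) * f w) \<partial>lborel)"
    unfolding pw_measure_def using pw_weight_measurable m assms
    by (intro integral_density) (auto simp del: add_2_eq_Suc')
  also have "\<dots> = (\<integral>w. f w \<partial>lborel)"
    by (intro Bochner_Integration.integral_cong refl) (simp add: scaleR_conv_of_real del: add_2_eq_Suc' of_real_power)
  finally show ?thesis .
qed

abbreviation jcont :: "('w::euclidean_space \<Rightarrow> 'a::euclidean_space \<Rightarrow> complex) \<Rightarrow> bool" where
  "jcont F \<equiv> continuous_on UNIV (\<lambda>z. F (fst z) (snd z))"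

text \<open>In every Schwartz seminorm a time-frequency shift grows polynomially in its parameter;
  coefficients that beat all powers turn this into uniform bounds. The map \<open>zz\<close> is left
  free so that pure modulations and shifts with reflected frequency are included.\<close>

lemma tf_family:
  fixes \<gamma> :: "real^'d \<Rightarrow> complex" and zz :: "'w::euclidean_space \<Rightarrow> (real^'d) \<times> (real^'d)"
  assumes \<gamma>: "schwartz \<gamma>" and zz: "continuous_on UNIV zz" "\<And>w. norm (zz w) \<le> norm w"
    and \<kappa>: "continuous_on UNIV \<kappa>" "\<And>k. \<exists>C. \<forall>w. norm (\<kappa> w :: complex) \<le> C / pw w ^ k"
  shows "all_derivs jrapid (\<lambda>w x. \<kappa> w * tfshift (zz w) \<gamma> x)"
proof -
  \<comment> \<open>\<open>jrapid\<close> demands joint continuity of all derivatives, so it is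
    built into both auxiliary classes.\<close>
  let ?jO = "\<lambda>F :: 'w \<Rightarrow> real^'d \<Rightarrow> complex. jcont F \<and> polyg norm F"
  let ?jR = "\<lambda>F :: 'w \<Rightarrow> real^'d \<Rightarrow> complex. jcont F \<and> rapid (\<lambda>_. 0) norm F"
  have nf: "norm (fst (zz w)) \<le> norm w" "norm (snd (zz w)) \<le> norm w" for w
    using order_trans[OF norm_fst_le[of "fst (zz w)" "snd (zz w)"], of "norm w"]
      order_trans[OF norm_snd_le[of "snd (zz w)" "fst (zz w)"], of "norm w"] zz(2)[of w] by auto
  have zc: "continuous_on UNIV (\<lambda>p::'w \<times> (real^'d). zz (fst p))"
    by (rule continuous_on_compose2[OF zz(1)]) (auto intro!: continuous_intros)
  have E: "all_derivs ?jO (\<lambda>w x. exp (\<i> * of_real (x \<bullet> snd (zz w))))"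
  proof (rule all_derivs_exp)
    show "?jO (\<lambda>i x. exp (\<i> * of_real (x \<bullet> snd (zz i))))"
      by (intro conjI polyg_exp continuous_intros zc)
    show "?jO (\<lambda>i x. of_real (b \<bullet> snd (zz i)))" for b
      using nf by (intro conjI polyg_inner_const continuous_intros zc) auto
  qed (auto intro: polyg_add polyg_mult polyg_const intro!: continuous_intros)
  have G: "all_derivs ?jR (\<lambda>w x. \<gamma> (x - fst (zz w)))"
    using \<gamma>[unfolded schwartz_iff]
  proof (rule all_derivs_map[where H="\<lambda>G w x. G () (x - fst (zz w))"])
    fix G :: "unit \<Rightarrow> real^'d \<Rightarrow> complex" assume R: "rapid (\<lambda>_. 0) (\<lambda>_. 0) G"
    then have c: "continuous_on UNIV (G ())" unfolding rapid_def by blast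
    have jc: "jcont (\<lambda>w x. G () (x - fst (zz w)))"
      by (rule continuous_on_compose2[OF c]) (auto intro!: continuous_intros zc)
    have "\<exists>C M. \<forall>w x. pw (0::real) ^ m * pw x ^ k * norm (G () (x - fst (zz w))) \<le> C * pw (norm w) ^ M" for k m
    proof -
      have "\<exists>C. \<forall>i x. pw x ^ k * norm (G i x) \<le> C" using R unfolding rapid_0_iff by blast
      then obtain C where C: "\<And>x. pw x ^ k * norm (G () x) \<le> C" by auto
      have "pw (0::real) ^ m * pw x ^ k * norm (G () (x - fst (zz w))) \<le> C * pw (norm w) ^ k" for w x
      proof -
        have "pw x \<le> pw (x - fst (zz w)) * pw (fst (zz w))" using pw_add[of "x - fst (zz w)" "fst (zz w)"] by simp
        also have "\<dots> \<le> pw (x - fst (zz w)) * pw (norm w)" using nf[of w] by (intro mult_left_mono) (auto simp: pw_def)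
        finally have "pw x ^ k \<le> (pw (x - fst (zz w)) * pw (norm w)) ^ k" by (rule power_mono) simp
        then have "pw x ^ k * norm (G () (x - fst (zz w))) \<le> (pw (x - fst (zz w)) ^ k * norm (G () (x - fst (zz w)))) * pw (norm w) ^ k"
          using mult_right_mono[OF _ norm_ge_zero[of "G () (x - fst (zz w))"]] by (fastforce simp: power_mult_distrib mult_ac)
        also have "\<dots> \<le> C * pw (norm w) ^ k" by (intro mult_right_mono C) auto
        finally show ?thesis by simp
      qed
      then show ?thesis by (intro exI allI)
    qed
    with jc show "?jR (\<lambda>w x. G () (x - fst (zz w)))"
      unfolding rapid_def by (intro conjI allI continuous_on_slice(1)[OF jc])
  qed (auto intro: has_pd_shift)
  have "all_derivs ?jR (\<lambda>w x. \<gamma> (x - fst (zz w)) * exp (\<i> * of_real (x \<bullet> snd (zz w))))"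
    by (rule all_derivs_mult[OF G E]) (auto intro: rapid_add rapid_polyg intro!: continuous_intros)
  then have "all_derivs jrapid (\<lambda>w x. \<kappa> w * (\<gamma> (x - fst (zz w)) * exp (\<i> * of_real (x \<bullet> snd (zz w)))))"
  proof (rule all_derivs_map[where H="\<lambda>F w x. \<kappa> w * F w x"])
    fix F :: "'w \<Rightarrow> real^'d \<Rightarrow> complex" assume F: "?jR F"
    have "\<exists>C. \<forall>w x. pw x ^ k * norm (\<kappa> w * F w x) \<le> C" for k
    proof -
      have "\<exists>C M. \<forall>w x. pw (0::real) ^ 0 * pw x ^ k * norm (F w x) \<le> C * pw (norm w) ^ M"
        using F unfolding rapid_def by blast
      then obtain C M where C: "\<And>w x. pw x ^ k * norm (F w x) \<le> C * pw (norm w) ^ M" by auto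
      obtain C' where C': "\<And>w. norm (\<kappa> w) \<le> C' / pw w ^ M" using \<kappa>(2) by metis
      have "pw x ^ k * norm (\<kappa> w * F w x) \<le> C' * C" for w x
      proof -
        have "norm (\<kappa> w) * (pw x ^ k * norm (F w x)) \<le> (C' / pw w ^ M) * (C * pw (norm w) ^ M)"
          by (intro mult_mono C C' order_trans[OF norm_ge_zero C']) auto
        then show ?thesis by (simp add: norm_mult mult_ac pw_def[of "norm w"] pw_def[symmetric])
      qed
      then show ?thesis by blast
    qed
    moreover have "jcont (\<lambda>w x. \<kappa> w * F w x)"
      using F by (intro continuous_on_mult continuous_on_compose2[OF \<kappa>(1)]) (auto intro!: continuous_intros)
    ultimately show "jrapid (\<lambda>w x. \<kappa> w * F w x)" by (simp add: jrapid_def)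
  qed (auto intro: has_pd_cmult)
  then show ?thesis unfolding tfshift_def by (simp only: mult.commute mult.left_commute)
qed

text \<open>The factor (2 pi)^d times the squared L^2 norm of the window, by which Gabor analysis
  followed by synthesis multiplies a function.\<close>

definition window_const :: "(real^'d \<Rightarrow> complex) \<Rightarrow> real" where
  "window_const g = (2 * pi) ^ CARD('d) * (\<integral>x. (norm (g x))\<^sup>2 \<partial>lborel)"

section \<open>Gabor expansions of distributions and of operator images\<close>

lemma cnj_tfshift: "cnj (tfshift w g x) = tfshift (fst w, - snd w) (\<lambda>x. cnj (g x)) x"
  by (simp add: tfshift_def exp_cnj)

lemma stft_weighted_bound:
  fixes f g :: "real^'d \<Rightarrow> complex"
  assumes "schwartz f" "schwartz g"
  shows "\<exists>C. \<forall>z. norm (of_real (pw z ^ l) * stft g f z) \<le> C / pw z ^ k"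
proof -
  obtain C where C: "\<And>z. norm (stft g f z) \<le> C / pw z ^ (l + k)" using stft_bound[OF assms] by metis
  have "norm (of_real (pw z ^ l) * stft g f z) \<le> C / pw z ^ k" for z
  proof -
    have "norm (of_real (pw z ^ l) * stft g f z) = pw z ^ l * norm (stft g f z)"
      unfolding norm_mult norm_of_real by simp
    also have "\<dots> \<le> pw z ^ l * (C / pw z ^ (l + k))" by (intro mult_left_mono C) auto
    finally show ?thesis by (simp add: power_add)
  qed
  then show ?thesis by blast
qed

lemma tfshift_schwartz:
  fixes g :: "real^'d \<Rightarrow> complex"
  assumes g: "schwartz g" shows "schwartz (tfshift z g)"
proof -
  let ?E = "\<lambda>(_::unit) x. exp (\<i> * of_real (x \<bullet> snd z)) :: complex"
  have "uschwartz (\<lambda>(_::unit) x. g (x - fst z))"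
    using g[unfolded schwartz_iff]
  proof (rule all_derivs_map[where H="\<lambda>G i x. G i (x - fst z)"])
    fix G :: "unit \<Rightarrow> real^'d \<Rightarrow> complex" assume R: "rapid (\<lambda>_. 0) (\<lambda>_. 0) G"
    have c: "continuous_on UNIV (\<lambda>x. G i (x - fst z))" for i
      by (rule continuous_on_compose2[of UNIV "G i"]) (use R in \<open>auto simp: rapid_def intro!: continuous_intros\<close>)
    have "\<exists>C. \<forall>i x. pw x ^ k * norm (G i (x - fst z)) \<le> C" for k
    proof -
      obtain C where C: "\<And>i x. pw x ^ k * norm (G i x) \<le> C" using R unfolding rapid_0_iff by metis
      have "pw x ^ k * norm (G i (x - fst z)) \<le> C * pw (fst z) ^ k" for i x
      proof -
        have "pw x ^ k \<le> (pw (x - fst z) * pw (fst z)) ^ k"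
          using pw_add[of "x - fst z" "fst z"] by (intro power_mono) auto
        then have "pw x ^ k * norm (G i (x - fst z)) \<le> (pw (x - fst z) * pw (fst z)) ^ k * norm (G i (x - fst z))"
          by (rule mult_right_mono) simp
        also have "\<dots> = (pw (x - fst z) ^ k * norm (G i (x - fst z))) * pw (fst z) ^ k"
          by (simp add: power_mult_distrib mult_ac)
        also have "\<dots> \<le> C * pw (fst z) ^ k" by (intro mult_right_mono C) auto
        finally show ?thesis .
      qed
      then show ?thesis by blast
    qed
    with c show "rapid (\<lambda>_. 0) (\<lambda>_. 0) (\<lambda>i x. G i (x - fst z))" unfolding rapid_0_iff by blast
  qed (auto intro: has_pd_shift)
  moreover have "all_derivs (polyg (\<lambda>_. norm (snd z))) ?E" by (rule all_derivs_polyg_exp) simp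
  then have "all_derivs (polyg (\<lambda>_. 0)) ?E"
  proof (rule all_derivs_mono)
    fix F :: "unit \<Rightarrow> real^'d \<Rightarrow> complex" assume P: "polyg (\<lambda>_. norm (snd z)) F"
    then obtain C M where "\<And>i x. norm (F i x) \<le> C * pw (norm (snd z)) ^ M * pw x ^ M" unfolding polyg_def by metis
    then have "\<forall>i x. norm (F i x) \<le> (C * pw (norm (snd z)) ^ M) * pw (0::real) ^ M * pw x ^ M" by simp
    then have "\<exists>C M. \<forall>i x. norm (F i x) \<le> C * pw (0::real) ^ M * pw x ^ M" by blast
    with P show "polyg (\<lambda>_. 0) F" unfolding polyg_def by blast
  qed
  ultimately have "uschwartz (\<lambda>(_::unit) x. g (x - fst z) * exp (\<i> * of_real (x \<bullet> snd z)))"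
    by (rule all_derivs_rapid_polyg)
  then show ?thesis unfolding schwartz_iff tfshift_def by (simp add: mult.commute)
qed

lemma pw_norm [simp]: "pw (norm x) = pw x"
  by (simp add: pw_def)

text \<open>Reconstruction is applied to the conjugate of \<open>h\<close> and conjugated back,
  because \<open>pairing\<close> conjugates its second argument; then \<open>u\<close> is moved
  under the integral.\<close>

lemma tempered_expand:
  fixes g h :: "real^'d \<Rightarrow> complex"
  assumes u: "tempered u" and g: "schwartz g" and h: "schwartz h"
  shows "of_real (window_const g) * u h = (\<integral>w. cnj (stft g (\<lambda>x. cnj (h x)) w) * pairing u (tfshift w g) \<partial>lborel)"
proof -
  let ?k = "DIM((real^'d) \<times> (real^'d)) + 2"
  let ?h = "\<lambda>x. cnj (h x)"
  have sh: "schwartz ?h" "schwartz (\<lambda>x. cnj (g x))" using h g by (auto intro: schwartz_cnj)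
  \<comment> \<open>The power of \<open>pw w\<close> cancels the density of
    \<open>pw_measure\<close>.\<close>
  let ?\<kappa> = "\<lambda>w. of_real (pw w ^ ?k) * cnj (stft g ?h w)"
  let ?t = "\<lambda>w x. tfshift (fst w, - snd w) (\<lambda>x. cnj (g x)) x"
  let ?F = "\<lambda>w x. ?\<kappa> w * ?t w x"
  have Vc: "continuous_on UNIV (stft g ?h)" by (intro stft_continuous schwartz_integrable sh g)
  have fam: "all_derivs jrapid ?F"
  proof (rule tf_family)
    show "continuous_on UNIV ?\<kappa>" by (intro continuous_intros Vc)
    show "\<exists>C. \<forall>w. norm (?\<kappa> w) \<le> C / pw w ^ k" for k
    proof -
      have "norm (?\<kappa> w) = norm (of_real (pw w ^ ?k) * stft g ?h w)" for w by (simp only: norm_mult complex_mod_cnj)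
      then show ?thesis using stft_weighted_bound[OF sh(1) g, of ?k k] by simp
    qed
  qed (auto intro!: sh continuous_intros simp: norm_prod_def)
  note ti = pwm.tempered_integral[OF fam u]
  have ts: "schwartz (?t w)" for w by (rule tfshift_schwartz[OF sh(2)])
  have uF: "u (?F w) = of_real (pw w ^ ?k) * (cnj (stft g ?h w) * pairing u (tfshift w g))" for w
    unfolding tempered_cmult[OF u ts] pairing_def cnj_tfshift by (simp only: mult.assoc)
  \<comment> \<open>Measurability is read off from the continuity of \<open>u (?F w)\<close>,
    divided by a weight without zeros.\<close>
  have m: "(\<lambda>w. cnj (stft g ?h w) * pairing u (tfshift w g)) \<in> borel_measurable borel"
  proof -
    have "continuous_on UNIV (\<lambda>w. u (?F w) / of_real (pw w ^ ?k))"
      by (intro continuous_intros ti(1)) auto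
    also have "(\<lambda>w. u (?F w) / of_real (pw w ^ ?k)) = (\<lambda>w. cnj (stft g ?h w) * pairing u (tfshift w g))"
      unfolding uF by (rule ext) (simp del: of_real_power)
    finally show ?thesis by (rule borel_measurable_continuous_onI)
  qed
  have "(\<integral>w. ?F w x \<partial>pw_measure) = of_real (window_const g) * h x" for x
  proof -
    have tc: "continuous_on UNIV (\<lambda>w. tfshift w g x)"
      by (rule continuous_on_slice(2)[OF continuous_on_tfshift[OF schwartz_cont[OF g]]])
    have "(\<integral>w. ?F w x \<partial>pw_measure) = (\<integral>w. cnj (stft g ?h w) * cnj (tfshift w g x) \<partial>lborel)"
      unfolding cnj_tfshift[symmetric] mult.assoc
      by (rule integral_pw_measure) (intro borel_measurable_continuous_onI continuous_intros Vc tc)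
    also have "\<dots> = cnj (\<integral>w. stft g ?h w * tfshift w g x \<partial>lborel)"
      unfolding complex_cnj_mult[symmetric] by (rule Bochner_Integration.integral_cnj)
    also have "\<dots> = of_real (window_const g) * h x"
      unfolding stft_reconstruct[OF sh(1) g] by (simp add: window_const_def)
    finally show ?thesis .
  qed
  then have "of_real (window_const g) * u h = u (\<lambda>x. \<integral>w. ?F w x \<partial>pw_measure)"
    by (simp add: tempered_cmult[OF u h])
  also have "\<dots> = (\<integral>w. u (?F w) \<partial>pw_measure)" by (rule ti(3))
  also have "\<dots> = (\<integral>w. cnj (stft g ?h w) * pairing u (tfshift w g) \<partial>lborel)"
    unfolding uF by (rule integral_pw_measure[OF m])
  finally show ?thesis .
qed

lemma tfshift_tempered:
  assumes "schwartz g" shows "tempered (emb (tfshift z g))"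
proof -
  obtain B where B: "\<And>x. norm (g x) \<le> B" using schwartz_bounded[OF assms] by metis
  show ?thesis
    by (rule emb_tempered[OF continuous_on_slice(1)[OF continuous_on_tfshift[OF schwartz_cont[OF assms]]], where B=B])
       (simp add: norm_tfshift B)
qed

lemma schwartz_tempered:
  assumes "schwartz f" shows "tempered (emb f)"
proof -
  obtain B where B: "\<And>x. norm (f x) \<le> B" using schwartz_bounded[OF assms] by metis
  show ?thesis by (rule emb_tempered[OF schwartz_cont[OF assms] B])
qed

text \<open>Here the input is expanded, so the family consists of distributions instead of test
  functions and the exchange concerns \<open>T\<close> itself.\<close>

lemma op_expand:
  fixes g f h :: "real^'d \<Rightarrow> complex"
  assumes T: "cont_lin_op T" and g: "schwartz g" and f: "schwartz f" and h: "schwartz h"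
  shows "of_real (window_const g) * T (emb f) h = (\<integral>z. stft g f z * T (emb (tfshift z g)) h \<partial>lborel)"
proof -
  let ?k = "DIM((real^'d) \<times> (real^'d)) + 2"
  let ?\<kappa> = "\<lambda>z. of_real (pw z ^ ?k) * stft g f z"
  \<comment> \<open>The vanishing second summands give both functionals the shape of a two-term
    combination, for which linearity of \<open>T\<close> and temperedness are stated.\<close>
  let ?U = "\<lambda>z \<phi>. ?\<kappa> z * emb (tfshift z g) \<phi> + 0 * emb f \<phi>"
  let ?u = "\<lambda>\<phi>. of_real (window_const g) * emb f \<phi> + 0 * emb f \<phi>"
  note tt = tfshift_tempered[OF g] and tf = schwartz_tempered[OF f]
  have Vc: "continuous_on UNIV (stft g f)" by (intro stft_continuous schwartz_integrable f g)
  have \<kappa>c: "continuous_on UNIV ?\<kappa>" by (intro continuous_intros Vc)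
  obtain Bg where Bg: "Bg > 0" "\<And>x. norm (g x) \<le> Bg" using schwartz_bounded[OF g] by metis
  have jc: "continuous_on UNIV (\<lambda>p. tfshift (fst p) g (snd p))" by (rule continuous_on_tfshift[OF schwartz_cont[OF g]])
  have ec: "continuous_on UNIV (\<lambda>z. emb (tfshift z g) \<phi>)" if \<phi>: "schwartz \<phi>" for \<phi>
    unfolding emb_def
  proof (rule continuous_on_integral_dominated)
    show "continuous_on UNIV (\<lambda>z. tfshift z g x * \<phi> x)" for x
      by (intro continuous_intros continuous_on_slice(2)[OF jc])
    show "(\<lambda>x. tfshift z g x * \<phi> x) \<in> borel_measurable lborel" for z
      unfolding measurable_lborel2
      by (intro borel_measurable_continuous_onI continuous_intros continuous_on_slice(1)[OF jc] schwartz_cont \<phi>)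
    show "\<exists>D. integrable lborel D \<and> (\<forall>q y. dist q p \<le> 1 \<longrightarrow> norm (tfshift q g y * \<phi> y) \<le> D y)" for p
      using schwartz_integrable[OF \<phi>] Bg
      by (intro exI[of _ "\<lambda>y. Bg * norm (\<phi> y)"]) (auto simp: norm_mult norm_tfshift intro!: mult_right_mono)
  qed
  have eb: "norm (emb (tfshift z g) \<phi>) \<le> Bg * (\<integral>x. norm (\<phi> x) \<partial>lborel)" if \<phi>: "schwartz \<phi>" for \<phi> z
  proof -
    have "norm (emb (tfshift z g) \<phi>) \<le> (\<integral>x. norm (tfshift z g x * \<phi> x) \<partial>lborel)"
      unfolding emb_def by (rule integral_norm_bound)
    also have "\<dots> \<le> (\<integral>x. Bg * norm (\<phi> x) \<partial>lborel)"
      using schwartz_integrable[OF \<phi>] Bg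
      by (intro integral_mono') (auto simp: norm_mult norm_tfshift intro!: mult_right_mono)
    finally show ?thesis by simp
  qed
  obtain C0 where C0: "\<And>z. norm (?\<kappa> z) \<le> C0 / pw z ^ 0" using stft_weighted_bound[OF f g, of ?k 0] by metis
  have ci: "continuous_on UNIV (\<lambda>w. T (?U w) h) \<and> T ?u h = (\<integral>w. T (?U w) h \<partial>pw_measure)"
  \<comment> \<open>Two conclusions of the same lemma are drawn, so each of its hypotheses is
    discharged twice.\<close>
  proof (intro conjI pwm.cont_lin_op_integral[OF T, where U="?U" and u="?u"])
    show "tempered (?U w)" for w by (rule tempered_lincomb[OF tt tf])
    then show "tempered (?U w)" for w .
    show "tempered ?u" by (rule tempered_lincomb[OF tf tf])
    then show "tempered ?u" .
    show 1: "continuous_on UNIV (\<lambda>w. ?U w \<phi>)" if "schwartz \<phi>" for \<phi>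
      by (intro continuous_intros \<kappa>c ec Vc that)
    then show "continuous_on UNIV (\<lambda>w. ?U w \<phi>)" if "schwartz \<phi>" for \<phi> using that by blast
    show 2: "\<exists>B. \<forall>w. norm (?U w \<phi>) \<le> B" if "schwartz \<phi>" for \<phi>
    proof -
      have "norm (?U w \<phi>) \<le> C0 * (Bg * (\<integral>x. norm (\<phi> x) \<partial>lborel))" for w
      proof -
        have "norm (?\<kappa> w) * norm (emb (tfshift w g) \<phi>) \<le> C0 * (Bg * (\<integral>x. norm (\<phi> x) \<partial>lborel))"
          using C0[of w] by (intro mult_mono eb[OF that] order_trans[OF norm_ge_zero C0[of w, unfolded power_0 div_by_1]]) auto
        then show ?thesis by (simp add: norm_mult)
      qed
      then show ?thesis by blast
    qed
    then show "\<exists>B. \<forall>w. norm (?U w \<phi>) \<le> B" if "schwartz \<phi>" for \<phi> using that by blast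
    show 3: "?u \<phi> = (\<integral>w. ?U w \<phi> \<partial>pw_measure)" if \<phi>: "schwartz \<phi>" for \<phi>
    proof -
      have int: "integrable lborel (\<lambda>p. stft g f (fst p) * (tfshift (fst p) g (snd p) * \<phi> (snd p)))"
      proof (rule Bochner_Integration.integrable_bound)
        show "integrable lborel (\<lambda>p. (stft g f (fst p) * of_real Bg) * \<phi> (snd p))"
          by (intro integrable_lborel_prod schwartz_integrable \<phi> integrable_mult_left impI stft_integrable f g)
        show "(\<lambda>p. stft g f (fst p) * (tfshift (fst p) g (snd p) * \<phi> (snd p))) \<in> borel_measurable lborel"
          unfolding measurable_lborel2
          by (intro borel_measurable_continuous_onI continuous_on_mult continuous_on_compose2[OF Vc] jc
                continuous_on_compose2[OF schwartz_cont[OF \<phi>]] continuous_on_fst continuous_on_snd continuous_on_id) auto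
        show "AE p in lborel. norm (stft g f (fst p) * (tfshift (fst p) g (snd p) * \<phi> (snd p))) \<le> norm ((stft g f (fst p) * of_real Bg) * \<phi> (snd p))"
          using Bg by (intro AE_I2) (auto simp: norm_mult norm_tfshift mult.assoc intro!: mult_left_mono mult_right_mono)
      qed
      have "(\<integral>w. ?U w \<phi> \<partial>pw_measure) = (\<integral>w. of_real (pw w ^ ?k) * (stft g f w * emb (tfshift w g) \<phi>) \<partial>pw_measure)"
        by (intro Bochner_Integration.integral_cong refl) (simp only: mult.assoc mult_zero_left add_0_right)
      also have "\<dots> = (\<integral>w. stft g f w * emb (tfshift w g) \<phi> \<partial>lborel)"
        by (rule integral_pw_measure) (intro borel_measurable_continuous_onI continuous_intros Vc ec \<phi>)
      also have "\<dots> = (\<integral>w. (\<integral>x. stft g f w * (tfshift w g x * \<phi> x) \<partial>lborel) \<partial>lborel)"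
        unfolding emb_def by (simp only: integral_mult_right_zero)
      also have "\<dots> = (\<integral>x. (\<integral>w. stft g f w * (tfshift w g x * \<phi> x) \<partial>lborel) \<partial>lborel)"
        by (rule lborel_Fubini(3)[OF int])
      also have "\<dots> = (\<integral>x. of_real (window_const g) * (f x * \<phi> x) \<partial>lborel)"
        unfolding mult.assoc[symmetric] integral_mult_left_zero stft_reconstruct[OF f g] window_const_def ..
      also have "\<dots> = ?u \<phi>" unfolding emb_def by (simp only: integral_mult_right_zero mult_zero_left add_0_right)
      finally show ?thesis by simp
    qed
    then show "?u \<phi> = (\<integral>w. ?U w \<phi> \<partial>pw_measure)" if "schwartz \<phi>" for \<phi> using that by blast
  qed (rule h h)+
  have lin: "T (\<lambda>\<phi>. a * v \<phi> + b * v' \<phi>) h = a * T v h + b * T v' h" if "tempered v" "tempered v'" for v v' a b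
    using T that h unfolding cont_lin_op_def by blast
  have TU: "T (?U w) h = of_real (pw w ^ ?k) * (stft g f w * T (emb (tfshift w g)) h)" for w
    unfolding lin[OF tt tf] by (simp only: mult.assoc mult_zero_left add_0_right)
  have m: "(\<lambda>w. stft g f w * T (emb (tfshift w g)) h) \<in> borel_measurable borel"
  proof -
    have "continuous_on UNIV (\<lambda>w. T (?U w) h / of_real (pw w ^ ?k))"
      by (intro continuous_on_divide conjunct1[OF ci] continuous_intros) auto
    also have "(\<lambda>w. T (?U w) h / of_real (pw w ^ ?k)) = (\<lambda>w. stft g f w * T (emb (tfshift w g)) h)"
      unfolding TU by (rule ext) (simp del: of_real_power)
    finally show ?thesis by (rule borel_measurable_continuous_onI)
  qed
  have "of_real (window_const g) * T (emb f) h = T ?u h" unfolding lin[OF tf tf] by simp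
  also have "\<dots> = (\<integral>w. T (?U w) h \<partial>pw_measure)" by (rule conjunct2[OF ci])
  also have "\<dots> = (\<integral>z. stft g f z * T (emb (tfshift z g)) h \<partial>lborel)"
    unfolding TU by (rule integral_pw_measure[OF m])
  finally show ?thesis .
qed

section \<open>Localized Fourier transforms of distributions\<close>

abbreviation modulated :: "(real^'d \<Rightarrow> complex) \<Rightarrow> real^'d \<Rightarrow> real^'d \<Rightarrow> complex" where
  "modulated \<phi> \<xi> \<equiv> \<lambda>x. \<phi> x * exp (- (\<i> * of_real (x \<bullet> \<xi>)))"

lemma modulated_tfshift: "modulated \<phi> \<xi> = tfshift (0, - \<xi>) \<phi>"
  by (rule ext) (simp add: tfshift_def)

lemma modulated_schwartz: "schwartz \<phi> \<Longrightarrow> schwartz (modulated \<phi> \<xi>)"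
  unfolding modulated_tfshift by (rule tfshift_schwartz)

lemma tempered_modulated_continuous:
  fixes \<phi> :: "real^'d \<Rightarrow> complex"
  assumes u: "tempered u" and \<phi>: "schwartz \<phi>"
  shows "continuous_on UNIV (\<lambda>\<xi>. u (modulated \<phi> \<xi>))"
  unfolding continuous_on_eq_continuous_at[OF open_UNIV]
proof
  fix w0 :: "real^'d"
  \<comment> \<open>Modulations alone carry no decaying coefficient. A tent of radius 2 about
    \<open>w0\<close> has compact support, where \<open>pw w\<close> is at most
    \<open>3 + norm w0\<close>, and exceeds 1 in the open unit ball about \<open>w0\<close>, where
    it is divided out again.\<close>
  let ?\<kappa> = "\<lambda>w. complex_of_real (max 0 (2 - norm (w - w0)))"
  have "all_derivs jrapid (\<lambda>w x. ?\<kappa> w * tfshift (0, - w) \<phi> x)"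
  proof (rule tf_family[OF \<phi>])
    show "\<exists>C. \<forall>w. norm (?\<kappa> w) \<le> C / pw w ^ k" for k
    proof (intro exI allI)
      fix w
      show "norm (?\<kappa> w) \<le> 2 * (3 + norm w0) ^ k / pw w ^ k"
      proof (cases "norm (w - w0) \<le> 2")
        case True
        then have "pw w \<le> 3 + norm w0" using norm_triangle_ineq[of "w - w0" w0] by (simp add: pw_def)
        then have "pw w ^ k \<le> (3 + norm w0) ^ k" by (rule power_mono) simp
        then have "2 * pw w ^ k \<le> 2 * (3 + norm w0) ^ k" by simp
        then have "2 \<le> 2 * (3 + norm w0) ^ k / pw w ^ k" by (simp add: pos_le_divide_eq)
        moreover have "norm (?\<kappa> w) \<le> 2" unfolding norm_of_real by simp
        ultimately show ?thesis by (rule order_trans[rotated])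
      qed (simp add: add_nonneg_nonneg)
    qed
  qed (auto intro!: continuous_intros simp: norm_prod_def)
  from pwm.tempered_integral(1)[OF this u]
  have "isCont (\<lambda>w. u (\<lambda>x. ?\<kappa> w * tfshift (0, - w) \<phi> x)) w0"
    by (simp add: continuous_on_eq_continuous_at)
  then have "isCont (\<lambda>w. ?\<kappa> w * u (modulated \<phi> w)) w0"
    unfolding modulated_tfshift by (simp add: tempered_cmult[OF u tfshift_schwartz[OF \<phi>]])
  moreover have "isCont ?\<kappa> w0" by (intro continuous_intros)
  ultimately have "isCont (\<lambda>w. ?\<kappa> w * u (modulated \<phi> w) / ?\<kappa> w) w0"
    by (intro continuous_divide) auto
  moreover have ev: "\<forall>\<^sub>F w in nhds w0. ?\<kappa> w * u (modulated \<phi> w) / ?\<kappa> w = u (modulated \<phi> w)"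
    unfolding eventually_nhds_metric
  proof (intro exI[of _ 1] conjI allI impI)
    fix w assume "dist w w0 < 1"
    then have "max 0 (2 - norm (w - w0)) \<noteq> 0" by (simp add: dist_norm)
    then have "?\<kappa> w \<noteq> 0" unfolding of_real_eq_0_iff .
    then show "?\<kappa> w * u (modulated \<phi> w) / ?\<kappa> w = u (modulated \<phi> w)"
      by (rule nonzero_mult_div_cancel_left)
  qed simp
  ultimately show "isCont (\<lambda>w. u (modulated \<phi> w)) w0"
    using isCont_cong[OF ev] by (simp only:)
qed

text \<open>Identifies the Fourier transform of the product of \<open>\<phi>\<close> and
  \<open>u\<close> with the function \<open>u (modulated \<phi> \<xi>)\<close> of
  \<open>\<xi>\<close>. The Fourier integral of \<open>g\<close> is a superposition of exponentials,
  and \<open>u\<close> is applied under it.\<close>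

lemma tempered_fourier_mult:
  fixes \<phi> :: "real^'d \<Rightarrow> complex"
  assumes u: "tempered u" and \<phi>: "schwartz \<phi>" and g: "schwartz g"
  shows "u (\<lambda>x. \<phi> x * fourier g x) = (\<integral>\<xi>. u (modulated \<phi> \<xi>) * g \<xi> \<partial>lborel)"
proof -
  let ?k = "DIM(real^'d) + 2"
  let ?\<kappa> = "\<lambda>\<xi>. of_real (pw \<xi> ^ ?k) * g \<xi>"
  have gc: "continuous_on UNIV g" by (rule schwartz_cont[OF g])
  have fam: "all_derivs jrapid (\<lambda>\<xi> x. ?\<kappa> \<xi> * tfshift (0, - \<xi>) \<phi> x)"
  proof (rule tf_family[OF \<phi>])
    show "continuous_on UNIV ?\<kappa>" by (intro continuous_intros gc)
    show "\<exists>C. \<forall>w. norm (?\<kappa> w) \<le> C / pw w ^ k" for k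
    proof -
      obtain C where C: "\<And>z. norm (g z) \<le> C / pw z ^ (?k + k)" using schwartz_bound[OF g] by metis
      have "norm (?\<kappa> z) \<le> C / pw z ^ k" for z
      proof -
        have "norm (?\<kappa> z) = pw z ^ ?k * norm (g z)" unfolding norm_mult norm_of_real by simp
        also have "\<dots> \<le> pw z ^ ?k * (C / pw z ^ (?k + k))" by (intro mult_left_mono C) auto
        finally show ?thesis by (simp add: power_add)
      qed
      then show ?thesis by blast
    qed
  qed (auto intro!: continuous_intros simp: norm_prod_def)
  note ti = pwm.tempered_integral[OF fam u]
  have "(\<integral>\<xi>. ?\<kappa> \<xi> * tfshift (0, - \<xi>) \<phi> x \<partial>pw_measure) = \<phi> x * fourier g x" for x
  proof -
    have "(\<integral>\<xi>. ?\<kappa> \<xi> * tfshift (0, - \<xi>) \<phi> x \<partial>pw_measure) = (\<integral>\<xi>. g \<xi> * modulated \<phi> \<xi> x \<partial>lborel)"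
      unfolding modulated_tfshift[symmetric] mult.assoc
      by (rule integral_pw_measure) (intro borel_measurable_continuous_onI continuous_intros gc)
    also have "\<dots> = (\<integral>\<xi>. \<phi> x * (exp (- (\<i> * of_real (\<xi> \<bullet> x))) * g \<xi>) \<partial>lborel)"
      by (intro Bochner_Integration.integral_cong refl) (simp add: inner_commute mult_ac)
    finally show ?thesis unfolding fourier_def by (simp only: integral_mult_right_zero)
  qed
  then have "u (\<lambda>x. \<phi> x * fourier g x) = (\<integral>\<xi>. u (\<lambda>x. ?\<kappa> \<xi> * tfshift (0, - \<xi>) \<phi> x) \<partial>pw_measure)"
    using ti(3) by simp
  also have "\<dots> = (\<integral>\<xi>. of_real (pw \<xi> ^ ?k) * (g \<xi> * u (modulated \<phi> \<xi>)) \<partial>pw_measure)"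
    by (intro Bochner_Integration.integral_cong refl)
       (simp only: tempered_cmult[OF u tfshift_schwartz[OF \<phi>]] modulated_tfshift, simp only: mult.assoc)
  also have "\<dots> = (\<integral>\<xi>. g \<xi> * u (modulated \<phi> \<xi>) \<partial>lborel)"
    by (rule integral_pw_measure) (intro borel_measurable_continuous_onI continuous_on_mult gc tempered_modulated_continuous u \<phi>)
  finally show ?thesis by (simp only: mult.commute)
qed

section \<open>Operators concentrated on the graph of a phase map\<close>

lemma linear_pw:
  fixes f :: "'a::euclidean_space \<Rightarrow> 'b::euclidean_space"
  assumes "linear f" obtains c where "c \<ge> 1" "\<And>x. pw (f x) \<le> c * pw x"
proof -
  obtain B where B: "B > 0" "\<And>x. norm (f x) \<le> B * norm x" using linear_bounded_pos[OF assms] by metis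
  have "pw (f x) \<le> (1 + B) * pw x" for x
  proof -
    have "(1 + B) * pw x = 1 + B + norm x + B * norm x" by (simp add: pw_def algebra_simps)
    then show ?thesis using B(2)[of x] B(1) norm_ge_zero[of x] unfolding pw_def by linarith
  qed
  then show ?thesis using that[of "1 + B"] B(1) by auto
qed

lemma divide_ge1_le: "0 \<le> x \<Longrightarrow> 1 \<le> p \<Longrightarrow> x / p \<le> (x::real)"
  by (simp add: divide_le_eq mult_le_cancel_left1)

text \<open>The graph of a convex power lies above its tangent at \<open>a\<close>. For positive
  arguments this is Young's inequality for \<open>t / a\<close> with second factor 1.\<close>

lemma powr_tangent:
  fixes t a p :: real
  assumes "t \<ge> 0" "a \<ge> 0" "p \<ge> 1"
  shows "a powr p + p * a powr (p - 1) * (t - a) \<le> t powr p"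
proof (cases "a = 0 \<or> t = 0")
  case True
  have "a powr (p - 1) * a = a powr p"
    by (cases "a = 0") (use assms powr_add[of a "p - 1" 1] in auto)
  then have e: "a powr p + p * a powr (p - 1) * (0 - a) = (1 - p) * a powr p" by (simp add: algebra_simps)
  have "(1 - p) * a powr p \<le> 0" using assms by (intro mult_nonpos_nonneg) auto
  with True e show ?thesis by (cases "a = 0"; cases "t = 0") auto
next
  case False
  with assms have a: "a > 0" and t: "t > 0" by auto
  define x where "x = t / a"
  have x: "x > 0" using a t by (simp add: x_def)
  have "(x powr p) powr (1 / p) * 1 powr (1 - 1 / p) \<le> (1 / p) * x powr p + (1 - 1 / p) * 1"
    by (rule Youngs_inequality_0) (use assms x in auto)
  then have "x \<le> (1 / p) * x powr p + (1 - 1 / p)" using assms x by (simp add: powr_powr)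
  then have "p * x \<le> p * ((1 / p) * x powr p + (1 - 1 / p))" using assms by (intro mult_left_mono) auto
  then have "p * x \<le> x powr p + p - 1" using assms by (simp add: distrib_left right_diff_distrib)
  then have "a powr p * (1 + p * (x - 1)) \<le> a powr p * x powr p" by (intro mult_left_mono) (auto simp: algebra_simps)
  also have "a powr p * x powr p = t powr p" using a t by (simp add: x_def powr_mult[symmetric])
  also have "a powr p * (1 + p * (x - 1)) = a powr p + p * a powr (p - 1) * (t - a)"
  proof -
    have "a powr p = a powr (p - 1) * a" using a powr_add[of a "p - 1" 1] by simp
    then show ?thesis using a by (simp add: x_def field_simps)
  qed
  finally show ?thesis .
qed

lemma integral_prod_lborel:
  fixes f :: "'a::euclidean_space \<Rightarrow> real" and h :: "'b::euclidean_space \<Rightarrow> real"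
  assumes "integrable lborel f" "integrable lborel h"
  shows "(\<integral>z. f (fst z) * h (snd z) \<partial>lborel) = (\<integral>x. f x \<partial>lborel) * (\<integral>y. h y \<partial>lborel)"
  using lborel_Fubini(1)[OF integrable_lborel_prod[OF assms], symmetric] by simp

lemma integrable_lborel_fst:
  fixes f :: "'a::euclidean_space \<Rightarrow> 'b::euclidean_space \<Rightarrow> real"
  assumes "integrable lborel (\<lambda>z. f (fst z) (snd z))"
  shows "integrable lborel (\<lambda>x. \<integral>y. f x y \<partial>lborel)"
proof -
  have "integrable (lborel \<Otimes>\<^sub>M lborel) (case_prod f)" using assms by (simp add: lborel_prod case_prod_unfold)
  then show ?thesis by (rule lborel_pair.integrable_fst)
qed

text \<open>Jensen's inequality at each point, followed by Fubini. The kernel is not normalized,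
  which produces the power of its mass \<open>I\<close>.\<close>

lemma convolution_Lp:
  fixes L :: "real^'d \<Rightarrow> real^'d" and p :: real
  assumes L: "linear L" "inj L" and p: "p \<ge> 1"
  shows "\<exists>K>0. \<forall>F::real^'d \<Rightarrow> complex. schwartz F \<longrightarrow>
     integrable lborel (\<lambda>\<xi>. (\<integral>y. norm (F y) / pw (L \<xi> - y) ^ (CARD('d) + 2) \<partial>lborel) powr p) \<and>
     (\<integral>\<xi>. (\<integral>y. norm (F y) / pw (L \<xi> - y) ^ (CARD('d) + 2) \<partial>lborel) powr p \<partial>lborel) \<le> K * (\<integral>y. norm (F y) powr p \<partial>lborel)"
proof -
  let ?D = "DIM(real^'d) + 2"
  have D: "CARD('d) + 2 = ?D" by simp
  define I where "I = pw_int TYPE(real^'d)"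
  have Ipos: "I > 0"
  proof -
    have "I \<noteq> 0"
    proof
      assume "I = 0"
      then have "AE x in lborel. 1 / pw (x::real^'d) ^ ?D = 0"
        unfolding I_def pw_int_def by (subst (asm) integral_nonneg_eq_0_iff_AE[OF integrable_pw]) auto
      then have "AE x in (lborel :: (real^'d) measure). False" by simp
      then have "AE x in (lebesgue :: (real^'d) measure). x \<in> {}" by (intro AE_completion) simp
      then have "(0::real^'d) \<in> {}" by (rule mem_closed_if_AE_lebesgue[rotated]) simp
      then show False by simp
    qed
    then show ?thesis using pw_int_nonneg[where 'a="real^'d"] unfolding I_def by linarith
  qed
  obtain \<Lambda> where \<Lambda>: "linear \<Lambda>" "\<And>x. \<Lambda> (L x) = x" "\<And>x. L (\<Lambda> x) = x"
    using linear_injective_isomorphism[OF L] by metis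
  obtain c where c: "c \<ge> 1" "\<And>x. pw (\<Lambda> x) \<le> c * pw x" using linear_pw[OF \<Lambda>(1)] by metis
  have c0: "c \<ge> 0" using c(1) by simp
  \<comment> \<open>Through the inverse \<open>\<Lambda>\<close> of \<open>L\<close> the kernel is
    compared with a translate in \<open>\<xi>\<close>, which replaces a linear change of
    variables.\<close>
  have lower: "1 / pw (L \<xi> - y) ^ ?D \<le> c ^ ?D / pw (\<xi> - \<Lambda> y) ^ ?D" for \<xi> y
  proof -
    have "\<xi> - \<Lambda> y = \<Lambda> (L \<xi> - y)" by (simp add: linear_diff[OF \<Lambda>(1)] \<Lambda>(2))
    then have "pw (\<xi> - \<Lambda> y) ^ ?D \<le> (c * pw (L \<xi> - y)) ^ ?D" by (intro power_mono) (auto simp: c(2))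
    then have "pw (\<xi> - \<Lambda> y) ^ ?D \<le> c ^ ?D * pw (L \<xi> - y) ^ ?D" by (simp only: power_mult_distrib)
    then show ?thesis by (simp add: divide_simps del: power_add add_2_eq_Suc')
  qed
  have Lc: "continuous_on UNIV L" using L(1) by (intro linear_continuous_on linear_conv_bounded_linear[THEN iffD1])
  have main: "integrable lborel (\<lambda>\<xi>. (\<integral>y. norm (F y) / pw (L \<xi> - y) ^ ?D \<partial>lborel) powr p) \<and>
     (\<integral>\<xi>. (\<integral>y. norm (F y) / pw (L \<xi> - y) ^ ?D \<partial>lborel) powr p \<partial>lborel)
       \<le> (I powr (p - 1) * (c ^ ?D * I)) * (\<integral>y. norm (F y) powr p \<partial>lborel)" if F: "schwartz F" for F :: "real^'d \<Rightarrow> complex"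
  proof -
    define U where "U \<xi> = (\<integral>y. norm (F y) / pw (L \<xi> - y) ^ ?D \<partial>lborel)" for \<xi>
    define W where "W \<xi> = (\<integral>y. norm (F y) powr p * (1 / pw (L \<xi> - y) ^ ?D) \<partial>lborel)" for \<xi>
    obtain BF where BF: "BF > 0" "\<And>y. norm (F y) \<le> BF" using schwartz_bounded[OF F] by metis
    have Fc: "continuous_on UNIV F" by (rule schwartz_cont[OF F])
    have Fpc: "continuous_on UNIV (\<lambda>y. norm (F y) powr p)"
      using p by (intro continuous_on_powr' continuous_intros Fc) auto
    have kc: "continuous_on UNIV (\<lambda>y. 1 / pw (L \<xi> - y) ^ ?D)" for \<xi> by (intro continuous_intros) auto
    have Up: "U \<xi> powr p \<le> I powr (p - 1) * W \<xi>" for \<xi>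
    proof -
      let ?k = "\<lambda>y. 1 / pw (L \<xi> - y) ^ ?D"
      have ki: "integrable lborel ?k" by (rule pw_int_shift(3)) simp
      have kI: "(\<integral>y. ?k y \<partial>lborel) = I" unfolding I_def by (rule pw_int_shift(1))
      have i1: "integrable lborel (\<lambda>y. norm (F y) * ?k y)"
        by (rule Bochner_Integration.integrable_bound[OF integrable_mult_right[of BF, OF ki]])
           (use BF in \<open>auto intro!: borel_measurable_continuous_onI continuous_intros Fc mult_right_mono divide_right_mono\<close>)
      have i2: "integrable lborel (\<lambda>y. norm (F y) powr p * ?k y)"
      proof (rule Bochner_Integration.integrable_bound[OF integrable_mult_right[of "BF powr p", OF ki]])
        show "(\<lambda>y. norm (F y) powr p * ?k y) \<in> borel_measurable lborel"
          unfolding measurable_lborel2 by (intro borel_measurable_continuous_onI continuous_on_mult Fpc kc)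
        have "norm (norm (F y) powr p * ?k y) \<le> norm (BF powr p * ?k y)" for y
          using BF p by (simp add: abs_mult powr_mono2 divide_right_mono)
        then show "AE y in lborel. norm (norm (F y) powr p * ?k y) \<le> norm (BF powr p * ?k y)" by simp
      qed
      have U: "U \<xi> = (\<integral>y. norm (F y) * ?k y \<partial>lborel)" unfolding U_def by simp
      have U0: "U \<xi> \<ge> 0" unfolding U by (intro integral_nonneg_AE) auto
      \<comment> \<open>The tangent is taken at the kernel average of \<open>norm (F y)\<close>.
        Integrated against the kernel, its linear terms cancel and Jensen's inequality
        remains.\<close>
      define a where "a = U \<xi> / I"
      have a0: "a \<ge> 0" using U0 Ipos by (simp add: a_def)
      let ?q = "a powr p - p * a powr (p - 1) * a"
      have "(\<integral>y. ?q * ?k y + p * a powr (p - 1) * (norm (F y) * ?k y) \<partial>lborel) \<le> W \<xi>"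
        unfolding W_def
      proof (rule integral_mono)
        show "integrable lborel (\<lambda>y. ?q * ?k y + p * a powr (p - 1) * (norm (F y) * ?k y))"
          using ki i1 by (intro Bochner_Integration.integrable_add integrable_mult_right) auto
        show "integrable lborel (\<lambda>y. norm (F y) powr p * ?k y)" by (rule i2)
        fix y
        have "(a powr p + p * a powr (p - 1) * (norm (F y) - a)) * ?k y \<le> norm (F y) powr p * ?k y"
          by (intro mult_right_mono powr_tangent a0 p) auto
        then show "?q * ?k y + p * a powr (p - 1) * (norm (F y) * ?k y) \<le> norm (F y) powr p * ?k y"
          by (simp only: algebra_simps)
      qed
      also have "(\<integral>y. ?q * ?k y + p * a powr (p - 1) * (norm (F y) * ?k y) \<partial>lborel) = ?q * I + p * a powr (p - 1) * U \<xi>"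
        using ki i1 by (subst Bochner_Integration.integral_add) (simp_all only: integrable_mult_right integral_mult_right_zero kI U)
      also have "\<dots> = a powr p * I" using Ipos by (simp add: a_def algebra_simps)
      finally have "a powr p * I \<le> W \<xi>" .
      moreover have "U \<xi> powr p = I powr (p - 1) * (a powr p * I)"
      proof -
        have "U \<xi> = a * I" using Ipos by (simp add: a_def)
        then have "U \<xi> powr p = a powr p * I powr p" using a0 Ipos by (simp add: powr_mult)
        also have "I powr p = I powr (p - 1) * I" using Ipos powr_add[of I "p - 1" 1] by simp
        finally show ?thesis by simp
      qed
      ultimately show ?thesis by (simp add: mult_left_mono)
    qed
    \<comment> \<open>One half of the exponent integrates over \<open>y\<close>; the other pays for
      turning decay in \<open>L \<xi> - y\<close> into decay in \<open>\<xi>\<close>.\<close>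
    obtain CF where CF: "CF > 0" "\<And>y. norm (F y) \<le> CF / pw y ^ (2 * ?D)" using schwartz_bound[OF F] by metis
    have Fp: "norm (F y) powr p \<le> CF powr p / pw y ^ (2 * ?D)" for y
    proof -
      have "norm (F y) powr p \<le> (CF / pw y ^ (2 * ?D)) powr p" using p CF by (intro powr_mono2) auto
      also have "\<dots> = CF powr p * ((1 / pw y ^ (2 * ?D)) powr p)"
        using CF by (simp add: powr_mult[symmetric] del: power_add add_2_eq_Suc')
      also have "(1 / pw y ^ (2 * ?D)) powr p \<le> (1 / pw y ^ (2 * ?D)) powr 1"
        using p by (intro powr_mono') (auto simp del: power_add add_2_eq_Suc' simp: divide_le_eq_1)
      finally show ?thesis using CF by (simp add: mult_left_mono)
    qed
    have int: "integrable lborel (\<lambda>z. norm (F (snd z)) powr p * (1 / pw (L (fst z) - snd z) ^ ?D))"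
    proof (rule Bochner_Integration.integrable_bound)
      have 1: "integrable lborel (\<lambda>\<xi>::real^'d. c ^ ?D * (1 / pw \<xi> ^ ?D))" by (intro integrable_mult_right integrable_pw) simp
      have 2: "integrable lborel (\<lambda>y::real^'d. (CF powr p * c ^ ?D) * (1 / pw y ^ ?D))" by (intro integrable_mult_right integrable_pw) simp
      show "integrable lborel (\<lambda>z::(real^'d) \<times> (real^'d). (c ^ ?D * (1 / pw (fst z) ^ ?D)) * ((CF powr p * c ^ ?D) * (1 / pw (snd z) ^ ?D)))"
        by (rule integrable_lborel_prod[OF 1 2])
      have "norm (F y) powr p * (1 / pw (L \<xi> - y) ^ ?D) \<le> (c ^ ?D * (1 / pw \<xi> ^ ?D)) * ((CF powr p * c ^ ?D) * (1 / pw y ^ ?D))" for \<xi> y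
      proof -
        have "pw \<xi> \<le> pw (\<xi> - \<Lambda> y) * pw (\<Lambda> y)" using pw_add[of "\<xi> - \<Lambda> y" "\<Lambda> y"] by simp
        also have "\<dots> \<le> pw (\<xi> - \<Lambda> y) * (c * pw y)" by (intro mult_left_mono c) auto
        finally have "pw \<xi> ^ ?D \<le> (pw (\<xi> - \<Lambda> y) * (c * pw y)) ^ ?D" by (rule power_mono) simp
        also have "\<dots> = pw (\<xi> - \<Lambda> y) ^ ?D * (c ^ ?D * pw y ^ ?D)" by (simp only: power_mult_distrib)
        finally have q: "c ^ ?D / pw (\<xi> - \<Lambda> y) ^ ?D \<le> c ^ ?D * ((c ^ ?D * pw y ^ ?D) / pw \<xi> ^ ?D)"
          using c(1) by (simp add: divide_simps mult_left_mono mult_ac del: power_add add_2_eq_Suc')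
        have "norm (F y) powr p * (1 / pw (L \<xi> - y) ^ ?D) \<le> (CF powr p / pw y ^ (2 * ?D)) * (c ^ ?D * ((c ^ ?D * pw y ^ ?D) / pw \<xi> ^ ?D))"
          by (intro mult_mono Fp order_trans[OF lower q]) auto
        also have "pw y ^ (2 * ?D) = pw y ^ ?D * pw y ^ ?D" by (simp only: mult_2 power_add)
        finally show ?thesis by (simp add: mult_ac del: power_add add_2_eq_Suc')
      qed
      then show "AE z in lborel. norm (norm (F (snd z)) powr p * (1 / pw (L (fst z) - snd z) ^ ?D)) \<le>
          norm ((c ^ ?D * (1 / pw (fst z) ^ ?D)) * ((CF powr p * c ^ ?D) * (1 / pw (snd z) ^ ?D)))"
        by (intro AE_I2) (simp only: real_norm_def abs_of_nonneg mult_nonneg_nonneg, smt (verit) c(1) divide_nonneg_nonneg mult_nonneg_nonneg powr_ge_zero pw_nonneg zero_le_power)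
      show "(\<lambda>z. norm (F (snd z)) powr p * (1 / pw (L (fst z) - snd z) ^ ?D)) \<in> borel_measurable lborel"
        unfolding measurable_lborel2
        by (intro borel_measurable_continuous_onI continuous_on_mult continuous_on_compose2[OF Fpc] continuous_on_snd continuous_on_id
             continuous_on_divide continuous_on_const continuous_on_power continuous_on_pw continuous_on_diff continuous_on_compose2[OF Lc] continuous_on_fst) auto
    qed
    have Wi: "integrable lborel W" unfolding W_def
      by (rule integrable_lborel_fst[OF int])
    have Wint: "(\<integral>\<xi>. W \<xi> \<partial>lborel) \<le> (c ^ ?D * I) * (\<integral>y. norm (F y) powr p \<partial>lborel)"
    proof -
      have "(\<integral>\<xi>. W \<xi> \<partial>lborel) = (\<integral>y. (\<integral>\<xi>. norm (F y) powr p * (1 / pw (L \<xi> - y) ^ ?D) \<partial>lborel) \<partial>lborel)"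
        unfolding W_def by (rule lborel_Fubini(3)[OF int])
      also have "\<dots> = (\<integral>y. norm (F y) powr p * (\<integral>\<xi>. 1 / pw (L \<xi> - y) ^ ?D \<partial>lborel) \<partial>lborel)"
        by (simp only: integral_mult_right_zero)
      also have "\<dots> \<le> (\<integral>y. norm (F y) powr p * (c ^ ?D * I) \<partial>lborel)"
      proof (rule integral_mono')
        have "integrable lborel (\<lambda>y. norm (F y) powr p)"
        proof (rule integrable_bound_pw[where k="2 * ?D"])
          show "norm (norm (F y) powr p) \<le> CF powr p / pw y ^ (2 * ?D)" for y using Fp[of y] by simp
        qed (use Fpc in \<open>auto intro: borel_measurable_continuous_onI\<close>)
        then show "integrable lborel (\<lambda>y. norm (F y) powr p * (c ^ ?D * I))" by simp
        fix y :: "real^'d"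
        have "(\<integral>\<xi>. 1 / pw (L \<xi> - y) ^ ?D \<partial>lborel) \<le> (\<integral>\<xi>. c ^ ?D * (1 / pw (\<xi> - \<Lambda> y) ^ ?D) \<partial>lborel)"
          using lower[of _ y] c0 by (intro integral_mono' integrable_mult_right pw_int_shift(4)) auto
        also have "\<dots> = c ^ ?D * I" unfolding integral_mult_right_zero pw_int_shift(2) I_def ..
        finally show "norm (F y) powr p * (\<integral>\<xi>. 1 / pw (L \<xi> - y) ^ ?D \<partial>lborel) \<le> norm (F y) powr p * (c ^ ?D * I)"
          by (intro mult_left_mono) auto
        show "0 \<le> norm (F y) powr p * (c ^ ?D * I)" using c(1) Ipos by simp
      qed
      finally show ?thesis by (simp add: mult.commute)
    qed
    have Uc: "continuous_on UNIV U" unfolding U_def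
    proof (rule continuous_on_integral_dominated)
      show "continuous_on UNIV (\<lambda>\<xi>. norm (F y) / pw (L \<xi> - y) ^ ?D)" for y
        by (intro continuous_intros Lc) auto
      show "(\<lambda>y. norm (F y) / pw (L \<xi> - y) ^ ?D) \<in> borel_measurable lborel" for \<xi>
        unfolding measurable_lborel2 by (intro borel_measurable_continuous_onI continuous_intros Fc) auto
      show "\<exists>Q. integrable lborel Q \<and> (\<forall>q y. dist q x \<le> 1 \<longrightarrow> norm (norm (F y) / pw (L q - y) ^ ?D) \<le> Q y)" for x
        using schwartz_integrable[OF F]
        by (intro exI[of _ "\<lambda>y. norm (F y)"]) (auto intro!: divide_ge1_le simp del: power_add add_2_eq_Suc')
    qed
    have U0: "U \<xi> \<ge> 0" for \<xi> unfolding U_def by (intro integral_nonneg_AE) auto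
    have iU: "integrable lborel (\<lambda>\<xi>. U \<xi> powr p)"
    proof (rule Bochner_Integration.integrable_bound)
      show "integrable lborel (\<lambda>\<xi>. I powr (p - 1) * W \<xi>)" using Wi by simp
      show "(\<lambda>\<xi>. U \<xi> powr p) \<in> borel_measurable lborel"
        using borel_measurable_continuous_onI[OF Uc] by simp
      show "AE \<xi> in lborel. norm (U \<xi> powr p) \<le> norm (I powr (p - 1) * W \<xi>)"
        using Up by (intro AE_I2) (auto intro: order_trans[OF _ abs_ge_self])
    qed
    have "(\<integral>\<xi>. U \<xi> powr p \<partial>lborel) \<le> (\<integral>\<xi>. I powr (p - 1) * W \<xi> \<partial>lborel)"
      using iU Wi Up by (intro integral_mono) auto
    also have "\<dots> \<le> I powr (p - 1) * ((c ^ ?D * I) * (\<integral>y. norm (F y) powr p \<partial>lborel))"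
      using Wint by (simp add: mult_left_mono)
    finally show ?thesis using iU unfolding U_def by (simp add: mult.assoc)
  qed
  show ?thesis
    unfolding D by (rule exI[of _ "I powr (p - 1) * (c ^ ?D * I)"]) (use main Ipos c(1) in auto)
qed


section \<open>Phase maps and kernel estimates\<close>

locale fio =
  fixes T :: "((real^'d \<Rightarrow> complex) \<Rightarrow> complex) \<Rightarrow> ((real^'d \<Rightarrow> complex) \<Rightarrow> complex)"
    and g :: "real^'d \<Rightarrow> complex" and A B C D :: "real^'d^'d"
  assumes T: "cont_lin_op T" and g: "schwartz g" and g_nz: "g \<noteq> (\<lambda>_. 0)"
    and sympl: "symplectic A B C D" and detB: "det B \<noteq> 0"
    and decay: "\<forall>N::nat. \<exists>CN. \<forall>z w. norm (pairing (T (emb (tfshift z g))) (tfshift w g))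
             \<le> CN * (1 + norm (w - phase_map A B C D z)) powr (- real N)"
begin

abbreviation "Ph \<equiv> phase_map A B C D"

lemma linear_Ph: "linear Ph"
  by (rule linearI) (auto simp: phase_map_def matrix_vector_right_distrib scaleR_matrix_vector_assoc
      matrix_vector_mult_scaleR scaleR_right_distrib)

text \<open>A kernel vector is orthogonal to everything for the symplectic form, which is
  nondegenerate.\<close>

lemma inj_Ph: "inj Ph"
proof (rule linear_injective_0[OF linear_Ph, THEN iffD2], intro allI impI)
  fix z assume "Ph z = 0"
  then have s: "sympl_form z w = 0" for w
    using sympl unfolding symplectic_def by (metis (no_types) sympl_form_def inner_zero_left fst_zero snd_zero diff_zero)
  show "z = 0"
    using s[of "(0, fst z)"] s[of "(snd z, 0)"] by (auto simp: sympl_form_def prod_eq_iff)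
qed

definition Ph_inv :: "(real^'d) \<times> (real^'d) \<Rightarrow> (real^'d) \<times> (real^'d)" where
  "Ph_inv = (SOME f. linear f \<and> (\<forall>z. f (Ph z) = z) \<and> (\<forall>w. Ph (f w) = w))"

lemma Ph_inv: "linear Ph_inv" "Ph_inv (Ph z) = z" "Ph (Ph_inv w) = w"
proof -
  have "linear Ph_inv \<and> (\<forall>z. Ph_inv (Ph z) = z) \<and> (\<forall>w. Ph (Ph_inv w) = w)"
    unfolding Ph_inv_def by (rule someI_ex[of "\<lambda>f. linear f \<and> (\<forall>z. f (Ph z) = z) \<and> (\<forall>w. Ph (f w) = w)"])
      (rule linear_injective_isomorphism[OF linear_Ph inj_Ph refl])
  then show "linear Ph_inv" "Ph_inv (Ph z) = z" "Ph (Ph_inv w) = w" by blast+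
qed

lemma Ph_inv_diff:
  obtains c where "c \<ge> 1" "\<And>w z. pw (Ph_inv w - z) \<le> c * pw (w - Ph z)"
proof -
  obtain c where c: "c \<ge> 1" "\<And>x. pw (Ph_inv x) \<le> c * pw x" using linear_pw[OF Ph_inv(1)] by metis
  have "Ph_inv w - z = Ph_inv (w - Ph z)" for w z by (simp add: linear_diff[OF Ph_inv(1)] Ph_inv(2))
  with c show ?thesis using that by metis
qed

text \<open>By the block form of the inverse of a symplectic matrix this is minus the transpose of
  \<open>B\<close> applied to \<open>\<xi>\<close>.\<close>

definition L :: "real^'d \<Rightarrow> real^'d" where
  "L \<xi> = fst (Ph_inv (0, \<xi>))"

lemma L: "linear L" "inj L"
proof -
  show lin: "linear L"
    unfolding L_def using Ph_inv(1)
    by (intro linearI) (simp_all add: linear_add[symmetric] linear_scale[symmetric] fst_add[symmetric] fst_scaleR[symmetric] del: fst_add fst_scaleR)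
  have "\<xi> = 0" if "L \<xi> = 0" for \<xi>
  proof -
    define q where "q = snd (Ph_inv (0, \<xi>))"
    have "Ph_inv (0, \<xi>) = (0, q)" using that unfolding L_def q_def by (simp add: prod_eq_iff)
    then have "Ph (0, q) = (0, \<xi>)" using Ph_inv(3)[of "(0, \<xi>)"] by simp
    then have e: "B *v q = 0" "D *v q = \<xi>" by (auto simp: phase_map_def)
    have "invertible B" using detB invertible_det_nz by blast
    then have "q = 0" using e(1) by (metis invertible_def matrix_vector_mul_assoc matrix_vector_mul_lid matrix_vector_mult_0_right)
    with e show ?thesis by simp
  qed
  then show "inj L" using linear_injective_0[OF lin] by blast
qed

abbreviation "K \<equiv> window_const g"

lemma K_pos: "K > 0"
  unfolding window_const_def using integral_norm2_pos[OF g g_nz] by simp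

lemma decay_pw: "\<exists>CN>0. \<forall>z w. norm (pairing (T (emb (tfshift z g))) (tfshift w g)) \<le> CN / pw (w - Ph z) ^ N"
proof -
  obtain CN where CN: "\<And>z w. norm (pairing (T (emb (tfshift z g))) (tfshift w g)) \<le> CN * (1 + norm (w - Ph z)) powr (- real N)"
    using decay by metis
  have "norm (pairing (T (emb (tfshift z g))) (tfshift w g)) \<le> max 1 CN / pw (w - Ph z) ^ N" for z w
  proof -
    have "(1 + norm (w - Ph z)) powr (- real N) = 1 / pw (w - Ph z) ^ N"
      unfolding pw_def[symmetric] by (simp add: powr_minus powr_realpow divide_inverse)
    then have "norm (pairing (T (emb (tfshift z g))) (tfshift w g)) \<le> CN / pw (w - Ph z) ^ N" using CN[of z w] by simp
    also have "\<dots> \<le> max 1 CN / pw (w - Ph z) ^ N" by (intro divide_right_mono) auto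
    finally show ?thesis .
  qed
  then show ?thesis by (intro exI[of _ "max 1 CN"]) auto
qed

lemma tempered_T: "schwartz f \<Longrightarrow> tempered (T (emb f))"
  using T schwartz_tempered unfolding cont_lin_op_def by blast

lemma tempered_T_tfshift: "tempered (T (emb (tfshift z g)))"
  using T tfshift_tempered[OF g] unfolding cont_lin_op_def by blast

text \<open>The short-time Fourier transform of the conjugate of \<open>\<phi>\<close> decays away
  from the origin of phase space; for the modulated function it is translated to
  \<open>(0, \<xi>)\<close>. Combined with the decay of the matrix in \<open>w - Ph z\<close>, the
  weight inequality leaves decay in \<open>(0, \<xi>) - Ph z\<close>.\<close>

lemma kernel_decay:
  assumes \<phi>: "schwartz \<phi>"
  shows "\<exists>C0>0. \<forall>\<xi> z. norm (T (emb (tfshift z g)) (modulated \<phi> \<xi>)) \<le> C0 / pw ((0, \<xi>) - Ph z) ^ n"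
proof -
  let ?D = "DIM((real^'d) \<times> (real^'d)) + 2"
  let ?I = "pw_int TYPE((real^'d) \<times> (real^'d))"
  obtain CN where CN: "CN > 0" "\<And>z w. norm (pairing (T (emb (tfshift z g))) (tfshift w g)) \<le> CN / pw (w - Ph z) ^ n"
    using decay_pw by metis
  \<comment> \<open>\<open>n\<close> powers are spent on the weight inequality and \<open>?D\<close>
    on the integration over \<open>w\<close>.\<close>
  obtain CV where CV: "CV > 0" "\<And>z. norm (stft g (\<lambda>x. cnj (\<phi> x)) z) \<le> CV / pw z ^ (n + ?D)"
    using stft_bound[OF schwartz_cnj[OF \<phi>] g] by metis
  have "norm (T (emb (tfshift z g)) (modulated \<phi> \<xi>)) \<le> (CV * CN * (?I + 1) / K) / pw ((0, \<xi>) - Ph z) ^ n" for \<xi> z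
  proof -
    let ?u = "T (emb (tfshift z g))"
    have V: "stft g (\<lambda>x. cnj (modulated \<phi> \<xi> x)) w = stft g (\<lambda>x. cnj (\<phi> x)) (w - (0::real^'d, \<xi>))" for w
      using stft_modulate[of g "\<lambda>x. cnj (\<phi> x)" \<xi> "fst w" "snd w"] by (simp add: exp_cnj minus_prod_def)
    have "K * norm (?u (modulated \<phi> \<xi>)) = norm (of_real K * ?u (modulated \<phi> \<xi>))"
      using K_pos by (simp add: norm_mult)
    also have "\<dots> = norm (\<integral>w. cnj (stft g (\<lambda>x. cnj (\<phi> x)) (w - (0::real^'d, \<xi>))) * pairing ?u (tfshift w g) \<partial>lborel)"
      unfolding tempered_expand[OF tempered_T_tfshift g modulated_schwartz[OF \<phi>]] V ..
    also have "\<dots> \<le> (\<integral>w. norm (cnj (stft g (\<lambda>x. cnj (\<phi> x)) (w - (0::real^'d, \<xi>))) * pairing ?u (tfshift w g)) \<partial>lborel)"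
      by (rule integral_norm_bound)
    also have "\<dots> \<le> (\<integral>w. (CV * CN / pw ((0, \<xi>) - Ph z) ^ n) * (1 / pw (w - (0::real^'d, \<xi>)) ^ ?D) \<partial>lborel)"
    proof (rule integral_mono')
      show "integrable lborel (\<lambda>w. (CV * CN / pw ((0, \<xi>) - Ph z) ^ n) * (1 / pw (w - (0::real^'d, \<xi>)) ^ ?D))"
        by (intro integrable_mult_right pw_int_shift(4)) simp
      show "0 \<le> (CV * CN / pw ((0, \<xi>) - Ph z) ^ n) * (1 / pw (w - (0::real^'d, \<xi>)) ^ ?D)" for w using CV CN by simp
      fix w
      have "norm (cnj (stft g (\<lambda>x. cnj (\<phi> x)) (w - (0::real^'d, \<xi>))) * pairing ?u (tfshift w g))
          \<le> (CV / pw (w - (0::real^'d, \<xi>)) ^ (n + ?D)) * (CN / pw (w - Ph z) ^ n)"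
        unfolding norm_mult complex_mod_cnj using CV CN by (intro mult_mono) auto
      also have "\<dots> = CV * CN / ((pw (w - (0::real^'d, \<xi>)) * pw (w - Ph z)) ^ n * pw (w - (0::real^'d, \<xi>)) ^ ?D)"
        by (simp only: power_add power_mult_distrib times_divide_times_eq mult_ac)
      also have "\<dots> \<le> CV * CN / (pw ((0, \<xi>) - Ph z) ^ n * pw (w - (0::real^'d, \<xi>)) ^ ?D)"
      proof -
        have "(0, \<xi>) - Ph z = (w - Ph z) - (w - (0::real^'d, \<xi>))" by simp
        then have "pw ((0, \<xi>) - Ph z) \<le> pw (w - Ph z) * pw (w - (0::real^'d, \<xi>))" using pw_diff by metis
        then have "pw ((0, \<xi>) - Ph z) ^ n \<le> (pw (w - (0::real^'d, \<xi>)) * pw (w - Ph z)) ^ n"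
          by (intro power_mono) (auto simp: mult.commute)
        then show ?thesis using CV CN by (intro divide_left_mono mult_right_mono mult_pos_pos) auto
      qed
      finally show "norm (cnj (stft g (\<lambda>x. cnj (\<phi> x)) (w - (0::real^'d, \<xi>))) * pairing ?u (tfshift w g))
          \<le> (CV * CN / pw ((0, \<xi>) - Ph z) ^ n) * (1 / pw (w - (0::real^'d, \<xi>)) ^ ?D)" by simp
    qed
    also have "\<dots> = (CV * CN / pw ((0, \<xi>) - Ph z) ^ n) * ?I"
      unfolding integral_mult_right_zero pw_int_shift(2) ..
    also have "\<dots> \<le> (CV * CN / pw ((0, \<xi>) - Ph z) ^ n) * (?I + 1)"
      using CV CN by (intro mult_left_mono) auto
    finally show ?thesis using K_pos by (simp add: field_simps)
  qed
  moreover have "CV * CN * (?I + 1) / K > 0" using CV CN K_pos by (intro divide_pos_pos mult_pos_pos) (auto intro: add_nonneg_pos)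
  ultimately show ?thesis by blast
qed

text \<open>From here on all phases are gone: only the modulus of the transform of the input is
  left, weighted by the distance to the fibre.\<close>

lemma output_bound:
  assumes \<phi>: "schwartz \<phi>"
  shows "\<exists>C0>0. \<forall>F \<xi>. schwartz F \<longrightarrow> norm (T (emb F) (modulated \<phi> \<xi>)) \<le>
      C0 * (\<integral>z. norm (stft g F z) / pw ((0, \<xi>) - Ph z) ^ n \<partial>lborel)"
proof -
  obtain C0 where C0: "C0 > 0" "\<And>\<xi> z. norm (T (emb (tfshift z g)) (modulated \<phi> \<xi>)) \<le> C0 / pw ((0, \<xi>) - Ph z) ^ n"
    using kernel_decay[OF \<phi>, of n] by blast
  have "norm (T (emb F) (modulated \<phi> \<xi>)) \<le> (C0 / K) * (\<integral>z. norm (stft g F z) / pw ((0, \<xi>) - Ph z) ^ n \<partial>lborel)"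
    if F: "schwartz F" for F \<xi>
  proof -
    have "K * norm (T (emb F) (modulated \<phi> \<xi>)) = norm (of_real K * T (emb F) (modulated \<phi> \<xi>))"
      using K_pos by (simp add: norm_mult)
    also have "\<dots> = norm (\<integral>z. stft g F z * T (emb (tfshift z g)) (modulated \<phi> \<xi>) \<partial>lborel)"
      unfolding op_expand[OF T g F modulated_schwartz[OF \<phi>]] ..
    also have "\<dots> \<le> (\<integral>z. norm (stft g F z * T (emb (tfshift z g)) (modulated \<phi> \<xi>)) \<partial>lborel)"
      by (rule integral_norm_bound)
    also have "\<dots> \<le> (\<integral>z. C0 * (norm (stft g F z) / pw ((0, \<xi>) - Ph z) ^ n) \<partial>lborel)"
    proof (rule integral_mono')
      have c: "continuous_on UNIV (\<lambda>z. norm (stft g F z) / pw ((0, \<xi>) - Ph z) ^ n)"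
        by (intro continuous_intros stft_continuous schwartz_integrable F g
            linear_continuous_on linear_conv_bounded_linear[THEN iffD1] linear_Ph) auto
      have "integrable lborel (\<lambda>z. norm (stft g F z) / pw ((0, \<xi>) - Ph z) ^ n)"
        by (rule Bochner_Integration.integrable_bound[OF integrable_norm[OF stft_integrable[OF F g]]])
           (use borel_measurable_continuous_onI[OF c] in \<open>auto intro!: divide_ge1_le\<close>)
      then show "integrable lborel (\<lambda>z. C0 * (norm (stft g F z) / pw ((0, \<xi>) - Ph z) ^ n))" by (rule integrable_mult_right)
      show "0 \<le> C0 * (norm (stft g F z) / pw ((0, \<xi>) - Ph z) ^ n)" for z using C0(1) by simp
      show "norm (stft g F z * T (emb (tfshift z g)) (modulated \<phi> \<xi>)) \<le> C0 * (norm (stft g F z) / pw ((0, \<xi>) - Ph z) ^ n)" for z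
        using mult_left_mono[OF C0(2)[of z \<xi>] norm_ge_zero[of "stft g F z"]] by (simp add: norm_mult mult.commute)
    qed
    finally have "K * norm (T (emb F) (modulated \<phi> \<xi>)) \<le> C0 * (\<integral>z. norm (stft g F z) / pw ((0, \<xi>) - Ph z) ^ n \<partial>lborel)"
      by (simp only: integral_mult_right_zero)
    then show ?thesis using K_pos by (simp add: field_simps)
  qed
  then show ?thesis using C0(1) K_pos by (intro exI[of _ "C0 / K"]) auto
qed

end

section \<open>L^p estimates of the output\<close>

lemma powr_add_le_add_powr:
  fixes x y r :: real
  assumes "x \<ge> 0" "y \<ge> 0" "0 < r" "r \<le> 1"
  shows "(x + y) powr r \<le> x powr r + y powr r"
proof (cases "x + y = 0")
  case False
  with assms have s: "x + y > 0" by simp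
  have le: "t / (x + y) \<le> (t / (x + y)) powr r" if "0 \<le> t" "t \<le> x + y" for t
    using that s assms powr_mono'[of r 1 "t / (x + y)"] by (simp add: divide_le_eq_1)
  have "1 = x / (x + y) + y / (x + y)" using s by (simp add: add_divide_distrib[symmetric])
  also have "\<dots> \<le> (x / (x + y)) powr r + (y / (x + y)) powr r" using assms by (intro add_mono le) auto
  also have "\<dots> = (x powr r + y powr r) / (x + y) powr r" using assms s by (simp add: powr_divide add_divide_distrib)
  finally show ?thesis using s by (simp add: le_divide_eq)
qed (use assms in auto)

text \<open>A crude Minkowski inequality: the modulus of a sum is at most twice the larger modulus,
  and the power \<open>1 / p\<close> is subadditive. The factor 2 reappears in the final
  constants.\<close>

lemma lp_norm_add_le:
  fixes h1 h2 :: "real^'d \<Rightarrow> complex"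
  assumes p: "p \<ge> 1" and m: "h1 \<in> borel_measurable borel" "h2 \<in> borel_measurable borel"
    and i: "integrable lborel (\<lambda>x. norm (h1 x) powr p)" "integrable lborel (\<lambda>x. norm (h2 x) powr p)"
  shows "integrable lborel (\<lambda>x. norm (h1 x + h2 x) powr p)" "lp_norm p (\<lambda>x. h1 x + h2 x) \<le> 2 * (lp_norm p h1 + lp_norm p h2)"
proof -
  let ?X = "\<integral>x. norm (h1 x) powr p \<partial>lborel" and ?Y = "\<integral>x. norm (h2 x) powr p \<partial>lborel"
  have le: "norm (h1 x + h2 x) powr p \<le> 2 powr p * (norm (h1 x) powr p + norm (h2 x) powr p)" for x
  proof -
    have "norm (h1 x + h2 x) \<le> 2 * max (norm (h1 x)) (norm (h2 x))" using norm_triangle_ineq[of "h1 x" "h2 x"] by auto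
    then have "norm (h1 x + h2 x) powr p \<le> (2 * max (norm (h1 x)) (norm (h2 x))) powr p" using p by (intro powr_mono2) auto
    also have "\<dots> = 2 powr p * max (norm (h1 x)) (norm (h2 x)) powr p" by (simp add: powr_mult)
    also have "max (norm (h1 x)) (norm (h2 x)) powr p \<le> norm (h1 x) powr p + norm (h2 x) powr p" by (auto simp: max_def)
    finally show ?thesis by (simp add: mult_left_mono)
  qed
  have ir: "integrable lborel (\<lambda>x. 2 powr p * (norm (h1 x) powr p + norm (h2 x) powr p))"
    using i by simp
  show ii: "integrable lborel (\<lambda>x. norm (h1 x + h2 x) powr p)"
    by (rule Bochner_Integration.integrable_bound[OF ir]) (use m le in auto)
  have "(\<integral>x. norm (h1 x + h2 x) powr p \<partial>lborel) \<le> (\<integral>x. 2 powr p * (norm (h1 x) powr p + norm (h2 x) powr p) \<partial>lborel)"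
    by (rule integral_mono[OF ii ir le])
  also have "\<dots> = 2 powr p * (?X + ?Y)" using i by simp
  finally have "lp_norm p (\<lambda>x. h1 x + h2 x) \<le> (2 powr p * (?X + ?Y)) powr (1 / p)"
    unfolding lp_norm_def using p by (intro powr_mono2) auto
  also have "\<dots> = 2 * (?X + ?Y) powr (1 / p)" using p by (simp add: powr_mult powr_powr)
  also have "\<dots> \<le> 2 * (?X powr (1 / p) + ?Y powr (1 / p))"
    using p by (intro mult_left_mono powr_add_le_add_powr) auto
  finally show "lp_norm p (\<lambda>x. h1 x + h2 x) \<le> 2 * (lp_norm p h1 + lp_norm p h2)" by (simp add: lp_norm_def)
qed

context fio
begin

abbreviation fio_out :: "(real^'d \<Rightarrow> complex) \<Rightarrow> (real^'d \<Rightarrow> complex) \<Rightarrow> real^'d \<Rightarrow> complex" where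
  "fio_out \<phi> F \<equiv> \<lambda>\<xi>. T (emb F) (modulated \<phi> \<xi>)"

lemma output_continuous: "schwartz \<phi> \<Longrightarrow> schwartz F \<Longrightarrow> continuous_on UNIV (fio_out \<phi> F)"
  by (intro tempered_modulated_continuous tempered_T)

text \<open>One half of the kernel decay controls the position and the other half the frequency of
  \<open>Ph_inv (0, \<xi>) - z\<close>. At position \<open>a\<close> the transform of
  \<open>F\<close> is bounded, independently of the frequency, by an average of
  \<open>norm F\<close> around \<open>a\<close>. The frequency thus integrates out, and the position
  integral leaves a convolution evaluated at \<open>L \<xi>\<close>.\<close>

lemma output_convolution_bound:
  assumes \<phi>: "schwartz \<phi>"
  shows "\<exists>C0>0. \<forall>F \<xi>. schwartz F \<longrightarrow> norm (fio_out \<phi> F \<xi>) \<le> C0 * (\<integral>y. norm (F y) / pw (L \<xi> - y) ^ (CARD('d) + 2) \<partial>lborel)"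
proof -
  let ?D = "DIM(real^'d) + 2"
  let ?n = "?D + ?D"
  let ?I = "pw_int TYPE(real^'d)"
  obtain C0 where C0: "C0 > 0" "\<And>F \<xi>. schwartz F \<Longrightarrow> norm (fio_out \<phi> F \<xi>) \<le> C0 * (\<integral>z. norm (stft g F z) / pw ((0, \<xi>) - Ph z) ^ ?n \<partial>lborel)"
    using output_bound[OF \<phi>, of ?n] by blast
  obtain c where c: "c \<ge> 1" "\<And>w z. pw (Ph_inv w - z) \<le> c * pw (w - Ph z)" using Ph_inv_diff by blast
  \<comment> \<open>One half of this exponent moves the weight from \<open>L \<xi> - a\<close> to
    \<open>L \<xi> - y\<close>, the other integrates over \<open>a\<close>.\<close>
  obtain Cg where Cg: "Cg > 0" "\<And>x. norm (g x) \<le> Cg / pw x ^ ?n" using schwartz_bound[OF g] by blast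
  have "norm (fio_out \<phi> F \<xi>) \<le> (C0 * (c ^ ?n * ?I * (Cg * ?I) + 1)) * (\<integral>y. norm (F y) / pw (L \<xi> - y) ^ ?D \<partial>lborel)"
    if F: "schwartz F" for F \<xi>
  proof -
    define l where "l = snd (Ph_inv (0, \<xi>))"
    have Fc: "continuous_on UNIV F" by (rule schwartz_cont[OF F])
    \<comment> \<open>Majorant of the position part: \<open>norm (F y)\<close> seen through the
      window decay at \<open>a\<close>, times the decay towards \<open>L \<xi>\<close>.\<close>
    define k where "k a y = norm (F y) * (Cg / (pw (y - a) ^ ?n * pw (L \<xi> - a) ^ ?D))" for a y
    define R where "R a = (\<integral>y. k a y \<partial>lborel)" for a
    have kint: "integrable lborel (\<lambda>z. k (fst z) (snd z))"
    proof (rule Bochner_Integration.integrable_bound)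
      have 1: "integrable lborel (\<lambda>a. Cg * (1 / pw (L \<xi> - a) ^ ?D))" by (intro integrable_mult_right pw_int_shift(3)) simp
      show "integrable lborel (\<lambda>z. (Cg * (1 / pw (L \<xi> - fst z) ^ ?D)) * norm (F (snd z)))"
        by (rule integrable_lborel_prod[OF 1 integrable_norm[OF schwartz_integrable[OF F]]])
      show "(\<lambda>z. k (fst z) (snd z)) \<in> borel_measurable lborel"
        unfolding measurable_lborel2 k_def
        by (intro borel_measurable_continuous_onI continuous_intros continuous_on_compose2[OF Fc]) auto
      have kle: "k a y \<le> (Cg * (1 / pw (L \<xi> - a) ^ ?D)) * norm (F y)" for a y
      proof -
        have "Cg / (pw (y - a) ^ ?n * pw (L \<xi> - a) ^ ?D) \<le> Cg / (1 * pw (L \<xi> - a) ^ ?D)"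
          using Cg by (intro divide_left_mono mult_right_mono pw_power_ge1) auto
        moreover have "(Cg * (1 / pw (L \<xi> - a) ^ ?D)) * norm (F y) = norm (F y) * (Cg / (1 * pw (L \<xi> - a) ^ ?D))" by simp
        ultimately show ?thesis unfolding k_def by (simp only: mult_left_mono norm_ge_zero)
      qed
      have k0: "0 \<le> k a y" for a y unfolding k_def using Cg by simp
      show "AE z in lborel. norm (k (fst z) (snd z)) \<le> norm ((Cg * (1 / pw (L \<xi> - fst z) ^ ?D)) * norm (F (snd z)))"
        by (intro AE_I2) (simp only: real_norm_def abs_of_nonneg[OF k0], rule order_trans[OF kle abs_ge_self])
    qed
    have Ri: "integrable lborel R" unfolding R_def by (rule integrable_lborel_fst[OF kint])
    have R0: "R a \<ge> 0" for a unfolding R_def k_def using Cg by (intro integral_nonneg_AE) auto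
    have Rint: "(\<integral>a. R a \<partial>lborel) \<le> (Cg * ?I) * (\<integral>y. norm (F y) / pw (L \<xi> - y) ^ ?D \<partial>lborel)"
    proof -
      have inner: "(\<integral>a. Cg / (pw (y - a) ^ ?n * pw (L \<xi> - a) ^ ?D) \<partial>lborel) \<le> Cg * ?I / pw (L \<xi> - y) ^ ?D" for y
      proof -
        have "(\<integral>a. Cg / (pw (y - a) ^ ?n * pw (L \<xi> - a) ^ ?D) \<partial>lborel) \<le> (\<integral>a. (Cg / pw (L \<xi> - y) ^ ?D) * (1 / pw (y - a) ^ ?D) \<partial>lborel)"
        proof (rule integral_mono')
          show "integrable lborel (\<lambda>a. (Cg / pw (L \<xi> - y) ^ ?D) * (1 / pw (y - a) ^ ?D))"
            by (intro integrable_mult_right pw_int_shift(3)) simp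
          show "0 \<le> (Cg / pw (L \<xi> - y) ^ ?D) * (1 / pw (y - a) ^ ?D)" for a using Cg by simp
          fix a
          have "L \<xi> - y = (L \<xi> - a) - (y - a)" by simp
          then have "pw (L \<xi> - y) \<le> pw (L \<xi> - a) * pw (y - a)" using pw_diff by metis
          then have "pw (L \<xi> - y) ^ ?D \<le> (pw (L \<xi> - a) * pw (y - a)) ^ ?D" by (rule power_mono) simp
          then have "pw (L \<xi> - y) ^ ?D * pw (y - a) ^ ?D \<le> (pw (L \<xi> - a) * pw (y - a)) ^ ?D * pw (y - a) ^ ?D"
            by (rule mult_right_mono) simp
          also have "\<dots> = pw (y - a) ^ ?n * pw (L \<xi> - a) ^ ?D" by (simp only: power_mult_distrib power_add mult_ac)
          finally have "Cg / (pw (y - a) ^ ?n * pw (L \<xi> - a) ^ ?D) \<le> Cg / (pw (L \<xi> - y) ^ ?D * pw (y - a) ^ ?D)"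
            using Cg by (intro divide_left_mono) auto
          then show "Cg / (pw (y - a) ^ ?n * pw (L \<xi> - a) ^ ?D) \<le> (Cg / pw (L \<xi> - y) ^ ?D) * (1 / pw (y - a) ^ ?D)" by simp
        qed
        also have "\<dots> = (Cg / pw (L \<xi> - y) ^ ?D) * ?I" unfolding integral_mult_right_zero pw_int_shift(1) ..
        finally show ?thesis by simp
      qed
      have "(\<integral>a. R a \<partial>lborel) = (\<integral>y. (\<integral>a. k a y \<partial>lborel) \<partial>lborel)"
        unfolding R_def by (rule lborel_Fubini(3)[OF kint])
      also have "\<dots> \<le> (\<integral>y. (Cg * ?I) * (norm (F y) / pw (L \<xi> - y) ^ ?D) \<partial>lborel)"
      proof (rule integral_mono')
        have c: "continuous_on UNIV (\<lambda>y. norm (F y) / pw (L \<xi> - y) ^ ?D)" by (intro continuous_intros Fc) auto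
        have "integrable lborel (\<lambda>y. norm (F y) / pw (L \<xi> - y) ^ ?D)"
          by (rule Bochner_Integration.integrable_bound[OF integrable_norm[OF schwartz_integrable[OF F]]])
             (use borel_measurable_continuous_onI[OF c] in \<open>auto intro!: divide_ge1_le simp del: power_add add_2_eq_Suc'\<close>)
        then show "integrable lborel (\<lambda>y. (Cg * ?I) * (norm (F y) / pw (L \<xi> - y) ^ ?D))" by (rule integrable_mult_right)
        show "0 \<le> (Cg * ?I) * (norm (F y) / pw (L \<xi> - y) ^ ?D)" for y using Cg by simp
        show "(\<integral>a. k a y \<partial>lborel) \<le> (Cg * ?I) * (norm (F y) / pw (L \<xi> - y) ^ ?D)" for y
          unfolding k_def integral_mult_right_zero using mult_left_mono[OF inner[of y] norm_ge_zero[of "F y"]]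
          by (simp only: times_divide_eq_right mult_ac)
      qed
      finally show ?thesis by (simp only: integral_mult_right_zero)
    qed
    have V: "norm (stft g F z) / pw (L \<xi> - fst z) ^ ?D \<le> R (fst z)" for z
    proof -
      have "norm (stft g F z) \<le> (\<integral>y. norm (F y * cnj (tfshift z g y)) \<partial>lborel)"
        unfolding stft_def by (rule integral_norm_bound)
      also have "\<dots> \<le> (\<integral>y. norm (F y) * (Cg / pw (y - fst z) ^ ?n) \<partial>lborel)"
      proof (rule integral_mono')
        have c: "continuous_on UNIV (\<lambda>y. norm (F y) * (Cg / pw (y - fst z) ^ ?n))" by (intro continuous_intros Fc) auto
        have "norm (F y) * (Cg / pw (y - fst z) ^ ?n) \<le> Cg * norm (F y)" for y
          unfolding mult.commute[of Cg] using Cg(1) by (intro mult_left_mono divide_ge1_le pw_power_ge1) auto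
        then show "integrable lborel (\<lambda>y. norm (F y) * (Cg / pw (y - fst z) ^ ?n))"
          using borel_measurable_continuous_onI[OF c] Cg
          by (intro Bochner_Integration.integrable_bound[OF integrable_mult_right[of Cg, OF integrable_norm[OF schwartz_integrable[OF F]]]])
             (auto simp: abs_mult simp del: power_add add_2_eq_Suc')
        show "norm (F y * cnj (tfshift z g y)) \<le> norm (F y) * (Cg / pw (y - fst z) ^ ?n)" for y
          unfolding norm_mult complex_mod_cnj norm_tfshift by (intro mult_left_mono Cg) auto
      qed (use Cg in auto)
      finally have "norm (stft g F z) / pw (L \<xi> - fst z) ^ ?D \<le> (\<integral>y. norm (F y) * (Cg / pw (y - fst z) ^ ?n) \<partial>lborel) / pw (L \<xi> - fst z) ^ ?D"
        by (rule divide_right_mono) simp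
      also have "\<dots> = R (fst z)" unfolding R_def k_def integral_divide_zero[symmetric]
        by (intro Bochner_Integration.integral_cong refl) (simp only: times_divide_eq_right divide_divide_eq_left)
      finally show ?thesis .
    qed
    have li: "integrable lborel (\<lambda>\<alpha>. c ^ ?n * (1 / pw (l - \<alpha>) ^ ?D))" by (intro integrable_mult_right pw_int_shift(3)) simp
    have "(\<integral>z. norm (stft g F z) / pw ((0, \<xi>) - Ph z) ^ ?n \<partial>lborel) \<le> (\<integral>z. R (fst z) * (c ^ ?n * (1 / pw (l - snd z) ^ ?D)) \<partial>lborel)"
    proof (rule integral_mono')
      show "integrable lborel (\<lambda>z. R (fst z) * (c ^ ?n * (1 / pw (l - snd z) ^ ?D)))"
        by (rule integrable_lborel_prod[OF Ri li])
      show "0 \<le> R (fst z) * (c ^ ?n * (1 / pw (l - snd z) ^ ?D))" for z :: "(real^'d) \<times> (real^'d)" using R0 c(1) by simp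
      fix z
      have P: "Ph_inv (0, \<xi>) - z = (L \<xi> - fst z, l - snd z)" by (simp add: L_def l_def prod_eq_iff)
      have "pw (L \<xi> - fst z) ^ ?D * pw (l - snd z) ^ ?D \<le> pw (Ph_inv (0, \<xi>) - z) ^ ?D * pw (Ph_inv (0, \<xi>) - z) ^ ?D"
        unfolding P by (intro mult_mono power_mono pw_Pair_ge) auto
      also have "\<dots> = pw (Ph_inv (0, \<xi>) - z) ^ ?n" by (simp only: power_add)
      also have "\<dots> \<le> (c * pw ((0, \<xi>) - Ph z)) ^ ?n" by (intro power_mono c) auto
      also have "\<dots> = c ^ ?n * pw ((0, \<xi>) - Ph z) ^ ?n" by (simp only: power_mult_distrib)
      finally have "1 / pw ((0, \<xi>) - Ph z) ^ ?n \<le> c ^ ?n / (pw (L \<xi> - fst z) ^ ?D * pw (l - snd z) ^ ?D)"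
        by (simp add: divide_simps mult.commute del: power_add add_2_eq_Suc')
      then have "norm (stft g F z) * (1 / pw ((0, \<xi>) - Ph z) ^ ?n) \<le> norm (stft g F z) * (c ^ ?n / (pw (L \<xi> - fst z) ^ ?D * pw (l - snd z) ^ ?D))"
        by (rule mult_left_mono) simp
      also have "\<dots> = (norm (stft g F z) / pw (L \<xi> - fst z) ^ ?D) * (c ^ ?n * (1 / pw (l - snd z) ^ ?D))"
        by (simp only: times_divide_eq_left times_divide_eq_right divide_divide_eq_left mult_ac mult_1_right)
      also have "\<dots> \<le> R (fst z) * (c ^ ?n * (1 / pw (l - snd z) ^ ?D))"
        using c(1) by (intro mult_right_mono V) auto
      finally show "norm (stft g F z) / pw ((0, \<xi>) - Ph z) ^ ?n \<le> R (fst z) * (c ^ ?n * (1 / pw (l - snd z) ^ ?D))"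
        by (simp only: mult_1_right times_divide_eq_right)
    qed
    also have "\<dots> = (\<integral>a. R a \<partial>lborel) * (c ^ ?n * ?I)"
      unfolding integral_prod_lborel[OF Ri li] integral_mult_right_zero pw_int_shift(1) ..
    also have "\<dots> \<le> ((Cg * ?I) * (\<integral>y. norm (F y) / pw (L \<xi> - y) ^ ?D \<partial>lborel)) * (c ^ ?n * ?I)"
      using c(1) by (intro mult_right_mono Rint) auto
    also have "\<dots> \<le> (c ^ ?n * ?I * (Cg * ?I) + 1) * (\<integral>y. norm (F y) / pw (L \<xi> - y) ^ ?D \<partial>lborel)"
    proof -
      have e: "((Cg * ?I) * X) * (c ^ ?n * ?I) = (c ^ ?n * ?I * (Cg * ?I)) * X" for X by (simp only: mult_ac)
      have "0 \<le> (\<integral>y. norm (F y) / pw (L \<xi> - y) ^ ?D \<partial>lborel)" by (intro integral_nonneg_AE) auto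
      then show ?thesis unfolding e distrib_right mult_1 by linarith
    qed
    finally have "C0 * (\<integral>z. norm (stft g F z) / pw ((0, \<xi>) - Ph z) ^ ?n \<partial>lborel)
        \<le> C0 * ((c ^ ?n * ?I * (Cg * ?I) + 1) * (\<integral>y. norm (F y) / pw (L \<xi> - y) ^ ?D \<partial>lborel))"
      using C0(1) by (intro mult_left_mono) auto
    with C0(2)[OF F, of \<xi>] show ?thesis by (simp only: mult.assoc)
  qed
  moreover have "C0 * (c ^ ?n * ?I * (Cg * ?I) + 1) > 0"
    using C0(1) Cg(1) c(1) by (intro mult_pos_pos add_nonneg_pos mult_nonneg_nonneg) auto
  moreover have D: "CARD('d) + 2 = ?D" by simp
  ultimately show ?thesis unfolding D by blast
qed

lemma output_Lp:
  assumes \<phi>: "schwartz \<phi>" and p: "p \<ge> 1"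
  shows "\<exists>C0>0. \<forall>F. schwartz F \<longrightarrow> integrable lborel (\<lambda>\<xi>. norm (fio_out \<phi> F \<xi>) powr p) \<and>
     lp_norm p (fio_out \<phi> F) \<le> C0 * lp_norm p F"
proof -
  obtain C1 where C1: "C1 > 0" "\<And>F \<xi>. schwartz F \<Longrightarrow> norm (fio_out \<phi> F \<xi>) \<le> C1 * (\<integral>y. norm (F y) / pw (L \<xi> - y) ^ (CARD('d) + 2) \<partial>lborel)"
    using output_convolution_bound[OF \<phi>] by blast
  obtain K' where K': "K' > 0" "\<And>F :: real^'d \<Rightarrow> complex. schwartz F \<Longrightarrow>
     integrable lborel (\<lambda>\<xi>. (\<integral>y. norm (F y) / pw (L \<xi> - y) ^ (CARD('d) + 2) \<partial>lborel) powr p) \<and>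
     (\<integral>\<xi>. (\<integral>y. norm (F y) / pw (L \<xi> - y) ^ (CARD('d) + 2) \<partial>lborel) powr p \<partial>lborel) \<le> K' * (\<integral>y. norm (F y) powr p \<partial>lborel)"
    using convolution_Lp[OF L p] by blast
  have "integrable lborel (\<lambda>\<xi>. norm (fio_out \<phi> F \<xi>) powr p) \<and> lp_norm p (fio_out \<phi> F) \<le> (C1 * K' powr (1 / p)) * lp_norm p F"
    if F: "schwartz F" for F
  proof -
    define U where "U \<xi> = (\<integral>y. norm (F y) / pw (L \<xi> - y) ^ (CARD('d) + 2) \<partial>lborel)" for \<xi>
    have U0: "U \<xi> \<ge> 0" for \<xi> unfolding U_def by (intro integral_nonneg_AE) auto
    have le: "norm (fio_out \<phi> F \<xi>) powr p \<le> C1 powr p * U \<xi> powr p" for \<xi>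
    proof -
      have "norm (fio_out \<phi> F \<xi>) powr p \<le> (C1 * U \<xi>) powr p"
        using C1(2)[OF F, of \<xi>] p unfolding U_def by (intro powr_mono2) auto
      then show ?thesis using C1(1) U0 by (simp add: powr_mult)
    qed
    have ir: "integrable lborel (\<lambda>\<xi>. C1 powr p * U \<xi> powr p)" using K'(2)[OF F] unfolding U_def by simp
    have i: "integrable lborel (\<lambda>\<xi>. norm (fio_out \<phi> F \<xi>) powr p)"
      by (rule Bochner_Integration.integrable_bound[OF ir])
         (use borel_measurable_continuous_onI[OF output_continuous[OF \<phi> F]] le in \<open>auto simp: abs_mult\<close>)
    have "(\<integral>\<xi>. norm (fio_out \<phi> F \<xi>) powr p \<partial>lborel) \<le> (\<integral>\<xi>. C1 powr p * U \<xi> powr p \<partial>lborel)"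
      by (rule integral_mono[OF i ir le])
    also have "\<dots> \<le> C1 powr p * (K' * (\<integral>y. norm (F y) powr p \<partial>lborel))"
      using K'(2)[OF F] unfolding U_def by (simp add: mult_left_mono)
    finally have "lp_norm p (fio_out \<phi> F) \<le> (C1 powr p * (K' * (\<integral>y. norm (F y) powr p \<partial>lborel))) powr (1 / p)"
      unfolding lp_norm_def using p by (intro powr_mono2) auto
    also have "\<dots> = (C1 * K' powr (1 / p)) * lp_norm p F"
      unfolding lp_norm_def using C1(1) K'(1) p by (simp add: powr_mult powr_powr)
    finally show ?thesis using i by blast
  qed
  moreover have "C1 * K' powr (1 / p) > 0" using C1 K' by simp
  ultimately show ?thesis by blast
qed

text \<open>\<open>M\<close> powers of the kernel decay cancel the loss in the hypothesis,
  \<open>?D2\<close> more integrate over \<open>z\<close>, and the gained powers of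
  \<open>pw \<xi>\<close> make the output integrable to the power \<open>p\<close>. \<open>Q\<close>
  is a variable because it will carry the weak norm of the input.\<close>

lemma output_small_Lp:
  assumes \<phi>: "schwartz \<phi>" and p: "p \<ge> 1"
  shows "\<exists>C0>0. \<forall>F Q. schwartz F \<longrightarrow> Q \<ge> 0 \<longrightarrow>
      (\<forall>z \<xi>. pw \<xi> ^ (CARD('d) + 2) * norm (stft g F z) \<le> Q * pw ((0, \<xi>) - Ph z) ^ M) \<longrightarrow>
     integrable lborel (\<lambda>\<xi>. norm (fio_out \<phi> F \<xi>) powr p) \<and> lp_norm p (fio_out \<phi> F) \<le> C0 * Q"
proof -
  let ?D = "DIM(real^'d) + 2"
  have D: "CARD('d) + 2 = ?D" by simp
  let ?D2 = "DIM((real^'d) \<times> (real^'d)) + 2"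
  let ?I = "pw_int TYPE(real^'d)" and ?I2 = "pw_int TYPE((real^'d) \<times> (real^'d))"
  obtain C0 where C0: "C0 > 0" "\<And>F \<xi>. schwartz F \<Longrightarrow> norm (fio_out \<phi> F \<xi>) \<le> C0 * (\<integral>z. norm (stft g F z) / pw ((0, \<xi>) - Ph z) ^ (M + ?D2) \<partial>lborel)"
    using output_bound[OF \<phi>, of "M + ?D2"] by blast
  obtain c where c: "c \<ge> 1" "\<And>w z. pw (Ph_inv w - z) \<le> c * pw (w - Ph z)" using Ph_inv_diff by blast
  define C2 where "C2 = C0 * (c ^ ?D2 * ?I2) + 1"
  have C2: "C2 > 0" unfolding C2_def using C0(1) c(1) by (intro add_nonneg_pos mult_nonneg_nonneg) auto
  have "integrable lborel (\<lambda>\<xi>. norm (fio_out \<phi> F \<xi>) powr p) \<and> lp_norm p (fio_out \<phi> F) \<le> (C2 * (?I powr (1 / p) + 1)) * Q"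
    if F: "schwartz F" and Q: "Q \<ge> 0" and V: "\<And>z \<xi>. pw \<xi> ^ ?D * norm (stft g F z) \<le> Q * pw ((0, \<xi>) - Ph z) ^ M" for F Q
  proof -
    have b: "norm (fio_out \<phi> F \<xi>) \<le> (C2 * Q) / pw \<xi> ^ ?D" for \<xi>
    proof -
      have "(\<integral>z. norm (stft g F z) / pw ((0, \<xi>) - Ph z) ^ (M + ?D2) \<partial>lborel) \<le> (\<integral>z. (Q / pw \<xi> ^ ?D * c ^ ?D2) * (1 / pw (Ph_inv (0, \<xi>) - z) ^ ?D2) \<partial>lborel)"
      proof (rule integral_mono')
        show "integrable lborel (\<lambda>z. (Q / pw \<xi> ^ ?D * c ^ ?D2) * (1 / pw (Ph_inv (0, \<xi>) - z) ^ ?D2))"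
          by (intro integrable_mult_right pw_int_shift(3)) simp
        show "0 \<le> (Q / pw \<xi> ^ ?D * c ^ ?D2) * (1 / pw (Ph_inv (0, \<xi>) - z) ^ ?D2)" for z using Q c(1) by simp
        fix z
        have 1: "norm (stft g F z) / pw ((0, \<xi>) - Ph z) ^ M \<le> Q / pw \<xi> ^ ?D"
          using V[of \<xi> z] by (simp add: divide_simps mult.commute del: power_add add_2_eq_Suc')
        have "pw (Ph_inv (0, \<xi>) - z) ^ ?D2 \<le> (c * pw ((0, \<xi>) - Ph z)) ^ ?D2" by (intro power_mono c) auto
        then have 2: "1 / pw ((0, \<xi>) - Ph z) ^ ?D2 \<le> c ^ ?D2 / pw (Ph_inv (0, \<xi>) - z) ^ ?D2"
          unfolding power_mult_distrib by (simp add: divide_simps mult.commute del: power_add add_2_eq_Suc')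
        have "norm (stft g F z) / pw ((0, \<xi>) - Ph z) ^ (M + ?D2) = (norm (stft g F z) / pw ((0, \<xi>) - Ph z) ^ M) * (1 / pw ((0, \<xi>) - Ph z) ^ ?D2)"
          by (simp only: power_add[of _ M] times_divide_times_eq mult_1_right)
        also have "\<dots> \<le> (Q / pw \<xi> ^ ?D) * (c ^ ?D2 / pw (Ph_inv (0, \<xi>) - z) ^ ?D2)"
          using Q by (intro mult_mono 1 2) auto
        finally show "norm (stft g F z) / pw ((0, \<xi>) - Ph z) ^ (M + ?D2) \<le> (Q / pw \<xi> ^ ?D * c ^ ?D2) * (1 / pw (Ph_inv (0, \<xi>) - z) ^ ?D2)"
          by (simp only: mult.assoc times_divide_eq_right mult_1_right)
      qed
      also have "\<dots> = (Q / pw \<xi> ^ ?D * c ^ ?D2) * ?I2" unfolding integral_mult_right_zero pw_int_shift(1) ..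
      finally have "norm (fio_out \<phi> F \<xi>) \<le> C0 * ((Q / pw \<xi> ^ ?D * c ^ ?D2) * ?I2)"
        using C0(1) by (intro order_trans[OF C0(2)[OF F]] mult_left_mono) auto
      also have "\<dots> = (C0 * (c ^ ?D2 * ?I2)) * (Q / pw \<xi> ^ ?D)" by (simp only: mult_ac)
      also have "\<dots> \<le> C2 * (Q / pw \<xi> ^ ?D)" unfolding C2_def using Q by (intro mult_right_mono) auto
      finally show ?thesis by simp
    qed
    have le: "norm (fio_out \<phi> F \<xi>) powr p \<le> (C2 * Q) powr p * (1 / pw \<xi> ^ ?D)" for \<xi>
    proof -
      have "norm (fio_out \<phi> F \<xi>) powr p \<le> ((C2 * Q) / pw \<xi> ^ ?D) powr p" using p b by (intro powr_mono2) auto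
      also have "\<dots> = (C2 * Q) powr p * (1 / pw \<xi> ^ ?D) powr p"
        using C2 Q by (simp add: powr_mult[symmetric] del: power_add add_2_eq_Suc')
      also have "(1 / pw \<xi> ^ ?D) powr p \<le> (1 / pw \<xi> ^ ?D) powr 1"
        using p by (intro powr_mono') (auto simp del: power_add add_2_eq_Suc' simp: divide_le_eq_1)
      finally show ?thesis by (simp add: mult_left_mono)
    qed
    have ir: "integrable lborel (\<lambda>\<xi>::real^'d. (C2 * Q) powr p * (1 / pw \<xi> ^ ?D))" by (intro integrable_mult_right integrable_pw) simp
    have i: "integrable lborel (\<lambda>\<xi>. norm (fio_out \<phi> F \<xi>) powr p)"
    proof (rule Bochner_Integration.integrable_bound[OF ir])
      show "(\<lambda>\<xi>. norm (fio_out \<phi> F \<xi>) powr p) \<in> borel_measurable lborel"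
        using borel_measurable_continuous_onI[OF output_continuous[OF \<phi> F]] by simp
      show "AE \<xi> in lborel. norm (norm (fio_out \<phi> F \<xi>) powr p) \<le> norm ((C2 * Q) powr p * (1 / pw \<xi> ^ ?D))"
        using le by (intro AE_I2) (simp only: real_norm_def abs_of_nonneg powr_ge_zero, rule order_trans[OF _ abs_ge_self])
    qed
    have "(\<integral>\<xi>. norm (fio_out \<phi> F \<xi>) powr p \<partial>lborel) \<le> (\<integral>(\<xi>::real^'d). (C2 * Q) powr p * (1 / pw \<xi> ^ ?D) \<partial>lborel)"
      by (rule integral_mono[OF i ir le])
    also have "\<dots> = (C2 * Q) powr p * ?I" unfolding integral_mult_right_zero pw_int_def ..
    finally have "lp_norm p (fio_out \<phi> F) \<le> ((C2 * Q) powr p * ?I) powr (1 / p)"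
      unfolding lp_norm_def using p by (intro powr_mono2) auto
    also have "\<dots> = C2 * Q * ?I powr (1 / p)" using C2 Q p by (simp add: powr_mult powr_powr)
    also have "\<dots> \<le> (C2 * (?I powr (1 / p) + 1)) * Q" using C2 Q by (simp add: algebra_simps)
    finally show ?thesis using i by blast
  qed
  moreover have "C2 * (?I powr (1 / p) + 1) > 0" using C2 by (intro mult_pos_pos add_nonneg_pos) auto
  ultimately show ?thesis unfolding D by blast
qed

text \<open>Divergent integrals have the value 0, so \<open>emb\<close> is additive only when tested
  with functions such as Schwartz functions. \<open>T\<close> is therefore first passed between
  functionals that agree on those.\<close>

lemma T_add:
  assumes f: "schwartz f1" "schwartz f2" and h: "schwartz h"
  shows "T (emb (\<lambda>x. f1 x + f2 x)) h = T (emb f1) h + T (emb f2) h"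
proof -
  note t = schwartz_tempered[OF f(1)] schwartz_tempered[OF f(2)] schwartz_tempered[OF schwartz_add[OF f]]
  have bi: "integrable lborel (\<lambda>x. F x * \<phi> x)" if F: "schwartz F" and \<phi>: "schwartz \<phi>" for F \<phi> :: "real^'d \<Rightarrow> complex"
  proof -
    obtain B where B: "B > 0" "\<And>x. norm (F x) \<le> B" using schwartz_bounded[OF F] by metis
    have c: "continuous_on UNIV (\<lambda>x. F x * \<phi> x)" by (intro continuous_intros schwartz_cont F \<phi>)
    show ?thesis
      by (rule Bochner_Integration.integrable_bound[OF integrable_mult_right[of B, OF integrable_norm[OF schwartz_integrable[OF \<phi>]]]])
         (use B borel_measurable_continuous_onI[OF c] in \<open>auto simp: norm_mult intro!: mult_right_mono\<close>)
  qed
  have "emb (\<lambda>x. f1 x + f2 x) \<phi> = 1 * emb f1 \<phi> + 1 * emb f2 \<phi>" if "schwartz \<phi>" for \<phi>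
    unfolding emb_def using bi[OF f(1) that] bi[OF f(2) that] by (simp add: distrib_right)
  moreover have "T u h = T v h" if "tempered u" "tempered v" "\<And>\<phi>. schwartz \<phi> \<Longrightarrow> u \<phi> = v \<phi>" for u v
    using T that h unfolding cont_lin_op_def by blast
  ultimately have "T (emb (\<lambda>x. f1 x + f2 x)) h = T (\<lambda>\<phi>. 1 * emb f1 \<phi> + 1 * emb f2 \<phi>) h"
    using t(3) tempered_lincomb[OF t(1,2), of 1 1] by blast
  also have "\<dots> = 1 * T (emb f1) h + 1 * T (emb f2) h"
    using T t(1,2) h unfolding cont_lin_op_def by blast
  finally show ?thesis by simp
qed

text \<open>The Fourier transform of the localized output is the function obtained by adding the two
  outputs, which serves as the L^p representative.\<close>

lemma output_dist_Lp:
  assumes \<phi>: "schwartz \<phi>" and p: "p \<ge> 1" and f: "schwartz f1" "schwartz f2"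
    and i: "integrable lborel (\<lambda>\<xi>. norm (fio_out \<phi> f1 \<xi>) powr p)" "integrable lborel (\<lambda>\<xi>. norm (fio_out \<phi> f2 \<xi>) powr p)"
    and R: "2 * (lp_norm p (fio_out \<phi> f1) + lp_norm p (fio_out \<phi> f2)) \<le> R"
  shows "dist_Lp_le p (dist_fourier (dist_mult \<phi> (T (emb (\<lambda>x. f1 x + f2 x))))) R"
  unfolding dist_Lp_le_def
proof (intro exI conjI allI impI)
  let ?h = "\<lambda>\<xi>. fio_out \<phi> f1 \<xi> + fio_out \<phi> f2 \<xi>"
  note m = borel_measurable_continuous_onI[OF output_continuous[OF \<phi> f(1)]] borel_measurable_continuous_onI[OF output_continuous[OF \<phi> f(2)]]
  show "?h \<in> borel_measurable lborel" using m by simp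
  show "integrable lborel (\<lambda>x. norm (?h x) powr p)" by (rule lp_norm_add_le(1)[OF p m i])
  show "lp_norm p ?h \<le> R" using lp_norm_add_le(2)[OF p m i] R by simp
  fix g' :: "real^'d \<Rightarrow> complex" assume g': "schwartz g'"
  have "dist_fourier (dist_mult \<phi> (T (emb (\<lambda>x. f1 x + f2 x)))) g' = T (emb (\<lambda>x. f1 x + f2 x)) (\<lambda>x. \<phi> x * fourier g' x)"
    by (simp add: dist_fourier_def dist_mult_def)
  also have "\<dots> = (\<integral>\<xi>. T (emb (\<lambda>x. f1 x + f2 x)) (modulated \<phi> \<xi>) * g' \<xi> \<partial>lborel)"
    by (rule tempered_fourier_mult[OF tempered_T[OF schwartz_add[OF f]] \<phi> g'])
  also have "\<dots> = (\<integral>\<xi>. ?h \<xi> * g' \<xi> \<partial>lborel)"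
    by (simp only: T_add[OF f modulated_schwartz[OF \<phi>]])
  finally show "dist_fourier (dist_mult \<phi> (T (emb (\<lambda>x. f1 x + f2 x)))) g' = (\<integral>\<xi>. ?h \<xi> * g' \<xi> \<partial>lborel)" .
qed

end

section \<open>Weyl operators\<close>

text \<open>Together with \<open>all_derivs\<close>: all derivatives grow with the same order
  \<open>n\<close>, without the gain under differentiation of classical symbols.\<close>

definition symb :: "nat \<Rightarrow> ('i \<Rightarrow> 'a::euclidean_space \<Rightarrow> complex) \<Rightarrow> bool" where
  "symb n F \<longleftrightarrow> (\<forall>i. continuous_on UNIV (F i)) \<and> (\<exists>C. \<forall>i x. norm (F i x) \<le> C * pw x ^ n)"

lemma symb_bound:
  assumes "symb n F" obtains C where "C > 0" "\<And>i x. norm (F i x) \<le> C * pw x ^ n"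
proof -
  obtain C where C: "\<And>i x. norm (F i x) \<le> C * pw x ^ n" using assms unfolding symb_def by blast
  have "norm (F i x) \<le> max C 1 * pw x ^ n" for i x
    by (rule order_trans[OF C]) (intro mult_right_mono, auto)
  then show ?thesis using that[of "max C 1"] by auto
qed

lemma symb_add:
  assumes "symb n F" "symb n G" shows "symb n (\<lambda>i x. F i x + G i x)"
proof -
  obtain C where C: "\<And>i x. norm (F i x) \<le> C * pw x ^ n" using assms(1) unfolding symb_def by blast
  obtain C' where C': "\<And>i x. norm (G i x) \<le> C' * pw x ^ n" using assms(2) unfolding symb_def by blast
  have "norm (F i x + G i x) \<le> (C + C') * pw x ^ n" for i x
    using norm_triangle_ineq[of "F i x" "G i x"] C[of i x] C'[of i x] by (simp add: distrib_right)
  moreover have "continuous_on UNIV (\<lambda>x. F i x + G i x)" for i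
    using assms by (auto simp: symb_def intro!: continuous_intros)
  ultimately show ?thesis unfolding symb_def by blast
qed

lemma symb_mult:
  assumes "symb m F" "symb n G" shows "symb (m + n) (\<lambda>i x. F i x * G i x)"
proof -
  obtain C where C: "C > 0" "\<And>i x. norm (F i x) \<le> C * pw x ^ m" using symb_bound[OF assms(1)] by blast
  obtain C' where C': "\<And>i x. norm (G i x) \<le> C' * pw x ^ n" using assms(2) unfolding symb_def by blast
  have "norm (F i x * G i x) \<le> (C * C') * pw x ^ (m + n)" for i x
  proof -
    have "norm (F i x) * norm (G i x) \<le> (C * pw x ^ m) * (C' * pw x ^ n)" using C by (intro mult_mono C C') auto
    then show ?thesis by (simp add: norm_mult power_add mult_ac)
  qed
  moreover have "continuous_on UNIV (\<lambda>x. F i x * G i x)" for i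
    using assms by (auto simp: symb_def intro!: continuous_intros)
  ultimately show ?thesis unfolding symb_def by blast
qed

lemma symb_mono: assumes "symb m F" "m \<le> n" shows "symb n F"
proof -
  obtain C where C: "C > 0" "\<And>i x. norm (F i x) \<le> C * pw x ^ m" using symb_bound[OF assms(1)] by blast
  have "norm (F i x) \<le> C * pw x ^ n" for i x
    using C pw_power_mono[OF assms(2), of x] by (intro order_trans[OF C(2)] mult_left_mono) auto
  then show ?thesis using assms(1) unfolding symb_def by blast
qed

lemma symb_const: "symb 0 (\<lambda>i x. c)"
  unfolding symb_def by (auto intro!: exI[of _ "norm c"])

lemma all_derivs_symb_const: "all_derivs (symb 0) (\<lambda>i x. c)"
proof (rule all_derivs_coinduct[where X="\<lambda>F. \<exists>c. F = (\<lambda>i x. c)"])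
  fix F :: "'a \<Rightarrow> 'b \<Rightarrow> complex" assume "\<exists>c. F = (\<lambda>i x. c)"
  then show "symb 0 F \<and> (\<forall>b\<in>Basis. \<exists>F'. (\<forall>i. has_pd b (F i) (F' i)) \<and> (\<exists>c. F' = (\<lambda>i x. c)))"
    using symb_const has_pd_const by metis
qed blast

lemma all_derivs_symb_inner: "all_derivs (symb 1) (\<lambda>i x. of_real (x \<bullet> e))"
proof (rule all_derivs_coinduct[where X="\<lambda>F. (\<exists>c. F = (\<lambda>i x. c)) \<or> F = (\<lambda>i x. of_real (x \<bullet> e))"])
  fix F :: "'a \<Rightarrow> 'b \<Rightarrow> complex"
  assume F: "(\<exists>c. F = (\<lambda>i x. c)) \<or> F = (\<lambda>i x. of_real (x \<bullet> e))"
  have "norm (of_real (x \<bullet> e)::complex) \<le> norm e * pw x ^ 1" for x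
  proof -
    have "norm (of_real (x \<bullet> e)::complex) \<le> norm e * norm x"
      using Cauchy_Schwarz_ineq2[of x e] by (simp add: mult.commute)
    also have "\<dots> \<le> norm e * pw x ^ 1" by (intro mult_left_mono) (auto simp: pw_def)
    finally show ?thesis .
  qed
  then have "symb 1 (\<lambda>i x. of_real (x \<bullet> e) :: complex)"
    unfolding symb_def by (intro conjI allI continuous_intros) blast
  moreover have "symb 1 (\<lambda>i x. c)" for c using symb_mono[OF symb_const] by simp
  ultimately show "symb 1 F \<and> (\<forall>b\<in>Basis. \<exists>F'. (\<forall>i. has_pd b (F i) (F' i)) \<and>
      ((\<exists>c. F' = (\<lambda>i x. c)) \<or> F' = (\<lambda>i x. of_real (x \<bullet> e))))"
    using F has_pd_const has_pd_inner by metis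
qed blast

lemma all_derivs_symb_mult:
  "all_derivs (symb m) F \<Longrightarrow> all_derivs (symb n) G \<Longrightarrow> all_derivs (symb (m + n)) (\<lambda>i x. F i x * G i x)"
  by (erule (1) all_derivs_mult[where R="symb (m + n)"]) (auto intro: symb_add symb_mult)

lemma all_derivs_symb_cmult: "all_derivs (symb n) F \<Longrightarrow> all_derivs (symb n) (\<lambda>i x. c * F i x)"
  using all_derivs_symb_mult[OF all_derivs_symb_const, of n F c] by simp

lemma all_derivs_symb_add:
  "all_derivs (symb n) F \<Longrightarrow> all_derivs (symb n) G \<Longrightarrow> all_derivs (symb n) (\<lambda>i x. F i x + G i x)"
  by (erule (1) all_derivs_add) (auto intro: symb_add)

lemma all_derivs_symb_mono: "all_derivs (symb m) F \<Longrightarrow> m \<le> n \<Longrightarrow> all_derivs (symb n) F"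
  by (erule all_derivs_mono) (auto intro: symb_mono)

text \<open>The double integral in \<open>weyl\<close> is iterated, not absolutely convergent: the inner integral \<open>wJ\<close>
  decays in \<open>\<xi>\<close> by integration by parts, which makes the outer integral \<open>wW\<close> converge.\<close>

definition wJ :: "((real^'d) \<times> (real^'d) \<Rightarrow> complex) \<Rightarrow> (real^'d \<Rightarrow> complex) \<Rightarrow> real^'d \<Rightarrow> real^'d \<Rightarrow> complex" where
  "wJ b h s \<xi> = (\<integral>y. exp (- (\<i> * of_real (y \<bullet> \<xi>))) * (b ((1/2) *\<^sub>R (s + y), \<xi>) * h y) \<partial>lborel)"

definition wW :: "((real^'d) \<times> (real^'d) \<Rightarrow> complex) \<Rightarrow> (real^'d \<Rightarrow> complex) \<Rightarrow> real^'d \<Rightarrow> complex" where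
  "wW b h s = (\<integral>\<xi>. exp (\<i> * of_real (s \<bullet> \<xi>)) * wJ b h s \<xi> \<partial>lborel)"

section \<open>Decay and smoothness of the iterated Weyl integral\<close>

lemma weyl_wW: "weyl b h s = of_real (inverse ((2 * pi) ^ CARD('d))) * wW b h (s :: real^'d)"
proof -
  have "(\<integral>y. exp (\<i> * of_real ((s - y) \<bullet> \<xi>)) * b ((1/2) *\<^sub>R (s + y), \<xi>) * h y \<partial>lborel) = exp (\<i> * of_real (s \<bullet> \<xi>)) * wJ b h s \<xi>" for \<xi>
    unfolding wJ_def integral_mult_right_zero[symmetric]
    by (intro Bochner_Integration.integral_cong refl) (simp add: inner_diff_left exp_diff exp_minus right_diff_distrib field_simps)
  then show ?thesis unfolding weyl_def wW_def by simp
qed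

lemma pw_midpoint: "pw ((1/2) *\<^sub>R (s + y), \<xi>) \<le> pw s * pw y * pw \<xi>"
proof -
  have "pw ((1/2) *\<^sub>R (s + y), \<xi>) \<le> pw ((1/2) *\<^sub>R (s + y)) * pw \<xi>" by (rule pw_Pair)
  also have "\<dots> \<le> (pw s * pw y) * pw \<xi>"
    by (intro mult_right_mono order_trans[OF pw_scale_le pw_add]) auto
  finally show ?thesis .
qed

lemma symb_midpoint_bound:
  assumes "\<And>z. norm (b z) \<le> C * pw z ^ n" "C \<ge> 0"
  shows "norm (b ((1/2) *\<^sub>R (s + y), \<xi>)) \<le> C * pw s ^ n * pw y ^ n * pw \<xi> ^ n"
proof -
  have "norm (b ((1/2) *\<^sub>R (s + y), \<xi>)) \<le> C * (pw s * pw y * pw \<xi>) ^ n"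
    using assms by (intro order_trans[OF assms(1)] mult_left_mono power_mono pw_midpoint) auto
  then show ?thesis by (simp add: power_mult_distrib mult.assoc)
qed

lemma wJ_integrand_continuous:
  fixes b :: "(real^'d) \<times> (real^'d) \<Rightarrow> complex"
  assumes b: "continuous_on UNIV b" and h: "continuous_on UNIV h"
  shows "continuous_on UNIV (\<lambda>y. exp (- (\<i> * of_real (y \<bullet> \<xi>))) * (b ((1/2) *\<^sub>R (s + y), \<xi>) * h y))"
    "continuous_on UNIV (\<lambda>p. exp (- (\<i> * of_real (y \<bullet> snd p))) * (b ((1/2) *\<^sub>R (fst p + y), snd p) * h y))"
  by (intro continuous_intros h continuous_on_compose2[OF b]; simp)+

lemma wJ_integrand_bound:
  fixes b :: "(real^'d) \<times> (real^'d) \<Rightarrow> complex"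
  assumes b: "\<And>z. norm (b z) \<le> C * pw z ^ n" "C \<ge> 0" and h: "\<And>y. norm (h y) \<le> H / pw y ^ (n + (DIM(real^'d) + 2))"
  shows "norm (exp (- (\<i> * of_real (y \<bullet> \<xi>))) * (b ((1/2) *\<^sub>R (s + y), \<xi>) * h y))
     \<le> (C * H * pw s ^ n * pw \<xi> ^ n) / pw y ^ (DIM(real^'d) + 2)"
proof -
  have "norm (exp (- (\<i> * of_real (y \<bullet> \<xi>))) * (b ((1/2) *\<^sub>R (s + y), \<xi>) * h y))
      \<le> (C * pw s ^ n * pw y ^ n * pw \<xi> ^ n) * (H / pw y ^ (n + (DIM(real^'d) + 2)))"
    unfolding norm_mult norm_cis mult_1
    using b(2) by (intro mult_mono symb_midpoint_bound b h) auto
  also have "\<dots> = (C * H * pw s ^ n * pw \<xi> ^ n) / pw y ^ (DIM(real^'d) + 2)"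
    by (simp only: power_add[of _ n]) (simp add: field_simps)
  finally show ?thesis .
qed

lemma wJ_integrable:
  fixes b :: "(real^'d) \<times> (real^'d) \<Rightarrow> complex"
  assumes b: "continuous_on UNIV b" "\<And>z. norm (b z) \<le> C * pw z ^ n" "C \<ge> 0" and h: "schwartz h"
  shows "integrable lborel (\<lambda>y. exp (- (\<i> * of_real (y \<bullet> \<xi>))) * (b ((1/2) *\<^sub>R (s + y), \<xi>) * h y))"
proof -
  obtain H where H: "\<And>y. norm (h y) \<le> H / pw y ^ (n + (DIM(real^'d) + 2))" using schwartz_bound[OF h] by blast
  show ?thesis
    by (rule integrable_bound_pw[OF borel_measurable_continuous_onI[OF wJ_integrand_continuous(1)[OF b(1) schwartz_cont[OF h]]]
          wJ_integrand_bound[OF b(2,3) H] order_refl])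
qed

lemma pw_near:
  fixes p q :: "'a::real_normed_vector"
  assumes "dist q p \<le> 1" shows "pw q \<le> 2 * pw p"
proof -
  have "norm q \<le> norm (q - p) + norm p" using norm_triangle_ineq[of "q - p" p] by simp
  moreover have "norm (q - p) \<le> 1" using assms by (simp add: dist_norm)
  moreover have "0 \<le> norm p" by simp
  ultimately show ?thesis unfolding pw_def by argo
qed

lemma wJ_continuous:
  fixes b :: "(real^'d) \<times> (real^'d) \<Rightarrow> complex"
  assumes b: "continuous_on UNIV b" "\<And>z. norm (b z) \<le> C * pw z ^ n" "C \<ge> 0" and h: "schwartz h"
  shows "continuous_on UNIV (\<lambda>p. wJ b h (fst p) (snd p))"
  unfolding wJ_def
proof (rule continuous_on_integral_dominated)
  let ?D = "DIM(real^'d) + 2"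
  obtain H where H: "H > 0" "\<And>y. norm (h y) \<le> H / pw y ^ (n + ?D)" using schwartz_bound[OF h] by blast
  show "continuous_on UNIV (\<lambda>p. exp (- (\<i> * of_real (y \<bullet> snd p))) * (b ((1/2) *\<^sub>R (fst p + y), snd p) * h y))" for y
    by (rule wJ_integrand_continuous(2)[OF b(1) schwartz_cont[OF h]])
  show "(\<lambda>y. exp (- (\<i> * of_real (y \<bullet> snd p))) * (b ((1/2) *\<^sub>R (fst p + y), snd p) * h y)) \<in> borel_measurable lborel" for p
    unfolding measurable_lborel2
    by (rule borel_measurable_continuous_onI[OF wJ_integrand_continuous(1)[OF b(1) schwartz_cont[OF h]]])
  show "\<exists>Q. integrable lborel Q \<and> (\<forall>q y. dist q p \<le> 1 \<longrightarrow>
      norm (exp (- (\<i> * of_real (y \<bullet> snd q))) * (b ((1/2) *\<^sub>R (fst q + y), snd q) * h y)) \<le> Q y)" for p :: "(real^'d) \<times> (real^'d)"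
  proof (intro exI conjI allI impI)
    show "integrable lborel (\<lambda>y::real^'d. (C * H * (2 * pw p) ^ n * (2 * pw p) ^ n) * (1 / pw y ^ ?D))"
      by (intro integrable_mult_right integrable_pw) simp
    fix q :: "(real^'d) \<times> (real^'d)" and y :: "real^'d" assume "dist q p \<le> 1"
    then have q: "pw q \<le> 2 * pw p" by (rule pw_near)
    have "C * H * pw (fst q) ^ n * pw (snd q) ^ n \<le> C * H * (2 * pw p) ^ n * (2 * pw p) ^ n"
      using b(3) H(1) order_trans[OF pw_fst_snd_le(1) q] order_trans[OF pw_fst_snd_le(2) q]
      by (intro mult_mono power_mono) auto
    then have "(C * H * pw (fst q) ^ n * pw (snd q) ^ n) / pw y ^ ?D \<le> (C * H * (2 * pw p) ^ n * (2 * pw p) ^ n) / pw y ^ ?D"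
      by (rule divide_right_mono) simp
    then show "norm (exp (- (\<i> * of_real (y \<bullet> snd q))) * (b ((1/2) *\<^sub>R (fst q + y), snd q) * h y))
        \<le> (C * H * (2 * pw p) ^ n * (2 * pw p) ^ n) * (1 / pw y ^ ?D)"
      using wJ_integrand_bound[OF b(2,3) H(2), of y "snd q" "fst q"] by simp
  qed
qed

text \<open>The amplitude itself contains \<open>\<xi>\<close>, so \<open>s\<close> and
  \<open>\<xi>\<close> are frozen in it as an index, and the Fourier transform is evaluated at the
  same \<open>\<xi>\<close> only at the end. The factor \<open>c\<close> makes the amplitudes
  uniform in the index; the \<open>n\<close> powers of \<open>pw \<xi>\<close> that this costs are
  recovered by asking for \<open>n + k\<close> powers of decay.\<close>

lemma wJ_decay:
  fixes B :: "'i \<Rightarrow> (real^'d) \<times> (real^'d) \<Rightarrow> complex"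
  assumes B: "all_derivs (symb n) B" and h: "schwartz h"
  shows "\<exists>C>0. \<forall>i s \<xi>. norm (wJ (B i) h s \<xi>) \<le> C * pw s ^ n / pw \<xi> ^ k"
proof -
  define c where "c p = 1 / (pw (fst (snd p)) ^ n * pw (snd (snd p)) ^ n)" for p :: "'i \<times> (real^'d) \<times> (real^'d)"
  define P where "P p y = of_real (c p) * B (fst p) ((1/2) *\<^sub>R (fst (snd p) + y), snd (snd p))" for p :: "'i \<times> (real^'d) \<times> (real^'d)" and y
  have c0: "c p > 0" for p unfolding c_def by simp
  have P: "all_derivs (polyg (\<lambda>_. 0)) P"
    unfolding P_def
  proof (rule all_derivs_transform[OF B, where H="\<lambda>B p y. of_real (c p) * B (fst p) ((1/2) *\<^sub>R (fst (snd p) + y), snd (snd p))"])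
    fix F :: "'i \<Rightarrow> (real^'d) \<times> (real^'d) \<Rightarrow> complex" assume F: "symb n F"
    obtain C where C: "C > 0" "\<And>i x. norm (F i x) \<le> C * pw x ^ n" using symb_bound[OF F] by blast
    have Fc: "continuous_on UNIV (F i)" for i using F by (simp add: symb_def)
    have "norm (of_real (c p) * F (fst p) ((1/2) *\<^sub>R (fst (snd p) + y), snd (snd p))) \<le> C * pw (0::real) ^ n * pw y ^ n" for p y
    proof -
      have "c p * norm (F (fst p) ((1/2) *\<^sub>R (fst (snd p) + y), snd (snd p))) \<le> c p * (C * pw (fst (snd p)) ^ n * pw y ^ n * pw (snd (snd p)) ^ n)"
        using C c0[of p] by (intro mult_left_mono symb_midpoint_bound) auto
      also have "\<dots> = C * pw y ^ n" unfolding c_def by (simp add: field_simps)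
      finally show ?thesis using c0[of p] by (simp add: norm_mult)
    qed
    moreover have "continuous_on UNIV (\<lambda>y. of_real (c p) * F (fst p) ((1/2) *\<^sub>R (fst (snd p) + y), snd (snd p)))" for p
      by (intro continuous_intros continuous_on_compose2[OF Fc]) auto
    ultimately show "polyg (\<lambda>_. 0) (\<lambda>p y. of_real (c p) * F (fst p) ((1/2) *\<^sub>R (fst (snd p) + y), snd (snd p)))"
      unfolding polyg_def by blast
  next
    fix a :: complex and F :: "'i \<times> (real^'d) \<times> (real^'d) \<Rightarrow> real^'d \<Rightarrow> complex" assume "polyg (\<lambda>_. 0) F"
    from polyg_mult[OF polyg_const this] show "polyg (\<lambda>_. 0) (\<lambda>i x. a * F i x)" .
  next
    fix e :: "real^'d" assume e: "e \<in> Basis"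
    have "has_pd e (\<lambda>y. of_real (c p) * F (fst p) ((1/2) *\<^sub>R (fst (snd p) + y), snd (snd p)))
        (\<lambda>y. of_real (1/2) * (of_real (c p) * F' (fst p) ((1/2) *\<^sub>R (fst (snd p) + y), snd (snd p))))"
      if "\<forall>i. has_pd (e, 0) (F i) (F' i)" for F F' and p :: "'i \<times> (real^'d) \<times> (real^'d)"
      using has_pd_cmult[OF has_pd_compose[where c="1/2" and L="\<lambda>y. ((1/2) *\<^sub>R (fst (snd p) + y), snd (snd p))", OF that[rule_format, of "fst p"]], of e "of_real (c p)"]
      by (simp add: algebra_simps)
    then show "\<exists>b'\<in>Basis. \<exists>d. \<forall>F F'. (\<forall>i. has_pd b' (F i) (F' i)) \<longrightarrow>
        (\<forall>j. has_pd e (\<lambda>y. of_real (c j) * F (fst j) ((1/2) *\<^sub>R (fst (snd j) + y), snd (snd j)))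
           (\<lambda>x. d * (of_real (c j) * F' (fst j) ((1/2) *\<^sub>R (fst (snd j) + x), snd (snd j)))))"
      using e by (intro bexI[of _ "(e, 0)"] exI[of _ "of_real (1/2)"]) (auto simp: Basis_prod_def)
  qed
  have hc: "uschwartz (\<lambda>_::'i \<times> (real^'d) \<times> (real^'d). h)"
    using h[unfolded schwartz_iff] by (rule all_derivs_map[where H="\<lambda>F _. F ()"]) (auto simp: rapid_0_iff)
  have "\<exists>C M. \<forall>p \<xi>. pw (0::real) ^ 0 * pw \<xi> ^ (n + k) * norm (fourier (\<lambda>y. h y * P p y) \<xi>) \<le> C * pw (0::real) ^ M"
    by (rule fourier_rapid[OF all_derivs_rapid_polyg[OF hc P], of 0 "n + k"])
  then obtain C where C: "\<And>p \<xi>. pw \<xi> ^ (n + k) * norm (fourier (\<lambda>y. h y * P p y) \<xi>) \<le> C" by auto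
  have "norm (wJ (B i) h s \<xi>) \<le> max C 1 * pw s ^ n / pw \<xi> ^ k" for i s \<xi>
  proof -
    have "fourier (\<lambda>y. h y * P (i, s, \<xi>) y) \<xi> = of_real (c (i, s, \<xi>)) * wJ (B i) h s \<xi>"
      unfolding fourier_def wJ_def P_def integral_mult_right_zero[symmetric]
      by (intro Bochner_Integration.integral_cong refl) (simp add: mult_ac)
    then have "norm (fourier (\<lambda>y. h y * P (i, s, \<xi>) y) \<xi>) = c (i, s, \<xi>) * norm (wJ (B i) h s \<xi>)"
      using c0[of "(i, s, \<xi>)"] by (simp add: norm_mult)
    with C[of \<xi> "(i, s, \<xi>)"] have "pw \<xi> ^ (n + k) * (c (i, s, \<xi>) * norm (wJ (B i) h s \<xi>)) \<le> max C 1" by simp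
    then have "(pw \<xi> ^ k / pw s ^ n) * norm (wJ (B i) h s \<xi>) \<le> max C 1"
      unfolding c_def by (simp add: power_add field_simps)
    then show ?thesis by (simp add: field_simps)
  qed
  then show ?thesis by (intro exI[of _ "max C 1"]) auto
qed

lemma wJ_pd_s:
  fixes b b1 :: "(real^'d) \<times> (real^'d) \<Rightarrow> complex"
  assumes pd: "has_pd (e, 0) b b1" and e: "e \<in> Basis"
    and b: "continuous_on UNIV b" "\<And>z. norm (b z) \<le> C * pw z ^ n" "C \<ge> 0"
    and b1: "continuous_on UNIV b1" "\<And>z. norm (b1 z) \<le> C * pw z ^ n" and h: "schwartz h"
  shows "has_pd e (\<lambda>s. wJ b h s \<xi>) (\<lambda>s. (1/2) * wJ b1 h s \<xi>)"
proof -
  let ?D = "DIM(real^'d) + 2"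
  let ?E = "\<lambda>y. exp (- (\<i> * of_real (y \<bullet> \<xi>)))"
  obtain H where H: "H > 0" "\<And>y. norm (h y) \<le> H / pw y ^ (n + ?D)" using schwartz_bound[OF h] by blast
  have "has_pd e (\<lambda>s. \<integral>y. ?E y * (b ((1/2) *\<^sub>R (s + y), \<xi>) * h y) \<partial>lborel)
      (\<lambda>s. \<integral>y. (1/2) * (?E y * (b1 ((1/2) *\<^sub>R (s + y), \<xi>) * h y)) \<partial>lborel)"
  proof (rule has_pd_integral)
    show "has_pd e (\<lambda>s. ?E y * (b ((1/2) *\<^sub>R (s + y), \<xi>) * h y)) (\<lambda>s. (1/2) * (?E y * (b1 ((1/2) *\<^sub>R (s + y), \<xi>) * h y)))" for y
      using has_pd_cmult[OF has_pd_compose[where c="1/2" and L="\<lambda>s. ((1/2) *\<^sub>R (s + y), \<xi>)", OF pd], of e "?E y * h y"]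
      by (simp add: algebra_simps)
    show "integrable lborel (\<lambda>y. ?E y * (b ((1/2) *\<^sub>R (s + y), \<xi>) * h y))" for s
      by (rule wJ_integrable[OF b h])
    show "(\<lambda>y. (1/2) * (?E y * (b1 ((1/2) *\<^sub>R (s + y), \<xi>) * h y))) \<in> borel_measurable lborel" for s
      unfolding measurable_lborel2
      by (intro borel_measurable_continuous_onI continuous_on_mult continuous_on_const wJ_integrand_continuous(1)[OF b1(1) schwartz_cont[OF h], of \<xi> s, unfolded mult.assoc[symmetric]]
           wJ_integrand_continuous(1)[OF b1(1) schwartz_cont[OF h]])
    show "\<exists>Q. integrable lborel Q \<and> (\<forall>t y. \<bar>t\<bar> \<le> 1 \<longrightarrow>
        norm ((1/2) * (?E y * (b1 ((1/2) *\<^sub>R ((s + t *\<^sub>R e) + y), \<xi>) * h y))) \<le> Q y)" for s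
    proof (intro exI conjI allI impI)
      show "integrable lborel (\<lambda>y::real^'d. (C * H * (2 * pw s) ^ n * pw \<xi> ^ n) * (1 / pw y ^ ?D))"
        by (intro integrable_mult_right integrable_pw) simp
      fix t :: real and y :: "real^'d" assume t: "\<bar>t\<bar> \<le> 1"
      have "dist (s + t *\<^sub>R e) s \<le> 1" using t e by (simp add: dist_norm)
      then have q: "pw (s + t *\<^sub>R e) \<le> 2 * pw s" by (rule pw_near)
      have "C * H * pw (s + t *\<^sub>R e) ^ n * pw \<xi> ^ n \<le> C * H * (2 * pw s) ^ n * pw \<xi> ^ n"
        using b(3) H(1) q by (intro mult_mono power_mono) auto
      then have "(C * H * pw (s + t *\<^sub>R e) ^ n * pw \<xi> ^ n) / pw y ^ ?D \<le> (C * H * (2 * pw s) ^ n * pw \<xi> ^ n) / pw y ^ ?D"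
        by (rule divide_right_mono) simp
      then have "norm (?E y * (b1 ((1/2) *\<^sub>R ((s + t *\<^sub>R e) + y), \<xi>) * h y)) \<le> (C * H * (2 * pw s) ^ n * pw \<xi> ^ n) * (1 / pw y ^ ?D)"
        using wJ_integrand_bound[OF b1(2) b(3) H(2), of y \<xi> "s + t *\<^sub>R e"] by simp
      moreover have "norm ((1/2) * x) \<le> norm x" for x :: complex by (simp add: norm_mult)
      ultimately show "norm ((1/2) * (?E y * (b1 ((1/2) *\<^sub>R ((s + t *\<^sub>R e) + y), \<xi>) * h y))) \<le> (C * H * (2 * pw s) ^ n * pw \<xi> ^ n) * (1 / pw y ^ ?D)"
        by (meson order_trans)
    qed
  qed
  then show ?thesis unfolding wJ_def by (simp only: integral_mult_right_zero)
qed

lemma wJ_pd_xi: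
  fixes b b2 :: "(real^'d) \<times> (real^'d) \<Rightarrow> complex"
  assumes pd: "has_pd (0, e) b b2" and e: "e \<in> Basis"
    and b: "continuous_on UNIV b" "\<And>z. norm (b z) \<le> C * pw z ^ n" "C \<ge> 0"
    and b2: "continuous_on UNIV b2" "\<And>z. norm (b2 z) \<le> C * pw z ^ n" and h: "schwartz h"
  shows "has_pd e (wJ b h s) (\<lambda>\<xi>. wJ b2 h s \<xi> - \<i> * wJ b (\<lambda>y. of_real (y \<bullet> e) * h y) s \<xi>)"
proof -
  let ?D = "DIM(real^'d) + 2"
  let ?E = "\<lambda>\<xi> y. exp (- (\<i> * of_real (y \<bullet> \<xi>)))"
  let ?h = "\<lambda>y. of_real (y \<bullet> e) * h y"
  have sh: "schwartz ?h" by (rule schwartz_inner_mult[OF h])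
  obtain H where H: "H > 0" "\<And>y. norm (h y) \<le> H / pw y ^ (n + ?D)" using schwartz_bound[OF h] by blast
  obtain H' where H': "H' > 0" "\<And>y. norm (?h y) \<le> H' / pw y ^ (n + ?D)" using schwartz_bound[OF sh] by blast
  let ?I' = "\<lambda>\<xi> y. ?E \<xi> y * (b2 ((1/2) *\<^sub>R (s + y), \<xi>) * h y) - \<i> * (?E \<xi> y * (b ((1/2) *\<^sub>R (s + y), \<xi>) * ?h y))"
  have "has_pd e (\<lambda>\<xi>. \<integral>y. ?E \<xi> y * (b ((1/2) *\<^sub>R (s + y), \<xi>) * h y) \<partial>lborel) (\<lambda>\<xi>. \<integral>y. ?I' \<xi> y \<partial>lborel)"
  proof (rule has_pd_integral)
    fix y
    have 1: "has_pd e (\<lambda>\<xi>. b ((1/2) *\<^sub>R (s + y), \<xi>)) (\<lambda>\<xi>. b2 ((1/2) *\<^sub>R (s + y), \<xi>))"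
      using has_pd_compose[where c=1 and L="\<lambda>\<xi>. ((1/2) *\<^sub>R (s + y), \<xi>)", OF pd, of e] by simp
    have 2: "has_pd e (\<lambda>\<xi>. ?E \<xi> y) (\<lambda>\<xi>. - (\<i> * of_real (e \<bullet> y)) * ?E \<xi> y)"
      using has_pd_exp[of e "- y"] by (simp add: inner_commute)
    show "has_pd e (\<lambda>\<xi>. ?E \<xi> y * (b ((1/2) *\<^sub>R (s + y), \<xi>) * h y)) (\<lambda>\<xi>. ?I' \<xi> y)"
      using has_pd_cmult[OF has_pd_mult[OF 2 1], of "h y"] by (simp add: algebra_simps inner_commute)
  next
    show "integrable lborel (\<lambda>y. ?E \<xi> y * (b ((1/2) *\<^sub>R (s + y), \<xi>) * h y))" for \<xi>
      by (rule wJ_integrable[OF b h])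
    show "(\<lambda>y. ?I' \<xi> y) \<in> borel_measurable lborel" for \<xi>
      unfolding measurable_lborel2
      by (intro borel_measurable_continuous_onI continuous_on_diff continuous_on_mult[OF continuous_on_const]
            wJ_integrand_continuous(1)[OF b2(1) schwartz_cont[OF h]] wJ_integrand_continuous(1)[OF b(1) schwartz_cont[OF sh]])
    show "\<exists>Q. integrable lborel Q \<and> (\<forall>t y. \<bar>t\<bar> \<le> 1 \<longrightarrow> norm (?I' (\<xi> + t *\<^sub>R e) y) \<le> Q y)" for \<xi>
    proof (intro exI conjI allI impI)
      show "integrable lborel (\<lambda>y::real^'d. (C * (H + H') * pw s ^ n * (2 * pw \<xi>) ^ n) * (1 / pw y ^ ?D))"
        by (intro integrable_mult_right integrable_pw) simp
      fix t :: real and y :: "real^'d" assume t: "\<bar>t\<bar> \<le> 1"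
      have "dist (\<xi> + t *\<^sub>R e) \<xi> \<le> 1" using t e by (simp add: dist_norm)
      then have q: "pw (\<xi> + t *\<^sub>R e) \<le> 2 * pw \<xi>" by (rule pw_near)
      have "norm (?I' (\<xi> + t *\<^sub>R e) y) \<le> norm (?E (\<xi> + t *\<^sub>R e) y * (b2 ((1/2) *\<^sub>R (s + y), \<xi> + t *\<^sub>R e) * h y))
          + norm (\<i> * (?E (\<xi> + t *\<^sub>R e) y * (b ((1/2) *\<^sub>R (s + y), \<xi> + t *\<^sub>R e) * ?h y)))"
        by (rule norm_triangle_ineq4)
      also have "\<dots> \<le> (C * H * pw s ^ n * pw (\<xi> + t *\<^sub>R e) ^ n) / pw y ^ ?D + (C * H' * pw s ^ n * pw (\<xi> + t *\<^sub>R e) ^ n) / pw y ^ ?D"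
        unfolding norm_mult[of \<i>] norm_ii mult_1
        by (intro add_mono wJ_integrand_bound[OF b2(2) b(3) H(2)] wJ_integrand_bound[OF b(2,3) H'(2)])
      also have "\<dots> = (C * (H + H') * pw s ^ n * pw (\<xi> + t *\<^sub>R e) ^ n) / pw y ^ ?D"
        unfolding add_divide_distrib[symmetric] by (simp only: distrib_left distrib_right)
      also have "\<dots> \<le> (C * (H + H') * pw s ^ n * (2 * pw \<xi>) ^ n) / pw y ^ ?D"
        using b(3) H(1) H'(1) q by (intro divide_right_mono mult_mono power_mono) auto
      finally show "norm (?I' (\<xi> + t *\<^sub>R e) y) \<le> (C * (H + H') * pw s ^ n * (2 * pw \<xi>) ^ n) * (1 / pw y ^ ?D)" by simp
    qed
  qed
  moreover have "(\<integral>y. ?I' \<xi> y \<partial>lborel) = wJ b2 h s \<xi> - \<i> * wJ b ?h s \<xi>" for \<xi>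
    unfolding wJ_def integral_mult_right_zero[symmetric]
    by (rule Bochner_Integration.integral_diff[OF wJ_integrable[OF b2 b(3) h] integrable_mult_right[OF wJ_integrable[OF b sh]]])
  ultimately show ?thesis unfolding wJ_def[abs_def] by simp
qed

lemma all_derivs_symb_D:
  assumes "all_derivs (symb n) B"
  obtains C where "C > 0" "\<And>i. continuous_on UNIV (B i)" "\<And>i x. norm (B i x) \<le> C * pw x ^ n"
proof -
  have s: "symb n B" by (rule all_derivs_base[OF assms])
  obtain C where "C > 0" "\<And>i x. norm (B i x) \<le> C * pw x ^ n" using symb_bound[OF s] by blast
  with s that show ?thesis unfolding symb_def by blast
qed

lemma wJ_symb_continuous:
  fixes B :: "'i \<Rightarrow> (real^'d) \<times> (real^'d) \<Rightarrow> complex"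
  assumes B: "all_derivs (symb n) B" and h: "schwartz h"
  shows "continuous_on UNIV (\<lambda>p. wJ (B i) h (fst p) (snd p))" "continuous_on UNIV (wJ (B i) h s)" "continuous_on UNIV (\<lambda>s. wJ (B i) h s \<xi>)"
proof -
  obtain C where C: "C > 0" "\<And>i. continuous_on UNIV (B i)" "\<And>i x. norm (B i x) \<le> C * pw x ^ n" using all_derivs_symb_D[OF B] by blast
  show c: "continuous_on UNIV (\<lambda>p. wJ (B i) h (fst p) (snd p))"
    using C(1) by (intro wJ_continuous[OF C(2,3) _ h]) simp
  show "continuous_on UNIV (wJ (B i) h s)" "continuous_on UNIV (\<lambda>s. wJ (B i) h s \<xi>)"
    using continuous_on_slice[OF c] by auto
qed

lemma wW_integrable:
  fixes B :: "'i \<Rightarrow> (real^'d) \<times> (real^'d) \<Rightarrow> complex"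
  assumes B: "all_derivs (symb n) B" and h: "schwartz h"
  shows "integrable lborel (\<lambda>\<xi>. exp (\<i> * of_real (s \<bullet> \<xi>)) * wJ (B i) h s \<xi>)"
proof -
  obtain C where C: "\<And>i s \<xi>. norm (wJ (B i) h s \<xi>) \<le> C * pw s ^ n / pw \<xi> ^ (DIM(real^'d) + 2)" using wJ_decay[OF B h] by blast
  have "continuous_on UNIV (\<lambda>\<xi>. exp (\<i> * of_real (s \<bullet> \<xi>)) * wJ (B i) h s \<xi>)"
    by (intro continuous_intros wJ_symb_continuous(2)[OF B h])
  moreover have "norm (exp (\<i> * of_real (s \<bullet> \<xi>)) * wJ (B i) h s \<xi>) \<le> (C * pw s ^ n) / pw \<xi> ^ (DIM(real^'d) + 2)" for \<xi>
    unfolding norm_mult norm_cis mult_1 by (rule C)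
  ultimately show ?thesis by (intro integrable_bound_pw[OF borel_measurable_continuous_onI _ order_refl])
qed

lemma wW_bound:
  fixes B :: "'i \<Rightarrow> (real^'d) \<times> (real^'d) \<Rightarrow> complex"
  assumes B: "all_derivs (symb n) B" and h: "schwartz h"
  shows "\<exists>C. \<forall>i s. norm (wW (B i) h s) \<le> C * pw s ^ n"
proof -
  obtain C where C: "\<And>i s \<xi>. norm (wJ (B i) h s \<xi>) \<le> C * pw s ^ n / pw \<xi> ^ (DIM(real^'d) + 2)" using wJ_decay[OF B h] by blast
  have "norm (wW (B i) h s) \<le> (C * pw s ^ n) * pw_int TYPE(real^'d)" for i s
    unfolding wW_def
    by (rule integral_bound_pw) (use C in \<open>simp only: norm_mult norm_cis mult_1\<close>)
  then have "norm (wW (B i) h s) \<le> (C * pw_int TYPE(real^'d)) * pw s ^ n" for i s by (simp only: mult_ac)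
  then show ?thesis by blast
qed

lemma wJ_dominated:
  fixes B :: "'i \<Rightarrow> (real^'d) \<times> (real^'d) \<Rightarrow> complex"
  assumes B: "all_derivs (symb n) B" and h: "schwartz h"
  shows "\<exists>Q. integrable lborel Q \<and> (\<forall>q \<xi>. dist q s \<le> 1 \<longrightarrow> norm (exp (\<i> * of_real (q \<bullet> \<xi>)) * wJ (B i) h q \<xi>) \<le> Q \<xi>)"
proof -
  let ?D = "DIM(real^'d) + 2"
  obtain C where C: "C > 0" "\<And>i s \<xi>. norm (wJ (B i) h s \<xi>) \<le> C * pw s ^ n / pw \<xi> ^ ?D" using wJ_decay[OF B h] by blast
  show ?thesis
  proof (intro exI conjI allI impI)
    show "integrable lborel (\<lambda>\<xi>::real^'d. (C * (2 * pw s) ^ n) * (1 / pw \<xi> ^ ?D))"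
      by (intro integrable_mult_right integrable_pw) simp
    fix q \<xi> :: "real^'d" assume "dist q s \<le> 1"
    then have q: "pw q \<le> 2 * pw s" by (rule pw_near)
    have "C * pw q ^ n / pw \<xi> ^ ?D \<le> C * (2 * pw s) ^ n / pw \<xi> ^ ?D"
      using C(1) q by (intro divide_right_mono mult_left_mono power_mono) auto
    with C(2)[of i q \<xi>] have "norm (wJ (B i) h q \<xi>) \<le> (C * (2 * pw s) ^ n) * (1 / pw \<xi> ^ ?D)" by simp
    then show "norm (exp (\<i> * of_real (q \<bullet> \<xi>)) * wJ (B i) h q \<xi>) \<le> (C * (2 * pw s) ^ n) * (1 / pw \<xi> ^ ?D)"
      by (simp only: norm_mult norm_cis mult_1)
  qed
qed

lemma wW_continuous:
  fixes B :: "'i \<Rightarrow> (real^'d) \<times> (real^'d) \<Rightarrow> complex"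
  assumes B: "all_derivs (symb n) B" and h: "schwartz h"
  shows "continuous_on UNIV (wW (B i) h)"
  unfolding wW_def[abs_def]
proof (rule continuous_on_integral_dominated)
  show "continuous_on UNIV (\<lambda>s. exp (\<i> * of_real (s \<bullet> \<xi>)) * wJ (B i) h s \<xi>)" for \<xi>
    by (intro continuous_intros wJ_symb_continuous(3)[OF B h])
  show "(\<lambda>\<xi>. exp (\<i> * of_real (s \<bullet> \<xi>)) * wJ (B i) h s \<xi>) \<in> borel_measurable lborel" for s
    using wW_integrable[OF B h] by (rule borel_measurable_integrable)
qed (rule wJ_dominated[OF B h])

text \<open>The exponential brings down a factor linear in the frequency, which is absorbed into the
  symbol; the chain rule at the midpoint contributes half a derivative of \<open>B\<close>. The
  order rises by one, but the result is again a Weyl integral of the same \<open>h\<close>.\<close>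

lemma wW_pd:
  fixes B :: "'i \<Rightarrow> (real^'d) \<times> (real^'d) \<Rightarrow> complex"
  assumes B: "all_derivs (symb n) B" and h: "schwartz h" and e: "e \<in> Basis"
  shows "\<exists>B'. all_derivs (symb (n + 1)) B' \<and> (\<forall>i. has_pd e (wW (B i) h) (wW (B' i) h))"
proof -
  have e0: "(e, 0) \<in> Basis" using e by (simp add: Basis_prod_def)
  obtain B1 where B1: "\<And>i. has_pd (e, 0) (B i) (B1 i)" "all_derivs (symb n) B1" using all_derivs_pd[OF B e0] by blast
  obtain C where C: "C > 0" "\<And>i. continuous_on UNIV (B i)" "\<And>i x. norm (B i x) \<le> C * pw x ^ n" using all_derivs_symb_D[OF B] by blast
  obtain C1 where C1: "C1 > 0" "\<And>i. continuous_on UNIV (B1 i)" "\<And>i x. norm (B1 i x) \<le> C1 * pw x ^ n" using all_derivs_symb_D[OF B1(2)] by blast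
  define Cm where "Cm = max C C1"
  have Cm: "Cm \<ge> 0" "norm (B i x) \<le> Cm * pw x ^ n" "norm (B1 i x) \<le> Cm * pw x ^ n" for i x
    using C C1 by (auto simp: Cm_def intro: order_trans[OF C(3)] order_trans[OF C1(3)] mult_right_mono)
  define B' where "B' i z = (\<i> * (of_real (z \<bullet> (0, e)) * B i z)) + (1/2) * B1 i z" for i z
  have "all_derivs (symb (1 + n)) (\<lambda>i z. of_real (z \<bullet> (0, e)) * B i z)"
    by (rule all_derivs_symb_mult[OF all_derivs_symb_inner B])
  then have B': "all_derivs (symb (n + 1)) B'"
    unfolding B'_def
    by (intro all_derivs_symb_add all_derivs_symb_cmult all_derivs_symb_mono[OF B1(2)]) (simp_all add: add.commute)
  have J': "wJ (B' i) h s \<xi> = \<i> * of_real (e \<bullet> \<xi>) * wJ (B i) h s \<xi> + (1/2) * wJ (B1 i) h s \<xi>" for i s \<xi>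
  proof -
    let ?E = "\<lambda>y. exp (- (\<i> * of_real (y \<bullet> \<xi>)))"
    have "wJ (B' i) h s \<xi> = (\<integral>y. (\<i> * of_real (e \<bullet> \<xi>)) * (?E y * (B i ((1/2) *\<^sub>R (s + y), \<xi>) * h y))
        + (1/2) * (?E y * (B1 i ((1/2) *\<^sub>R (s + y), \<xi>) * h y)) \<partial>lborel)"
      unfolding wJ_def B'_def by (intro Bochner_Integration.integral_cong refl) (simp add: algebra_simps inner_commute)
    also have "\<dots> = \<i> * of_real (e \<bullet> \<xi>) * wJ (B i) h s \<xi> + (1/2) * wJ (B1 i) h s \<xi>"
      unfolding wJ_def integral_mult_right_zero[symmetric]
      by (intro Bochner_Integration.integral_add integrable_mult_right wJ_integrable[OF C(2) Cm(2,1) h] wJ_integrable[OF C1(2) Cm(3,1) h])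
    finally show ?thesis .
  qed
  have "has_pd e (wW (B i) h) (wW (B' i) h)" for i
    unfolding wW_def[abs_def]
  proof (rule has_pd_integral)
    show "has_pd e (\<lambda>s. exp (\<i> * of_real (s \<bullet> \<xi>)) * wJ (B i) h s \<xi>) (\<lambda>s. exp (\<i> * of_real (s \<bullet> \<xi>)) * wJ (B' i) h s \<xi>)" for \<xi>
      using has_pd_mult[OF has_pd_exp[of e \<xi>] wJ_pd_s[OF B1(1) e C(2) Cm(2,1) C1(2) Cm(3) h, of i \<xi>]]
      unfolding J' by (simp add: algebra_simps)
    show "integrable lborel (\<lambda>\<xi>. exp (\<i> * of_real (s \<bullet> \<xi>)) * wJ (B i) h s \<xi>)" for s by (rule wW_integrable[OF B h])
    show "(\<lambda>\<xi>. exp (\<i> * of_real (s \<bullet> \<xi>)) * wJ (B' i) h s \<xi>) \<in> borel_measurable lborel" for s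
      using wW_integrable[OF B' h] by (rule borel_measurable_integrable)
    show "\<exists>Q. integrable lborel Q \<and> (\<forall>t \<xi>. \<bar>t\<bar> \<le> 1 \<longrightarrow>
        norm (exp (\<i> * of_real ((s + t *\<^sub>R e) \<bullet> \<xi>)) * wJ (B' i) h (s + t *\<^sub>R e) \<xi>) \<le> Q \<xi>)" for s
    proof -
      obtain Q where Q: "integrable lborel Q" "\<And>q \<xi>. dist q s \<le> 1 \<Longrightarrow> norm (exp (\<i> * of_real (q \<bullet> \<xi>)) * wJ (B' i) h q \<xi>) \<le> Q \<xi>"
        using wJ_dominated[OF B' h, of s i] by blast
      have "dist (s + t *\<^sub>R e) s \<le> 1" if "\<bar>t\<bar> \<le> 1" for t using that e by (simp add: dist_norm)
      with Q show ?thesis by blast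
    qed
  qed
  with B' show ?thesis by blast
qed

text \<open>A factor \<open>s \<bullet> e\<close> amounts to a frequency derivative of the
  exponential. Integration by parts moves it to \<open>wJ\<close>, where it multiplies
  \<open>h\<close> or differentiates the symbol. The order \<open>n\<close> does not change, so the
  step can be iterated for decay.\<close>

lemma wW_inner:
  fixes B :: "'i \<Rightarrow> (real^'d) \<times> (real^'d) \<Rightarrow> complex"
  assumes B: "all_derivs (symb n) B" and h: "schwartz h" and e: "e \<in> Basis"
  shows "\<exists>B2. all_derivs (symb n) B2 \<and> (\<forall>i s. of_real (s \<bullet> e) * wW (B i) h s =
     wW (B i) (\<lambda>y. of_real (y \<bullet> e) * h y) s + \<i> * wW (B2 i) h s)"
proof -
  have e0: "(0, e) \<in> Basis" using e by (simp add: Basis_prod_def)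
  obtain B2 where B2: "\<And>i. has_pd (0, e) (B i) (B2 i)" "all_derivs (symb n) B2" using all_derivs_pd[OF B e0] by blast
  obtain C where C: "C > 0" "\<And>i. continuous_on UNIV (B i)" "\<And>i x. norm (B i x) \<le> C * pw x ^ n" using all_derivs_symb_D[OF B] by blast
  obtain C2 where C2: "C2 > 0" "\<And>i. continuous_on UNIV (B2 i)" "\<And>i x. norm (B2 i x) \<le> C2 * pw x ^ n" using all_derivs_symb_D[OF B2(2)] by blast
  define Cm where "Cm = max C C2"
  have Cm: "Cm \<ge> 0" "norm (B i x) \<le> Cm * pw x ^ n" "norm (B2 i x) \<le> Cm * pw x ^ n" for i x
    using C C2 by (auto simp: Cm_def intro: order_trans[OF C(3)] order_trans[OF C2(3)] mult_right_mono)
  let ?h = "\<lambda>y. of_real (y \<bullet> e) * h y"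
  have sh: "schwartz ?h" by (rule schwartz_inner_mult[OF h])
  have "of_real (s \<bullet> e) * wW (B i) h s = wW (B i) ?h s + \<i> * wW (B2 i) h s" for i s
  proof -
    let ?E = "\<lambda>\<xi>. exp (\<i> * of_real (s \<bullet> \<xi>))"
    let ?F' = "\<lambda>\<xi>. (\<i> * of_real (s \<bullet> e)) * (?E \<xi> * wJ (B i) h s \<xi>) + (?E \<xi> * wJ (B2 i) h s \<xi> - \<i> * (?E \<xi> * wJ (B i) ?h s \<xi>))"
    have i1: "integrable lborel (\<lambda>\<xi>. (\<i> * of_real (s \<bullet> e)) * (?E \<xi> * wJ (B i) h s \<xi>))"
      by (intro integrable_mult_right wW_integrable[OF B h])
    have i2: "integrable lborel (\<lambda>\<xi>. ?E \<xi> * wJ (B2 i) h s \<xi>)" by (rule wW_integrable[OF B2(2) h])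
    have i3: "integrable lborel (\<lambda>\<xi>. \<i> * (?E \<xi> * wJ (B i) ?h s \<xi>))" by (intro integrable_mult_right wW_integrable[OF B sh])
    have "has_pd e ?E (\<lambda>\<xi>. \<i> * of_real (e \<bullet> s) * ?E \<xi>)" using has_pd_exp[of e s] by (simp add: inner_commute)
    from has_pd_mult[OF this wJ_pd_xi[OF B2(1) e C(2) Cm(2,1) C2(2) Cm(3) h, of i s]]
    have pd: "has_pd e (\<lambda>\<xi>. ?E \<xi> * wJ (B i) h s \<xi>) ?F'" by (simp add: algebra_simps inner_commute)
    have "(\<integral>\<xi>. ?F' \<xi> \<partial>lborel) = 0"
    proof (rule has_pd_integral_zero[OF pd])
      show "continuous_on UNIV ?F'"
        by (intro continuous_intros wJ_symb_continuous(2)[OF B h] wJ_symb_continuous(2)[OF B2(2) h] wJ_symb_continuous(2)[OF B sh])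
      show "integrable lborel (\<lambda>\<xi>. ?E \<xi> * wJ (B i) h s \<xi>)" by (rule wW_integrable[OF B h])
      show "integrable lborel ?F'" by (intro Bochner_Integration.integrable_add Bochner_Integration.integrable_diff i1 i2 i3)
    qed
    also have "(\<integral>\<xi>. ?F' \<xi> \<partial>lborel) = \<i> * of_real (s \<bullet> e) * wW (B i) h s + (wW (B2 i) h s - \<i> * wW (B i) ?h s)"
      unfolding wW_def Bochner_Integration.integral_add[OF i1 Bochner_Integration.integrable_diff[OF i2 i3]]
        Bochner_Integration.integral_diff[OF i2 i3] integral_mult_right_zero ..
    finally have "\<i> * (of_real (s \<bullet> e) * wW (B i) h s) = \<i> * (wW (B i) ?h s + \<i> * wW (B2 i) h s)"
      by (simp add: algebra_simps eq_neg_iff_add_eq_0)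
    then show ?thesis by (simp only: mult_cancel_left) simp
  qed
  with B2(2) show ?thesis by blast
qed

text \<open>One power at a time by \<open>wW_inner\<close>; the induction runs over \<open>B\<close>
  and \<open>h\<close> together because each step replaces one of them.\<close>

lemma wW_decay:
  fixes B :: "'i \<Rightarrow> (real^'d) \<times> (real^'d) \<Rightarrow> complex"
  assumes "all_derivs (symb n) B" and "schwartz h"
  shows "\<exists>C. \<forall>i s. pw s ^ k * norm (wW (B i) h s) \<le> C * pw s ^ n"
  using assms
proof (induction k arbitrary: B h)
  case 0
  then show ?case using wW_bound[of n B h] by simp
next
  case (Suc k)
  have "\<exists>C. \<forall>i s. pw s ^ k * (\<bar>e \<bullet> s\<bar> * norm (wW (B i) h s)) \<le> C * pw s ^ n" if e: "e \<in> Basis" for e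
  proof -
    let ?h = "\<lambda>y. of_real (y \<bullet> e) * h y"
    obtain B2 where B2: "all_derivs (symb n) B2" "\<And>i s. of_real (s \<bullet> e) * wW (B i) h s = wW (B i) ?h s + \<i> * wW (B2 i) h s"
      using wW_inner[OF Suc.prems e] by blast
    obtain C1 where C1: "\<And>i s. pw s ^ k * norm (wW (B i) ?h s) \<le> C1 * pw s ^ n"
      using Suc.IH[OF Suc.prems(1) schwartz_inner_mult[OF Suc.prems(2)], of e] by blast
    obtain C2 where C2: "\<And>i s. pw s ^ k * norm (wW (B2 i) h s) \<le> C2 * pw s ^ n"
      using Suc.IH[OF B2(1) Suc.prems(2)] by blast
    have "pw s ^ k * (\<bar>e \<bullet> s\<bar> * norm (wW (B i) h s)) \<le> (C1 + C2) * pw s ^ n" for i s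
    proof -
      have "\<bar>e \<bullet> s\<bar> * norm (wW (B i) h s) = norm (of_real (s \<bullet> e) * wW (B i) h s)" by (simp add: norm_mult inner_commute)
      also have "\<dots> \<le> norm (wW (B i) ?h s) + norm (wW (B2 i) h s)"
        unfolding B2(2) using norm_triangle_ineq[of "wW (B i) ?h s" "\<i> * wW (B2 i) h s"] by (simp add: norm_mult)
      finally have "pw s ^ k * (\<bar>e \<bullet> s\<bar> * norm (wW (B i) h s)) \<le> pw s ^ k * (norm (wW (B i) ?h s) + norm (wW (B2 i) h s))"
        by (rule mult_left_mono) simp
      also have "\<dots> \<le> C1 * pw s ^ n + C2 * pw s ^ n" unfolding distrib_left by (intro add_mono C1 C2)
      finally show ?thesis by (simp add: distrib_right)
    qed
    then show ?thesis by blast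
  qed
  then obtain C where C: "\<And>e i s. e \<in> Basis \<Longrightarrow> pw s ^ k * (\<bar>e \<bullet> s\<bar> * norm (wW (B i) h s)) \<le> C e * pw s ^ n"
    by metis
  obtain C0 where C0: "\<And>i s. pw s ^ k * norm (wW (B i) h s) \<le> C0 * pw s ^ n" using Suc.IH[OF Suc.prems] by blast
  have "pw s ^ Suc k * norm (wW (B i) h s) \<le> (C0 + (\<Sum>e\<in>Basis. C e)) * pw s ^ n" for i s
  proof -
    have "pw s ^ Suc k * norm (wW (B i) h s) = (pw s ^ k * norm (wW (B i) h s)) * pw s" by simp
    also have "\<dots> \<le> (pw s ^ k * norm (wW (B i) h s)) * (1 + (\<Sum>e\<in>Basis. \<bar>e \<bullet> s\<bar>))"
      by (intro mult_left_mono pw_le_sum_Basis) auto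
    also have "\<dots> = pw s ^ k * norm (wW (B i) h s) + (\<Sum>e\<in>Basis. pw s ^ k * (\<bar>e \<bullet> s\<bar> * norm (wW (B i) h s)))"
      by (simp add: distrib_left sum_distrib_left mult_ac)
    also have "\<dots> \<le> C0 * pw s ^ n + (\<Sum>e\<in>Basis. C e * pw s ^ n)"
      by (intro add_mono sum_mono C0 C)
    finally show ?thesis by (simp add: distrib_right sum_distrib_right)
  qed
  then show ?case by blast
qed

text \<open>Each derivative raises the order of the symbol, so the invariant class contains Weyl
  integrals of all orders.\<close>

lemma wW_uschwartz:
  fixes B :: "'i \<Rightarrow> (real^'d) \<times> (real^'d) \<Rightarrow> complex"
  assumes B: "all_derivs (symb n) B" and h: "schwartz h"
  shows "uschwartz (\<lambda>i. wW (B i) h)"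
proof (rule all_derivs_coinduct[where X="\<lambda>G. \<exists>n B. all_derivs (symb n) B \<and> G = (\<lambda>i. wW (B i) h)"])
  fix G :: "'i \<Rightarrow> real^'d \<Rightarrow> complex"
  assume "\<exists>n B. all_derivs (symb n) B \<and> G = (\<lambda>i. wW (B i) h)"
  then obtain n B where B: "all_derivs (symb n) B" and G: "G = (\<lambda>i. wW (B i) h)" by blast
  show "rapid (\<lambda>_. 0) (\<lambda>_. 0) G \<and> (\<forall>e\<in>Basis. \<exists>G'. (\<forall>i. has_pd e (G i) (G' i)) \<and>
      (\<exists>n B. all_derivs (symb n) B \<and> G' = (\<lambda>i. wW (B i) h)))"
  proof (intro conjI ballI)
    show "rapid (\<lambda>_. 0) (\<lambda>_. 0) G"
      unfolding rapid_0_iff G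
    proof (intro conjI allI wW_continuous[OF B h])
      fix k
      \<comment> \<open>The additional \<open>n\<close> powers absorb the growth of the bound in
        \<open>s\<close>.\<close>
      obtain C where C: "\<And>i s. pw s ^ (k + n) * norm (wW (B i) h s) \<le> C * pw s ^ n" using wW_decay[OF B h] by blast
      have "pw s ^ k * norm (wW (B i) h s) \<le> C" for i s
      proof -
        have "pw s ^ n * (pw s ^ k * norm (wW (B i) h s)) \<le> pw s ^ n * C" using C[of s i] by (simp add: power_add mult_ac)
        then show ?thesis by (simp add: mult_le_cancel_left_pos)
      qed
      then show "\<exists>C. \<forall>i x. pw x ^ k * norm (wW (B i) h x) \<le> C" by blast
    qed
    fix e :: "real^'d" assume "e \<in> Basis"
    from wW_pd[OF B h this] obtain B' where "all_derivs (symb (n + 1)) B'" "\<And>i. has_pd e (wW (B i) h) (wW (B' i) h)" by blast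
    then show "\<exists>G'. (\<forall>i. has_pd e (G i) (G' i)) \<and> (\<exists>n B. all_derivs (symb n) B \<and> G' = (\<lambda>i. wW (B i) h))"
      unfolding G by (intro exI[of _ "\<lambda>i. wW (B' i) h"] conjI exI[of _ "n + 1"] exI[of _ B']) auto
  qed
qed (use B in blast)

lemma weyl_uschwartz:
  fixes B :: "'i \<Rightarrow> (real^'d) \<times> (real^'d) \<Rightarrow> complex"
  assumes B: "all_derivs (symb n) B" and h: "schwartz h"
  shows "uschwartz (\<lambda>i. weyl (B i) h)"
proof -
  let ?c = "complex_of_real (inverse ((2 * pi) ^ CARD('d)))"
  have "uschwartz (\<lambda>i x. wW (B i) h x * ?c)"
    by (rule all_derivs_rapid_polyg[OF wW_uschwartz[OF B h] all_derivs_polyg_const])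
  moreover have "(\<lambda>i x. wW (B i) h x * ?c) = (\<lambda>i. weyl (B i) h)"
    by (intro ext) (simp add: weyl_wW mult.commute)
  ultimately show ?thesis by simp
qed

text \<open>For the symbol 1 the inner integral is the Fourier transform of \<open>f\<close>, so its
  quantization is the identity by Fourier inversion.\<close>

lemma weyl_complement:
  fixes \<psi> :: "(real^'d) \<times> (real^'d) \<Rightarrow> complex"
  assumes \<psi>: "all_derivs (symb n) (\<lambda>_::unit. \<psi>)" and f: "schwartz f"
  shows "weyl (\<lambda>z. 1 - \<psi> z) f s = f s - weyl \<psi> f s"
proof -
  let ?E = "\<lambda>\<xi> y. exp (- (\<i> * of_real (y \<bullet> \<xi>)))"
  obtain C where C: "C > 0" "\<And>i::unit. continuous_on UNIV \<psi>" "\<And>i::unit. \<And>x. norm (\<psi> x) \<le> C * pw x ^ n" using all_derivs_symb_D[OF \<psi>] by blast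
  have c0: "C \<ge> 0" using C(1) by simp
  have J: "wJ (\<lambda>z. 1 - \<psi> z) f s \<xi> = fourier f \<xi> - wJ \<psi> f s \<xi>" for \<xi>
  proof -
    have i1: "integrable lborel (\<lambda>y. ?E \<xi> y * f y)"
      using wJ_integrable[of "\<lambda>_. 1" 1 0 f \<xi> s] f by simp
    have i2: "integrable lborel (\<lambda>y. ?E \<xi> y * (\<psi> ((1/2) *\<^sub>R (s + y), \<xi>) * f y))"
      by (rule wJ_integrable[OF C(2,3) c0 f])
    have "wJ (\<lambda>z. 1 - \<psi> z) f s \<xi> = (\<integral>y. ?E \<xi> y * f y - ?E \<xi> y * (\<psi> ((1/2) *\<^sub>R (s + y), \<xi>) * f y) \<partial>lborel)"
      unfolding wJ_def by (intro Bochner_Integration.integral_cong refl) (simp add: algebra_simps)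
    also have "\<dots> = fourier f \<xi> - wJ \<psi> f s \<xi>"
      unfolding fourier_def wJ_def by (rule Bochner_Integration.integral_diff[OF i1 i2])
    finally show ?thesis .
  qed
  have i1: "integrable lborel (\<lambda>\<xi>. exp (\<i> * of_real (s \<bullet> \<xi>)) * fourier f \<xi>)"
  proof (rule Bochner_Integration.integrable_bound[OF integrable_norm[OF fourier_schwartz_bound(2)[OF f]]])
    show "(\<lambda>\<xi>. exp (\<i> * of_real (s \<bullet> \<xi>)) * fourier f \<xi>) \<in> borel_measurable lborel"
      unfolding measurable_lborel2
      by (intro borel_measurable_continuous_onI continuous_intros fourier_continuous schwartz_integrable f)
  qed (simp add: norm_mult)
  have i2: "integrable lborel (\<lambda>\<xi>. exp (\<i> * of_real (s \<bullet> \<xi>)) * wJ \<psi> f s \<xi>)"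
    by (rule wW_integrable[OF \<psi> f])
  have "wW (\<lambda>z. 1 - \<psi> z) f s = (\<integral>\<xi>. exp (\<i> * of_real (s \<bullet> \<xi>)) * fourier f \<xi> - exp (\<i> * of_real (s \<bullet> \<xi>)) * wJ \<psi> f s \<xi> \<partial>lborel)"
    unfolding wW_def J by (simp only: right_diff_distrib)
  also have "\<dots> = of_real ((2 * pi) ^ CARD('d)) * f s - wW \<psi> f s"
    unfolding wW_def schwartz_fourier_inversion[OF f, symmetric] by (rule Bochner_Integration.integral_diff[OF i1 i2])
  finally have "weyl (\<lambda>z. 1 - \<psi> z) f s = of_real (inverse ((2 * pi) ^ CARD('d))) * (of_real ((2 * pi) ^ CARD('d)) * f s) - weyl \<psi> f s"
    unfolding weyl_wW by (simp only: right_diff_distrib)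
  also have "complex_of_real (inverse ((2 * pi) ^ CARD('d))) * (of_real ((2 * pi) ^ CARD('d)) * f s) = f s"
    unfolding mult.assoc[symmetric] of_real_mult[symmetric] by (subst left_inverse) auto
  finally show ?thesis .
qed

section \<open>Transposition and phase-space covariance\<close>

lemma weyl_cmult: "weyl (\<lambda>z. c * b z) h s = c * weyl b h s"
proof -
  have "wJ (\<lambda>z. c * b z) h s \<xi> = c * wJ b h s \<xi>" for \<xi>
    unfolding wJ_def integral_mult_right_zero[symmetric] by (intro Bochner_Integration.integral_cong refl) (simp add: mult_ac)
  then have "wW (\<lambda>z. c * b z) h s = c * wW b h s"
    unfolding wW_def integral_mult_right_zero[symmetric] by (intro Bochner_Integration.integral_cong refl) (simp add: mult_ac)
  then show ?thesis by (simp add: weyl_wW mult_ac)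
qed

lemma all_derivs_symb_reflect:
  fixes \<psi> :: "(real^'d) \<times> (real^'d) \<Rightarrow> complex"
  assumes "all_derivs (symb n) (\<lambda>_::unit. b)"
  shows "all_derivs (symb n) (\<lambda>_::unit. \<lambda>z::(real^'d) \<times> (real^'d). b (fst z, - snd z))"
proof (rule all_derivs_transform[OF assms, where H="\<lambda>F _ z. F () (fst z, - snd z)"])
  fix F :: "unit \<Rightarrow> (real^'d) \<times> (real^'d) \<Rightarrow> complex" assume F: "symb n F"
  obtain C where C0: "C > 0" and C: "\<And>i x. norm (F i x) \<le> C * pw x ^ n" by (rule symb_bound[OF F]) (rule that)
  have "norm (F () (fst z, - snd z)) \<le> C * pw z ^ n" for z
    using C[of "()" "(fst z, - snd z)"] by (simp add: pw_def norm_prod_def)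
  moreover have c: "continuous_on UNIV (F ())" using F by (simp add: symb_def)
  then have "continuous_on UNIV (\<lambda>z. F () (fst z, - snd z))"
    by (rule continuous_on_compose2) (auto intro!: continuous_intros)
  ultimately show "symb n (\<lambda>_::unit. \<lambda>z. F () (fst z, - snd z))" unfolding symb_def by blast
next
  fix c and F :: "unit \<Rightarrow> (real^'d) \<times> (real^'d) \<Rightarrow> complex" assume "symb n F"
  from symb_mult[OF symb_const this] show "symb n (\<lambda>i x. c * F i x)" by simp
next
  fix e :: "(real^'d) \<times> (real^'d)" assume e: "e \<in> Basis"
  define c :: real where "c = (if snd e = 0 then 1 else - 1)"
  have "has_pd e (\<lambda>z. F () (fst z, - snd z)) (\<lambda>z. of_real c * F' () (fst z, - snd z))"
    if F: "\<forall>i. has_pd e (F i) (F' i)" for F F' :: "unit \<Rightarrow> (real^'d) \<times> (real^'d) \<Rightarrow> complex"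
  proof (rule has_pd_compose[OF F[rule_format]])
    show "(fst (x + t *\<^sub>R e), - snd (x + t *\<^sub>R e)) = (fst x, - snd x) + (c * t) *\<^sub>R e" for x t
      using e by (auto simp: c_def Basis_prod_def prod_eq_iff)
  qed
  with e show "\<exists>b'\<in>Basis. \<exists>c. \<forall>F F'. (\<forall>i. has_pd b' (F i) (F' i)) \<longrightarrow>
      (\<forall>j::unit. has_pd e (\<lambda>z. F () (fst z, - snd z)) (\<lambda>x. c * F' () (fst x, - snd x)))"
    by blast
qed

lemma weyl_transpose:
  fixes b :: "(real^'d) \<times> (real^'d) \<Rightarrow> complex"
  assumes b: "all_derivs (symb n) (\<lambda>_::unit. b)" and f: "schwartz f" and h: "schwartz h"
  shows "(\<integral>x. weyl b f x * h x \<partial>lborel) = (\<integral>y. f y * weyl (\<lambda>z. b (fst z, - snd z)) h y \<partial>lborel)"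
proof -
  let ?b = "\<lambda>z. b (fst z, - snd z)"
  let ?D = "DIM(real^'d) + 2"
  note b' = all_derivs_symb_reflect[OF b]
  have key: "integrable lborel (\<lambda>p. h (fst p) * (exp (\<i> * of_real (fst p \<bullet> snd p)) * wJ c f (fst p) (snd p)))"
    if c: "all_derivs (symb n) (\<lambda>_::unit. c)" and f: "schwartz f" and h: "schwartz h" for c and f h :: "real^'d \<Rightarrow> complex"
  proof -
    obtain C where C: "C > 0" "\<And>i::unit. \<And>s \<xi>. norm (wJ c f s \<xi>) \<le> C * pw s ^ n / pw \<xi> ^ ?D" using wJ_decay[OF c f] by blast
    obtain H where H: "H > 0" "\<And>y. norm (h y) \<le> H / pw y ^ (n + ?D)" using schwartz_bound[OF h] by blast
    have 1: "integrable lborel (\<lambda>x::real^'d. (H * C) * (1 / pw x ^ ?D))" by (intro integrable_mult_right integrable_pw) simp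
    have 2: "integrable lborel (\<lambda>x::real^'d. 1 / pw x ^ ?D)" by (intro integrable_pw) simp
    show ?thesis
    proof (rule Bochner_Integration.integrable_bound[OF integrable_lborel_prod[OF 1 2]])
      show "(\<lambda>p. h (fst p) * (exp (\<i> * of_real (fst p \<bullet> snd p)) * wJ c f (fst p) (snd p))) \<in> borel_measurable lborel"
        unfolding measurable_lborel2
        by (intro borel_measurable_continuous_onI continuous_on_mult continuous_on_compose2[OF schwartz_cont[OF h]]
              wJ_symb_continuous(1)[OF c f] continuous_on_fst continuous_on_id) (auto intro!: continuous_intros)
      have "norm (h x * (exp (\<i> * of_real (x \<bullet> \<xi>)) * wJ c f x \<xi>)) \<le> ((H * C) * (1 / pw x ^ ?D)) * (1 / pw \<xi> ^ ?D)" for x \<xi>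
      proof -
        have "norm (h x * (exp (\<i> * of_real (x \<bullet> \<xi>)) * wJ c f x \<xi>)) \<le> (H / pw x ^ (n + ?D)) * (C * pw x ^ n / pw \<xi> ^ ?D)"
          unfolding norm_mult norm_cis mult_1 using C H by (intro mult_mono) auto
        also have "\<dots> = ((H * C) * (1 / pw x ^ ?D)) * (1 / pw \<xi> ^ ?D)"
          by (simp only: power_add[of _ n]) (simp add: field_simps)
        finally show ?thesis .
      qed
      then show "AE p in lborel. norm (h (fst p) * (exp (\<i> * of_real (fst p \<bullet> snd p)) * wJ c f (fst p) (snd p)))
          \<le> norm (((H * C) * (1 / pw (fst p) ^ ?D)) * (1 / pw (snd p) ^ ?D))"
        by (intro AE_I2) (simp only: real_norm_def, rule order_trans[OF _ abs_ge_self])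
    qed
  qed
  obtain C where C: "C > 0" "\<And>i::unit. continuous_on UNIV b" "\<And>i::unit. \<And>x. norm (b x) \<le> C * pw x ^ n" using all_derivs_symb_D[OF b] by blast
  have swap: "(\<integral>x. h x * (exp (\<i> * of_real (x \<bullet> \<xi>)) * wJ b f x \<xi>) \<partial>lborel) = (\<integral>y. f y * (exp (- (\<i> * of_real (y \<bullet> \<xi>))) * wJ ?b h y (- \<xi>)) \<partial>lborel)" for \<xi>
  proof -
    let ?k = "\<lambda>x y. h x * (exp (\<i> * of_real (x \<bullet> \<xi>)) * (exp (- (\<i> * of_real (y \<bullet> \<xi>))) * (b ((1/2) *\<^sub>R (x + y), \<xi>) * f y)))"
    obtain H where H: "H > 0" "\<And>y. norm (h y) \<le> H / pw y ^ (n + ?D)" using schwartz_bound[OF h] by blast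
    obtain F where F: "F > 0" "\<And>y. norm (f y) \<le> F / pw y ^ (n + ?D)" using schwartz_bound[OF f] by blast
    have 1: "integrable lborel (\<lambda>x::real^'d. (H * C * F * pw \<xi> ^ n) * (1 / pw x ^ ?D))" by (intro integrable_mult_right integrable_pw) simp
    have 2: "integrable lborel (\<lambda>x::real^'d. 1 / pw x ^ ?D)" by (intro integrable_pw) simp
    have int: "integrable lborel (\<lambda>p. ?k (fst p) (snd p))"
    proof (rule Bochner_Integration.integrable_bound[OF integrable_lborel_prod[OF 1 2]])
      show "(\<lambda>p. ?k (fst p) (snd p)) \<in> borel_measurable lborel"
        unfolding measurable_lborel2
        by (intro borel_measurable_continuous_onI continuous_on_mult continuous_on_compose2[OF schwartz_cont[OF h]] continuous_on_compose2[OF C(2)]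
              continuous_on_compose2[OF schwartz_cont[OF f]] continuous_on_fst continuous_on_snd continuous_on_id) (auto intro!: continuous_intros)
      have "norm (?k x y) \<le> ((H * C * F * pw \<xi> ^ n) * (1 / pw x ^ ?D)) * (1 / pw y ^ ?D)" for x y
      proof -
        have "norm (?k x y) \<le> (H / pw x ^ (n + ?D)) * ((C * F * pw x ^ n * pw \<xi> ^ n) / pw y ^ ?D)"
          unfolding norm_mult[of "h x"] norm_mult[of "exp (\<i> * of_real (x \<bullet> \<xi>))"] norm_cis(1) mult_1
          using H C(1) by (intro mult_mono wJ_integrand_bound[OF C(3) _ F(2)]) auto
        also have "\<dots> = ((H * C * F * pw \<xi> ^ n) * (1 / pw x ^ ?D)) * (1 / pw y ^ ?D)"
          by (simp only: power_add[of _ n]) (simp add: field_simps)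
        finally show ?thesis .
      qed
      then show "AE p in lborel. norm (?k (fst p) (snd p)) \<le> norm (((H * C * F * pw \<xi> ^ n) * (1 / pw (fst p) ^ ?D)) * (1 / pw (snd p) ^ ?D))"
        by (intro AE_I2) (simp only: real_norm_def, rule order_trans[OF _ abs_ge_self])
    qed
    have "(\<integral>x. h x * (exp (\<i> * of_real (x \<bullet> \<xi>)) * wJ b f x \<xi>) \<partial>lborel) = (\<integral>x. (\<integral>y. ?k x y \<partial>lborel) \<partial>lborel)"
      unfolding wJ_def by (simp only: integral_mult_right_zero)
    also have "\<dots> = (\<integral>y. (\<integral>x. ?k x y \<partial>lborel) \<partial>lborel)" by (rule lborel_Fubini(3)[OF int])
    also have "\<dots> = (\<integral>y. f y * (exp (- (\<i> * of_real (y \<bullet> \<xi>))) * wJ ?b h y (- \<xi>)) \<partial>lborel)"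
      unfolding wJ_def integral_mult_right_zero[symmetric]
      by (intro Bochner_Integration.integral_cong refl) (simp add: mult_ac add.commute)
    finally show ?thesis .
  qed
  let ?c = "complex_of_real (inverse ((2 * pi) ^ CARD('d)))"
  have "(\<integral>x. weyl b f x * h x \<partial>lborel) = ?c * (\<integral>x. (\<integral>\<xi>. h x * (exp (\<i> * of_real (x \<bullet> \<xi>)) * wJ b f x \<xi>) \<partial>lborel) \<partial>lborel)"
  proof -
    have "weyl b f x * h x = ?c * (\<integral>\<xi>. h x * (exp (\<i> * of_real (x \<bullet> \<xi>)) * wJ b f x \<xi>) \<partial>lborel)" for x
      unfolding weyl_wW wW_def integral_mult_right_zero by (simp only: mult_ac)
    then show ?thesis by (simp only: integral_mult_right_zero)
  qed
  also have "(\<integral>x. (\<integral>\<xi>. h x * (exp (\<i> * of_real (x \<bullet> \<xi>)) * wJ b f x \<xi>) \<partial>lborel) \<partial>lborel)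
      = (\<integral>\<xi>. (\<integral>x. h x * (exp (\<i> * of_real (x \<bullet> \<xi>)) * wJ b f x \<xi>) \<partial>lborel) \<partial>lborel)"
    by (rule lborel_Fubini(3)[OF key[OF b f h]])
  also have "\<dots> = (\<integral>\<xi>. (\<integral>y. f y * (exp (- (\<i> * of_real (y \<bullet> \<xi>))) * wJ ?b h y (- \<xi>)) \<partial>lborel) \<partial>lborel)"
    unfolding swap ..
  also have "\<dots> = (\<integral>\<xi>. (\<integral>y. f y * (exp (\<i> * of_real (y \<bullet> \<xi>)) * wJ ?b h y \<xi>) \<partial>lborel) \<partial>lborel)"
  proof -
    have "(\<integral>\<xi>. (\<lambda>\<xi>. \<integral>y. f y * (exp (\<i> * of_real (y \<bullet> \<xi>)) * wJ ?b h y \<xi>) \<partial>lborel) (- \<xi>) \<partial>lborel)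
        = (\<integral>\<xi>. (\<integral>y. f y * (exp (\<i> * of_real (y \<bullet> \<xi>)) * wJ ?b h y \<xi>) \<partial>lborel) \<partial>lborel)"
    proof (rule lborel_integral_shift(4))
      have "integrable (lborel \<Otimes>\<^sub>M lborel) (\<lambda>(y, \<xi>). f y * (exp (\<i> * of_real (y \<bullet> \<xi>)) * wJ ?b h y \<xi>))"
        using key[OF b' h f] by (simp add: lborel_prod case_prod_unfold)
      from lborel_pair.integrable_snd[OF this]
      show "(\<lambda>\<xi>. \<integral>y. f y * (exp (\<i> * of_real (y \<bullet> \<xi>)) * wJ ?b h y \<xi>) \<partial>lborel) \<in> borel_measurable borel"
        using borel_measurable_integrable by fastforce
    qed
    then show ?thesis by simp
  qed
  also have "\<dots> = (\<integral>y. (\<integral>\<xi>. f y * (exp (\<i> * of_real (y \<bullet> \<xi>)) * wJ ?b h y \<xi>) \<partial>lborel) \<partial>lborel)"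
    by (rule lborel_Fubini(3)[OF key[OF b' h f], symmetric])
  also have "?c * \<dots> = (\<integral>y. f y * weyl ?b h y \<partial>lborel)"
  proof -
    have "f y * weyl ?b h y = ?c * (\<integral>\<xi>. f y * (exp (\<i> * of_real (y \<bullet> \<xi>)) * wJ ?b h y \<xi>) \<partial>lborel)" for y
      unfolding weyl_wW wW_def integral_mult_right_zero by (simp only: mult_ac)
    then show ?thesis by (simp only: integral_mult_right_zero)
  qed
  finally show ?thesis .
qed

text \<open>Shifting \<open>s\<close> and \<open>y\<close> by \<open>a\<close> shifts their midpoint
  by \<open>a\<close>, and a modulation shifts the frequency variable; so the time-frequency shift
  enters the symbol as a translation.\<close>

lemma weyl_covariance:
  fixes b :: "(real^'d) \<times> (real^'d) \<Rightarrow> complex"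
  assumes b: "all_derivs (symb n) (\<lambda>_::unit. \<lambda>z. b ((a, \<beta>) + z))" and bc: "continuous_on UNIV b" and h: "schwartz h"
  shows "weyl b (tfshift (a, \<beta>) h) s = tfshift (a, \<beta>) (weyl (\<lambda>z. b ((a, \<beta>) + z)) h) s"
proof -
  let ?b = "\<lambda>z. b ((a, \<beta>) + z)"
  have J: "wJ b (tfshift (a, \<beta>) h) s \<xi> = exp (- (\<i> * of_real (a \<bullet> (\<xi> - \<beta>)))) * wJ ?b h (s - a) (\<xi> - \<beta>)" for s \<xi>
  proof -
    let ?k = "\<lambda>y. exp (- (\<i> * of_real (y \<bullet> \<xi>))) * (b ((1/2) *\<^sub>R (s + y), \<xi>) * tfshift (a, \<beta>) h y)"
    have "continuous_on UNIV ?k"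
      by (intro wJ_integrand_continuous(1) bc continuous_on_slice(1)[OF continuous_on_tfshift[OF schwartz_cont[OF h]]])
    then have "(\<integral>y. ?k y \<partial>lborel) = (\<integral>y. ?k (y + a) \<partial>lborel)"
      by (intro lborel_integral_shift(2)[symmetric] borel_measurable_continuous_onI)
    also have "\<dots> = (\<integral>y. exp (- (\<i> * of_real (a \<bullet> (\<xi> - \<beta>)))) *
        (exp (- (\<i> * of_real (y \<bullet> (\<xi> - \<beta>)))) * (?b ((1/2) *\<^sub>R ((s - a) + y), \<xi> - \<beta>) * h y)) \<partial>lborel)"
    proof (intro Bochner_Integration.integral_cong refl)
      fix y
      have "(1/2) *\<^sub>R (s + (y + a)) = a + (1/2) *\<^sub>R ((s - a) + y)"
        using scaleR_add_left[of "1/2" "1/2" a] by (simp add: algebra_simps)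
      then have m: "b ((1/2) *\<^sub>R (s + (y + a)), \<xi>) = ?b ((1/2) *\<^sub>R ((s - a) + y), \<xi> - \<beta>)" by simp
      show "?k (y + a) = exp (- (\<i> * of_real (a \<bullet> (\<xi> - \<beta>)))) *
        (exp (- (\<i> * of_real (y \<bullet> (\<xi> - \<beta>)))) * (?b ((1/2) *\<^sub>R ((s - a) + y), \<xi> - \<beta>) * h y))"
        unfolding m tfshift_def
        by (simp add: inner_add_left inner_diff_right exp_add exp_diff exp_minus ring_distribs field_simps)
    qed
    finally show ?thesis unfolding wJ_def integral_mult_right_zero .
  qed
  let ?G = "\<lambda>\<xi>. exp (\<i> * of_real (s \<bullet> (\<xi> + \<beta>))) * (exp (- (\<i> * of_real (a \<bullet> \<xi>))) * wJ ?b h (s - a) \<xi>)"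
  have Gc: "continuous_on UNIV ?G" by (intro continuous_intros wJ_symb_continuous(2)[OF b h])
  have "wW b (tfshift (a, \<beta>) h) s = (\<integral>\<xi>. ?G (\<xi> - \<beta>) \<partial>lborel)"
    unfolding wW_def J by simp
  also have "\<dots> = (\<integral>\<xi>. ?G \<xi> \<partial>lborel)" by (intro lborel_integral_shift(1) borel_measurable_continuous_onI Gc)
  also have "\<dots> = exp (\<i> * of_real (s \<bullet> \<beta>)) * wW ?b h (s - a)"
    unfolding wW_def integral_mult_right_zero[symmetric]
    by (intro Bochner_Integration.integral_cong refl) (simp add: inner_add_right inner_diff_left exp_add exp_diff exp_minus ring_distribs field_simps)
  finally show ?thesis by (simp add: weyl_wW tfshift_def mult_ac)
qed

section \<open>Symbols vanishing in a cone\<close>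

lemma has_pd_local_unique:
  assumes pd: "has_pd b f f'" and S: "open S" "z \<in> S"
    and eq: "\<And>s. z + s *\<^sub>R b \<in> S \<Longrightarrow> f (z + s *\<^sub>R b) = k s" and k: "(k has_vector_derivative d) (at 0)"
  shows "f' z = d"
proof -
  let ?U = "(\<lambda>s. z + s *\<^sub>R b) -` S"
  have U: "open ?U" by (intro open_vimage S continuous_intros)
  have "((\<lambda>s. f (z + s *\<^sub>R b)) has_vector_derivative f' z) (at 0)" using pd by (simp add: has_pd_def)
  then have "(k has_vector_derivative f' z) (at 0)"
    by (rule has_vector_derivative_transform_within_open[OF _ U]) (use S eq in auto)
  with k show ?thesis by (rule vector_derivative_unique_at[rotated])
qed

text \<open>A derivative of a function homogeneous of degree -k is homogeneous of degree -k-1. All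
  derivatives of \<open>\<psi>\<close> are therefore bounded by their values on a compact
  ball.\<close>

lemma homogeneous_derivs_bounded:
  fixes \<psi> h :: "'a::euclidean_space \<Rightarrow> complex"
  assumes smooth: "C_inf \<psi>" and h: "\<And>z t. t > 0 \<Longrightarrow> h (t *\<^sub>R z) = h z" and eq: "\<And>z. norm z \<ge> 1 \<Longrightarrow> \<psi> z = h z"
  shows "all_derivs (symb 0) (\<lambda>_::unit. \<psi>)"
proof -
  \<comment> \<open>The strict inequality makes the region open, as differentiation requires, and
    factors \<open>t \<ge> 1\<close> keep points inside it.\<close>
  define hom :: "nat \<Rightarrow> ('a \<Rightarrow> complex) \<Rightarrow> bool" where
    "hom k f \<longleftrightarrow> (\<forall>z t. norm z > 1 \<longrightarrow> t \<ge> 1 \<longrightarrow> f (t *\<^sub>R z) = of_real ((1 / t) ^ k) * f z)" for k f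
  have bdd: "\<exists>C. \<forall>z. norm (f z) \<le> C" if c: "continuous_on UNIV f" and f: "hom k f" for k f
  proof -
    have "compact (f ` cball 0 2)" by (intro compact_continuous_image continuous_on_subset[OF c]) auto
    then have "bounded (f ` cball 0 2)" by (rule compact_imp_bounded)
    then obtain C where "\<forall>y\<in>f ` cball 0 2. norm y \<le> C" unfolding bounded_iff by (rule exE)
    then have C: "norm (f z) \<le> C" if "norm z \<le> 2" for z using that by simp
    have "norm (f z) \<le> C" if "norm z > 2" for z
    proof -
      \<comment> \<open>A far point is dilated down to norm 2, which lies both in the region of
        homogeneity and in the compact ball.\<close>
      let ?w = "(2 / norm z) *\<^sub>R z" and ?t = "norm z / 2"
      have "f (?t *\<^sub>R ?w) = of_real ((1 / ?t) ^ k) * f ?w"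
        using f[unfolded hom_def, rule_format, of ?w ?t] that by auto
      also have "?t *\<^sub>R ?w = z" using that by simp
      finally have "norm (f z) = (1 / ?t) ^ k * norm (f ?w)" using that by (simp add: norm_mult norm_power norm_divide)
      also have "\<dots> \<le> 1 * norm (f ?w)" using that by (intro mult_right_mono power_le_one) (auto simp: divide_simps)
      also have "\<dots> \<le> C" using that by (simp add: C)
      finally show ?thesis .
    qed
    with C show ?thesis by (meson not_le)
  qed
  have deriv: "hom (Suc k) f'" if pd: "has_pd b f f'" and f: "hom k f" for k b f f'
    unfolding hom_def
  proof (intro allI impI)
    fix z :: 'a and t :: real assume z: "norm z > 1" and t: "t \<ge> 1"
    let ?S = "{y. norm ((1 / t) *\<^sub>R y) > 1}"
    have k: "((\<lambda>s. of_real ((1 / t) ^ k) * f (z + (s / t) *\<^sub>R b)) has_vector_derivative of_real ((1 / t) ^ k) * ((1 / t) *\<^sub>R f' z)) (at 0)"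
    proof (intro has_vector_derivative_mult_right)
      have "((\<lambda>s. f (z + s *\<^sub>R b)) has_vector_derivative f' z) (at (0 / t))" using pd by (simp add: has_pd_def)
      then show "((\<lambda>s. f (z + (s / t) *\<^sub>R b)) has_vector_derivative (1 / t) *\<^sub>R f' z) (at 0)"
        using t by (intro vector_diff_chain_at[unfolded o_def, where f="\<lambda>s. s / t" and g="\<lambda>s. f (z + s *\<^sub>R b)"])
          (auto intro!: derivative_eq_intros)
    qed
    have "f' (t *\<^sub>R z) = of_real ((1 / t) ^ k) * ((1 / t) *\<^sub>R f' z)"
    proof (rule has_pd_local_unique[OF pd _ _ _ k])
      show "open ?S" by (intro open_Collect_less continuous_intros)
      show "t *\<^sub>R z \<in> ?S" using z t by simp
      fix s assume "t *\<^sub>R z + s *\<^sub>R b \<in> ?S"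
      moreover have "t *\<^sub>R z + s *\<^sub>R b = t *\<^sub>R (z + (s / t) *\<^sub>R b)" using t by (simp add: scaleR_right_distrib)
      ultimately show "f (t *\<^sub>R z + s *\<^sub>R b) = of_real ((1 / t) ^ k) * f (z + (s / t) *\<^sub>R b)"
        using f[unfolded hom_def, rule_format, of "z + (s / t) *\<^sub>R b" t] t by simp
    qed
    then show "f' (t *\<^sub>R z) = of_real ((1 / t) ^ Suc k) * f' z" by (simp add: scaleR_conv_of_real)
  qed
  show ?thesis
  proof (rule all_derivs_coinduct[where X="\<lambda>F. (\<exists>k. all_derivs (\<lambda>F. \<forall>i. continuous_on UNIV (F i)) F \<and> hom k (F ()))"])
    have "hom 0 \<psi>"
      unfolding hom_def
    proof (intro allI impI)
      fix z :: 'a and t :: real assume z: "norm z > 1" and t: "t \<ge> 1"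
      have "norm (t *\<^sub>R z) \<ge> 1" using z t mult_mono[of 1 t 1 "norm z"] by simp
      then show "\<psi> (t *\<^sub>R z) = of_real ((1 / t) ^ 0) * \<psi> z" using eq[of z] eq[of "t *\<^sub>R z"] h[of t z] z t by simp
    qed
    then show "\<exists>k. all_derivs (\<lambda>F. \<forall>i. continuous_on UNIV (F i)) (\<lambda>_::unit. \<psi>) \<and> hom k \<psi>"
      using smooth unfolding C_inf_iff by blast
    fix F :: "unit \<Rightarrow> 'a \<Rightarrow> complex"
    assume "\<exists>k. all_derivs (\<lambda>F. \<forall>i. continuous_on UNIV (F i)) F \<and> hom k (F ())"
    then obtain k where F: "all_derivs (\<lambda>F. \<forall>i. continuous_on UNIV (F i)) F" "hom k (F ())" by blast
    show "symb 0 F \<and> (\<forall>b\<in>Basis. \<exists>F'. (\<forall>i. has_pd b (F i) (F' i)) \<and>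
       (\<exists>k. all_derivs (\<lambda>F. \<forall>i. continuous_on UNIV (F i)) F' \<and> hom k (F' ())))"
    proof (intro conjI ballI)
      have c: "\<forall>i. continuous_on UNIV (F i)" using all_derivs_base[OF F(1)] .
      from bdd[OF c[rule_format] F(2)] obtain C where "\<And>z. norm (F () z) \<le> C" by blast
      then show "symb 0 F" using c unfolding symb_def by (intro conjI exI[of _ C]) auto
      fix b :: 'a assume "b \<in> Basis"
      from all_derivs_pd[OF F(1) this] obtain F' where F': "\<And>i. has_pd b (F i) (F' i)" "all_derivs (\<lambda>F. \<forall>i. continuous_on UNIV (F i)) F'" by blast
      show "\<exists>F'. (\<forall>i. has_pd b (F i) (F' i)) \<and> (\<exists>k. all_derivs (\<lambda>F. \<forall>i. continuous_on UNIV (F i)) F' \<and> hom k (F' ()))"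
        using F' deriv[OF F'(1) F(2)] by (intro exI[of _ F'] conjI allI exI[of _ "Suc k"]) auto
    qed
  qed
qed

lemma all_derivs_vanishing:
  fixes F :: "'i \<Rightarrow> 'a::euclidean_space \<Rightarrow> complex"
  assumes F: "all_derivs P F" and S: "open S" and v: "\<And>i z. z \<in> S \<Longrightarrow> F i z = 0"
  shows "all_derivs (\<lambda>F. P F \<and> (\<forall>i. \<forall>z\<in>S. F i z = 0)) F"
proof (rule all_derivs_coinduct[where X="\<lambda>F. all_derivs P F \<and> (\<forall>i. \<forall>z\<in>S. F i z = 0)"])
  fix F :: "'i \<Rightarrow> 'a \<Rightarrow> complex" assume F: "all_derivs P F \<and> (\<forall>i. \<forall>z\<in>S. F i z = 0)"
  show "(P F \<and> (\<forall>i. \<forall>z\<in>S. F i z = 0)) \<and> (\<forall>b\<in>Basis. \<exists>F'. (\<forall>i. has_pd b (F i) (F' i)) \<and>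
      (all_derivs P F' \<and> (\<forall>i. \<forall>z\<in>S. F' i z = 0)))"
  proof (intro conjI ballI)
    show "P F" using F all_derivs_base by blast
    show "\<forall>i. \<forall>z\<in>S. F i z = 0" using F by blast
    fix b :: 'a assume "b \<in> Basis"
    from all_derivs_pd[OF conjunct1[OF F] this] obtain F' where F': "\<And>i. has_pd b (F i) (F' i)" "all_derivs P F'" by blast
    have "F' i z = 0" if "z \<in> S" for i z
      by (rule has_pd_local_unique[OF F'(1) S that, where k="\<lambda>_. 0"]) (use F in auto)
    with F' show "\<exists>F'. (\<forall>i. has_pd b (F i) (F' i)) \<and> (all_derivs P F' \<and> (\<forall>i. \<forall>z\<in>S. F' i z = 0))" by blast
  qed
qed (use F v in blast)

text \<open>A gain of \<open>m\<close> powers in \<open>\<rho>\<close> against a loss of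
  \<open>m\<close> powers in \<open>\<tau>\<close> is a uniform bound for the family scaled by the
  m-th power of the ratio. In this way results about bounded families reach the two-parameter
  class.\<close>

lemma all_derivs_rapid_scaled:
  fixes F :: "'i \<Rightarrow> 'a::euclidean_space \<Rightarrow> complex"
  assumes "\<And>m. uschwartz (\<lambda>i x. of_real ((pw (\<rho> i) / pw (\<tau> i)) ^ m) * F i x)"
  shows "all_derivs (rapid \<rho> \<tau>) F"
proof (rule all_derivs_coinduct[where X="\<lambda>F. \<forall>m. uschwartz (\<lambda>i x. of_real ((pw (\<rho> i) / pw (\<tau> i)) ^ m) * F i x)"])
  let ?c = "\<lambda>m i. complex_of_real ((pw (\<rho> i) / pw (\<tau> i)) ^ m)"
  show "\<forall>m. uschwartz (\<lambda>i x. ?c m i * F i x)" using assms by blast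
  fix F :: "'i \<Rightarrow> 'a \<Rightarrow> complex" assume F: "\<forall>m. uschwartz (\<lambda>i x. ?c m i * F i x)"
  have c0: "?c m i \<noteq> 0" for m i by simp
  show "rapid \<rho> \<tau> F \<and> (\<forall>b\<in>Basis. \<exists>F'. (\<forall>i. has_pd b (F i) (F' i)) \<and> (\<forall>m. uschwartz (\<lambda>i x. ?c m i * F' i x)))"
  proof (intro conjI ballI)
    show "rapid \<rho> \<tau> F"
      unfolding rapid_def
    proof (intro conjI allI)
      have "rapid (\<lambda>_. 0) (\<lambda>_. 0) (\<lambda>i x. ?c 0 i * F i x)" by (rule all_derivs_base[OF F[rule_format]])
      then have r: "rapid (\<lambda>_. 0) (\<lambda>_. 0) F" by simp
      show "continuous_on UNIV (F i)" for i by (rule all_derivs_rapid_integrable(2)[OF r])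
      fix k m
      have "\<exists>C. \<forall>i x. pw x ^ k * norm (?c m i * F i x) \<le> C"
        using all_derivs_base[OF F[rule_format, of m]] unfolding rapid_0_iff by blast
      then obtain C where C: "\<And>i x. pw x ^ k * norm (?c m i * F i x) \<le> C" by blast
      have "pw (\<rho> i) ^ m * pw x ^ k * norm (F i x) \<le> C * pw (\<tau> i) ^ m" for i x
      proof -
        have "norm (?c m i * F i x) = (pw (\<rho> i) / pw (\<tau> i)) ^ m * norm (F i x)"
          unfolding norm_mult norm_of_real by simp
        then have "pw x ^ k * ((pw (\<rho> i) ^ m / pw (\<tau> i) ^ m) * norm (F i x)) \<le> C"
          using C[of x i] by (simp add: power_divide)
        then show ?thesis by (simp add: field_simps)
      qed
      then show "\<exists>C M. \<forall>i x. pw (\<rho> i) ^ m * pw x ^ k * norm (F i x) \<le> C * pw (\<tau> i) ^ M" by blast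
    qed
    fix b :: 'a assume b: "b \<in> Basis"
    have "\<exists>G. (\<forall>i. has_pd b (\<lambda>x. ?c m i * F i x) (G i)) \<and> uschwartz G" for m
      by (rule all_derivs_pd[OF F[rule_format] b])
    then obtain G where G: "\<And>m i. has_pd b (\<lambda>x. ?c m i * F i x) (G m i)" "\<And>m. uschwartz (G m)" by metis
    have G0: "has_pd b (F i) (G 0 i)" for i using G(1)[where m=0 and i=i] by simp
    \<comment> \<open>The derivative families for the various \<open>m\<close> are scalings of a
      single one, by uniqueness of derivatives.\<close>
    have "G m = (\<lambda>i x. ?c m i * G 0 i x)" for m
      by (rule has_pd_family_unique[where b=b and F="\<lambda>i x. ?c m i * F i x"]) (use G(1) has_pd_cmult[OF G0] in auto)
    with G(2) have "uschwartz (\<lambda>i x. ?c m i * G 0 i x)" for m by metis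
    with G0 show "\<exists>F'. (\<forall>i. has_pd b (F i) (F' i)) \<and> (\<forall>m. uschwartz (\<lambda>i x. ?c m i * F' i x))" by blast
  qed
qed

text \<open>Growth in a third parameter is harmless if the product of the other two controls it:
  part is paid by requesting more gain in \<open>\<rho>\<close>, the rest is more loss in
  \<open>\<tau>\<close>.\<close>

lemma rapid_polyg_absorb:
  assumes F: "rapid \<rho> \<tau> F" and G: "polyg \<sigma> G" and c: "c \<ge> 0" "\<And>i. pw (\<sigma> i) \<le> c * pw (\<rho> i) * pw (\<tau> i)"
  shows "rapid \<rho> \<tau> (\<lambda>i x. F i x * G i x)"
  unfolding rapid_def
proof (intro conjI allI)
  show "continuous_on UNIV (\<lambda>x. F i x * G i x)" for i
    using F G by (auto simp: rapid_def polyg_def intro!: continuous_intros)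
  fix k m
  obtain C' M' where 2: "\<And>i x. norm (G i x) \<le> C' * pw (\<sigma> i) ^ M' * pw x ^ M'" using G unfolding polyg_def by metis
  obtain C M where 1: "\<And>i x. pw (\<rho> i) ^ (m + M') * pw x ^ (k + M') * norm (F i x) \<le> C * pw (\<tau> i) ^ M"
    using F unfolding rapid_def by metis
  have "pw (\<rho> i) ^ m * pw x ^ k * norm (F i x * G i x) \<le> (C * (\<bar>C'\<bar> * c ^ M')) * pw (\<tau> i) ^ (M + M')" for i x
  proof -
    have "norm (G i x) \<le> \<bar>C'\<bar> * pw (\<sigma> i) ^ M' * pw x ^ M'"
      using 2 by (rule order_trans) (intro mult_right_mono, auto)
    also have "\<dots> \<le> \<bar>C'\<bar> * (c * pw (\<rho> i) * pw (\<tau> i)) ^ M' * pw x ^ M'"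
      using c by (intro mult_right_mono mult_left_mono power_mono) auto
    finally have "pw (\<rho> i) ^ m * pw x ^ k * norm (F i x * G i x) \<le>
        pw (\<rho> i) ^ m * pw x ^ k * norm (F i x) * (\<bar>C'\<bar> * (c * pw (\<rho> i) * pw (\<tau> i)) ^ M' * pw x ^ M')"
      unfolding norm_mult mult.assoc by (intro mult_left_mono) auto
    also have "\<dots> = (pw (\<rho> i) ^ (m + M') * pw x ^ (k + M') * norm (F i x)) * (\<bar>C'\<bar> * c ^ M' * pw (\<tau> i) ^ M')"
      by (simp only: power_add power_mult_distrib mult_ac)
    also have "\<dots> \<le> (C * pw (\<tau> i) ^ M) * (\<bar>C'\<bar> * c ^ M' * pw (\<tau> i) ^ M')"
      using c(1) by (intro mult_right_mono 1) auto
    finally show ?thesis by (simp only: power_add mult_ac)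
  qed
  then show "\<exists>C M. \<forall>i x. pw (\<rho> i) ^ m * pw x ^ k * norm (F i x * G i x) \<le> C * pw (\<tau> i) ^ M" by blast
qed

lemma rapid_tfshift:
  fixes F :: "'i \<Rightarrow> real^'d \<Rightarrow> complex"
  assumes F: "all_derivs (rapid \<rho> \<tau>) F" and c: "c \<ge> 0" "\<And>i. pw (zz i) \<le> c * pw (\<rho> i) * pw (\<tau> i)"
  shows "all_derivs (rapid \<rho> \<tau>) (\<lambda>i. tfshift (zz i) (F i))"
proof -
  have ca: "pw (fst (zz i)) \<le> c * pw (\<rho> i) * pw (\<tau> i)" for i using order_trans[OF pw_fst_snd_le(1) c(2)] .
  have "all_derivs (rapid \<rho> \<tau>) (\<lambda>i x. F i (x - fst (zz i)))"
    using F
  proof (rule all_derivs_map[where H="\<lambda>F i x. F i (x - fst (zz i))"])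
    fix F :: "'i \<Rightarrow> real^'d \<Rightarrow> complex" assume F: "rapid \<rho> \<tau> F"
    show "rapid \<rho> \<tau> (\<lambda>i x. F i (x - fst (zz i)))"
      unfolding rapid_def
    proof (intro conjI allI)
      show "continuous_on UNIV (\<lambda>x. F i (x - fst (zz i)))" for i
        by (rule continuous_on_compose2[OF all_derivs_rapid_integrable(2)[OF F]]) (auto intro!: continuous_intros)
      fix k m
      obtain C M where C: "\<And>i x. pw (\<rho> i) ^ (m + k) * pw x ^ k * norm (F i x) \<le> C * pw (\<tau> i) ^ M"
        using F unfolding rapid_def by metis
      have "pw (\<rho> i) ^ m * pw x ^ k * norm (F i (x - fst (zz i))) \<le> (C * c ^ k) * pw (\<tau> i) ^ (M + k)" for i x
      proof -
        let ?y = "x - fst (zz i)"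
        have "pw x \<le> pw ?y * pw (fst (zz i))" using pw_add[of ?y "fst (zz i)"] by simp
        also have "\<dots> \<le> pw ?y * (c * pw (\<rho> i) * pw (\<tau> i))" by (intro mult_left_mono ca) auto
        finally have "pw x ^ k \<le> (pw ?y * (c * pw (\<rho> i) * pw (\<tau> i))) ^ k" by (rule power_mono) simp
        then have "pw (\<rho> i) ^ m * pw x ^ k * norm (F i ?y) \<le> pw (\<rho> i) ^ m * (pw ?y * (c * pw (\<rho> i) * pw (\<tau> i))) ^ k * norm (F i ?y)"
          by (intro mult_right_mono mult_left_mono) auto
        also have "\<dots> = (pw (\<rho> i) ^ (m + k) * pw ?y ^ k * norm (F i ?y)) * (c ^ k * pw (\<tau> i) ^ k)"
          by (simp only: power_add power_mult_distrib mult_ac)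
        also have "\<dots> \<le> (C * pw (\<tau> i) ^ M) * (c ^ k * pw (\<tau> i) ^ k)"
          using c(1) by (intro mult_right_mono C) auto
        finally show ?thesis by (simp only: power_add mult_ac)
      qed
      then show "\<exists>C M. \<forall>i x. pw (\<rho> i) ^ m * pw x ^ k * norm (F i (x - fst (zz i))) \<le> C * pw (\<tau> i) ^ M" by blast
    qed
  qed (auto intro: has_pd_shift)
  moreover have "all_derivs (polyg (\<lambda>i. norm (zz i))) (\<lambda>i x. exp (\<i> * of_real (x \<bullet> snd (zz i))))"
    by (rule all_derivs_polyg_exp) (metis norm_snd_le prod.collapse)
  ultimately have "all_derivs (rapid \<rho> \<tau>) (\<lambda>i x. F i (x - fst (zz i)) * exp (\<i> * of_real (x \<bullet> snd (zz i))))"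
    by (rule all_derivs_mult) (use c in \<open>auto intro!: rapid_add rapid_polyg_absorb[where c=c]\<close>)
  then show ?thesis unfolding tfshift_def by (simp only: mult.commute)
qed

section \<open>Separation from the cone and the remainder estimate\<close>

context fio
begin

text \<open>By compactness of the unit sphere, the point mapped to \<open>(0, \<xi>)\<close> has distance at least
  a constant times \<open>norm \<xi>\<close> from the complement of \<open>\<Gamma>\<close>.\<close>

lemma cone_separation:
  assumes \<Gamma>: "open \<Gamma>" "\<And>z t. z \<in> \<Gamma> \<Longrightarrow> t > 0 \<Longrightarrow> t *\<^sub>R z \<in> \<Gamma>"
    and core: "{z. Ph z \<in> {0} \<times> (UNIV - {0})} \<subseteq> \<Gamma>"
  shows "\<exists>C0>0. \<forall>\<xi> z X. z + X \<notin> {z \<in> \<Gamma>. norm z > 1} \<longrightarrow> pw \<xi> \<le> C0 * pw ((0, \<xi>) - Ph z) * pw X"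
proof -
  define u where "u \<xi> = Ph_inv (0, \<xi>)" for \<xi>
  have linu: "linear u"
    unfolding u_def using Ph_inv(1)
    by (intro linearI) (simp_all add: linear_add[symmetric] linear_scale[symmetric])
  have uc: "continuous_on UNIV u" using linu by (intro linear_continuous_on linear_conv_bounded_linear[THEN iffD1])
  have u\<Gamma>: "u \<xi> \<in> \<Gamma>" if "\<xi> \<noteq> 0" for \<xi> using core that unfolding u_def by (auto simp: Ph_inv(3))
  have uinj: "inj u"
    using linear_injective_0[OF linu] Ph_inv(3) linear_0[OF linear_Ph] unfolding u_def by (metis prod.inject zero_prod_def)
  obtain c1 where c1: "c1 > 0" "\<And>\<xi>. norm (u \<xi>) \<ge> c1 * norm \<xi>" using linear_inj_bounded_below_pos[OF linu uinj] by metis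
  have "compact (u ` sphere 0 1)" by (intro compact_continuous_image continuous_on_subset[OF uc]) auto
  moreover have "u ` sphere 0 1 \<subseteq> \<Gamma>"
  proof (rule image_subsetI)
    fix \<xi> :: "real^'d" assume "\<xi> \<in> sphere 0 1"
    then have "\<xi> \<noteq> 0" by auto
    then show "u \<xi> \<in> \<Gamma>" by (rule u\<Gamma>)
  qed
  ultimately obtain e where e: "e > 0" "(\<Union>x\<in>u ` sphere 0 1. ball x e) \<subseteq> \<Gamma>"
    using compact_subset_open_imp_ball_epsilon_subset[OF _ \<Gamma>(1)] by metis
  obtain c where c: "c \<ge> 1" "\<And>w z. pw (Ph_inv w - z) \<le> c * pw (w - Ph z)" using Ph_inv_diff by blast
  \<comment> \<open>The bound by \<open>e\<close> keeps the rescaled point in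
    \<open>\<Gamma>\<close>; the bound by \<open>c1 / 2\<close> keeps the norm of the point itself
    above half of \<open>c1 * norm \<xi>\<close>.\<close>
  define e' where "e' = min e (c1 / 2)"
  have e': "e' > 0" "e' \<le> e" "e' \<le> c1 / 2" using e(1) c1(1) by (auto simp: e'_def)
  \<comment> \<open>The summands account for the additive 1 in \<open>pw\<close>, for displacements
    proportional to \<open>\<xi>\<close>, and for bounded \<open>\<xi>\<close>.\<close>
  define C1 where "C1 = 1 + 1 / e' + 2 / c1"
  have C1: "C1 > 0" unfolding C1_def using e' c1 by (simp add: add_pos_pos)
  have "pw \<xi> \<le> (C1 * c) * pw ((0, \<xi>) - Ph z) * pw X" if out: "z + X \<notin> {z \<in> \<Gamma>. norm z > 1}" for \<xi> z X
  proof -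
    define Y where "Y = z + X - u \<xi>"
    \<comment> \<open>Either the displacement from \<open>u \<xi>\<close> is proportional to
      \<open>\<xi>\<close> or \<open>\<xi>\<close> is bounded. Otherwise, rescaling by
      \<open>norm \<xi>\<close> shows that the point lies in \<open>\<Gamma>\<close>, and it lies
      outside the unit ball.\<close>
    have "e' * norm \<xi> \<le> norm Y \<or> c1 * norm \<xi> \<le> 2"
    proof (rule ccontr)
      assume "\<not> ?thesis"
      then have Y: "norm Y < e' * norm \<xi>" and n: "c1 * norm \<xi> > 2" by auto
      then have \<xi>: "\<xi> \<noteq> 0" by auto
      let ?r = "norm \<xi>"
      have r: "?r > 0" using \<xi> by simp
      have zX: "z + X = ?r *\<^sub>R (u ((1 / ?r) *\<^sub>R \<xi>) + (1 / ?r) *\<^sub>R Y)"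
        using r by (simp add: Y_def linear_scale[OF linu] algebra_simps)
      have "norm ((1 / ?r) *\<^sub>R Y) < e'" using Y r by (simp add: divide_less_eq)
      then have "u ((1 / ?r) *\<^sub>R \<xi>) + (1 / ?r) *\<^sub>R Y \<in> ball (u ((1 / ?r) *\<^sub>R \<xi>)) e"
        using e'(2) by (simp add: dist_norm)
      moreover have "(1 / ?r) *\<^sub>R \<xi> \<in> sphere 0 1" using r by simp
      ultimately have "u ((1 / ?r) *\<^sub>R \<xi>) + (1 / ?r) *\<^sub>R Y \<in> \<Gamma>" using e(2) by blast
      then have "z + X \<in> \<Gamma>" unfolding zX by (rule \<Gamma>(2)) (rule r)
      moreover have "norm (z + X) > 1"
      proof -
        have "norm (u \<xi>) - norm Y \<le> norm (z + X)" using norm_triangle_ineq4[of "z + X" Y] by (simp add: Y_def)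
        moreover have "norm Y < (c1 / 2) * ?r" using Y e'(3) r by (meson less_le_trans mult_right_mono norm_ge_zero)
        ultimately have "(c1 * ?r) / 2 < norm (z + X)" using c1(2)[of \<xi>] by simp
        then show ?thesis using n by simp
      qed
      ultimately show False using out by simp
    qed
    then have "pw \<xi> \<le> C1 * pw Y"
    proof
      assume "e' * norm \<xi> \<le> norm Y"
      then have "norm \<xi> \<le> (1 / e') * norm Y" using e'(1) by (simp add: field_simps)
      then have "pw \<xi> \<le> 1 + (1 / e') * norm Y" by (simp add: pw_def)
      also have "\<dots> \<le> C1 * 1 + C1 * norm Y"
        using e'(1) c1(1) by (intro add_mono mult_right_mono) (auto simp: C1_def)
      finally show ?thesis by (simp add: pw_def distrib_left)
    next
      assume "c1 * norm \<xi> \<le> 2"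
      then have "norm \<xi> \<le> 2 / c1" using c1(1) by (simp add: field_simps)
      then have "pw \<xi> \<le> C1 * 1" unfolding C1_def pw_def using e'(1) by (simp add: add_increasing)
      also have "\<dots> \<le> C1 * pw Y" using C1 by (intro mult_left_mono) auto
      finally show ?thesis .
    qed
    also have "pw Y \<le> pw X * (c * pw ((0, \<xi>) - Ph z))"
    proof -
      have "Y = X - (u \<xi> - z)" by (simp add: Y_def)
      then have "pw Y \<le> pw X * pw (u \<xi> - z)" using pw_diff by metis
      also have "\<dots> \<le> pw X * (c * pw ((0, \<xi>) - Ph z))" unfolding u_def by (intro mult_left_mono c) auto
      finally show ?thesis .
    qed
    finally show ?thesis using C1 by (simp add: mult_left_mono mult_ac)
  qed
  moreover have "C1 * c > 0" using C1 c(1) by simp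
  ultimately show ?thesis by blast
qed

text \<open>\<open>z\<close> differs from \<open>Ph_inv (0, \<xi>)\<close> by at most a multiple of
  the distance to the fibre. Shifts by \<open>z\<close> can thus be absorbed by the two parameters
  of \<open>rapid\<close> in families indexed by \<open>(z, \<xi>)\<close>.\<close>

lemma pw_le_index: "\<exists>c\<ge>0. \<forall>z \<xi>. pw z \<le> c * pw \<xi> * pw ((0, \<xi>) - Ph z)"
proof -
  obtain c where c: "c \<ge> 1" "\<And>w z. pw (Ph_inv w - z) \<le> c * pw (w - Ph z)" using Ph_inv_diff by blast
  obtain c' where c': "c' \<ge> 1" "\<And>x. pw (Ph_inv x) \<le> c' * pw x" using linear_pw[OF Ph_inv(1)] by metis
  have "pw z \<le> (c' * c) * pw \<xi> * pw ((0, \<xi>) - Ph z)" for z \<xi>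
  proof -
    have "pw z \<le> pw (Ph_inv (0, \<xi>)) * pw (Ph_inv (0, \<xi>) - z)"
      using pw_diff[of "Ph_inv (0, \<xi>)" "Ph_inv (0, \<xi>) - z"] by simp
    also have "\<dots> \<le> (c' * pw (0::real^'d, \<xi>)) * (c * pw ((0, \<xi>) - Ph z))"
      using c' by (intro mult_mono c c') auto
    also have "pw (0::real^'d, \<xi>) = pw \<xi>" by (simp add: pw_def norm_Pair)
    finally show ?thesis by (simp only: mult_ac)
  qed
  then show ?thesis using c(1) c'(1) by (intro exI[of _ "c' * c"]) auto
qed

text \<open>Outside the open set where the symbol vanishes, \<open>cone_separation\<close> bounds
  the ratio of \<open>pw \<xi>\<close> to \<open>pw ((0, \<xi>) - Ph z)\<close> by a multiple of
  \<open>pw X\<close>. The symbol scaled by the m-th power of that ratio is then of order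
  \<open>m\<close>, uniformly in the index, and its derivatives as well since they vanish on the
  same set. The minus sign in the frequency of \<open>X\<close> prepares for the
  transposition.\<close>

lemma shifted_symbol_rapid:
  fixes b :: "(real^'d) \<times> (real^'d) \<Rightarrow> complex"
  assumes b: "all_derivs (symb 0) (\<lambda>_::unit. b)"
    and \<Gamma>: "open \<Gamma>" "\<And>z t. z \<in> \<Gamma> \<Longrightarrow> t > 0 \<Longrightarrow> t *\<^sub>R z \<in> \<Gamma>" "{z. Ph z \<in> {0} \<times> (UNIV - {0})} \<subseteq> \<Gamma>"
    and v: "\<And>z. z \<in> \<Gamma> \<Longrightarrow> norm z > 1 \<Longrightarrow> b z = 0" and \<gamma>: "schwartz \<gamma>"
  shows "all_derivs (rapid (\<lambda>i. norm (snd i)) (\<lambda>i. norm ((0, snd i) - Ph (fst i))))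
    (\<lambda>i::((real^'d) \<times> (real^'d)) \<times> (real^'d). weyl (\<lambda>X. b (fst (fst i) + fst X, snd (fst i) - snd X)) \<gamma>)"
proof (rule all_derivs_rapid_scaled)
  fix m
  let ?S = "{z \<in> \<Gamma>. norm z > 1}"
  let ?r = "\<lambda>i::((real^'d) \<times> (real^'d)) \<times> (real^'d). (pw (norm (snd i)) / pw (norm ((0, snd i) - Ph (fst i)))) ^ m"
  let ?p = "\<lambda>i::((real^'d) \<times> (real^'d)) \<times> (real^'d). \<lambda>X::(real^'d) \<times> (real^'d). (fst (fst i) + fst X, snd (fst i) - snd X)"
  obtain C0 where C0: "C0 > 0" "\<And>\<xi> z X. z + X \<notin> ?S \<Longrightarrow> pw \<xi> \<le> C0 * pw ((0, \<xi>) - Ph z) * pw X"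
    using cone_separation[OF \<Gamma>] by blast
  have oS: "open ?S" using \<Gamma>(1) by (intro open_Collect_conj open_Collect_less continuous_intros) (simp add: Collect_mem_eq)
  have B: "all_derivs (\<lambda>F. symb 0 F \<and> (\<forall>i. \<forall>z\<in>?S. F i z = 0)) (\<lambda>_::unit. b)"
    by (rule all_derivs_vanishing[OF b oS]) (use v in auto)
  have "all_derivs (symb m) (\<lambda>i X. of_real (?r i) * b (?p i X))"
  proof (rule all_derivs_transform[OF B, where H="\<lambda>F i X. of_real (?r i) * F () (?p i X)"])
    fix F :: "unit \<Rightarrow> (real^'d) \<times> (real^'d) \<Rightarrow> complex" assume F: "symb 0 F \<and> (\<forall>i. \<forall>z\<in>?S. F i z = 0)"
    obtain C where C: "C > 0" "\<And>i x. norm (F i x) \<le> C * pw x ^ 0" by (rule symb_bound[OF conjunct1[OF F]]) (rule that)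
    have c: "continuous_on UNIV (F ())" using F by (simp add: symb_def)
    have "norm (of_real (?r i) * F () (?p i X)) \<le> (C0 ^ m * C) * pw X ^ m" for i X
    proof (cases "?p i X \<in> ?S")
      case True
      then have "F () (?p i X) = 0" using F by blast
      then show ?thesis using C0(1) C(1) by simp
    next
      case False
      have "?p i X = fst i + (fst X, - snd X)" by (simp add: prod_eq_iff)
      with False have "pw (snd i) \<le> C0 * pw ((0, snd i) - Ph (fst i)) * pw (fst X, - snd X)" by (intro C0(2)) simp
      also have "pw (fst X, - snd X) = pw X" by (simp add: pw_def norm_prod_def)
      finally have "pw (snd i) / pw ((0, snd i) - Ph (fst i)) \<le> C0 * pw X" by (simp add: field_simps)
      then have "?r i \<le> (C0 * pw X) ^ m" by (simp add: power_mono)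
      then have "?r i * norm (F () (?p i X)) \<le> (C0 * pw X) ^ m * C"
        using C(2)[of "()" "?p i X"] C0(1) by (intro mult_mono) auto
      moreover have "norm (of_real (?r i) * F () (?p i X)) = ?r i * norm (F () (?p i X))"
        unfolding norm_mult norm_of_real by simp
      ultimately show ?thesis by (simp add: power_mult_distrib mult_ac)
    qed
    moreover have "continuous_on UNIV (\<lambda>X. of_real (?r i) * F () (?p i X))" for i
      by (intro continuous_on_mult continuous_on_const continuous_on_compose2[OF c]) (auto intro!: continuous_intros)
    ultimately show "symb m (\<lambda>i X. of_real (?r i) * F () (?p i X))" unfolding symb_def by blast
  next
    fix c and F :: "((real^'d) \<times> (real^'d)) \<times> (real^'d) \<Rightarrow> (real^'d) \<times> (real^'d) \<Rightarrow> complex" assume "symb m F"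
    from symb_mult[OF symb_const this] show "symb m (\<lambda>i x. c * F i x)" by simp
  next
    fix e :: "(real^'d) \<times> (real^'d)" assume e: "e \<in> Basis"
    define c :: real where "c = (if snd e = 0 then 1 else - 1)"
    have "has_pd e (\<lambda>X. of_real (?r i) * F () (?p i X)) (\<lambda>X. of_real c * (of_real (?r i) * F' () (?p i X)))"
      if F: "\<forall>i. has_pd e (F i) (F' i)" for F F' :: "unit \<Rightarrow> (real^'d) \<times> (real^'d) \<Rightarrow> complex" and i
    proof -
      have "has_pd e (\<lambda>X. F () (?p i X)) (\<lambda>X. of_real c * F' () (?p i X))"
      proof (rule has_pd_compose[OF F[rule_format]])
        show "?p i (x + t *\<^sub>R e) = ?p i x + (c * t) *\<^sub>R e" for x t
          using e by (auto simp: c_def Basis_prod_def prod_eq_iff)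
      qed
      from has_pd_cmult[OF this, of "of_real (?r i)"] show ?thesis by (simp only: mult.left_commute)
    qed
    with e show "\<exists>b'\<in>Basis. \<exists>c. \<forall>F F'. (\<forall>i. has_pd b' (F i) (F' i)) \<longrightarrow>
        (\<forall>j. has_pd e (\<lambda>X. of_real (?r j) * F () (?p j X)) (\<lambda>x. c * (of_real (?r j) * F' () (?p j x))))"
      by blast
  qed
  from weyl_uschwartz[OF this \<gamma>]
  show "uschwartz (\<lambda>i x. of_real (?r i) * weyl (\<lambda>X. b (?p i X)) \<gamma> x)"
    unfolding weyl_cmult .
qed

text \<open>Transposition moves the Weyl operator to the window, and covariance turns it into a
  shift of a Weyl operator with translated symbol applied to the conjugate of \<open>g\<close>.
  These functions form a \<open>rapid\<close> family, which duality pairs with \<open>f\<close> in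
  the weak norm.\<close>

lemma stft_weyl_bound:
  fixes b :: "(real^'d) \<times> (real^'d) \<Rightarrow> complex"
  assumes b: "all_derivs (symb 0) (\<lambda>_::unit. b)"
    and \<Gamma>: "open \<Gamma>" "\<And>z t. z \<in> \<Gamma> \<Longrightarrow> t > 0 \<Longrightarrow> t *\<^sub>R z \<in> \<Gamma>" "{z. Ph z \<in> {0} \<times> (UNIV - {0})} \<subseteq> \<Gamma>"
    and v: "\<And>z. z \<in> \<Gamma> \<Longrightarrow> norm z > 1 \<Longrightarrow> b z = 0"
  shows "\<exists>C0 M. C0 \<ge> 0 \<and> (\<forall>f z \<xi>. schwartz f \<longrightarrow> pw \<xi> ^ m * norm (stft g (weyl b f) z) \<le>
     (C0 * sobolev_norm (- real N) (\<lambda>x. of_real (japanese x powr (- real N)) * f x)) * pw ((0, \<xi>) - Ph z) ^ M)"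
proof -
  let ?g = "\<lambda>x. cnj (g x)"
  let ?\<rho> = "\<lambda>i::((real^'d) \<times> (real^'d)) \<times> (real^'d). norm (snd i)"
  let ?\<tau> = "\<lambda>i::((real^'d) \<times> (real^'d)) \<times> (real^'d). norm ((0, snd i) - Ph (fst i))"
  let ?W = "\<lambda>i::((real^'d) \<times> (real^'d)) \<times> (real^'d). weyl (\<lambda>X. b (fst (fst i) + fst X, snd (fst i) - snd X)) ?g"
  have sg: "schwartz ?g" by (rule schwartz_cnj[OF g])
  obtain c where c: "c \<ge> 0" "\<And>z \<xi>. pw z \<le> c * pw \<xi> * pw ((0, \<xi>) - Ph z)" using pw_le_index by blast
  let ?G = "\<lambda>i. tfshift (fst (fst i), - snd (fst i)) (?W i)"
  have "all_derivs (rapid ?\<rho> ?\<tau>) ?G"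
  proof (rule rapid_tfshift[OF shifted_symbol_rapid[OF b \<Gamma> v sg] c(1)])
    fix i :: "((real^'d) \<times> (real^'d)) \<times> (real^'d)"
    have "pw (fst (fst i), - snd (fst i)) = pw (fst i)" by (simp add: pw_def norm_prod_def)
    then show "pw (fst (fst i), - snd (fst i)) \<le> c * pw (?\<rho> i) * pw (?\<tau> i)" using c(2)[of "fst i" "snd i"] by simp
  qed
  from sobolev_duality[OF this, of m N] obtain C0 M where C0: "C0 \<ge> 0" "\<And>i f. schwartz f \<Longrightarrow> pw (?\<rho> i) ^ m * norm (\<integral>x. f x * ?G i x \<partial>lborel) \<le>
     C0 * pw (?\<tau> i) ^ M * sobolev_norm (- real N) (\<lambda>x. of_real (japanese x powr (- real N)) * f x)" by blast
  \<comment> \<open>The left-hand side does not contain \<open>\<xi>\<close>; it is a free index at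
    which gain and loss are read off.\<close>
  have key: "stft g (weyl b f) z = (\<integral>x. f x * ?G (z, \<xi>) x \<partial>lborel)" if f: "schwartz f" for f z \<xi>
  proof -
    let ?z = "(fst z, - snd z)"
    have br: "all_derivs (symb 0) (\<lambda>_::unit. \<lambda>X. b (fst z + fst X, snd z - snd X))"
    proof (rule all_derivs_transform[OF b, where H="\<lambda>F _ X. F () (fst z + fst X, snd z - snd X)"])
      fix F :: "unit \<Rightarrow> (real^'d) \<times> (real^'d) \<Rightarrow> complex" assume F: "symb 0 F"
      have c: "continuous_on UNIV (F ())" using F by (simp add: symb_def)
      have "continuous_on UNIV (\<lambda>X. F () (fst z + fst X, snd z - snd X))"
        by (rule continuous_on_compose2[OF c]) (auto intro!: continuous_intros)
      with F show "symb 0 (\<lambda>_::unit. \<lambda>X. F () (fst z + fst X, snd z - snd X))" unfolding symb_def by simp blast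
    next
      fix c and F :: "unit \<Rightarrow> (real^'d) \<times> (real^'d) \<Rightarrow> complex" assume "symb 0 F"
      from symb_mult[OF symb_const this] show "symb 0 (\<lambda>i x. c * F i x)" by simp
    next
      fix e :: "(real^'d) \<times> (real^'d)" assume e: "e \<in> Basis"
      define c :: real where "c = (if snd e = 0 then 1 else - 1)"
      have "has_pd e (\<lambda>X. F () (fst z + fst X, snd z - snd X)) (\<lambda>X. of_real c * F' () (fst z + fst X, snd z - snd X))"
        if F: "\<forall>i. has_pd e (F i) (F' i)" for F F' :: "unit \<Rightarrow> (real^'d) \<times> (real^'d) \<Rightarrow> complex"
      proof (rule has_pd_compose[OF F[rule_format]])
        show "(fst z + fst (x + t *\<^sub>R e), snd z - snd (x + t *\<^sub>R e)) = (fst z + fst x, snd z - snd x) + (c * t) *\<^sub>R e" for x t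
          using e by (auto simp: c_def Basis_prod_def prod_eq_iff)
      qed
      with e show "\<exists>b'\<in>Basis. \<exists>c. \<forall>F F'. (\<forall>i. has_pd b' (F i) (F' i)) \<longrightarrow>
          (\<forall>j::unit. has_pd e (\<lambda>X. F () (fst z + fst X, snd z - snd X)) (\<lambda>x. c * F' () (fst z + fst x, snd z - snd x)))"
        by blast
    qed
    have sh: "(\<lambda>X. b (fst (?z + X), - snd (?z + X))) = (\<lambda>X. b (fst z + fst X, snd z - snd X))"
      by (simp add: fun_eq_iff)
    have bc: "continuous_on UNIV (\<lambda>X. b (fst X, - snd X))"
      using all_derivs_base[OF all_derivs_symb_reflect[OF b]] by (simp add: symb_def)
    have cov: "weyl (\<lambda>X. b (fst X, - snd X)) (tfshift ?z ?g) y = ?G (z, \<xi>) y" for y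
      using weyl_covariance[of 0 "\<lambda>X. b (fst X, - snd X)" "fst z" "- snd z" ?g y] br bc sg unfolding sh by simp
    have "stft g (weyl b f) z = (\<integral>x. weyl b f x * tfshift ?z ?g x \<partial>lborel)"
      unfolding stft_def cnj_tfshift ..
    also have "\<dots> = (\<integral>y. f y * weyl (\<lambda>X. b (fst X, - snd X)) (tfshift ?z ?g) y \<partial>lborel)"
      by (rule weyl_transpose[OF b f tfshift_schwartz[OF sg]])
    finally show ?thesis unfolding cov .
  qed
  have "pw \<xi> ^ m * norm (stft g (weyl b f) z) \<le>
     (C0 * sobolev_norm (- real N) (\<lambda>x. of_real (japanese x powr (- real N)) * f x)) * pw ((0, \<xi>) - Ph z) ^ M"
    if "schwartz f" for f z \<xi>
    using C0(2)[OF that, of "(z, \<xi>)"] unfolding key[OF that, of z \<xi>] by (simp add: mult_ac)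
  with C0(1) show ?thesis by blast
qed

end

section \<open>Splitting the input\<close>

lemma sobolev_norm_nonneg: "sobolev_norm s f \<ge> 0"
  unfolding sobolev_norm_def by (intro real_sqrt_ge_zero mult_nonneg_nonneg integral_nonneg_AE) auto

theorem theorem7p1:
  fixes Aop :: "((real^'d \<Rightarrow> complex) \<Rightarrow> complex) \<Rightarrow> ((real^'d \<Rightarrow> complex) \<Rightarrow> complex)"
    and g :: "real^'d \<Rightarrow> complex"
    and A B C D :: "real^'d^'d"
    and \<psi> :: "(real^'d) \<times> (real^'d) \<Rightarrow> complex"
  assumes "cont_lin_op Aop"
    and "schwartz g" and "g \<noteq> (\<lambda>_. 0)"
    and "symplectic A B C D" and "det B \<noteq> 0"
    and "\<forall>N::nat. \<exists>CN. \<forall>z w.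
           norm (pairing (Aop (emb (tfshift z g))) (tfshift w g))
             \<le> CN * (1 + norm (w - phase_map A B C D z)) powr (- real N)"
    and "C_inf \<psi>"
    and "\<exists>h. (\<forall>z t. t > 0 \<longrightarrow> h (t *\<^sub>R z) = h z) \<and> (\<forall>z. norm z \<ge> 1 \<longrightarrow> \<psi> z = h z)"
    and "\<exists>\<Gamma>. open \<Gamma> \<and> (\<forall>z\<in>\<Gamma>. \<forall>t>0. t *\<^sub>R z \<in> \<Gamma>) \<and>
           {z. phase_map A B C D z \<in> {0} \<times> (UNIV - {0})} \<subseteq> \<Gamma> \<and>
           (\<forall>z\<in>\<Gamma>. norm z \<ge> 1 \<longrightarrow> \<psi> z = 1)"
  shows "\<forall>\<phi> p. schwartz \<phi> \<and> 1 \<le> p \<and> p \<le> 2 \<longrightarrow>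
           (\<exists>C>0. \<forall>N::nat. \<exists>CN>0. \<forall>f. schwartz f \<longrightarrow>
              dist_Lp_le p (dist_fourier (dist_mult \<phi> (Aop (emb f))))
                (C * lp_norm p (weyl \<psi> f) +
                 CN * sobolev_norm (- real N) (\<lambda>x. complex_of_real (japanese x powr (- real N)) * f x)))"
proof (intro allI impI)
  fix \<phi> :: "real^'d \<Rightarrow> complex" and p :: real
  assume "schwartz \<phi> \<and> 1 \<le> p \<and> p \<le> 2"
  then have \<phi>: "schwartz \<phi>" and p: "p \<ge> 1" by auto
  interpret fio Aop g A B C D by (unfold_locales) (use assms in blast)+
  let ?P = "phase_map A B C D"
  obtain h where h: "\<And>z t. t > 0 \<Longrightarrow> h (t *\<^sub>R z) = h z" "\<And>z. norm z \<ge> 1 \<Longrightarrow> \<psi> z = h z" using assms(8) by blast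
  have \<psi>: "all_derivs (symb 0) (\<lambda>_::unit. \<psi>)" by (rule homogeneous_derivs_bounded[OF assms(7) h])
  from assms(9) obtain \<Gamma> where \<Gamma>: "open \<Gamma>" "\<forall>z\<in>\<Gamma>. \<forall>t>0. t *\<^sub>R z \<in> \<Gamma>" "{z. ?P z \<in> {0} \<times> (UNIV - {0})} \<subseteq> \<Gamma>"
    and \<psi>1: "\<forall>z\<in>\<Gamma>. norm z \<ge> 1 \<longrightarrow> \<psi> z = 1" by (elim exE conjE)
  let ?b = "\<lambda>z. 1 - \<psi> z"
  have b: "all_derivs (symb 0) (\<lambda>_::unit. ?b)"
    using all_derivs_symb_add[OF all_derivs_symb_const[of 1] all_derivs_symb_cmult[OF \<psi>, of "-1"]] by simp
  obtain C1 where C1: "C1 > 0" "\<And>F. schwartz F \<Longrightarrow> integrable lborel (\<lambda>\<xi>. norm (fio_out \<phi> F \<xi>) powr p) \<and>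
      lp_norm p (fio_out \<phi> F) \<le> C1 * lp_norm p F" using output_Lp[OF \<phi> p] by blast
  show "\<exists>C>0. \<forall>N::nat. \<exists>CN>0. \<forall>f. schwartz f \<longrightarrow>
      dist_Lp_le p (dist_fourier (dist_mult \<phi> (Aop (emb f))))
        (C * lp_norm p (weyl \<psi> f) + CN * sobolev_norm (- real N) (\<lambda>x. complex_of_real (japanese x powr (- real N)) * f x))"
  \<comment> \<open>The 2 is the constant of \<open>lp_norm_add_le\<close>. \<open>C1\<close> is
    obtained before \<open>N\<close> is fixed, as the order of the quantifiers requires.\<close>
  proof (rule exI[of _ "2 * C1"], intro conjI allI)
    show "2 * C1 > 0" using C1(1) by simp
    fix N :: nat
    let ?s = "\<lambda>f. sobolev_norm (- real N) (\<lambda>x. complex_of_real (japanese x powr (- real N)) * f x)"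
    \<comment> \<open>\<open>CARD('d) + 2\<close> is the gain that \<open>output_small_Lp\<close>
      integrates; the loss \<open>M\<close> is handed on to it.\<close>
    obtain C0 M where C0: "C0 \<ge> 0" "\<And>f z \<xi>. schwartz f \<Longrightarrow> pw \<xi> ^ (CARD('d) + 2) * norm (stft g (weyl ?b f) z) \<le> (C0 * ?s f) * pw ((0, \<xi>) - ?P z) ^ M"
      using stft_weyl_bound[OF b \<Gamma>(1) \<Gamma>(2)[rule_format] \<Gamma>(3), of "CARD('d) + 2" N] \<psi>1 by force
    obtain C2 where C2: "C2 > 0" "\<And>F Q. schwartz F \<Longrightarrow> Q \<ge> 0 \<Longrightarrow>
      (\<forall>z \<xi>. pw \<xi> ^ (CARD('d) + 2) * norm (stft g F z) \<le> Q * pw ((0, \<xi>) - ?P z) ^ M) \<Longrightarrow>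
      integrable lborel (\<lambda>\<xi>. norm (fio_out \<phi> F \<xi>) powr p) \<and> lp_norm p (fio_out \<phi> F) \<le> C2 * Q"
      using output_small_Lp[OF \<phi> p, of M] by blast
    show "\<exists>CN>0. \<forall>f. schwartz f \<longrightarrow> dist_Lp_le p (dist_fourier (dist_mult \<phi> (Aop (emb f))))
        (2 * C1 * lp_norm p (weyl \<psi> f) + CN * ?s f)"
    \<comment> \<open>\<open>C0\<close> is only known to be nonnegative; adding 1 makes the constant
      positive.\<close>
    proof (intro exI[of _ "2 * C2 * (C0 + 1)"] conjI allI impI)
      show "2 * C2 * (C0 + 1) > 0" using C2(1) C0(1) by simp
      fix f :: "real^'d \<Rightarrow> complex" assume f: "schwartz f"
      have s0: "?s f \<ge> 0" by (rule sobolev_norm_nonneg)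
      have f1: "schwartz (weyl \<psi> f)" using weyl_uschwartz[OF \<psi> f] by (simp add: schwartz_iff)
      have f2: "schwartz (weyl ?b f)" using weyl_uschwartz[OF b f] by (simp add: schwartz_iff)
      have feq: "f = (\<lambda>x. weyl \<psi> f x + weyl ?b f x)" using weyl_complement[OF \<psi> f] by (simp add: fun_eq_iff)
      have 1: "integrable lborel (\<lambda>\<xi>. norm (fio_out \<phi> (weyl \<psi> f) \<xi>) powr p)" "lp_norm p (fio_out \<phi> (weyl \<psi> f)) \<le> C1 * lp_norm p (weyl \<psi> f)"
        using C1(2)[OF f1] by auto
      have 2: "integrable lborel (\<lambda>\<xi>. norm (fio_out \<phi> (weyl ?b f) \<xi>) powr p)" "lp_norm p (fio_out \<phi> (weyl ?b f)) \<le> C2 * (C0 * ?s f)"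
        using C2(2)[OF f2, of "C0 * ?s f"] C0 f s0 by auto
      have "2 * (lp_norm p (fio_out \<phi> (weyl \<psi> f)) + lp_norm p (fio_out \<phi> (weyl ?b f))) \<le> 2 * (C1 * lp_norm p (weyl \<psi> f) + C2 * (C0 * ?s f))"
        using 1(2) 2(2) by simp
      also have "\<dots> \<le> 2 * C1 * lp_norm p (weyl \<psi> f) + 2 * C2 * (C0 + 1) * ?s f"
        using C2(1) s0 by (simp add: algebra_simps)
      finally have "dist_Lp_le p (dist_fourier (dist_mult \<phi> (Aop (emb (\<lambda>x. weyl \<psi> f x + weyl ?b f x)))))
          (2 * C1 * lp_norm p (weyl \<psi> f) + 2 * C2 * (C0 + 1) * ?s f)"
        by (rule output_dist_Lp[OF \<phi> p f1 f2 1(1) 2(1)])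
      then show "dist_Lp_le p (dist_fourier (dist_mult \<phi> (Aop (emb f)))) (2 * C1 * lp_norm p (weyl \<psi> f) + 2 * C2 * (C0 + 1) * ?s f)"
        using feq by simp
    qed
  qed
qed

end
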